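(* Let $\Lambda$ be a ring such that the category $\mathsf{K}^{2}(\operatorname{proj}\Lambda)$ of $2$-term complexes in $\mathsf{K}^{\mathrm b}(\operatorname{proj}\Lambda)$ is Krull-Schmidt, and let $P$ be an almost complete $2$-term silting complex. Then: (a) If there exists a completion of $P$, then it is either the Bongartz completion of $P$ or the co-Bongartz completion of $P$ (up to additive equivalence). (b) If $P$ admits both the Bongartz completion $S$ and the co-Bongartz completion $T$, then $T$ is an irreducible left mutation of $S$.
   Context: $\operatorname{proj}\Lambda$ is the category of finitely generated projective left $\Lambda$-modules, and $\mathcal{K}=\mathsf{K}^{\mathrm b}(\operatorname{proj}\Lambda)$ is its bounded homotopy category with shift $[1]$. $\operatorname{add}X$ is the full subcategory of direct summands of finite direct sums of copies of $X$. $C(f)$ is the mapping cone of $f$. $X,Y$ are additively equivalent if $\operatorname{add}X=\operatorname{add}Y$. An additive category is Krull-Schmidt if every object is a finite direct sum of objects with local endomorphism rings; then $|X|$ denotes the number of pairwise non-isomorphic indecomposable direct summands of $X$. A complex $P=(P_i)$ in $\mathcal{K}$ is $2$-term if $P_i=0$ for $i\neq 0,-1$; $\mathsf{K}^2(\operatorname{proj}\Lambda)$ is the full subcategory of $2$-term complexes. $P$ is presilting if $\operatorname{Hom}_{\mathcal{K}}(P,P[i])=0$ for all $i>0$; it is silting if moreover the smallest triangulated subcategory of $\mathcal{K}$ containing $P$ and closed under direct summands is $\mathcal{K}$. A $2$-term (pre)silting complex is a (pre)silting complex that is $2$-term. An almost complete $2$-term silting complex is a $2$-term presilting complex $P$ with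 $|P|=|\Lambda|-1$. A completion of a $2$-term presilting complex $P$ is a $2$-term silting complex $T$ with $\operatorname{add}P\subset\operatorname{add}T$. For $X\in\mathcal{K}$, a right $(\operatorname{add}P)$-approximation of $X$ is a morphism $f:P'\to X$ with $P'\in\operatorname{add}P$ such that every morphism from an object of $\operatorname{add}P$ to $X$ factors through $f$; left approximations are defined dually. For a $2$-term presilting complex $P$: if there is a right $(\operatorname{add}P)$-approximation $f$ of $\Lambda[1]$, then $P\oplus C(f)[-1]$ is a $2$-term silting complex, called the Bongartz completion of $P$ (one says $P$ admits the Bongartz completion if such an $f$ exists). Dually, if there is a left $(\operatorname{add}P)$-approximation $g$ of $\Lambda$, then $P\oplus C(g)$ is a $2$-term silting complex, called the co-Bongartz completion of $P$. Both are independent of choices up to additive equivalence. Let $X\oplus Y$ be a silting complex with $\operatorname{add}X\cap\operatorname{add}Y=0$ and $Y$ indecomposable; if $f$ is a left $(\operatorname{add}X)$-approximation of $Y$, then $X\oplus C(f)$ is a silting complex, called the irreducible left mutation of $X\oplus Y$ at $Y$. Silting complexes are considered up to additive equivalence: $T$ is an irreducible left mutation of $S$ if this holds after replacing $S$ and $T$ by additively equivalent complexes. *)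

theory Defs
  imports "HOL-Algebra.Module"
begin

section \<open>Preadditive categories\<close>

text \<open>
  A category whose Hom-sets are abelian groups.  Arrows are meant to determine their source and
  target, so composition and addition take only arrows as arguments; \<open>Cmp C g f\<close> is
  \<open>g\<close> after \<open>f\<close>.
\<close>

record ('o, 'f) precat =
  Obj :: "'o set"
  Hom :: "'o \<Rightarrow> 'o \<Rightarrow> 'f set"
  Cmp :: "'f \<Rightarrow> 'f \<Rightarrow> 'f"
  Idn :: "'o \<Rightarrow> 'f"
  Add :: "'f \<Rightarrow> 'f \<Rightarrow> 'f"
  Neg :: "'f \<Rightarrow> 'f"
  Zer :: "'o \<Rightarrow> 'o \<Rightarrow> 'f"

definition full_subcat :: "('o, 'f) precat \<Rightarrow> 'o set \<Rightarrow> ('o, 'f) precat" where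
  "full_subcat C U = C\<lparr>Obj := Obj C \<inter> U\<rparr>"

definition zero_object :: "('o, 'f) precat \<Rightarrow> 'o \<Rightarrow> bool" where
  "zero_object C X \<longleftrightarrow> X \<in> Obj C \<and> Idn C X = Zer C X X"

definition isomorphic :: "('o, 'f) precat \<Rightarrow> 'o \<Rightarrow> 'o \<Rightarrow> bool" where
  "isomorphic C X Y \<longleftrightarrow> X \<in> Obj C \<and> Y \<in> Obj C \<and>
     (\<exists>f\<in>Hom C X Y. \<exists>g\<in>Hom C Y X. Cmp C g f = Idn C X \<and> Cmp C f g = Idn C Y)"

definition biproduct_diagram ::
  "('o, 'f) precat \<Rightarrow> 'o \<Rightarrow> 'o \<Rightarrow> 'o \<Rightarrow> 'f \<Rightarrow> 'f \<Rightarrow> 'f \<Rightarrow> 'f \<Rightarrow> bool" where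
  "biproduct_diagram C X Y Z i j p q \<longleftrightarrow>
     X \<in> Obj C \<and> Y \<in> Obj C \<and> Z \<in> Obj C \<and>
     i \<in> Hom C X Z \<and> j \<in> Hom C Y Z \<and> p \<in> Hom C Z X \<and> q \<in> Hom C Z Y \<and>
     Cmp C p i = Idn C X \<and> Cmp C q j = Idn C Y \<and>
     Cmp C q i = Zer C X Y \<and> Cmp C p j = Zer C Y X \<and>
     Add C (Cmp C i p) (Cmp C j q) = Idn C Z"

text \<open>\<open>biproduct C X Y Z\<close>: the object \<open>Z\<close> is a direct sum of \<open>X\<close> and \<open>Y\<close>.  Direct sums are
  a relation, since they are determined only up to isomorphism.\<close>

definition biproduct :: "('o, 'f) precat \<Rightarrow> 'o \<Rightarrow> 'o \<Rightarrow> 'o \<Rightarrow> bool" where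
  "biproduct C X Y Z \<longleftrightarrow> (\<exists>i j p q. biproduct_diagram C X Y Z i j p q)"

fun direct_sum :: "('o, 'f) precat \<Rightarrow> 'o list \<Rightarrow> 'o \<Rightarrow> bool" where
  "direct_sum C [] Z \<longleftrightarrow> zero_object C Z"
| "direct_sum C (X # Xs) Z \<longleftrightarrow> (\<exists>W. direct_sum C Xs W \<and> biproduct C X W Z)"

definition summand :: "('o, 'f) precat \<Rightarrow> 'o \<Rightarrow> 'o \<Rightarrow> bool" where
  "summand C Y X \<longleftrightarrow> (\<exists>Z. biproduct C Y Z X)"

definition add_cat :: "('o, 'f) precat \<Rightarrow> 'o \<Rightarrow> 'o set" where
  "add_cat C X = {Y. \<exists>n Z. direct_sum C (replicate n X) Z \<and> summand C Y Z}"

definition additively_equivalent :: "('o, 'f) precat \<Rightarrow> 'o \<Rightarrow> 'o \<Rightarrow> bool" where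
  "additively_equivalent C X Y \<longleftrightarrow> add_cat C X = add_cat C Y"

definition indecomposable :: "('o, 'f) precat \<Rightarrow> 'o \<Rightarrow> bool" where
  "indecomposable C X \<longleftrightarrow> X \<in> Obj C \<and> \<not> zero_object C X \<and>
     (\<forall>Y Z. biproduct C Y Z X \<longrightarrow> zero_object C Y \<or> zero_object C Z)"

definition End_ring :: "('o, 'f) precat \<Rightarrow> 'o \<Rightarrow> 'f ring" where
  "End_ring C X = \<lparr>carrier = Hom C X X, monoid.mult = Cmp C, one = Idn C X,
     zero = Zer C X X, add = Add C\<rparr>"

text \<open>A not necessarily commutative ring is local if it is nonzero and its non-units are closed
  under addition.\<close>

definition local_ring :: "('a, 'r) ring_scheme \<Rightarrow> bool" where
  "local_ring E \<longleftrightarrow> ring E \<and> \<one>\<^bsub>E\<^esub> \<noteq> \<zero>\<^bsub>E\<^esub> \<and>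
     (\<forall>a\<in>carrier E - Units E. \<forall>b\<in>carrier E - Units E. a \<oplus>\<^bsub>E\<^esub> b \<notin> Units E)"

definition Krull_Schmidt :: "('o, 'f) precat \<Rightarrow> bool" where
  "Krull_Schmidt C \<longleftrightarrow> (\<forall>X\<in>Obj C. \<exists>Xs.
     (\<forall>Y\<in>set Xs. Y \<in> Obj C \<and> local_ring (End_ring C Y)) \<and> direct_sum C Xs X)"

text \<open>\<open>|X|\<close>: the number of isomorphism classes of indecomposable direct summands.\<close>

definition num_indec :: "('o, 'f) precat \<Rightarrow> 'o \<Rightarrow> nat" where
  "num_indec C X =
     card ({Y. indecomposable C Y \<and> summand C Y X} // {(Y, Y'). isomorphic C Y Y'})"

text \<open>\<open>f : Q \<rightarrow> X\<close>, respectively \<open>f : X \<rightarrow> Q\<close>, is an approximation by the class \<open>U\<close>.\<close>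

definition right_approx :: "('o, 'f) precat \<Rightarrow> 'o set \<Rightarrow> 'o \<Rightarrow> 'o \<Rightarrow> 'f \<Rightarrow> bool" where
  "right_approx C U Q X f \<longleftrightarrow> Q \<in> U \<and> f \<in> Hom C Q X \<and>
     (\<forall>W\<in>U. \<forall>h\<in>Hom C W X. \<exists>g\<in>Hom C W Q. h = Cmp C f g)"

definition left_approx :: "('o, 'f) precat \<Rightarrow> 'o set \<Rightarrow> 'o \<Rightarrow> 'o \<Rightarrow> 'f \<Rightarrow> bool" where
  "left_approx C U X Q f \<longleftrightarrow> Q \<in> U \<and> f \<in> Hom C X Q \<and>
     (\<forall>W\<in>U. \<forall>h\<in>Hom C X W. \<exists>g\<in>Hom C Q W. h = Cmp C g f)"


section \<open>The bounded homotopy category of an additive category\<close>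

text \<open>Complexes are graded cohomologically: \<open>dif X n : cob X n \<rightarrow> cob X (n + 1)\<close>.\<close>

record ('o, 'f) cplx =
  cob :: "int \<Rightarrow> 'o"
  dif :: "int \<Rightarrow> 'f"

definition bounded_complex :: "('o, 'f) precat \<Rightarrow> ('o, 'f) cplx \<Rightarrow> bool" where
  "bounded_complex A X \<longleftrightarrow>
     (\<forall>n. cob X n \<in> Obj A \<and> dif X n \<in> Hom A (cob X n) (cob X (n + 1)) \<and>
          Cmp A (dif X (n + 1)) (dif X n) = Zer A (cob X n) (cob X (n + 1 + 1))) \<and>
     finite {n. \<not> zero_object A (cob X n)}"

definition chain_map ::
  "('o, 'f) precat \<Rightarrow> ('o, 'f) cplx \<Rightarrow> ('o, 'f) cplx \<Rightarrow> (int \<Rightarrow> 'f) \<Rightarrow> bool" where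
  "chain_map A X Y \<phi> \<longleftrightarrow>
     (\<forall>n. \<phi> n \<in> Hom A (cob X n) (cob Y n) \<and>
          Cmp A (dif Y n) (\<phi> n) = Cmp A (\<phi> (n + 1)) (dif X n))"

definition homotopic ::
  "('o, 'f) precat \<Rightarrow> ('o, 'f) cplx \<Rightarrow> ('o, 'f) cplx \<Rightarrow> (int \<Rightarrow> 'f) \<Rightarrow> (int \<Rightarrow> 'f) \<Rightarrow> bool" where
  "homotopic A X Y \<phi> \<psi> \<longleftrightarrow>
     (\<exists>s. (\<forall>n. s n \<in> Hom A (cob X n) (cob Y (n - 1))) \<and>
          (\<forall>n. Add A (\<phi> n) (Neg A (\<psi> n)) =
               Add A (Cmp A (dif Y (n - 1)) (s n)) (Cmp A (s (n + 1)) (dif X n))))"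

definition homotopy_class ::
  "('o, 'f) precat \<Rightarrow> ('o, 'f) cplx \<Rightarrow> ('o, 'f) cplx \<Rightarrow> (int \<Rightarrow> 'f) \<Rightarrow> (int \<Rightarrow> 'f) set" where
  "homotopy_class A X Y \<phi> = {\<psi>. chain_map A X Y \<psi> \<and> homotopic A X Y \<phi> \<psi>}"

text \<open>
  An arrow \<open>X \<rightarrow> Y\<close> of \<open>Kb A\<close> is a triple \<open>(X, F, Y)\<close> with \<open>F\<close> a homotopy class of chain maps.
  The operations on classes are induced from representatives: the unions below run over classes
  that all coincide.
\<close>

type_synonym ('o, 'f) karr = "('o, 'f) cplx \<times> (int \<Rightarrow> 'f) set \<times> ('o, 'f) cplx"

fun K_cmp :: "('o, 'f) precat \<Rightarrow> ('o, 'f) karr \<Rightarrow> ('o, 'f) karr \<Rightarrow> ('o, 'f) karr" where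
  "K_cmp A (Y', G, Z) (X, F, Y) =
     (X, \<Union>\<phi>\<in>F. \<Union>\<gamma>\<in>G. homotopy_class A X Z (\<lambda>n. Cmp A (\<gamma> n) (\<phi> n)), Z)"

fun K_add :: "('o, 'f) precat \<Rightarrow> ('o, 'f) karr \<Rightarrow> ('o, 'f) karr \<Rightarrow> ('o, 'f) karr" where
  "K_add A (X, F, Y) (X', G, Y') =
     (X, \<Union>\<phi>\<in>F. \<Union>\<gamma>\<in>G. homotopy_class A X Y (\<lambda>n. Add A (\<phi> n) (\<gamma> n)), Y)"

fun K_neg :: "('o, 'f) precat \<Rightarrow> ('o, 'f) karr \<Rightarrow> ('o, 'f) karr" where
  "K_neg A (X, F, Y) = (X, \<Union>\<phi>\<in>F. homotopy_class A X Y (\<lambda>n. Neg A (\<phi> n)), Y)"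

definition Kb :: "('o, 'f) precat \<Rightarrow> (('o, 'f) cplx, ('o, 'f) karr) precat" where
  "Kb A = \<lparr>
     Obj = {X. bounded_complex A X},
     Hom = (\<lambda>X Y. {(X, homotopy_class A X Y \<phi>, Y) | \<phi>. chain_map A X Y \<phi>}),
     Cmp = K_cmp A,
     Idn = (\<lambda>X. (X, homotopy_class A X X (\<lambda>n. Idn A (cob X n)), X)),
     Add = K_add A,
     Neg = K_neg A,
     Zer = (\<lambda>X Y. (X, homotopy_class A X Y (\<lambda>n. Zer A (cob X n) (cob Y n)), Y))\<rparr>"

text \<open>\<open>shift A k X\<close> is \<open>X[k]\<close>, with differential \<open>(-1)^k d\<close>.\<close>

definition shift :: "('o, 'f) precat \<Rightarrow> int \<Rightarrow> ('o, 'f) cplx \<Rightarrow> ('o, 'f) cplx" where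
  "shift A k X = \<lparr>
     cob = (\<lambda>n. cob X (n + k)),
     dif = (\<lambda>n. if even k then dif X (n + k) else Neg A (dif X (n + k)))\<rparr>"

text \<open>
  \<open>chain_cone A X Y \<phi> Z\<close>: in each degree \<open>Z\<close> is a direct sum of \<open>X\<^sub>n\<^sub>+\<^sub>1\<close> and \<open>Y\<^sub>n\<close>, and with respect
  to this decomposition its differential is the matrix with rows \<open>(-d, 0)\<close> and \<open>(\<phi>, d)\<close>.
\<close>

definition chain_cone ::
  "('o, 'f) precat \<Rightarrow> ('o, 'f) cplx \<Rightarrow> ('o, 'f) cplx \<Rightarrow> (int \<Rightarrow> 'f) \<Rightarrow> ('o, 'f) cplx \<Rightarrow> bool" where
  "chain_cone A X Y \<phi> Z \<longleftrightarrow>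
     (\<exists>i j p q. \<forall>n.
        biproduct_diagram A (cob X (n + 1)) (cob Y n) (cob Z n) (i n) (j n) (p n) (q n) \<and>
        dif Z n =
          Add A (Cmp A (i (n + 1)) (Cmp A (Neg A (dif X (n + 1))) (p n)))
         (Add A (Cmp A (j (n + 1)) (Cmp A (\<phi> (n + 1)) (p n)))
                (Cmp A (j (n + 1)) (Cmp A (dif Y n) (q n)))))"

text \<open>\<open>cone A X Y f Z\<close>: the complex \<open>Z\<close> is a mapping cone of a representative of the arrow
  \<open>f : X \<rightarrow> Y\<close> of \<open>Kb A\<close>; this determines \<open>Z\<close> up to isomorphism in \<open>Kb A\<close>.\<close>

definition cone ::
  "('o, 'f) precat \<Rightarrow> ('o, 'f) cplx \<Rightarrow> ('o, 'f) cplx \<Rightarrow> ('o, 'f) karr \<Rightarrow> ('o, 'f) cplx \<Rightarrow> bool" where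
  "cone A X Y f Z \<longleftrightarrow> X \<in> Obj (Kb A) \<and> Y \<in> Obj (Kb A) \<and> Z \<in> Obj (Kb A) \<and> f \<in> Hom (Kb A) X Y \<and>
     (\<exists>\<phi>\<in>fst (snd f). chain_cone A X Y \<phi> Z)"

text \<open>Full triangulated subcategories closed under direct summands.\<close>

definition thick :: "('o, 'f) precat \<Rightarrow> ('o, 'f) cplx set \<Rightarrow> bool" where
  "thick A U \<longleftrightarrow> U \<subseteq> Obj (Kb A) \<and> U \<noteq> {} \<and>
     (\<forall>X\<in>U. \<forall>Y. isomorphic (Kb A) X Y \<longrightarrow> Y \<in> U) \<and>
     (\<forall>X\<in>U. \<forall>k. shift A k X \<in> U) \<and>
     (\<forall>X\<in>U. \<forall>Y\<in>U. \<forall>f Z. cone A X Y f Z \<longrightarrow> Z \<in> U) \<and>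
     (\<forall>X\<in>U. \<forall>Y. summand (Kb A) Y X \<longrightarrow> Y \<in> U)"

definition thick_closure :: "('o, 'f) precat \<Rightarrow> ('o, 'f) cplx \<Rightarrow> ('o, 'f) cplx set" where
  "thick_closure A P = \<Inter>{U. thick A U \<and> P \<in> U}"

definition presilting :: "('o, 'f) precat \<Rightarrow> ('o, 'f) cplx \<Rightarrow> bool" where
  "presilting A P \<longleftrightarrow> P \<in> Obj (Kb A) \<and>
     (\<forall>k>0. Hom (Kb A) P (shift A k P) = {Zer (Kb A) P (shift A k P)})"

definition silting :: "('o, 'f) precat \<Rightarrow> ('o, 'f) cplx \<Rightarrow> bool" where
  "silting A P \<longleftrightarrow> presilting A P \<and> thick_closure A P = Obj (Kb A)"

definition K2 :: "('o, 'f) precat \<Rightarrow> (('o, 'f) cplx, ('o, 'f) karr) precat" where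
  "K2 A = full_subcat (Kb A) {X. \<forall>n. n \<noteq> 0 \<and> n \<noteq> -1 \<longrightarrow> zero_object A (cob X n)}"

text \<open>\<open>U\<close> is a direct sum \<open>X \<oplus> Y\<close>, and \<open>V\<close> is a direct sum of \<open>X\<close> and a cone of \<open>f\<close>.\<close>

definition irreducible_left_mutation ::
  "('o, 'f) precat \<Rightarrow> ('o, 'f) cplx \<Rightarrow> ('o, 'f) cplx \<Rightarrow> bool" where
  "irreducible_left_mutation A S T \<longleftrightarrow>
     (\<exists>X Y U X' f Z V.
        biproduct (Kb A) X Y U \<and> silting A U \<and>
        (\<forall>W \<in> add_cat (Kb A) X \<inter> add_cat (Kb A) Y. zero_object (Kb A) W) \<and>
        indecomposable (Kb A) Y \<and>
        left_approx (Kb A) (add_cat (Kb A) X) Y X' f \<and>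
        cone A Y X' f Z \<and> biproduct (Kb A) X Z V \<and>
        additively_equivalent (Kb A) S U \<and> additively_equivalent (Kb A) T V)"


section \<open>Finitely generated projective left modules\<close>

text \<open>The library locale \<open>module\<close> assumes a commutative ring; its record type is reused here.\<close>

locale left_module = R?: ring R + M?: abelian_group M
  for R :: "('a, 'r) ring_scheme" (structure) and M :: "('a, 'm) module" (structure) +
  assumes smult_closed:
      "\<lbrakk>a \<in> carrier R; x \<in> carrier M\<rbrakk> \<Longrightarrow> a \<odot>\<^bsub>M\<^esub> x \<in> carrier M"
    and smult_l_distr:
      "\<lbrakk>a \<in> carrier R; b \<in> carrier R; x \<in> carrier M\<rbrakk> \<Longrightarrow>
       (a \<oplus> b) \<odot>\<^bsub>M\<^esub> x = a \<odot>\<^bsub>M\<^esub> x \<oplus>\<^bsub>M\<^esub> b \<odot>\<^bsub>M\<^esub> x"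
    and smult_r_distr:
      "\<lbrakk>a \<in> carrier R; x \<in> carrier M; y \<in> carrier M\<rbrakk> \<Longrightarrow>
       a \<odot>\<^bsub>M\<^esub> (x \<oplus>\<^bsub>M\<^esub> y) = a \<odot>\<^bsub>M\<^esub> x \<oplus>\<^bsub>M\<^esub> a \<odot>\<^bsub>M\<^esub> y"
    and smult_assoc:
      "\<lbrakk>a \<in> carrier R; b \<in> carrier R; x \<in> carrier M\<rbrakk> \<Longrightarrow>
       (a \<otimes> b) \<odot>\<^bsub>M\<^esub> x = a \<odot>\<^bsub>M\<^esub> (b \<odot>\<^bsub>M\<^esub> x)"
    and smult_one:
      "x \<in> carrier M \<Longrightarrow> \<one> \<odot>\<^bsub>M\<^esub> x = x"

definition lmod_hom ::
  "('a, 'r) ring_scheme \<Rightarrow> ('a, 'm) module \<Rightarrow> ('a, 'n) module \<Rightarrow> ('m \<Rightarrow> 'n) set" where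
  "lmod_hom R M N = {f \<in> carrier M \<rightarrow>\<^sub>E carrier N.
     (\<forall>x\<in>carrier M. \<forall>y\<in>carrier M. f (x \<oplus>\<^bsub>M\<^esub> y) = f x \<oplus>\<^bsub>N\<^esub> f y) \<and>
     (\<forall>r\<in>carrier R. \<forall>x\<in>carrier M. f (r \<odot>\<^bsub>M\<^esub> x) = r \<odot>\<^bsub>N\<^esub> f x)}"

definition fin_generated :: "('a, 'r) ring_scheme \<Rightarrow> ('a, 'm) module \<Rightarrow> bool" where
  "fin_generated R M \<longleftrightarrow> (\<exists>B. finite B \<and> B \<subseteq> carrier M \<and>
     (\<forall>x\<in>carrier M. \<exists>c\<in>B \<rightarrow> carrier R. x = (\<Oplus>\<^bsub>M\<^esub>b\<in>B. c b \<odot>\<^bsub>M\<^esub> b)))"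

text \<open>
  From here on the elements of modules over \<open>R :: 'a ring\<close> are taken from the type \<open>'a list\<close>.  Every
  finitely generated \<open>R\<close>-module is a quotient of some \<open>R\<^sup>n\<close>, hence isomorphic to a module whose
  carrier is a set of lists of length \<open>n\<close>; so \<open>proj R\<close> below is equivalent to the category of all
  finitely generated projective left \<open>R\<close>-modules.  For a finitely generated module the lifting
  property against surjections between modules in this type is ordinary projectivity, because
  the free modules \<open>R\<^sup>n\<close> are among them.
\<close>

definition projective_module :: "('a, 'r) ring_scheme \<Rightarrow> ('a, 'a list) module \<Rightarrow> bool" where
  "projective_module R M \<longleftrightarrow>
     (\<forall>(N :: ('a, 'a list) module) (N' :: ('a, 'a list) module).
        \<forall>e\<in>lmod_hom R N N'. \<forall>f\<in>lmod_hom R M N'.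
        left_module R N \<and> left_module R N' \<and> e ` carrier N = carrier N' \<longrightarrow>
        (\<exists>g\<in>lmod_hom R M N. \<forall>x\<in>carrier M. e (g x) = f x))"

text \<open>The module \<open>R\<^sup>n\<close>; the fields \<open>mult\<close> and \<open>one\<close> of a module record carry no meaning.\<close>

definition free_module :: "('a, 'r) ring_scheme \<Rightarrow> nat \<Rightarrow> ('a, 'a list) module" where
  "free_module R n = \<lparr>
     carrier = {xs. length xs = n \<and> set xs \<subseteq> carrier R},
     monoid.mult = undefined, one = undefined,
     zero = replicate n \<zero>\<^bsub>R\<^esub>, add = map2 (add R),
     smult = (\<lambda>r. map (\<lambda>x. r \<otimes>\<^bsub>R\<^esub> x))\<rparr>"

type_synonym 'a lmod = "('a, 'a list) module"
type_synonym 'a lmod_arr = "'a lmod \<times> ('a list \<Rightarrow> 'a list) \<times> 'a lmod"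

fun lmod_cmp :: "'a lmod_arr \<Rightarrow> 'a lmod_arr \<Rightarrow> 'a lmod_arr" where
  "lmod_cmp (N', g, L) (M, f, N) = (M, \<lambda>x\<in>carrier M. g (f x), L)"

fun lmod_add :: "'a lmod_arr \<Rightarrow> 'a lmod_arr \<Rightarrow> 'a lmod_arr" where
  "lmod_add (M, f, N) (M', g, N') = (M, \<lambda>x\<in>carrier M. f x \<oplus>\<^bsub>N\<^esub> g x, N)"

fun lmod_neg :: "'a lmod_arr \<Rightarrow> 'a lmod_arr" where
  "lmod_neg (M, f, N) = (M, \<lambda>x\<in>carrier M. \<ominus>\<^bsub>N\<^esub> f x, N)"

definition proj :: "('a, 'r) ring_scheme \<Rightarrow> ('a lmod, 'a lmod_arr) precat" where
  "proj R = \<lparr>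
     Obj = {M. left_module R M \<and> fin_generated R M \<and> projective_module R M},
     Hom = (\<lambda>M N. {(M, f, N) | f. f \<in> lmod_hom R M N}),
     Cmp = lmod_cmp,
     Idn = (\<lambda>M. (M, \<lambda>x\<in>carrier M. x, M)),
     Add = lmod_add,
     Neg = lmod_neg,
     Zer = (\<lambda>M N. (M, \<lambda>x\<in>carrier M. \<zero>\<^bsub>N\<^esub>, N))\<rparr>"

type_synonym 'a pcplx = "('a lmod, 'a lmod_arr) cplx"

text \<open>The ring as a complex concentrated in degree \<open>0\<close>; \<open>free_module R 0\<close> is the zero module.\<close>

definition stalk :: "('a, 'r) ring_scheme \<Rightarrow> 'a pcplx" where
  "stalk R = (let c = (\<lambda>n. free_module R (if n = 0 then 1 else 0)) in
     \<lparr>cob = c, dif = (\<lambda>n. Zer (proj R) (c n) (c (n + 1)))\<rparr>)"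


section \<open>Two-term silting complexes\<close>

definition two_term_presilting :: "('a, 'r) ring_scheme \<Rightarrow> 'a pcplx \<Rightarrow> bool" where
  "two_term_presilting R P \<longleftrightarrow> P \<in> Obj (K2 (proj R)) \<and> presilting (proj R) P"

definition two_term_silting :: "('a, 'r) ring_scheme \<Rightarrow> 'a pcplx \<Rightarrow> bool" where
  "two_term_silting R P \<longleftrightarrow> P \<in> Obj (K2 (proj R)) \<and> silting (proj R) P"

definition almost_complete_two_term_silting :: "('a, 'r) ring_scheme \<Rightarrow> 'a pcplx \<Rightarrow> bool" where
  "almost_complete_two_term_silting R P \<longleftrightarrow> two_term_presilting R P \<and>
     int (num_indec (K2 (proj R)) P) = int (num_indec (K2 (proj R)) (stalk R)) - 1"

definition completion :: "('a, 'r) ring_scheme \<Rightarrow> 'a pcplx \<Rightarrow> 'a pcplx \<Rightarrow> bool" where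
  "completion R P T \<longleftrightarrow> two_term_silting R T \<and>
     add_cat (Kb (proj R)) P \<subseteq> add_cat (Kb (proj R)) T"

text \<open>\<open>S\<close> is a Bongartz completion \<open>P \<oplus> C(f)[-1]\<close>, where \<open>f : P' \<rightarrow> R[1]\<close>, respectively
  a co-Bongartz completion \<open>P \<oplus> C(g)\<close>, where \<open>g : R \<rightarrow> P'\<close>.\<close>

definition bongartz_completion :: "('a, 'r) ring_scheme \<Rightarrow> 'a pcplx \<Rightarrow> 'a pcplx \<Rightarrow> bool" where
  "bongartz_completion R P S \<longleftrightarrow>
     (let A = proj R; K = Kb A in
      \<exists>P' f Z. right_approx K (add_cat K P) P' (shift A 1 (stalk R)) f \<and>
               cone A P' (shift A 1 (stalk R)) f Z \<and>
               biproduct K P (shift A (-1) Z) S)"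

definition co_bongartz_completion :: "('a, 'r) ring_scheme \<Rightarrow> 'a pcplx \<Rightarrow> 'a pcplx \<Rightarrow> bool" where
  "co_bongartz_completion R P T \<longleftrightarrow>
     (let A = proj R; K = Kb A in
      \<exists>P' g Z. left_approx K (add_cat K P) (stalk R) P' g \<and>
               cone A (stalk R) P' g Z \<and>
               biproduct K P Z T)"

end

theory Submission
  imports Defs
begin

text \<open>
  Write \<open>\<Lambda>\<close> for \<open>R\<close> as a stalk complex.  A two-term silting complex \<open>T\<close> has a coresolution \<open>\<Lambda> \<rightarrow> T0 \<rightarrow> T1 \<rightarrow> \<Lambda>[1]\<close>
  with \<open>T0\<close>, \<open>T1\<close> in \<open>add T\<close>, obtained by reordering a filtration of \<open>\<Lambda>\<close> by shifts of \<open>T\<close>; counting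
  multiplicities along such triangles gives \<open>|T| = |\<Lambda>|\<close>, so a completion of \<open>P\<close> has exactly one
  indecomposable summand \<open>X\<close> outside \<open>add P\<close>.  If the coresolution is minimal, \<open>X\<close> does not occur in both
  \<open>T0\<close> and \<open>T1\<close>.  If \<open>T1\<close> lies in \<open>add P\<close>, then \<open>T1 \<rightarrow> \<Lambda>[1]\<close> is a right approximation with shifted cone
  \<open>T0\<close>, and \<open>T\<close> is the Bongartz completion; if \<open>T0\<close> does, \<open>\<Lambda> \<rightarrow> T0\<close> is a left approximation with cone
  \<open>T1\<close>, and \<open>T\<close> is the co-Bongartz completion.  If both completions exist, pushing out the Bongartz triangle
  \<open>\<Lambda> \<rightarrow> B \<rightarrow> Q\<close> along \<open>\<Lambda> \<rightarrow> Q'\<close> yields a left approximation \<open>B \<rightarrow> E\<close> whose cone is that of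
  \<open>\<Lambda> \<rightarrow> Q'\<close>; restricted to the summand \<open>X\<close> of \<open>B\<close> it is the mutation triangle.
\<close>

text \<open>Three obstacles shape the proof. Hom groups satisfy no finiteness condition, so
  approximations do not exist for free. The one of \<Lambda> has to come out of a finite filtration,
  and as \<Lambda> is known only to be a retract of a filtered object, the retraction is carried
  along. Krull-Schmidt is given for two-term complexes only, so each object that has to be
  decomposed is first placed in \<open>addc T\<close> for a two-term T or replaced by an isomorphic
  two-term complex. Finally, arrows live in carrier sets. Graded arrows from X to Y therefore become
  elements of subsets \<open>G X Y n\<close> of a ring. This is done twice: for families of arrows
  that ignore differentials, where a differential is itself a ring element and homotopies and cones
  are computed algebraically, and for the homotopy category, whose elements are classes of the
  closed ones. The count of summands avoids a Grothendieck group: coefficients of resolutions and of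
  coresolutions form two integer matrices whose product is an identity matrix, so that no
  independence of choices has to be shown.\<close>

section \<open>Additive endomorphisms as elements of a type-class ring\<close>

text \<open>Values outside the carrier and at structures that are not abelian groups are prescribed,
  so families that agree on all carriers are equal. The value zero outside the carrier is compatible
  with composition, because an additive map fixes zero.\<close>

definition good_family :: "('g ring \<Rightarrow> 'g \<Rightarrow> 'g) \<Rightarrow> bool" where
  "good_family T \<longleftrightarrow> (\<forall>G. (abelian_group G \<longrightarrow>
      (\<forall>x\<in>carrier G. T G x \<in> carrier G) \<and>
      (\<forall>x\<in>carrier G. \<forall>y\<in>carrier G. T G (x \<oplus>\<^bsub>G\<^esub> y) = T G x \<oplus>\<^bsub>G\<^esub> T G y) \<and>
      (\<forall>x. x \<notin> carrier G \<longrightarrow> T G x = \<zero>\<^bsub>G\<^esub>)) \<and>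
      (\<not> abelian_group G \<longrightarrow> T G = (\<lambda>_. undefined)))"

lemma good_familyD:
  assumes "good_family T" "abelian_group G"
  shows "x \<in> carrier G \<Longrightarrow> T G x \<in> carrier G"
    and "x \<in> carrier G \<Longrightarrow> y \<in> carrier G \<Longrightarrow> T G (x \<oplus>\<^bsub>G\<^esub> y) = T G x \<oplus>\<^bsub>G\<^esub> T G y"
    and "x \<notin> carrier G \<Longrightarrow> T G x = \<zero>\<^bsub>G\<^esub>"
  using assms unfolding good_family_def by blast+

lemma good_family_zero:
  assumes "good_family T" "abelian_group G"
  shows "T G \<zero>\<^bsub>G\<^esub> = \<zero>\<^bsub>G\<^esub>"
proof -
  interpret abelian_group G by fact
  note D = good_familyD[OF assms]
  have "T G \<zero>\<^bsub>G\<^esub> \<oplus>\<^bsub>G\<^esub> T G \<zero>\<^bsub>G\<^esub> = T G \<zero>\<^bsub>G\<^esub>"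
    using D(2)[of "\<zero>\<^bsub>G\<^esub>" "\<zero>\<^bsub>G\<^esub>"] by simp
  then show ?thesis using D(1)[of "\<zero>\<^bsub>G\<^esub>"] by (metis add.r_cancel_one' zero_closed)
qed

lemma good_family_zero_family:
  "good_family (\<lambda>G (x::'g). if abelian_group G then \<zero>\<^bsub>G\<^esub> else undefined)"
proof -
  { fix G :: "'g ring" assume "abelian_group G"
    then interpret abelian_group G .
    have "\<zero>\<^bsub>G\<^esub> \<in> carrier G" "\<zero>\<^bsub>G\<^esub> = \<zero>\<^bsub>G\<^esub> \<oplus>\<^bsub>G\<^esub> \<zero>\<^bsub>G\<^esub>" by simp_all }
  then show ?thesis unfolding good_family_def by simp
qed

lemma good_family_in: "good_family T \<Longrightarrow> abelian_group G \<Longrightarrow> T G x \<in> carrier G"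
  by (metis abelian_group.axioms(1) abelian_monoid.zero_closed good_familyD(1) good_familyD(3))

text \<open>
  Arrows of a carrier-based preadditive category act on a suitable abelian group.  Ranging over all
  abelian groups at once turns such actions into elements of one type-class ring, in which identities
  between composites and sums can be checked without membership side conditions.
\<close>

typedef 'g endo = "{T :: 'g ring \<Rightarrow> 'g \<Rightarrow> 'g. good_family T}"
  morphisms act Abs_endo
  using good_family_zero_family by blast

setup_lifting type_definition_endo

lemma good_act: "good_family (act T)" using act by blast

instantiation endo :: (type) "{ring, monoid_mult}"
begin

lift_definition zero_endo :: "'g endo" is "\<lambda>G x. if abelian_group G then \<zero>\<^bsub>G\<^esub> else undefined"
  by (rule good_family_zero_family)

lift_definition one_endo :: "'g endo" is
  "\<lambda>G x. if abelian_group G then (if x \<in> carrier G then x else \<zero>\<^bsub>G\<^esub>) else undefined"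
  unfolding good_family_def by (simp add: abelian_monoid.a_closed[OF abelian_group.axioms(1)])

lift_definition plus_endo :: "'g endo \<Rightarrow> 'g endo \<Rightarrow> 'g endo" is
  "\<lambda>S T G x. if abelian_group G then S G x \<oplus>\<^bsub>G\<^esub> T G x else undefined"
  subgoal premises prems for S T
  proof -
    { fix G :: "'g ring" assume ag: "abelian_group G"
      interpret abelian_group G by fact
      note S = good_familyD[OF prems(1) ag] and T = good_familyD[OF prems(2) ag]
      have "\<forall>x\<in>carrier G. S G x \<oplus>\<^bsub>G\<^esub> T G x \<in> carrier G" using S(1) T(1) by simp
      moreover have "\<forall>x\<in>carrier G. \<forall>y\<in>carrier G. S G (x \<oplus>\<^bsub>G\<^esub> y) \<oplus>\<^bsub>G\<^esub> T G (x \<oplus>\<^bsub>G\<^esub> y)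
          = (S G x \<oplus>\<^bsub>G\<^esub> T G x) \<oplus>\<^bsub>G\<^esub> (S G y \<oplus>\<^bsub>G\<^esub> T G y)"
        using S(1) T(1) by (simp add: S(2) T(2) a_ac)
      moreover have "\<forall>x. x \<notin> carrier G \<longrightarrow> S G x \<oplus>\<^bsub>G\<^esub> T G x = \<zero>\<^bsub>G\<^esub>" by (simp add: S(3) T(3))
      ultimately have "(\<forall>x\<in>carrier G. S G x \<oplus>\<^bsub>G\<^esub> T G x \<in> carrier G) \<and>
        (\<forall>x\<in>carrier G. \<forall>y\<in>carrier G. S G (x \<oplus>\<^bsub>G\<^esub> y) \<oplus>\<^bsub>G\<^esub> T G (x \<oplus>\<^bsub>G\<^esub> y)
          = (S G x \<oplus>\<^bsub>G\<^esub> T G x) \<oplus>\<^bsub>G\<^esub> (S G y \<oplus>\<^bsub>G\<^esub> T G y)) \<and>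
        (\<forall>x. x \<notin> carrier G \<longrightarrow> S G x \<oplus>\<^bsub>G\<^esub> T G x = \<zero>\<^bsub>G\<^esub>)" by blast }
    then show ?thesis unfolding good_family_def by auto
  qed
  done

lift_definition uminus_endo :: "'g endo \<Rightarrow> 'g endo" is
  "\<lambda>S G x. if abelian_group G then \<ominus>\<^bsub>G\<^esub> S G x else undefined"
  subgoal premises prems for S
  proof -
    { fix G :: "'g ring" assume ag: "abelian_group G"
      interpret abelian_group G by fact
      note S = good_familyD[OF prems(1) ag]
      have "(\<forall>x\<in>carrier G. \<ominus>\<^bsub>G\<^esub> S G x \<in> carrier G) \<and>
        (\<forall>x\<in>carrier G. \<forall>y\<in>carrier G. \<ominus>\<^bsub>G\<^esub> S G (x \<oplus>\<^bsub>G\<^esub> y) = \<ominus>\<^bsub>G\<^esub> S G x \<oplus>\<^bsub>G\<^esub> \<ominus>\<^bsub>G\<^esub> S G y) \<and>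
        (\<forall>x. x \<notin> carrier G \<longrightarrow> \<ominus>\<^bsub>G\<^esub> S G x = \<zero>\<^bsub>G\<^esub>)"
        using S(1) by (auto simp: S(2,3) minus_add) }
    then show ?thesis unfolding good_family_def by auto
  qed
  done

lift_definition times_endo :: "'g endo \<Rightarrow> 'g endo \<Rightarrow> 'g endo" is
  "\<lambda>S T G x. if abelian_group G then S G (T G x) else undefined"
  subgoal premises prems for S T
  proof -
    { fix G :: "'g ring" assume ag: "abelian_group G"
      note S = good_familyD[OF prems(1) ag] and T = good_familyD[OF prems(2) ag]
      have "(\<forall>x\<in>carrier G. S G (T G x) \<in> carrier G) \<and>
        (\<forall>x\<in>carrier G. \<forall>y\<in>carrier G. S G (T G (x \<oplus>\<^bsub>G\<^esub> y)) = S G (T G x) \<oplus>\<^bsub>G\<^esub> S G (T G y)) \<and>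
        (\<forall>x. x \<notin> carrier G \<longrightarrow> S G (T G x) = \<zero>\<^bsub>G\<^esub>)"
        using S(1) T(1) by (auto simp: S(2) T(2,3) good_family_zero[OF prems(1) ag]) }
    then show ?thesis unfolding good_family_def by auto
  qed
  done

definition minus_endo :: "'g endo \<Rightarrow> 'g endo \<Rightarrow> 'g endo" where "minus_endo S T = S + (- T)"

instance
proof
  fix a b c :: "'g endo"
  have eqI: "S = T" if "\<And>G x. abelian_group G \<Longrightarrow> act S G x = act T G x" for S T :: "'g endo"
  proof -
    have "act S = act T"
      using that good_act[of S] good_act[of T] unfolding good_family_def fun_eq_iff by metis
    then show ?thesis by (simp add: act_inject)
  qed
  note acts = times_endo.rep_eq plus_endo.rep_eq zero_endo.rep_eq one_endo.rep_eq uminus_endo.rep_eq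
  note cl = good_family_in[OF good_act]
  show "a * b * c = a * (b * c)" by (rule eqI) (simp add: acts)
  show "a + b + c = a + (b + c)"
    by (rule eqI) (simp add: acts cl abelian_monoid.a_assoc[OF abelian_group.axioms(1)])
  show "a + b = b + a"
    by (rule eqI) (simp add: acts, rule abelian_monoid.a_comm[OF abelian_group.axioms(1)], auto simp: cl)
  show "0 + a = a"
    by (rule eqI) (simp add: acts cl abelian_monoid.l_zero[OF abelian_group.axioms(1)])
  show "- a + a = 0"
    by (rule eqI) (simp add: acts cl abelian_group.l_neg)
  show "a - b = a + - b" by (simp add: minus_endo_def)
  show "(a + b) * c = a * c + b * c" by (rule eqI) (simp add: acts)
  show "a * (b + c) = a * b + a * c"
    by (rule eqI) (simp add: acts cl good_familyD(2)[OF good_act])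
  show "1 * a = a" by (rule eqI) (simp add: acts cl)
  show "a * 1 = a"
    by (rule eqI) (simp add: acts cl good_family_zero[OF good_act] good_familyD(3)[OF good_act])
qed

end

text \<open>Every other abelian group gets the zero endomorphism. So \<open>endo_of G\<close>
  respects sums and products and is faithful on additive maps, but in general the identity of G does
  not become \<open>1\<close>; the units in use are local ones such as
  \<open>E X X (Idn C X)\<close>.\<close>

definition endo_of :: "'g ring \<Rightarrow> ('g \<Rightarrow> 'g) \<Rightarrow> 'g endo" where
  "endo_of G t = Abs_endo (\<lambda>G' x. if G' = G then (if x \<in> carrier G then t x else \<zero>\<^bsub>G\<^esub>)
     else if abelian_group G' then \<zero>\<^bsub>G'\<^esub> else undefined)"

definition additive_on :: "'g ring \<Rightarrow> ('g \<Rightarrow> 'g) \<Rightarrow> bool" where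
  "additive_on G t \<longleftrightarrow> (\<forall>x\<in>carrier G. t x \<in> carrier G) \<and>
     (\<forall>x\<in>carrier G. \<forall>y\<in>carrier G. t (x \<oplus>\<^bsub>G\<^esub> y) = t x \<oplus>\<^bsub>G\<^esub> t y)"

context
  fixes G :: "'g ring"
  assumes G: "abelian_group G"
begin

interpretation abelian_group G by (rule G)

lemma act_endo_of:
  assumes "additive_on G t"
  shows "act (endo_of G t) = (\<lambda>G' x. if G' = G then (if x \<in> carrier G then t x else \<zero>\<^bsub>G\<^esub>)
     else if abelian_group G' then \<zero>\<^bsub>G'\<^esub> else undefined)"
proof -
  have "good_family (\<lambda>G' x. if G' = G then (if x \<in> carrier G then t x else \<zero>\<^bsub>G\<^esub>)
     else if abelian_group G' then \<zero>\<^bsub>G'\<^esub> else undefined)"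
    unfolding good_family_def
  proof (intro allI, goal_cases)
    case (1 G')
    show ?case
    proof (cases "G' = G \<or> \<not> abelian_group G'")
      case True
      then show ?thesis using assms G unfolding additive_on_def by (auto simp: fun_eq_iff)
    next
      case False
      then interpret H: abelian_group G' by simp
      show ?thesis using False by simp
    qed
  qed
  then show ?thesis unfolding endo_of_def by (simp add: Abs_endo_inverse)
qed

lemma endo_of_eqI: "(\<And>x. x \<in> carrier G \<Longrightarrow> t x = t' x) \<Longrightarrow> endo_of G t = endo_of G t'"
  unfolding endo_of_def by (rule arg_cong[where f = Abs_endo]) (auto simp: fun_eq_iff)

lemma endo_of_inject:
  assumes "additive_on G t" "additive_on G t'" "endo_of G t = endo_of G t'" "x \<in> carrier G"
  shows "t x = t' x"
proof -
  have "act (endo_of G t) G x = act (endo_of G t') G x" using assms(3) by simp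
  then show ?thesis using assms(4) by (simp add: act_endo_of[OF assms(1)] act_endo_of[OF assms(2)])
qed

lemma additive_onD: "additive_on G t \<Longrightarrow> x \<in> carrier G \<Longrightarrow> t x \<in> carrier G"
  unfolding additive_on_def by blast

lemma additive_on_zero: "additive_on G t \<Longrightarrow> t \<zero>\<^bsub>G\<^esub> = \<zero>\<^bsub>G\<^esub>"
  unfolding additive_on_def by (metis add.r_cancel_one' r_zero zero_closed)

lemma endo_of_mult:
  assumes "additive_on G s" "additive_on G t"
  shows "endo_of G s * endo_of G t = endo_of G (\<lambda>x. s (t x))"
proof -
  have a: "additive_on G (\<lambda>x. s (t x))" using assms unfolding additive_on_def by auto
  show ?thesis
    by (rule act_inject[THEN iffD1])
      (auto simp: times_endo.rep_eq act_endo_of[OF assms(1)] act_endo_of[OF assms(2)] act_endo_of[OF a]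
        fun_eq_iff additive_onD[OF assms(2)] additive_on_zero[OF assms(1)] G)
qed

lemma endo_of_add:
  assumes "additive_on G s" "additive_on G t"
  shows "endo_of G s + endo_of G t = endo_of G (\<lambda>x. s x \<oplus>\<^bsub>G\<^esub> t x)"
proof -
  have a: "additive_on G (\<lambda>x. s x \<oplus>\<^bsub>G\<^esub> t x)"
    using assms unfolding additive_on_def by (auto simp: a_ac)
  show ?thesis
    by (rule act_inject[THEN iffD1])
      (auto simp: plus_endo.rep_eq act_endo_of[OF assms(1)] act_endo_of[OF assms(2)] act_endo_of[OF a]
        fun_eq_iff G abelian_monoid.zero_closed[OF abelian_group.axioms(1)]
        abelian_monoid.l_zero[OF abelian_group.axioms(1)])
qed

end

section \<open>Preadditive categories represented in a ring\<close>

locale preadd =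
  fixes C :: "('o, 'f) precat"
  assumes cmp_in: "\<lbrakk>g \<in> Hom C Y Z; f \<in> Hom C X Y; X \<in> Obj C; Y \<in> Obj C; Z \<in> Obj C\<rbrakk> \<Longrightarrow> Cmp C g f \<in> Hom C X Z"
    and cmp_assoc: "\<lbrakk>h \<in> Hom C Y Z; g \<in> Hom C X Y; f \<in> Hom C W X; W \<in> Obj C; X \<in> Obj C; Y \<in> Obj C; Z \<in> Obj C\<rbrakk>
      \<Longrightarrow> Cmp C (Cmp C h g) f = Cmp C h (Cmp C g f)"
    and idn_in: "X \<in> Obj C \<Longrightarrow> Idn C X \<in> Hom C X X"
    and idn_left: "\<lbrakk>f \<in> Hom C X Y; X \<in> Obj C; Y \<in> Obj C\<rbrakk> \<Longrightarrow> Cmp C (Idn C Y) f = f"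
    and idn_right: "\<lbrakk>f \<in> Hom C X Y; X \<in> Obj C; Y \<in> Obj C\<rbrakk> \<Longrightarrow> Cmp C f (Idn C X) = f"
    and add_in: "\<lbrakk>f \<in> Hom C X Y; g \<in> Hom C X Y; X \<in> Obj C; Y \<in> Obj C\<rbrakk> \<Longrightarrow> Add C f g \<in> Hom C X Y"
    and zer_in: "\<lbrakk>X \<in> Obj C; Y \<in> Obj C\<rbrakk> \<Longrightarrow> Zer C X Y \<in> Hom C X Y"
    and neg_in: "\<lbrakk>f \<in> Hom C X Y; X \<in> Obj C; Y \<in> Obj C\<rbrakk> \<Longrightarrow> Neg C f \<in> Hom C X Y"
    and add_assoc: "\<lbrakk>f \<in> Hom C X Y; g \<in> Hom C X Y; h \<in> Hom C X Y; X \<in> Obj C; Y \<in> Obj C\<rbrakk>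
      \<Longrightarrow> Add C (Add C f g) h = Add C f (Add C g h)"
    and add_comm: "\<lbrakk>f \<in> Hom C X Y; g \<in> Hom C X Y; X \<in> Obj C; Y \<in> Obj C\<rbrakk> \<Longrightarrow> Add C f g = Add C g f"
    and add_zer: "\<lbrakk>f \<in> Hom C X Y; X \<in> Obj C; Y \<in> Obj C\<rbrakk> \<Longrightarrow> Add C (Zer C X Y) f = f"
    and add_neg: "\<lbrakk>f \<in> Hom C X Y; X \<in> Obj C; Y \<in> Obj C\<rbrakk> \<Longrightarrow> Add C (Neg C f) f = Zer C X Y"
    and cmp_add_left: "\<lbrakk>g \<in> Hom C Y Z; g' \<in> Hom C Y Z; f \<in> Hom C X Y; X \<in> Obj C; Y \<in> Obj C; Z \<in> Obj C\<rbrakk>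
      \<Longrightarrow> Cmp C (Add C g g') f = Add C (Cmp C g f) (Cmp C g' f)"
    and cmp_add_right: "\<lbrakk>g \<in> Hom C Y Z; f \<in> Hom C X Y; f' \<in> Hom C X Y; X \<in> Obj C; Y \<in> Obj C; Z \<in> Obj C\<rbrakk>
      \<Longrightarrow> Cmp C g (Add C f f') = Add C (Cmp C g f) (Cmp C g f')"
begin

lemma add_self_zer:
  assumes "X \<in> Obj C" "Y \<in> Obj C" "f \<in> Hom C X Y" "Add C f f = f"
  shows "f = Zer C X Y"
proof -
  have "Add C (Neg C f) (Add C f f) = Add C (Neg C f) f" using assms(4) by simp
  then have "Add C (Add C (Neg C f) f) f = Add C (Neg C f) f"
    using add_assoc[OF neg_in[OF assms(3,1,2)] assms(3,3,1,2)] by simp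
  then show ?thesis using add_neg[OF assms(3,1,2)] add_zer[OF assms(3,1,2)] by simp
qed

lemma cmp_zer_right:
  assumes "X \<in> Obj C" "Y \<in> Obj C" "Z \<in> Obj C" "g \<in> Hom C Y Z"
  shows "Cmp C g (Zer C X Y) = Zer C X Z"
proof (rule add_self_zer)
  note z = zer_in[OF assms(1,2)]
  show "Cmp C g (Zer C X Y) \<in> Hom C X Z" by (rule cmp_in[OF assms(4) z assms(1-3)])
  show "Add C (Cmp C g (Zer C X Y)) (Cmp C g (Zer C X Y)) = Cmp C g (Zer C X Y)"
    using cmp_add_right[OF assms(4) z z assms(1-3)] add_zer[OF z assms(1,2)] by simp
qed fact+

lemma cmp_zer_left:
  assumes "X \<in> Obj C" "Y \<in> Obj C" "Z \<in> Obj C" "f \<in> Hom C X Y"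
  shows "Cmp C (Zer C Y Z) f = Zer C X Z"
proof (rule add_self_zer)
  note z = zer_in[OF assms(2,3)]
  show "Cmp C (Zer C Y Z) f \<in> Hom C X Z" by (rule cmp_in[OF z assms(4,1-3)])
  show "Add C (Cmp C (Zer C Y Z) f) (Cmp C (Zer C Y Z) f) = Cmp C (Zer C Y Z) f"
    using cmp_add_left[OF z z assms(4,1-3)] add_zer[OF z assms(2,3)] by simp
qed fact+

text \<open>The product of all Hom groups of the category. Composition from the left acts on it, and
  the action is faithful because the product contains elements with an identity in a prescribed
  place.\<close>

definition test_group :: "('o \<Rightarrow> 'o \<Rightarrow> 'f) ring" where
  "test_group = \<lparr>carrier = {v. \<forall>W X. if W \<in> Obj C \<and> X \<in> Obj C then v W X \<in> Hom C W X else v W X = undefined},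
     monoid.mult = undefined, one = undefined,
     zero = (\<lambda>W X. if W \<in> Obj C \<and> X \<in> Obj C then Zer C W X else undefined),
     add = (\<lambda>u v W X. if W \<in> Obj C \<and> X \<in> Obj C then Add C (u W X) (v W X) else undefined)\<rparr>"

lemma test_groupD: "\<lbrakk>v \<in> carrier test_group; W \<in> Obj C; X \<in> Obj C\<rbrakk> \<Longrightarrow> v W X \<in> Hom C W X"
  unfolding test_group_def by auto

lemma test_groupI:
  "(\<And>W X. \<lbrakk>W \<in> Obj C; X \<in> Obj C\<rbrakk> \<Longrightarrow> v W X \<in> Hom C W X) \<Longrightarrow>
   (\<lambda>W X. if W \<in> Obj C \<and> X \<in> Obj C then v W X else undefined) \<in> carrier test_group"
  unfolding test_group_def by auto

lemma test_group_eqI: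
  "(\<And>W X. \<lbrakk>W \<in> Obj C; X \<in> Obj C\<rbrakk> \<Longrightarrow> u W X = v W X) \<Longrightarrow>
   (\<lambda>W X. if W \<in> Obj C \<and> X \<in> Obj C then u W X else undefined) =
   (\<lambda>W X. if W \<in> Obj C \<and> X \<in> Obj C then v W X else undefined)"
  by (auto simp: fun_eq_iff)

lemma test_group_add:
  "u \<oplus>\<^bsub>test_group\<^esub> v = (\<lambda>W X. if W \<in> Obj C \<and> X \<in> Obj C then Add C (u W X) (v W X) else undefined)"
  unfolding test_group_def by simp

lemma abelian_group_test_group: "abelian_group test_group"
proof (rule abelian_groupI)
  fix x y z assume x: "x \<in> carrier test_group" and y: "y \<in> carrier test_group" and z: "z \<in> carrier test_group"
  show "x \<oplus>\<^bsub>test_group\<^esub> y \<in> carrier test_group" using x y by (auto simp: test_group_def add_in)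
  show "x \<oplus>\<^bsub>test_group\<^esub> y \<oplus>\<^bsub>test_group\<^esub> z = x \<oplus>\<^bsub>test_group\<^esub> (y \<oplus>\<^bsub>test_group\<^esub> z)"
    using x y z by (auto simp: test_group_def fun_eq_iff intro!: add_assoc[OF test_groupD[OF x] test_groupD[OF y] test_groupD[OF z]])
  show "x \<oplus>\<^bsub>test_group\<^esub> y = y \<oplus>\<^bsub>test_group\<^esub> x"
    using x y by (auto simp: test_group_def fun_eq_iff intro!: add_comm[OF test_groupD[OF x] test_groupD[OF y]])
next
  show "\<zero>\<^bsub>test_group\<^esub> \<in> carrier test_group" by (auto simp: test_group_def zer_in)
next
  fix x assume x: "x \<in> carrier test_group"
  show "\<zero>\<^bsub>test_group\<^esub> \<oplus>\<^bsub>test_group\<^esub> x = x"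
    using x by (auto simp: test_group_def fun_eq_iff intro!: add_zer[OF test_groupD[OF x]])
  have "(\<lambda>W X. if W \<in> Obj C \<and> X \<in> Obj C then Neg C (x W X) else undefined) \<in> carrier test_group"
    using x by (auto simp: test_group_def neg_in)
  moreover have "(\<lambda>W X. if W \<in> Obj C \<and> X \<in> Obj C then Neg C (x W X) else undefined) \<oplus>\<^bsub>test_group\<^esub> x = \<zero>\<^bsub>test_group\<^esub>"
    using x by (auto simp: test_group_def fun_eq_iff intro!: add_neg[OF test_groupD[OF x]])
  ultimately show "\<exists>y\<in>carrier test_group. y \<oplus>\<^bsub>test_group\<^esub> x = \<zero>\<^bsub>test_group\<^esub>" by blast
qed

text \<open>A matrix unit: the component at X is sent by f to the component at Y and every other
  component is killed.\<close>

definition left_action :: "'o \<Rightarrow> 'o \<Rightarrow> 'f \<Rightarrow> ('o \<Rightarrow> 'o \<Rightarrow> 'f) \<Rightarrow> ('o \<Rightarrow> 'o \<Rightarrow> 'f)" where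
  "left_action X Y f v = (\<lambda>W Z. if W \<in> Obj C \<and> Z \<in> Obj C then
     (if Z = Y then Cmp C f (v W X) else Zer C W Z) else undefined)"

definition E :: "'o \<Rightarrow> 'o \<Rightarrow> 'f \<Rightarrow> ('o \<Rightarrow> 'o \<Rightarrow> 'f) endo" where
  "E X Y f = endo_of test_group (left_action X Y f)"

lemma additive_left_action:
  assumes "X \<in> Obj C" "Y \<in> Obj C" "f \<in> Hom C X Y"
  shows "additive_on test_group (left_action X Y f)"
  unfolding additive_on_def
proof (intro conjI ballI)
  fix u v assume u: "u \<in> carrier test_group" and v: "v \<in> carrier test_group"
  show "left_action X Y f u \<in> carrier test_group"
    unfolding left_action_def
    by (rule test_groupI) (use assms test_groupD[OF u] in \<open>auto intro: cmp_in zer_in\<close>)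
  show "left_action X Y f (u \<oplus>\<^bsub>test_group\<^esub> v) = left_action X Y f u \<oplus>\<^bsub>test_group\<^esub> left_action X Y f v"
    unfolding left_action_def test_group_add
    by (rule test_group_eqI)
      (use assms in \<open>auto simp: add_zer zer_in intro!: cmp_add_right[OF _ test_groupD[OF u] test_groupD[OF v]]\<close>)
qed

lemma E_mult:
  assumes "X \<in> Obj C" "Y \<in> Obj C" "Z \<in> Obj C" "f \<in> Hom C X Y" "g \<in> Hom C Y Z"
  shows "E Y Z g * E X Y f = E X Z (Cmp C g f)"
  unfolding E_def endo_of_mult[OF abelian_group_test_group additive_left_action[OF assms(2,3,5)] additive_left_action[OF assms(1,2,4)]]
  by (rule endo_of_eqI[OF abelian_group_test_group], unfold left_action_def, rule test_group_eqI)
    (use assms in \<open>auto intro!: cmp_assoc[OF assms(5,4) test_groupD, symmetric]\<close>)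

lemma E_add:
  assumes "X \<in> Obj C" "Y \<in> Obj C" "f \<in> Hom C X Y" "g \<in> Hom C X Y"
  shows "E X Y f + E X Y g = E X Y (Add C f g)"
  unfolding E_def endo_of_add[OF abelian_group_test_group additive_left_action[OF assms(1,2,3)] additive_left_action[OF assms(1,2,4)]]
  by (rule endo_of_eqI[OF abelian_group_test_group], unfold left_action_def test_group_add, rule test_group_eqI)
    (use assms in \<open>auto simp: add_zer zer_in intro!: cmp_add_left[OF assms(3,4) test_groupD, symmetric]\<close>)

lemma E_zer:
  assumes "X \<in> Obj C" "Y \<in> Obj C"
  shows "E X Y (Zer C X Y) = 0"
proof -
  have "E X Y (Zer C X Y) + E X Y (Zer C X Y) = E X Y (Zer C X Y)"
    using assms by (simp add: E_add zer_in add_zer)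
  then show ?thesis by simp
qed

lemma E_neg:
  assumes "X \<in> Obj C" "Y \<in> Obj C" "f \<in> Hom C X Y"
  shows "E X Y (Neg C f) = - E X Y f"
proof -
  have "E X Y (Neg C f) + E X Y f = 0"
    using assms by (simp add: E_add neg_in add_neg E_zer)
  then show ?thesis by (simp add: eq_neg_iff_add_eq_0)
qed

lemma E_inject:
  assumes "X \<in> Obj C" "Y \<in> Obj C" "f \<in> Hom C X Y" "g \<in> Hom C X Y"
  shows "E X Y f = E X Y g \<longleftrightarrow> f = g"
proof
  assume eq: "E X Y f = E X Y g"
  \<comment> \<open>The test vector is the identity in place (X, X) and zero elsewhere. Acting on
    it, f reappears in place (X, Y), as in the Yoneda lemma.\<close>
  let ?v = "\<lambda>W X'. if W \<in> Obj C \<and> X' \<in> Obj C then (if W = X \<and> X' = X then Idn C X else Zer C W X') else undefined"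
  have v: "?v \<in> carrier test_group" using assms by (auto simp: test_group_def idn_in zer_in)
  have "left_action X Y f ?v = left_action X Y g ?v"
    using eq unfolding E_def
    by (rule endo_of_inject[OF abelian_group_test_group additive_left_action[OF assms(1,2,3)] additive_left_action[OF assms(1,2,4)]])
      (rule v)
  then have "left_action X Y f ?v X Y = left_action X Y g ?v X Y" by simp
  then show "f = g" using assms by (simp add: left_action_def idn_right)
qed simp

lemma E_idn_left: "\<lbrakk>X \<in> Obj C; Y \<in> Obj C; f \<in> Hom C X Y\<rbrakk> \<Longrightarrow> E Y Y (Idn C Y) * E X Y f = E X Y f"
  by (simp add: E_mult idn_in idn_left)

lemma E_idn_right: "\<lbrakk>X \<in> Obj C; Y \<in> Obj C; f \<in> Hom C X Y\<rbrakk> \<Longrightarrow> E X Y f * E X X (Idn C X) = E X Y f"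
  by (simp add: E_mult idn_in idn_right)

end

section \<open>Strict shift automorphisms and arrows of arbitrary degree\<close>

locale shift_category = preadd +
  fixes sO :: "int \<Rightarrow> 'a \<Rightarrow> 'a" and sA :: "int \<Rightarrow> 'b \<Rightarrow> 'b"
  assumes sO_in: "X \<in> Obj C \<Longrightarrow> sO k X \<in> Obj C"
    and sO_add: "X \<in> Obj C \<Longrightarrow> sO k (sO l X) = sO (k + l) X"
    and sO_0: "X \<in> Obj C \<Longrightarrow> sO 0 X = X"
    and sA_in: "\<lbrakk>f \<in> Hom C X Y; X \<in> Obj C; Y \<in> Obj C\<rbrakk> \<Longrightarrow> sA k f \<in> Hom C (sO k X) (sO k Y)"
    and sA_add: "\<lbrakk>f \<in> Hom C X Y; X \<in> Obj C; Y \<in> Obj C\<rbrakk> \<Longrightarrow> sA k (sA l f) = sA (k + l) f"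
    and sA_0: "\<lbrakk>f \<in> Hom C X Y; X \<in> Obj C; Y \<in> Obj C\<rbrakk> \<Longrightarrow> sA 0 f = f"
    and sA_cmp: "\<lbrakk>f \<in> Hom C X Y; g \<in> Hom C Y Z; X \<in> Obj C; Y \<in> Obj C; Z \<in> Obj C\<rbrakk>
      \<Longrightarrow> sA k (Cmp C g f) = Cmp C (sA k g) (sA k f)"
    and sA_Add: "\<lbrakk>f \<in> Hom C X Y; g \<in> Hom C X Y; X \<in> Obj C; Y \<in> Obj C\<rbrakk>
      \<Longrightarrow> sA k (Add C f g) = Add C (sA k f) (sA k g)"
    and sA_idn: "X \<in> Obj C \<Longrightarrow> sA k (Idn C X) = Idn C (sO k X)"
begin

lemma sA_zer:
  assumes "X \<in> Obj C" "Y \<in> Obj C"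
  shows "sA k (Zer C X Y) = Zer C (sO k X) (sO k Y)"
proof (rule add_self_zer)
  note z = zer_in[OF assms]
  show "sA k (Zer C X Y) \<in> Hom C (sO k X) (sO k Y)" by (rule sA_in[OF z assms])
  show "Add C (sA k (Zer C X Y)) (sA k (Zer C X Y)) = sA k (Zer C X Y)"
    using sA_Add[OF z z assms] add_zer[OF z assms] by simp
qed (use assms in \<open>auto simp: sO_in\<close>)

text \<open>\<open>S k\<close> moves the component at (W, X) to the one at (W[k], X[k]). Strictness
  of the shift on objects makes these operators add up, and by \<open>S_E\<close> an arrow that
  passes through \<open>S k\<close> is replaced by its shift.\<close>

definition shift_action :: "int \<Rightarrow> ('a \<Rightarrow> 'a \<Rightarrow> 'b) \<Rightarrow> ('a \<Rightarrow> 'a \<Rightarrow> 'b)" where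
  "shift_action k v = (\<lambda>W X. if W \<in> Obj C \<and> X \<in> Obj C then sA k (v (sO (- k) W) (sO (- k) X)) else undefined)"

definition S :: "int \<Rightarrow> ('a \<Rightarrow> 'a \<Rightarrow> 'b) endo" where
  "S k = endo_of test_group (shift_action k)"

lemma sA_in': "\<lbrakk>X \<in> Obj C; Y \<in> Obj C; f \<in> Hom C (sO (- k) X) (sO (- k) Y)\<rbrakk> \<Longrightarrow> sA k f \<in> Hom C X Y"
  using sA_in[of f "sO (- k) X" "sO (- k) Y" k] by (simp add: sO_in sO_add sO_0)

lemma additive_shift_action: "additive_on test_group (shift_action k)"
  unfolding additive_on_def
proof (intro conjI ballI)
  fix u v assume u: "u \<in> carrier test_group" and v: "v \<in> carrier test_group"
  show "shift_action k u \<in> carrier test_group"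
    unfolding shift_action_def by (rule test_groupI) (auto intro!: sA_in' test_groupD[OF u] sO_in)
  show "shift_action k (u \<oplus>\<^bsub>test_group\<^esub> v) = shift_action k u \<oplus>\<^bsub>test_group\<^esub> shift_action k v"
    unfolding shift_action_def test_group_add
    by (rule test_group_eqI) (auto simp: sO_in intro!: sA_Add[OF test_groupD[OF u] test_groupD[OF v]])
qed

lemma S_mult: "S k * S l = S (k + l)"
  unfolding S_def endo_of_mult[OF abelian_group_test_group additive_shift_action additive_shift_action]
proof (rule endo_of_eqI[OF abelian_group_test_group], unfold shift_action_def, rule test_group_eqI)
  fix v W X assume v: "v \<in> carrier test_group" and "W \<in> Obj C" "X \<in> Obj C"
  moreover have "sA k (sA l (v (sO (- (k + l)) W) (sO (- (k + l)) X))) = sA (k + l) (v (sO (- (k + l)) W) (sO (- (k + l)) X))"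
    using calculation by (intro sA_add[OF test_groupD[OF v]]) (auto simp: sO_in)
  ultimately show "sA k (if sO (- k) W \<in> Obj C \<and> sO (- k) X \<in> Obj C
     then sA l (v (sO (- l) (sO (- k) W)) (sO (- l) (sO (- k) X))) else undefined) =
     sA (k + l) (v (sO (- (k + l)) W) (sO (- (k + l)) X))"
    by (simp add: sO_in sO_add add.commute)
qed

lemma S_E:
  assumes "X \<in> Obj C" "Y \<in> Obj C" "f \<in> Hom C X Y"
  shows "S k * E X Y f = E (sO k X) (sO k Y) (sA k f) * S k"
proof -
  note a = additive_left_action[OF assms] additive_left_action[of "sO k X" "sO k Y" "sA k f"]
  have b: "additive_on test_group (left_action (sO k X) (sO k Y) (sA k f))"
    by (rule a(2)) (use assms in \<open>auto simp: sO_in sA_in\<close>)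
  have eq: "sO (- k) Z = Y \<longleftrightarrow> Z = sO k Y" if "Z \<in> Obj C" for Z
    using that assms sO_add[of Z k "- k"] sO_add[of Y "- k" k] by (auto simp: sO_0)
  show ?thesis
    unfolding E_def S_def endo_of_mult[OF abelian_group_test_group additive_shift_action a(1)]
      endo_of_mult[OF abelian_group_test_group b additive_shift_action]
  proof (rule endo_of_eqI[OF abelian_group_test_group])
    fix v assume v: "v \<in> carrier test_group"
    show "shift_action k (left_action X Y f v) = left_action (sO k X) (sO k Y) (sA k f) (shift_action k v)"
    proof (intro ext)
      fix W Z
      show "shift_action k (left_action X Y f v) W Z = left_action (sO k X) (sO k Y) (sA k f) (shift_action k v) W Z"
      proof (cases "W \<in> Obj C \<and> Z \<in> Obj C")
        case True
        then have W: "sO (- k) W \<in> Obj C" and Z: "sO (- k) Z \<in> Obj C" by (auto simp: sO_in)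
        have vin: "v (sO (- k) W) X \<in> Hom C (sO (- k) W) X"
          using v W assms(1) unfolding test_group_def by auto
        show ?thesis
          using True W Z assms vin
          by (auto simp: shift_action_def left_action_def eq sO_in sA_zer sO_add sO_0
              sA_cmp[OF vin assms(3) W assms(1,2)])
      qed (auto simp: shift_action_def left_action_def)
    qed
  qed
qed

text \<open>\<open>S 0\<close> is the identity on \<open>test_group\<close> but zero at all other
  groups, so it is a local unit that has to be absorbed explicitly.\<close>

lemma S0_E:
  assumes "X \<in> Obj C" "Y \<in> Obj C" "f \<in> Hom C X Y"
  shows "S 0 * E X Y f = E X Y f"
  unfolding E_def S_def endo_of_mult[OF abelian_group_test_group additive_shift_action additive_left_action[OF assms]]
proof (rule endo_of_eqI[OF abelian_group_test_group], unfold shift_action_def left_action_def, rule test_group_eqI)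
  fix v W Z assume v: "v \<in> carrier test_group" and W: "W \<in> Obj C" and Z: "Z \<in> Obj C"
  have "(if Z = Y then Cmp C f (v W X) else Zer C W Z) \<in> Hom C W Z"
    using assms W Z test_groupD[OF v W assms(1)] by (auto intro: cmp_in zer_in)
  from sA_0[OF this] W Z
  show "sA 0 (if sO (- 0) W \<in> Obj C \<and> sO (- 0) Z \<in> Obj C
     then if sO (- 0) Z = Y then Cmp C f (v (sO (- 0) W) X) else Zer C (sO (- 0) W) (sO (- 0) Z)
     else undefined) = (if Z = Y then Cmp C f (v W X) else Zer C W Z)" by (simp only: sO_0 minus_zero if_True simp_thms)
qed

lemma E_S0:
  assumes "X \<in> Obj C" "Y \<in> Obj C" "f \<in> Hom C X Y"
  shows "E X Y f * S 0 = E X Y f"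
  using S_E[OF assms, of 0] assms by (simp add: S0_E sO_0 sA_0)

lemma E_S:
  assumes "X \<in> Obj C" "Y \<in> Obj C" "f \<in> Hom C X Y"
  shows "E X Y f * S (- k) = S (- k) * E (sO k X) (sO k Y) (sA k f)"
proof -
  have in': "sO k X \<in> Obj C" "sO k Y \<in> Obj C" "sA k f \<in> Hom C (sO k X) (sO k Y)"
    using assms by (auto simp: sO_in sA_in)
  have "E X Y f * S (- k) = S (- k) * (S k * E X Y f) * S (- k)"
    using assms by (simp add: S_mult S0_E mult.assoc[symmetric])
  also have "\<dots> = S (- k) * (E (sO k X) (sO k Y) (sA k f) * (S k * S (- k)))"
    using assms by (simp add: S_E mult.assoc)
  also have "\<dots> = S (- k) * E (sO k X) (sO k Y) (sA k f)"
    using in' by (simp add: S_mult E_S0)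
  finally show ?thesis .
qed

text \<open>An arrow f from X to Y[n], followed by the operator that moves Y[n] back to Y. With this
  normalisation the product of elements of degrees n and m is the arrow
  \<open>Cmp C (sA n g) f\<close> into Z[m + n], without signs.\<close>

definition gel :: "'a \<Rightarrow> 'a \<Rightarrow> int \<Rightarrow> 'b \<Rightarrow> ('a \<Rightarrow> 'a \<Rightarrow> 'b) endo" where
  "gel X Y n f = S (- n) * E X (sO n Y) f"

definition G :: "'a \<Rightarrow> 'a \<Rightarrow> int \<Rightarrow> ('a \<Rightarrow> 'a \<Rightarrow> 'b) endo set" where
  "G X Y n = {gel X Y n f | f. X \<in> Obj C \<and> Y \<in> Obj C \<and> f \<in> Hom C X (sO n Y)}"

definition unit :: "'a \<Rightarrow> ('a \<Rightarrow> 'a \<Rightarrow> 'b) endo" where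
  "unit X = E X X (Idn C X)"

lemma gel_in: "\<lbrakk>X \<in> Obj C; Y \<in> Obj C; f \<in> Hom C X (sO n Y)\<rbrakk> \<Longrightarrow> gel X Y n f \<in> G X Y n"
  unfolding G_def by blast

lemma G_E:
  assumes "x \<in> G X Y n"
  obtains f where "X \<in> Obj C" "Y \<in> Obj C" "f \<in> Hom C X (sO n Y)" "x = gel X Y n f"
  using assms unfolding G_def by blast

lemma gel_mult:
  assumes "X \<in> Obj C" "Y \<in> Obj C" "Z \<in> Obj C" "f \<in> Hom C X (sO n Y)" "g \<in> Hom C Y (sO m Z)"
  shows "gel Y Z m g * gel X Y n f = gel X Z (m + n) (Cmp C (sA n g) f)"
proof -
  have g': "sA n g \<in> Hom C (sO n Y) (sO (m + n) Z)"
    using sA_in[OF assms(5) assms(2) sO_in[OF assms(3)], of n] assms(3) by (simp add: sO_add add.commute)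
  have "gel Y Z m g * gel X Y n f = S (- m) * (E Y (sO m Z) g * S (- n)) * E X (sO n Y) f"
    by (simp add: gel_def mult.assoc)
  also have "\<dots> = S (- m) * S (- n) * (E (sO n Y) (sO (m + n) Z) (sA n g) * E X (sO n Y) f)"
    using assms by (simp add: E_S sO_in sO_add mult.assoc add.commute)
  also have "\<dots> = S (- (m + n)) * E X (sO (m + n) Z) (Cmp C (sA n g) f)"
    using assms g' by (simp add: S_mult E_mult sO_in add.commute)
  finally show ?thesis by (simp add: gel_def)
qed

lemma gel_mult_in:
  assumes "X \<in> Obj C" "Y \<in> Obj C" "Z \<in> Obj C" "f \<in> Hom C X (sO n Y)" "g \<in> Hom C Y (sO m Z)"
  shows "Cmp C (sA n g) f \<in> Hom C X (sO (m + n) Z)"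
proof -
  have g': "sA n g \<in> Hom C (sO n Y) (sO (m + n) Z)"
    using sA_in[OF assms(5) assms(2) sO_in[OF assms(3)], of n] assms(3) by (simp add: sO_add add.commute)
  show ?thesis using cmp_in[OF g' assms(4) assms(1) sO_in[OF assms(2)] sO_in[OF assms(3)]] .
qed

lemma gel_add:
  assumes "X \<in> Obj C" "Y \<in> Obj C" "f \<in> Hom C X (sO n Y)" "g \<in> Hom C X (sO n Y)"
  shows "gel X Y n f + gel X Y n g = gel X Y n (Add C f g)"
  using assms unfolding gel_def by (simp add: E_add[symmetric] sO_in distrib_left)

lemma gel_neg:
  assumes "X \<in> Obj C" "Y \<in> Obj C" "f \<in> Hom C X (sO n Y)"
  shows "- gel X Y n f = gel X Y n (Neg C f)"
  using assms unfolding gel_def by (simp add: E_neg sO_in)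

lemma gel_zer:
  assumes "X \<in> Obj C" "Y \<in> Obj C"
  shows "gel X Y n (Zer C X (sO n Y)) = 0"
  using assms unfolding gel_def by (simp add: E_zer sO_in)

lemma gel_inject:
  assumes "X \<in> Obj C" "Y \<in> Obj C" "f \<in> Hom C X (sO n Y)" "g \<in> Hom C X (sO n Y)"
  shows "gel X Y n f = gel X Y n g \<longleftrightarrow> f = g"
proof
  assume "gel X Y n f = gel X Y n g"
  then have "S n * S (- n) * E X (sO n Y) f = S n * S (- n) * E X (sO n Y) g"
    unfolding gel_def by (simp add: mult.assoc)
  then show "f = g" using assms by (simp add: S_mult S0_E sO_in E_inject)
qed simp

lemma unit_eq_gel: "X \<in> Obj C \<Longrightarrow> unit X = gel X X 0 (Idn C X)"
  by (simp add: unit_def gel_def sO_0 S0_E idn_in)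

lemma G_obj: "x \<in> G X Y n \<Longrightarrow> X \<in> Obj C \<and> Y \<in> Obj C"
  unfolding G_def by blast

lemma G_unit: "X \<in> Obj C \<Longrightarrow> unit X \<in> G X X 0"
  by (simp add: unit_eq_gel gel_in sO_0 idn_in)

lemma G_zero: "X \<in> Obj C \<Longrightarrow> Y \<in> Obj C \<Longrightarrow> 0 \<in> G X Y n"
  by (metis gel_in gel_zer sO_in zer_in)

lemma G_add: "x \<in> G X Y n \<Longrightarrow> y \<in> G X Y n \<Longrightarrow> x + y \<in> G X Y n"
  by (auto elim!: G_E simp: gel_add intro!: gel_in add_in sO_in)

lemma G_neg: "x \<in> G X Y n \<Longrightarrow> - x \<in> G X Y n"
  by (auto elim!: G_E simp: gel_neg intro!: gel_in neg_in sO_in)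

lemma G_mult: "y \<in> G Y Z m \<Longrightarrow> x \<in> G X Y n \<Longrightarrow> y * x \<in> G X Z (m + n)"
  by (auto elim!: G_E simp: gel_mult intro!: gel_in gel_mult_in)

lemma G_unit_left: "x \<in> G X Y n \<Longrightarrow> unit Y * x = x"
  by (erule G_E) (simp add: unit_eq_gel gel_mult sO_0 idn_in sA_idn idn_left sO_in)

lemma G_unit_right: "x \<in> G X Y n \<Longrightarrow> x * unit X = x"
  by (erule G_E) (simp add: unit_def gel_def mult.assoc E_idn_right sO_in)

text \<open>Both elements are identity arrows: that of X, read as an arrow into the shift of X[k] by
  -k, and that of X[k], read as an arrow into the shift of X by k.\<close>

lemma G_shift:
  assumes "X \<in> Obj C"
  shows "\<exists>a\<in>G X (sO k X) (- k). \<exists>b\<in>G (sO k X) X k. b * a = unit X \<and> a * b = unit (sO k X)"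
proof -
  let ?a = "gel X (sO k X) (- k) (Idn C X)" and ?b = "gel (sO k X) X k (Idn C (sO k X))"
  have "?a \<in> G X (sO k X) (- k)" "?b \<in> G (sO k X) X k"
    using assms by (auto intro!: gel_in simp: sO_in sO_add sO_0 idn_in)
  moreover have "?b * ?a = unit X"
    using assms by (subst gel_mult) (auto simp: sO_in sO_add sO_0 idn_in sA_idn unit_eq_gel idn_left[OF idn_in])
  moreover have "?a * ?b = unit (sO k X)"
    using assms by (subst gel_mult) (auto simp: sO_in sO_add sO_0 idn_in sA_idn unit_eq_gel idn_left[OF idn_in])
  ultimately show ?thesis by blast
qed

end

section \<open>Graded additive categories inside a ring\<close>

text \<open>Products are kept nested to the right; this form lets an equation for two adjacent
  factors rewrite inside a longer product.\<close>

lemma assoc_rule: "x * y = z \<Longrightarrow> x * (y * w) = z * (w :: 'r :: semigroup_mult)"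
  by (simp add: mult.assoc[symmetric])

text \<open>\<open>G X Y n\<close> stands for Hom(X, Y[n]) and \<open>e X\<close> for a local unit.
  The shift is given by an invertible element of degree -k from X to \<open>sh k X\<close> rather
  than by a functor; shifted arrows arise by conjugation.\<close>

locale graded_category =
  fixes Ob :: "'o set"
    and G :: "'o \<Rightarrow> 'o \<Rightarrow> int \<Rightarrow> ('r :: {ring, monoid_mult}) set"
    and e :: "'o \<Rightarrow> 'r"
    and sh :: "int \<Rightarrow> 'o \<Rightarrow> 'o"
  assumes G_ob: "x \<in> G X Y n \<Longrightarrow> X \<in> Ob \<and> Y \<in> Ob"
    and e_in: "X \<in> Ob \<Longrightarrow> e X \<in> G X X 0"
    and zero_in: "X \<in> Ob \<Longrightarrow> Y \<in> Ob \<Longrightarrow> 0 \<in> G X Y n"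
    and add_in: "x \<in> G X Y n \<Longrightarrow> y \<in> G X Y n \<Longrightarrow> x + y \<in> G X Y n"
    and neg_in: "x \<in> G X Y n \<Longrightarrow> - x \<in> G X Y n"
    and mult_in: "y \<in> G Y Z m \<Longrightarrow> x \<in> G X Y n \<Longrightarrow> y * x \<in> G X Z (m + n)"
    and e_left: "x \<in> G X Y n \<Longrightarrow> e Y * x = x"
    and e_right: "x \<in> G X Y n \<Longrightarrow> x * e X = x"
    and has_zero: "\<exists>Z\<in>Ob. e Z = 0"
    and has_biproduct: "\<lbrakk>X \<in> Ob; Y \<in> Ob\<rbrakk> \<Longrightarrow> \<exists>Z\<in>Ob. \<exists>i\<in>G X Z 0. \<exists>j\<in>G Y Z 0. \<exists>p\<in>G Z X 0. \<exists>q\<in>G Z Y 0.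
      p * i = e X \<and> q * j = e Y \<and> q * i = 0 \<and> p * j = 0 \<and> i * p + j * q = e Z"
    and has_shift: "X \<in> Ob \<Longrightarrow> \<exists>a\<in>G X (sh k X) (- k). \<exists>b\<in>G (sh k X) X k. b * a = e X \<and> a * b = e (sh k X)"
begin

abbreviation H :: "'o \<Rightarrow> 'o \<Rightarrow> 'r set" where "H X Y \<equiv> G X Y 0"

lemma mult0: "y \<in> H Y Z \<Longrightarrow> x \<in> H X Y \<Longrightarrow> y * x \<in> H X Z"
  using mult_in[of y Y Z 0 x X 0] by simp

lemma mult_n0: "y \<in> G Y Z n \<Longrightarrow> x \<in> H X Y \<Longrightarrow> y * x \<in> G X Z n"
  using mult_in[of y Y Z n x X 0] by simp

lemma mult_0n: "y \<in> H Y Z \<Longrightarrow> x \<in> G X Y n \<Longrightarrow> y * x \<in> G X Z n"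
  using mult_in[of y Y Z 0 x X n] by simp

lemma diff_in: "x \<in> G X Y n \<Longrightarrow> y \<in> G X Y n \<Longrightarrow> x - y \<in> G X Y n"
  using add_in[OF _ neg_in] by (metis add_uminus_conv_diff)

lemma sh_in: "X \<in> Ob \<Longrightarrow> sh k X \<in> Ob"
  using has_shift G_ob by blast

definition iso :: "'o \<Rightarrow> 'o \<Rightarrow> bool" where
  "iso X Y \<longleftrightarrow> (\<exists>f\<in>H X Y. \<exists>g\<in>H Y X. g * f = e X \<and> f * g = e Y)"

definition zero_obj :: "'o \<Rightarrow> bool" where "zero_obj X \<longleftrightarrow> X \<in> Ob \<and> e X = 0"

definition bip :: "'o \<Rightarrow> 'o \<Rightarrow> 'o \<Rightarrow> 'r \<Rightarrow> 'r \<Rightarrow> 'r \<Rightarrow> 'r \<Rightarrow> bool" where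
  "bip X Y Z i j p q \<longleftrightarrow> i \<in> H X Z \<and> j \<in> H Y Z \<and> p \<in> H Z X \<and> q \<in> H Z Y \<and>
     p * i = e X \<and> q * j = e Y \<and> q * i = 0 \<and> p * j = 0 \<and> i * p + j * q = e Z"

definition isbip :: "'o \<Rightarrow> 'o \<Rightarrow> 'o \<Rightarrow> bool" where
  "isbip X Y Z \<longleftrightarrow> (\<exists>i j p q. bip X Y Z i j p q)"

fun dsum :: "'o list \<Rightarrow> 'o \<Rightarrow> bool" where
  "dsum [] Z \<longleftrightarrow> zero_obj Z"
| "dsum (X # Xs) Z \<longleftrightarrow> (\<exists>W. dsum Xs W \<and> isbip X W Z)"

definition retract :: "'o \<Rightarrow> 'o \<Rightarrow> bool" where
  "retract Y X \<longleftrightarrow> (\<exists>f\<in>H Y X. \<exists>g\<in>H X Y. g * f = e Y)"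

definition invertible :: "'o \<Rightarrow> 'r \<Rightarrow> bool" where
  "invertible X a \<longleftrightarrow> (\<exists>b\<in>H X X. a * b = e X \<and> b * a = e X)"

definition loc :: "'o \<Rightarrow> bool" where
  "loc X \<longleftrightarrow> X \<in> Ob \<and> e X \<noteq> 0 \<and> (\<forall>a\<in>H X X. invertible X a \<or> invertible X (e X - a))"

subsection \<open>Isomorphisms and direct sums\<close>

lemma isoI: "\<lbrakk>f \<in> H X Y; g \<in> H Y X; g * f = e X; f * g = e Y\<rbrakk> \<Longrightarrow> iso X Y"
  unfolding iso_def by blast

lemma iso_refl: "X \<in> Ob \<Longrightarrow> iso X X"
  by (rule isoI[of "e X" _ _ "e X"]) (auto intro: e_in simp: e_left[OF e_in])

lemma iso_sym: "iso X Y \<Longrightarrow> iso Y X"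
  unfolding iso_def by blast

lemma iso_trans:
  assumes "iso X Y" "iso Y Z" shows "iso X Z"
proof -
  obtain f g where f: "f \<in> H X Y" "g \<in> H Y X" "g * f = e X" "f * g = e Y"
    using assms(1) unfolding iso_def by blast
  obtain f' g' where f': "f' \<in> H Y Z" "g' \<in> H Z Y" "g' * f' = e Y" "f' * g' = e Z"
    using assms(2) unfolding iso_def by blast
  show ?thesis
    by (rule isoI[of "f' * f" _ _ "g * g'"])
      (auto intro: mult0 f f' simp: mult.assoc f'(3)[THEN assoc_rule] f(4)[THEN assoc_rule] e_left[OF f(1)] e_left[OF f'(2)] f(3) f'(4))
qed

lemma iso_ob: "iso X Y \<Longrightarrow> X \<in> Ob \<and> Y \<in> Ob"
  unfolding iso_def using G_ob by blast

lemma bip_ob: "bip X Y Z i j p q \<Longrightarrow> X \<in> Ob \<and> Y \<in> Ob \<and> Z \<in> Ob"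
  unfolding bip_def using G_ob by blast

lemma isbip_ob: "isbip X Y Z \<Longrightarrow> X \<in> Ob \<and> Y \<in> Ob \<and> Z \<in> Ob"
  unfolding isbip_def using bip_ob by blast

lemma bip_exists: "\<lbrakk>X \<in> Ob; Y \<in> Ob\<rbrakk> \<Longrightarrow> \<exists>Z i j p q. bip X Y Z i j p q"
  using has_biproduct[of X Y] unfolding bip_def by blast

lemma isbip_exists: "\<lbrakk>X \<in> Ob; Y \<in> Ob\<rbrakk> \<Longrightarrow> \<exists>Z. isbip X Y Z"
  using bip_exists[of X Y] unfolding isbip_def by blast

lemma bip_in:
  assumes "bip X Y Z i j p q"
  shows "i \<in> H X Z" "j \<in> H Y Z" "p \<in> H Z X" "q \<in> H Z Y"
  using assms unfolding bip_def by auto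

lemma bip_simps:
  assumes "bip X Y Z i j p q"
  shows "p * i = e X" "q * j = e Y" "q * i = 0" "p * j = 0"
    "p * (i * w) = e X * w" "q * (j * w) = e Y * w" "q * (i * w) = 0" "p * (j * w) = 0"
    "e Z * i = i" "e Z * j = j" "e X * p = p" "e Y * q = q"
    "i * e X = i" "j * e Y = j" "p * e Z = p" "q * e Z = q"
    "e Z * (i * w) = i * w" "e Z * (j * w) = j * w" "e X * (p * w) = p * w" "e Y * (q * w) = q * w"
    "i * (e X * w) = i * w" "j * (e Y * w) = j * w" "p * (e Z * w) = p * w" "q * (e Z * w) = q * w"
proof -
  have b: "i \<in> H X Z" "j \<in> H Y Z" "p \<in> H Z X" "q \<in> H Z Y" "p * i = e X" "q * j = e Y" "q * i = 0" "p * j = 0"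
    using assms unfolding bip_def by auto
  show 1: "p * i = e X" "q * j = e Y" "q * i = 0" "p * j = 0" by fact+
  show "p * (i * w) = e X * w" "q * (j * w) = e Y * w" "q * (i * w) = 0" "p * (j * w) = 0"
    using 1[THEN assoc_rule, of w] by auto
  show 2: "e Z * i = i" "e Z * j = j" "e X * p = p" "e Y * q = q" using b(1-4)[THEN e_left] by auto
  show 3: "i * e X = i" "j * e Y = j" "p * e Z = p" "q * e Z = q" using b(1-4)[THEN e_right] by auto
  show "e Z * (i * w) = i * w" "e Z * (j * w) = j * w" "e X * (p * w) = p * w" "e Y * (q * w) = q * w"
    using 2[THEN assoc_rule, of w] by auto
  show "i * (e X * w) = i * w" "j * (e Y * w) = j * w" "p * (e Z * w) = p * w" "q * (e Z * w) = q * w"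
    using 3[THEN assoc_rule, of w] by auto
qed

lemma bip_sum:
  assumes "bip X Y Z i j p q"
  shows "j * q = e Z - i * p" "j * (q * w) = e Z * w - i * (p * w)"
proof -
  have s: "i * p + j * q = e Z" using assms unfolding bip_def by auto
  then show "j * q = e Z - i * p" by (metis add_diff_cancel_left')
  then show "j * (q * w) = e Z * w - i * (p * w)"
    by (metis left_diff_distrib mult.assoc)
qed

lemma mem_simps:
  assumes "f \<in> G X Y n"
  shows "e Y * f = f" "f * e X = f" "e Y * (f * w) = f * w" "f * (e X * w) = f * w"
  using e_left[OF assms] e_right[OF assms] e_left[OF assms, THEN assoc_rule] e_right[OF assms, THEN assoc_rule] by auto

lemma bip_swap: "bip X Y Z i j p q \<Longrightarrow> bip Y X Z j i q p"
  unfolding bip_def by (auto simp: add.commute)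

lemma isbip_swap: "isbip X Y Z \<Longrightarrow> isbip Y X Z"
  unfolding isbip_def using bip_swap by blast

lemma bip_map:
  assumes b: "bip X Y Z i j p q" and b': "bip X' Y' Z' i' j' p' q'" and "iso X X'" "iso Y Y'"
  shows "iso Z Z'"
proof -
  obtain f g where f: "f \<in> H X X'" "g \<in> H X' X" "g * f = e X" "f * g = e X'"
    using assms(3) unfolding iso_def by blast
  obtain h k where h: "h \<in> H Y Y'" "k \<in> H Y' Y" "k * h = e Y" "h * k = e Y'"
    using assms(4) unfolding iso_def by blast
  note r = bip_simps[OF b] bip_simps[OF b'] f(3,4) f(3,4)[THEN assoc_rule] h(3,4) h(3,4)[THEN assoc_rule]
    f(1,2)[THEN mem_simps(1)] f(1,2)[THEN mem_simps(2)] f(1,2)[THEN mem_simps(3)] f(1,2)[THEN mem_simps(4)]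
    h(1,2)[THEN mem_simps(1)] h(1,2)[THEN mem_simps(2)] h(1,2)[THEN mem_simps(3)] h(1,2)[THEN mem_simps(4)]
  note m = bip_in[OF b] bip_in[OF b'] f(1,2) h(1,2)
  show ?thesis
  proof (rule isoI)
    show "i' * (f * p) + j' * (h * q) \<in> H Z Z'" using m by (blast intro: mult0 add_in)
    show "i * (g * p') + j * (k * q') \<in> H Z' Z" using m by (blast intro: mult0 add_in)
    show "(i * (g * p') + j * (k * q')) * (i' * (f * p) + j' * (h * q)) = e Z"
      by (simp add: algebra_simps r) (simp add: bip_sum[OF b])
    show "(i' * (f * p) + j' * (h * q)) * (i * (g * p') + j * (k * q')) = e Z'"
      by (simp add: algebra_simps r) (simp add: bip_sum[OF b'])
  qed
qed

lemma isbip_map: "\<lbrakk>isbip X Y Z; isbip X' Y' Z'; iso X X'; iso Y Y'\<rbrakk> \<Longrightarrow> iso Z Z'"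
  unfolding isbip_def using bip_map by blast

lemma bip_iso:
  assumes b: "bip X Y Z i j p q" and "f \<in> H Z Z'" "g \<in> H Z' Z" "g * f = e Z" "f * g = e Z'"
  shows "bip X Y Z' (f * i) (f * j) (p * g) (q * g)"
proof -
  note m = bip_in[OF b] assms(2,3)
  note r = bip_simps[OF b] assms(4,5) assms(4,5)[THEN assoc_rule] m(5,6)[THEN mem_simps(1)] m(5,6)[THEN mem_simps(2)]
     m(5,6)[THEN mem_simps(3)] m(5,6)[THEN mem_simps(4)]
  have "f * i * (p * g) + f * j * (q * g) = e Z'"
    by (simp add: algebra_simps bip_sum[OF b]) (simp add: r)
  then show ?thesis
    unfolding bip_def using m by (auto intro: mult0 simp: mult.assoc r)
qed

lemma bip_iso_left:
  assumes b: "bip X Y Z i j p q" and "f \<in> H X X'" "g \<in> H X' X" "g * f = e X" "f * g = e X'"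
  shows "bip X' Y Z (i * g) j (f * p) q"
proof -
  note m = bip_in[OF b] assms(2,3)
  note r = bip_simps[OF b] assms(4,5) assms(4,5)[THEN assoc_rule] m(5,6)[THEN mem_simps(1)] m(5,6)[THEN mem_simps(2)]
     m(5,6)[THEN mem_simps(3)] m(5,6)[THEN mem_simps(4)]
  have "i * g * (f * p) + j * q = e Z"
    by (simp add: algebra_simps bip_sum[OF b]) (simp add: r)
  then show ?thesis
    unfolding bip_def using m by (auto intro: mult0 simp: mult.assoc r)
qed

lemma isbip_iso: "\<lbrakk>isbip X Y Z; iso Z Z'\<rbrakk> \<Longrightarrow> isbip X Y Z'"
  unfolding isbip_def iso_def using bip_iso by blast

lemma isbip_iso_left: "\<lbrakk>isbip X Y Z; iso X X'\<rbrakk> \<Longrightarrow> isbip X' Y Z"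
  unfolding isbip_def iso_def using bip_iso_left by blast

lemma isbip_iso_right: "\<lbrakk>isbip X Y Z; iso Y Y'\<rbrakk> \<Longrightarrow> isbip X Y' Z"
  using isbip_swap isbip_iso_left by blast

lemma zero_obj_hom: "zero_obj X \<Longrightarrow> f \<in> G X Y n \<Longrightarrow> f = 0" "zero_obj X \<Longrightarrow> f \<in> G Y X n \<Longrightarrow> f = 0"
  unfolding zero_obj_def using e_left e_right by fastforce+

lemma zero_obj_iso: "zero_obj X \<Longrightarrow> zero_obj Y \<Longrightarrow> iso X Y"
  by (rule isoI[of 0 _ _ 0]) (auto simp: zero_obj_def zero_in)

lemma iso_zero: "iso X Y \<Longrightarrow> zero_obj X \<Longrightarrow> zero_obj Y"
  using iso_ob[of X Y] unfolding iso_def zero_obj_def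
  by (metis e_left mult_zero_left mult_zero_right)

lemma isbip_zero: "\<lbrakk>X \<in> Ob; zero_obj O'\<rbrakk> \<Longrightarrow> isbip X O' X"
  unfolding isbip_def bip_def zero_obj_def
  by (rule exI[of _ "e X"], rule exI[of _ 0], rule exI[of _ "e X"], rule exI[of _ 0])
    (auto intro: e_in zero_in simp: e_left[OF e_in])

lemma isbip_zero_iso: "\<lbrakk>isbip X O' Z; zero_obj O'\<rbrakk> \<Longrightarrow> iso X Z"
  using isbip_map[OF isbip_zero] iso_refl isbip_ob by blast

lemma bip_assoc:
  assumes b1: "bip X Y XY i j p q" and b2: "bip XY Z T k l r s" and b3: "bip Y Z YZ a b c d"
  shows "bip X YZ T (k * i) (k * j * c + l * d) (p * r) (a * q * r + b * s)"
proof -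
  note m = bip_in[OF b1] bip_in[OF b2] bip_in[OF b3]
  note r = bip_simps[OF b1] bip_simps[OF b2] bip_simps[OF b3]
  have 1: "(a * q * r + b * s) * (k * j * c + l * d) = e YZ"
    by (simp add: algebra_simps r) (simp add: bip_sum[OF b3])
  have 2: "k * i * (p * r) + (k * j * c + l * d) * (a * q * r + b * s) = e T"
    by (simp add: algebra_simps r) (simp add: bip_sum[OF b1] bip_sum[OF b2] algebra_simps r)
  have 3: "k * i \<in> H X T" "k * j * c + l * d \<in> H YZ T" "p * r \<in> H T X" "a * q * r + b * s \<in> H T YZ"
    using m by (blast intro: mult0 add_in)+
  show ?thesis unfolding bip_def using 1 2 3 by (auto simp: algebra_simps r)
qed

lemma isbip_assoc:
  assumes "isbip X Y XY" "isbip XY Z T" "isbip Y Z YZ" shows "isbip X YZ T"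
  using assms unfolding isbip_def by (elim exE) (intro exI, rule bip_assoc)

lemma isbip_assoc_ex:
  assumes "isbip X Y XY" "isbip XY Z T"
  obtains YZ where "isbip Y Z YZ" "isbip X YZ T"
proof -
  obtain YZ where "isbip Y Z YZ" using isbip_exists isbip_ob[OF assms(1)] isbip_ob[OF assms(2)] by blast
  then show ?thesis using that isbip_assoc[OF assms] by blast
qed

lemma isbip_assoc_ex':
  assumes "isbip Y Z YZ" "isbip X YZ T"
  obtains XY where "isbip X Y XY" "isbip XY Z T"
proof -
  obtain V where V: "isbip Y X V" "isbip Z V T"
    using isbip_assoc_ex[OF isbip_swap[OF assms(1)] isbip_swap[OF assms(2)]] .
  show ?thesis by (rule that[OF isbip_swap[OF V(1)] isbip_swap[OF V(2)]])
qed

lemma isbip_exchange: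
  assumes "isbip A B X" "isbip C D Y" "isbip X Y T"
  obtains AC BD where "isbip A C AC" "isbip B D BD" "isbip AC BD T"
proof -
  obtain BY where BY: "isbip B Y BY" "isbip A BY T" using isbip_assoc_ex[OF assms(1,3)] .
  obtain BC where BC: "isbip B C BC" "isbip BC D BY" using isbip_assoc_ex'[OF assms(2) BY(1)] .
  obtain BD where BD: "isbip B D BD" "isbip C BD BY" using isbip_assoc_ex[OF isbip_swap[OF BC(1)] BC(2)] .
  obtain AC where "isbip A C AC" "isbip AC BD T" using isbip_assoc_ex'[OF BD(2) BY(2)] .
  then show ?thesis using that BD(1) by blast
qed

lemma dsum_ob: "dsum Xs X \<Longrightarrow> X \<in> Ob \<and> set Xs \<subseteq> Ob"
  by (induction Xs arbitrary: X) (auto simp: zero_obj_def dest: isbip_ob)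

lemma dsum_iso: "\<lbrakk>dsum Xs X; iso X X'\<rbrakk> \<Longrightarrow> dsum Xs X'"
proof (cases Xs)
  case Nil
  then show "dsum Xs X \<Longrightarrow> iso X X' \<Longrightarrow> ?thesis" using iso_zero by simp
next
  case (Cons a Ys)
  then show "dsum Xs X \<Longrightarrow> iso X X' \<Longrightarrow> ?thesis" using isbip_iso by auto
qed

lemma dsum_exists: "set Xs \<subseteq> Ob \<Longrightarrow> \<exists>X. dsum Xs X"
proof (induction Xs)
  case Nil
  then show ?case using has_zero unfolding dsum.simps zero_obj_def by blast
next
  case (Cons a Xs)
  then obtain X where X: "dsum Xs X" by auto
  then obtain Z where "isbip a X Z" using isbip_exists[of a X] Cons.prems dsum_ob[OF X] by auto
  then show ?case using X by auto
qed

lemma dsum_map_iso: "\<lbrakk>dsum Xs X; dsum Ys Y; list_all2 iso Xs Ys\<rbrakk> \<Longrightarrow> iso X Y"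
proof (induction Xs arbitrary: X Y Ys)
  case Nil
  then show ?case by (auto intro: zero_obj_iso)
next
  case (Cons a Xs)
  then obtain b Ys' where Y: "Ys = b # Ys'" "iso a b" "list_all2 iso Xs Ys'" by (cases Ys) auto
  obtain W W' where W: "dsum Xs W" "isbip a W X" "dsum Ys' W'" "isbip b W' Y" using Cons Y by auto
  have "iso W W'" using Cons.IH W(1,3) Y(3) by blast
  then show ?case using isbip_map[OF W(2,4) Y(2)] by blast
qed

lemma dsum_list_iso:
  assumes "dsum Xs X" "list_all2 iso Xs Ys" shows "dsum Ys X"
proof -
  have "set Ys \<subseteq> Ob" using assms(2) by (induction rule: list_all2_induct) (auto dest: iso_ob)
  then obtain Y where "dsum Ys Y" using dsum_exists by blast
  then show ?thesis using dsum_map_iso[OF assms(1) _ assms(2)] dsum_iso iso_sym by blast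
qed

lemma dsum_append: "\<lbrakk>dsum Xs X; dsum Ys Y; isbip X Y Z\<rbrakk> \<Longrightarrow> dsum (Xs @ Ys) Z"
proof (induction Xs arbitrary: X Z)
  case Nil
  then have "iso Y Z" using isbip_zero_iso[OF isbip_swap[OF Nil(3)]] by simp
  then show ?case using Nil dsum_iso by auto
next
  case (Cons a Xs)
  then obtain W where W: "dsum Xs W" "isbip a W X" by auto
  obtain V where V: "isbip W Y V" "isbip a V Z" using isbip_assoc_ex[OF W(2) Cons.prems(3)] .
  have "dsum (Xs @ Ys) V" using Cons.IH[OF W(1) Cons.prems(2) V(1)] .
  then show ?case using V(2) by auto
qed

lemma dsum_single: "X \<in> Ob \<Longrightarrow> dsum [X] X"
  using isbip_zero has_zero unfolding dsum.simps zero_obj_def by blast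

lemma retract_trans:
  assumes "retract X Y" "retract Y Z" shows "retract X Z"
proof -
  obtain f g where f: "f \<in> H X Y" "g \<in> H Y X" "g * f = e X" using assms(1) unfolding retract_def by blast
  obtain f' g' where f': "f' \<in> H Y Z" "g' \<in> H Z Y" "g' * f' = e Y" using assms(2) unfolding retract_def by blast
  have "(g * g') * (f' * f) = e X" by (simp add: mult.assoc f'(3)[THEN assoc_rule] mem_simps[OF f(1)] f(3))
  then show ?thesis unfolding retract_def using f f' by (blast intro: mult0)
qed

lemma isbip_retract: "isbip X Y Z \<Longrightarrow> retract X Z" "isbip X Y Z \<Longrightarrow> retract Y Z"
  unfolding isbip_def bip_def retract_def by blast+

lemma iso_retract: "iso X Y \<Longrightarrow> retract X Y"
  unfolding iso_def retract_def by blast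

subsection \<open>The Krull-Schmidt theorem\<close>

lemma invertible_e: "X \<in> Ob \<Longrightarrow> invertible X (e X)"
  unfolding invertible_def using e_in e_left[OF e_in] by blast

text \<open>The idempotent u * v of the local object M equals \<open>e M\<close> or zero, and zero
  would force e L = v * (u * v) * u to vanish.\<close>

lemma loc_retract_iso:
  assumes "loc M" "e L \<noteq> 0" and u: "u \<in> H L M" and v: "v \<in> H M L" and vu: "v * u = e L"
  shows "u * v = e M"
proof -
  note r = mem_simps[OF u] mem_simps[OF v] vu vu[THEN assoc_rule]
  have uv: "u * v \<in> H M M" using u v by (rule mult0)
  have idem: "(u * v) * (u * v) = u * v" by (simp add: mult.assoc r)
  consider "invertible M (u * v)" | "invertible M (e M - u * v)" using assms(1) uv unfolding loc_def by blast
  then show ?thesis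
  proof cases
    case 1
    then obtain b where b: "b \<in> H M M" "b * (u * v) = e M" unfolding invertible_def by blast
    have "u * v = e M * (u * v)" by (simp add: r)
    also have "\<dots> = b * ((u * v) * (u * v))" by (simp add: b(2)[symmetric] mult.assoc)
    also have "\<dots> = e M" by (simp only: idem b(2))
    finally show ?thesis .
  next
    case 2
    then obtain b where b: "b \<in> H M M" "b * (e M - u * v) = e M" unfolding invertible_def by blast
    have "u * v = e M * (u * v)" by (simp add: r)
    also have "\<dots> = b * ((e M - u * v) * (u * v))" using arg_cong[OF b(2), of "\<lambda>t. t * (u * v)"] by (simp only: mult.assoc)
    also have "(e M - u * v) * (u * v) = 0" by (simp add: algebra_simps r)
    finally have "u * v = 0" by simp
    moreover have "e L = v * (u * v) * u" by (simp add: mult.assoc r)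
    ultimately show ?thesis using assms(2) by simp
  qed
qed

text \<open>The isomorphism is a Schur complement.\<close>

lemma bip_cancel:
  assumes b: "bip L W X i j p q" and b': "bip L' W' X i' j' p' q'"
    and h: "h \<in> H L' L" "h * (p' * i) = e L" "(p' * i) * h = e L'"
  shows "iso W W'"
proof -
  note m = bip_in[OF b] bip_in[OF b'] h(1)
  note r = bip_simps[OF b] bip_simps[OF b'] mem_simps[OF h(1)] h(2,3) h(2,3)[THEN assoc_rule]
  have h2: "h * (p' * (i * w)) = e L * w" "p' * (i * h) = e L'" "p' * (i * (h * w)) = e L' * w" for w
    using h(2,3)[THEN assoc_rule, of w] h(3) by (simp_all add: mult.assoc)
  show ?thesis
  proof (rule isoI)
    show "q' * j - q' * i * h * p' * j \<in> H W W'" using m by (blast intro: mult0 diff_in)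
    show "q * j' \<in> H W' W" using m by (blast intro: mult0)
    show "(q' * j - q' * i * h * p' * j) * (q * j') = e W'"
      by (simp add: algebra_simps bip_sum[OF b] r h2)
    show "q * j' * (q' * j - q' * i * h * p' * j) = e W"
      by (simp add: algebra_simps bip_sum[OF b'] r h2)
  qed
qed

text \<open>When the (L, L) entry of \<epsilon> is invertible, \<epsilon> * i embeds L into the
  image of \<epsilon>. The new biproduct keeps the complement W and satisfies \<epsilon> * i1 = i1
  and p1 * \<epsilon> = p1, so \<epsilon> becomes block diagonal with blocks \<open>e L\<close> and
  \<delta>. Splitting \<delta> on W finishes the step.\<close>

lemma split_idempotent_step:
  assumes b: "bip L W X i j p q" and \<epsilon>: "\<epsilon> \<in> H X X" "\<epsilon> * \<epsilon> = \<epsilon>"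
    and c: "c \<in> H L L" "c * (p * \<epsilon> * i) = e L" "(p * \<epsilon> * i) * c = e L"
    and W: "\<And>\<delta>. \<lbrakk>\<delta> \<in> H W W; \<delta> * \<delta> = \<delta>\<rbrakk> \<Longrightarrow> \<exists>Y Z i j p q Ys Zs. bip Y Z W i j p q \<and> i * p = \<delta> \<and>
       dsum Ys Y \<and> dsum Zs Z \<and> set Ys \<union> set Zs = set Ls \<and> length Ys + length Zs = length Ls"
  shows "\<exists>Y Z i j p q Ys Zs. bip Y Z X i j p q \<and> i * p = \<epsilon> \<and>
       dsum Ys Y \<and> dsum Zs Z \<and> set Ys \<union> set Zs = set (L # Ls) \<and> length Ys + length Zs = length (L # Ls)"
proof -
  define i1 p1 j1 q1 where "i1 = \<epsilon> * i" and "p1 = c * p * \<epsilon>"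
    and "j1 = j - i1 * p1 * j" and "q1 = q - q * i1 * c * p"
  note m = bip_in[OF b] \<epsilon>(1) c(1)
  have m1: "i1 \<in> H L X" "p1 \<in> H X L" using m unfolding i1_def p1_def by (blast intro: mult0)+
  have m2: "j1 \<in> H W X" "q1 \<in> H X W" using m m1 unfolding j1_def q1_def by (blast intro: mult0 diff_in)+
  note r = bip_simps[OF b] mem_simps[OF \<epsilon>(1)] mem_simps[OF c(1)] \<epsilon>(2) \<epsilon>(2)[THEN assoc_rule]
  have c2: "c * (p * (\<epsilon> * i)) = e L" "c * (p * (\<epsilon> * (i * w))) = e L * w"
    "p * (\<epsilon> * (i * c)) = e L" "p * (\<epsilon> * (i * (c * w))) = e L * w" for w
    using c(2,3) c(2,3)[THEN assoc_rule, of w] by (simp_all add: mult.assoc)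
  have b1: "bip L W X i1 j1 p1 q1"
  proof -
    have "p1 * i1 = e L" "q1 * j1 = e W" "q1 * i1 = 0" "p1 * j1 = 0"
      unfolding i1_def j1_def p1_def q1_def by (simp_all add: algebra_simps r c2)
    moreover have "i1 * p1 + j1 * q1 = e X"
      unfolding i1_def j1_def p1_def q1_def by (simp add: algebra_simps r c2 bip_sum[OF b])
    ultimately show ?thesis unfolding bip_def using m1 m2 by blast
  qed
  note r1 = bip_simps[OF b1]
  have \<epsilon>i: "\<epsilon> * i1 = i1" "p1 * \<epsilon> = p1" unfolding i1_def p1_def by (simp_all add: mult.assoc r)
  note \<epsilon>r = \<epsilon>i \<epsilon>i[THEN assoc_rule] r
  define \<delta> where "\<delta> = q1 * \<epsilon> * j1"
  have "\<delta> * \<delta> = \<delta>" unfolding \<delta>_def by (simp add: algebra_simps bip_sum[OF b1] \<epsilon>r r1)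
  moreover have "\<delta> \<in> H W W" unfolding \<delta>_def using m2 \<epsilon>(1) by (blast intro: mult0)
  ultimately obtain Y Z k l t s Ys Zs where Y: "bip Y Z W k l t s" "k * t = \<delta>"
    "dsum Ys Y" "dsum Zs Z" "set Ys \<union> set Zs = set Ls" "length Ys + length Zs = length Ls"
    using W by blast
  obtain V a1 a2 b1' b2' where V: "bip L Y V a1 a2 b1' b2'"
    using bip_exists[of L Y] bip_ob[OF b] bip_ob[OF Y(1)] by blast
  note m3 = bip_in[OF Y(1)] bip_in[OF V]
  note r2 = r1 bip_simps[OF Y(1)] bip_simps[OF V]
  let ?I = "i1 * b1' + j1 * k * b2'" and ?P = "a1 * p1 + a2 * t * q1" and ?J = "j1 * l" and ?Q = "s * q1"
  have ip: "?I * ?P = i1 * p1 + j1 * (k * t) * q1" by (simp add: algebra_simps r2)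
  have "bip V Z X ?I ?J ?P ?Q"
  proof -
    have "?P * ?I = e V" by (simp add: algebra_simps r2) (simp add: bip_sum[OF V])
    moreover have "?Q * ?J = e Z" "?Q * ?I = 0" "?P * ?J = 0" by (simp_all add: algebra_simps r2)
    moreover have "?I * ?P + ?J * ?Q = e X"
      by (simp add: algebra_simps r2) (simp add: bip_sum[OF Y(1)] bip_sum[OF b1] r2 algebra_simps)
    moreover have "?I \<in> H V X" "?P \<in> H X V" "?J \<in> H Z X" "?Q \<in> H X Z"
      using m1 m2 m3 by (blast intro: mult0 add_in)+
    ultimately show ?thesis unfolding bip_def by blast
  qed
  moreover have "?I * ?P = \<epsilon>"
    unfolding ip Y(2) \<delta>_def by (simp add: algebra_simps bip_sum[OF b1] \<epsilon>r r1)
  moreover have "isbip L Y V" using V unfolding isbip_def by blast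
  then have "dsum (L # Ys) V" using Y(3) by auto
  moreover have "set (L # Ys) \<union> set Zs = set (L # Ls)" "length (L # Ys) + length Zs = length (L # Ls)"
    using Y by auto
  ultimately show ?thesis using Y(4)
    by (intro exI[of _ V] exI[of _ Z] exI[of _ ?I] exI[of _ ?J] exI[of _ ?P] exI[of _ ?Q]
        exI[of _ "L # Ys"] exI[of _ Zs] conjI)
qed

text \<open>Idempotents are not assumed to split in general; on sums of local objects they do.
  Locality of L makes the diagonal entry of \<epsilon> or of e X - \<epsilon> invertible, and the
  second case follows from the first by exchanging the two summands. The lists record that the local
  objects of the pieces are those of the whole.\<close>

lemma split_idempotent:
  assumes "dsum Ls X" "\<forall>L\<in>set Ls. loc L" "\<epsilon> \<in> H X X" "\<epsilon> * \<epsilon> = \<epsilon>"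
  shows "\<exists>Y Z i j p q Ys Zs. bip Y Z X i j p q \<and> i * p = \<epsilon> \<and>
       dsum Ys Y \<and> dsum Zs Z \<and> set Ys \<union> set Zs = set Ls \<and> length Ys + length Zs = length Ls"
  using assms
proof (induction Ls arbitrary: X \<epsilon>)
  case Nil
  then have "zero_obj X" by simp
  moreover then have "\<epsilon> = 0" using zero_obj_hom(1)[OF _ Nil(3)] by simp
  moreover have "bip X X X 0 0 0 0" using \<open>zero_obj X\<close> unfolding bip_def zero_obj_def by (simp add: zero_in)
  ultimately show ?case by (intro exI[of _ X] exI[of _ 0] exI[of _ "[]"]) auto
next
  case (Cons L Ls)
  then obtain W i j p q where W: "dsum Ls W" and b: "bip L W X i j p q" unfolding dsum.simps isbip_def by blast
  have IH: "\<And>\<delta>. \<lbrakk>\<delta> \<in> H W W; \<delta> * \<delta> = \<delta>\<rbrakk> \<Longrightarrow> \<exists>Y Z i j p q Ys Zs. bip Y Z W i j p q \<and> i * p = \<delta> \<and>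
       dsum Ys Y \<and> dsum Zs Z \<and> set Ys \<union> set Zs = set Ls \<and> length Ys + length Zs = length Ls"
    by (rule Cons.IH[OF W]) (use Cons.prems in auto)
  note m = bip_in[OF b]
  have "p * \<epsilon> * i \<in> H L L" using m Cons.prems(3) by (blast intro: mult0)
  then consider "invertible L (p * \<epsilon> * i)" | "invertible L (e L - p * \<epsilon> * i)"
    using Cons.prems(2) unfolding loc_def by force
  then show ?case
  proof cases
    case 1
    then obtain c where "c \<in> H L L" "c * (p * \<epsilon> * i) = e L" "(p * \<epsilon> * i) * c = e L"
      unfolding invertible_def by blast
    from split_idempotent_step[OF b Cons.prems(3,4) this IH] show ?thesis by blast
  next
    case 2
    let ?\<epsilon> = "e X - \<epsilon>"
    have eX: "e X \<in> H X X" using e_in bip_ob[OF b] by blast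
    have "p * ?\<epsilon> * i = e L - p * \<epsilon> * i" by (simp add: algebra_simps bip_simps[OF b])
    then obtain c where c: "c \<in> H L L" "c * (p * ?\<epsilon> * i) = e L" "(p * ?\<epsilon> * i) * c = e L"
      using 2 unfolding invertible_def by auto
    have "?\<epsilon> * ?\<epsilon> = ?\<epsilon>" using Cons.prems(4) by (simp add: algebra_simps mem_simps[OF eX] mem_simps[OF Cons.prems(3)])
    from split_idempotent_step[OF b diff_in[OF eX Cons.prems(3)] this c IH]
    obtain Y Z i j p q Ys Zs where Y: "bip Y Z X i j p q" "i * p = ?\<epsilon>" "dsum Ys Y" "dsum Zs Z"
      "set Ys \<union> set Zs = set (L # Ls)" "length Ys + length Zs = length (L # Ls)" by blast
    have "j * q = \<epsilon>" using bip_sum(1)[OF Y(1)] Y(2) by simp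
    moreover have "set Zs \<union> set Ys = set (L # Ls)" "length Zs + length Ys = length (L # Ls)" using Y by auto
    ultimately show ?thesis using bip_swap[OF Y(1)] Y(3,4)
      by (intro exI[of _ Z] exI[of _ Y] exI[of _ j] exI[of _ i] exI[of _ q] exI[of _ p]
          exI[of _ Zs] exI[of _ Ys] conjI)
  qed
qed

text \<open>A retract becomes a direct summand once the idempotent f * g splits; its image is
  isomorphic to Y through g * i and p * f.\<close>

lemma retract_dsum:
  assumes "dsum Ls X" "\<forall>L\<in>set Ls. loc L" "retract Y X"
  obtains Z Ys Zs where "isbip Y Z X" "dsum Ys Y" "dsum Zs Z" "set Ys \<union> set Zs = set Ls"
    "length Ys + length Zs = length Ls"
proof -
  obtain f g where f: "f \<in> H Y X" "g \<in> H X Y" "g * f = e Y" using assms(3) unfolding retract_def by blast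
  note r = mem_simps[OF f(1)] mem_simps[OF f(2)] f(3) f(3)[THEN assoc_rule]
  have "f * g \<in> H X X" "(f * g) * (f * g) = f * g" using f mult0 by (auto simp: mult.assoc r)
  from split_idempotent[OF assms(1,2) this] obtain Y' Z i j p q Ys Zs
    where Y: "bip Y' Z X i j p q" "i * p = f * g" "dsum Ys Y'" "dsum Zs Z"
      "set Ys \<union> set Zs = set Ls" "length Ys + length Zs = length Ls" by blast
  note r' = r bip_simps[OF Y(1)]
  have 1: "(g * i) * (p * f) = e Y" by (simp add: mult.assoc Y(2)[THEN assoc_rule]) (simp add: mult.assoc r)
  have 2: "(p * f) * (g * i) = e Y'"
    by (simp add: mult.assoc Y(2)[symmetric, THEN assoc_rule]) (simp add: mult.assoc r')
  have iso: "iso Y' Y"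
    by (rule isoI[OF _ _ 2 1]) (use f bip_in[OF Y(1)] in \<open>blast intro: mult0\<close>)+
  have "isbip Y' Z X" using Y(1) unfolding isbip_def by blast
  then have "isbip Y Z X" using isbip_iso_left iso by blast
  then show ?thesis using that dsum_iso[OF Y(3) iso] Y(4-6) by simp
qed

text \<open>The contributions to \<open>e L\<close> that pass through M and through the remaining
  sum W add up to \<open>e L\<close>, so one of them is invertible. The isomorphism found is the
  component p * f of the given f, which is the form that \<open>bip_cancel\<close> requires.\<close>

lemma exchange:
  assumes "dsum Ms X" "\<forall>M\<in>set Ms. loc M" "loc L" "f \<in> H L X" "g \<in> H X L" "invertible L (g * f)"
  shows "\<exists>M As Bs W i j p q h. Ms = As @ M # Bs \<and> bip M W X i j p q \<and> dsum (As @ Bs) W \<and>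
    h \<in> H M L \<and> h * (p * f) = e L \<and> (p * f) * h = e M"
  using assms
proof (induction Ms arbitrary: X f g)
  case Nil
  then have "f = 0" using zero_obj_hom(2)[of X f] by simp
  then have "e L = 0" using Nil.prems(6) unfolding invertible_def by auto
  then show ?case using Nil.prems(3) unfolding loc_def by blast
next
  case (Cons M Ms)
  then obtain W i j p q where W: "dsum Ms W" and b: "bip M W X i j p q" unfolding dsum.simps isbip_def by blast
  note m = bip_in[OF b] Cons.prems(4,5)
  obtain c where c: "c \<in> H L L" "c * (g * f) = e L" using Cons.prems(6) unfolding invertible_def by blast
  have L: "L \<in> Ob" "e L \<noteq> 0" using Cons.prems(3) unfolding loc_def by auto
  let ?a = "c * g * i * (p * f)"
  have a: "?a \<in> H L L" using m c by (blast intro: mult0)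
  have sum: "e L - ?a = (c * g * j) * (q * f)"
    using c(2) by (simp add: mult.assoc bip_sum[OF b]) (simp add: algebra_simps mem_simps[OF m(5)])
  consider "invertible L ?a" | "invertible L (e L - ?a)"
    using a Cons.prems(3) unfolding loc_def by blast
  then show ?case
  proof cases
    case 1
    then obtain d where d: "d \<in> H L L" "d * ?a = e L" unfolding invertible_def by blast
    let ?h = "d * (c * g * i)"
    have h: "?h \<in> H M L" using d c m by (blast intro: mult0)
    have pf: "p * f \<in> H L M" using m by (blast intro: mult0)
    have hpf: "?h * (p * f) = e L" using d(2) by (simp add: mult.assoc)
    have "(p * f) * ?h = e M"
      by (rule loc_retract_iso[OF _ L(2) pf h hpf]) (use Cons.prems(2) in auto)
    then show ?thesis using h hpf b W
      by (intro exI[of _ M] exI[of _ "[]"] exI[of _ Ms] exI[of _ W] exI[of _ i] exI[of _ j] exI[of _ p] exI[of _ q] exI[of _ ?h]) simp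
  next
    case 2
    have "q * f \<in> H L W" "c * g * j \<in> H W L" using m c by (blast intro: mult0)+
    from Cons.IH[OF W _ Cons.prems(3) this] 2 Cons.prems(2)
    obtain M' As Bs W' i2 j2 p2 q2 h where IH: "Ms = As @ M' # Bs" "bip M' W' W i2 j2 p2 q2" "dsum (As @ Bs) W'"
      "h \<in> H M' L" "h * (p2 * (q * f)) = e L" "(p2 * (q * f)) * h = e M'" unfolding sum by auto
    obtain V a1 a2 b1 b2 where V: "bip W' M V a1 a2 b1 b2"
      using bip_exists[of W' M] bip_ob[OF b] bip_ob[OF IH(2)] by blast
    note as = bip_assoc[OF IH(2) bip_swap[OF b] V]
    have "isbip M W' V" using bip_swap[OF V] unfolding isbip_def by blast
    then have "dsum ((M # As) @ Bs) V" using IH(3) by auto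
    moreover have "M # Ms = (M # As) @ M' # Bs" using IH(1) by simp
    moreover have "h * ((p2 * q) * f) = e L" "((p2 * q) * f) * h = e M'" using IH(5,6) by (simp_all add: mult.assoc)
    ultimately show ?thesis using as IH(4)
      by (intro exI[of _ M'] exI[of _ "M # As"] exI[of _ Bs] exI[of _ V] exI[of _ "j * i2"]
          exI[of _ "j * j2 * b1 + i * b2"] exI[of _ "p2 * q"] exI[of _ "a1 * q2 * q + a2 * p"] exI[of _ h] conjI)
  qed
qed

definition cnt :: "'o \<Rightarrow> 'o list \<Rightarrow> nat" where
  "cnt N Ls = length (filter (iso N) Ls)"

lemma cnt_append [simp]: "cnt N (Ls @ Ms) = cnt N Ls + cnt N Ms"
  and cnt_Nil [simp]: "cnt N [] = 0"
  and cnt_Cons [simp]: "cnt N (L # Ls) = (if iso N L then 1 else 0) + cnt N Ls"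
  by (simp_all add: cnt_def)

text \<open>Decompositions are compared through the numbers \<open>cnt N\<close>, the form from
  which the multiplicity \<open>mul\<close> and its additivity are obtained.\<close>

theorem Krull_Schmidt_unique:
  assumes "dsum Ls X" "dsum Ms X" "\<forall>L\<in>set Ls. loc L" "\<forall>M\<in>set Ms. loc M"
  shows "cnt N Ls = cnt N Ms" "length Ls = length Ms"
proof -
  have "cnt N Ls = cnt N Ms \<and> length Ls = length Ms"
    using assms
  proof (induction Ls arbitrary: X Ms)
    case Nil
    have "Ms = []"
    proof (cases Ms)
      case (Cons M Ms')
      then obtain W i j p q where "bip M W X i j p q" using Nil.prems(2) unfolding Cons dsum.simps isbip_def by blast
      then have "e M = p * i" "i = 0"
        using zero_obj_hom[of X] Nil.prems(1) unfolding bip_def dsum.simps by auto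
      then show ?thesis using Nil.prems(4) Cons unfolding loc_def by auto
    qed
    then show ?case by simp
  next
    case (Cons L Ls)
    then obtain W i j p q where W: "dsum Ls W" and b: "bip L W X i j p q" unfolding dsum.simps isbip_def by blast
    have L: "loc L" "invertible L (p * i)"
      using Cons.prems(3) invertible_e bip_ob[OF b] by (auto simp: bip_simps[OF b])
    from exchange[OF Cons.prems(2,4) L(1) bip_in(1)[OF b] bip_in(3)[OF b] L(2)]
    obtain M As Bs W' i' j' p' q' h where M: "Ms = As @ M # Bs" "bip M W' X i' j' p' q'" "dsum (As @ Bs) W'"
      "h \<in> H M L" "h * (p' * i) = e L" "(p' * i) * h = e M" by blast
    have "iso W W'" by (rule bip_cancel[OF b M(2,4,5,6)])
    then have "dsum (As @ Bs) W" using M(3) dsum_iso iso_sym by blast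
    then have IH: "cnt N Ls = cnt N (As @ Bs) \<and> length Ls = length (As @ Bs)"
      by (rule Cons.IH[OF W]) (use Cons.prems(3,4) M(1) in auto)
    have "iso L M" by (rule isoI[OF _ M(4,5,6)]) (use bip_in[OF b] bip_in[OF M(2)] mult0 in blast)
    then have "iso N L \<longleftrightarrow> iso N M" using iso_trans iso_sym by blast
    then show ?case using IH M(1) by simp
  qed
  then show "cnt N Ls = cnt N Ms" "length Ls = length Ms" by auto
qed

section \<open>Additive closures\<close>

text \<open>For local entries this is the additive closure of their sum, by \<open>addc_iff\<close>,
  in a form that hands out a decomposition. The set \<open>addc\<close> below instead copies the
  shape of \<open>add_cat\<close>.\<close>

definition addl :: "'o list \<Rightarrow> 'o \<Rightarrow> bool" where
  "addl Ls Y \<longleftrightarrow> (\<exists>Ys. dsum Ys Y \<and> (\<forall>y\<in>set Ys. \<exists>l\<in>set Ls. iso y l))"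

definition addc :: "'o \<Rightarrow> 'o set" where
  "addc P = {Y. \<exists>n Z W. dsum (replicate n P) Z \<and> isbip Y W Z}"

lemma addl_iso: "addl Ls X \<Longrightarrow> iso X Y \<Longrightarrow> addl Ls Y"
  unfolding addl_def by (meson dsum_iso)

lemma addl_bip:
  assumes "addl Ls X" "addl Ls Y" "isbip X Y Z"
  shows "addl Ls Z"
proof -
  obtain Xs where "dsum Xs X" "\<forall>y\<in>set Xs. \<exists>l\<in>set Ls. iso y l" using assms(1) unfolding addl_def by blast
  moreover obtain Ys where "dsum Ys Y" "\<forall>y\<in>set Ys. \<exists>l\<in>set Ls. iso y l" using assms(2) unfolding addl_def by blast
  ultimately have "dsum Xs X" "dsum Ys Y" "\<forall>y\<in>set Xs \<union> set Ys. \<exists>l\<in>set Ls. iso y l" by auto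
  then show ?thesis
    unfolding addl_def using dsum_append[OF _ _ assms(3), of Xs Ys] by (intro exI[of _ "Xs @ Ys"]) simp
qed

lemma addl_zero: "zero_obj Z \<Longrightarrow> addl Ls Z"
  unfolding addl_def by (rule exI[of _ "[]"]) simp

lemma addl_member: "L \<in> set Ls \<Longrightarrow> L \<in> Ob \<Longrightarrow> addl Ls L"
  unfolding addl_def using dsum_single iso_refl by (intro exI[of _ "[L]"]) auto

lemma addl_list_obtain:
  assumes "addl Ls Y"
  obtains Ys where "dsum Ys Y" "set Ys \<subseteq> set Ls"
proof -
  obtain Ys where Ys: "dsum Ys Y" "\<forall>y\<in>set Ys. \<exists>l\<in>set Ls. iso y l" using assms unfolding addl_def by blast
  then obtain h where h: "\<And>y. y \<in> set Ys \<Longrightarrow> h y \<in> set Ls \<and> iso y (h y)" by metis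
  have "list_all2 iso Ys (map h Ys)" using h by (auto simp: list_all2_conv_all_nth)
  then have "dsum (map h Ys) Y" by (rule dsum_list_iso[OF Ys(1)])
  moreover have "set (map h Ys) \<subseteq> set Ls" using h by auto
  ultimately show ?thesis by (rule that)
qed

lemma addl_dsum:
  "\<lbrakk>dsum Ys Y; \<And>y. y \<in> set Ys \<Longrightarrow> addl Ls y\<rbrakk> \<Longrightarrow> addl Ls Y"
proof (induction Ys arbitrary: Y)
  case Nil
  then show ?case using addl_zero by simp
next
  case (Cons a Ys)
  then obtain W where W: "dsum Ys W" "isbip a W Y" by auto
  have "addl Ls W" using Cons.IH[OF W(1)] Cons.prems(2) by simp
  then show ?case using addl_bip[OF _ _ W(2)] Cons.prems(2) by simp
qed

lemma addl_trans: "addl Ms Y \<Longrightarrow> (\<And>m. m \<in> set Ms \<Longrightarrow> addl Ls m) \<Longrightarrow> addl Ls Y"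
  by (erule addl_list_obtain, erule addl_dsum) auto

lemma addl_retract:
  assumes "addl Ls Y" "\<forall>L\<in>set Ls. loc L" "retract X Y"
  shows "addl Ls X"
proof -
  obtain Ys where Ys: "dsum Ys Y" "set Ys \<subseteq> set Ls" using addl_list_obtain[OF assms(1)] .
  obtain Z Xs Zs where "dsum Xs X" "set Xs \<union> set Zs = set Ys"
    using retract_dsum[OF Ys(1) _ assms(3)] assms(2) Ys(2) by (metis subset_iff)
  then show ?thesis unfolding addl_def using Ys(2) dsum_ob[of Xs X] iso_refl by blast
qed

lemma isbip_retracts:
  assumes "isbip X A Z" "isbip Y B W" "isbip X Y T" "isbip Z W V"
  shows "\<exists>C. isbip T C V"
proof -
  obtain T' C where T: "isbip X Y T'" "isbip T' C V" using isbip_exchange[OF assms(1,2,4)] by metis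
  have "iso T' T" using isbip_map[OF T(1) assms(3)] iso_refl isbip_ob[OF assms(3)] by simp
  then show ?thesis using isbip_iso_left[OF T(2)] by blast
qed

lemma dsum_summands:
  "\<lbrakk>dsum Ys Y; dsum Zs Z; list_all2 (\<lambda>y z. \<exists>w. isbip y w z) Ys Zs\<rbrakk> \<Longrightarrow> \<exists>W. isbip Y W Z"
proof (induction Ys arbitrary: Y Z Zs)
  case Nil
  then have Z: "zero_obj Z" "zero_obj Y" by auto
  have "isbip Y Z Y" using isbip_zero[OF _ Z(1)] Z(2) unfolding zero_obj_def by blast
  then show ?case using isbip_iso[OF _ zero_obj_iso[OF Z(2,1)]] by blast
next
  case (Cons a Ys)
  then obtain b Zs' w where Z: "Zs = b # Zs'" "isbip a w b" "list_all2 (\<lambda>y z. \<exists>w. isbip y w z) Ys Zs'"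
    by (cases Zs) auto
  obtain U V where U: "dsum Ys U" "isbip a U Y" "dsum Zs' V" "isbip b V Z" using Cons Z by auto
  obtain W where "isbip U W V" using Cons.IH U Z(3) by blast
  then show ?case using isbip_retracts[OF Z(2) _ U(2,4)] by blast
qed

lemma addc_iff:
  assumes P: "dsum Ps P" and loc: "\<forall>p\<in>set Ps. loc p"
  shows "Y \<in> addc P \<longleftrightarrow> addl Ps Y"
proof
  assume "Y \<in> addc P"
  then obtain n Z W where Z: "dsum (replicate n P) Z" "isbip Y W Z" unfolding addc_def by blast
  have "addl Ps P" unfolding addl_def using P dsum_ob[OF P] iso_refl by blast
  then have "addl Ps Z" by (intro addl_dsum[OF Z(1)]) auto
  then show "addl Ps Y" using addl_retract loc isbip_retract[OF Z(2)] by blast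
next
  assume "addl Ps Y"
  then obtain Ys where Ys: "dsum Ys Y" "set Ys \<subseteq> set Ps" using addl_list_obtain by blast
  have "\<exists>w. isbip y w P" if y: "y \<in> set Ps" for y
  proof -
    have "retract y P" using P y
    proof (induction Ps arbitrary: P)
      case (Cons a Ps)
      then obtain W where W: "dsum Ps W" "isbip a W P" by auto
      show ?case
      proof (cases "y = a")
        case True
        then show ?thesis using isbip_retract(1)[OF W(2)] by simp
      next
        case False
        then show ?thesis using Cons.IH[OF W(1)] Cons.prems(2) isbip_retract(2)[OF W(2)] retract_trans by auto
      qed
    qed simp
    then show ?thesis using retract_dsum[OF P loc] by metis
  qed
  \<comment> \<open>Each entry of Ys is split off from a copy of P of its own.\<close>
  moreover obtain Z where Z: "dsum (replicate (length Ys) P) Z"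
    using dsum_exists[of "replicate (length Ys) P"] dsum_ob[OF P] by (fastforce simp: set_replicate_conv_if split: if_splits)
  ultimately have "list_all2 (\<lambda>y z. \<exists>w. isbip y w z) Ys (replicate (length Ys) P)"
    using Ys(2) nth_mem by (fastforce simp: list_all2_conv_all_nth)
  then show "Y \<in> addc P" using dsum_summands[OF Ys(1) Z] Z unfolding addc_def by blast
qed

section \<open>Vanishing of graded Hom groups and shifts of objects\<close>

definition van :: "'o \<Rightarrow> 'o \<Rightarrow> int \<Rightarrow> bool" where
  "van X Y n \<longleftrightarrow> (\<forall>f\<in>G X Y n. f = 0)"

lemma vanI: "(\<And>f. f \<in> G X Y n \<Longrightarrow> f = 0) \<Longrightarrow> van X Y n"
  and vanD: "van X Y n \<Longrightarrow> f \<in> G X Y n \<Longrightarrow> f = 0"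
  unfolding van_def by auto

lemma van_retract_right:
  assumes "van W Z n" "retract X Z" shows "van W X n"
proof (rule vanI)
  fix f assume f: "f \<in> G W X n"
  obtain a b where ab: "a \<in> H X Z" "b \<in> H Z X" "b * a = e X" using assms(2) unfolding retract_def by blast
  have "a * f = 0" using vanD[OF assms(1) mult_0n[OF ab(1) f]] .
  then have "b * (a * f) = 0" by simp
  then show "f = 0" using ab(3)[THEN assoc_rule] e_left[OF f] by simp
qed

lemma van_retract_left:
  assumes "van Z W n" "retract X Z" shows "van X W n"
proof (rule vanI)
  fix f assume f: "f \<in> G X W n"
  obtain a b where ab: "a \<in> H X Z" "b \<in> H Z X" "b * a = e X" using assms(2) unfolding retract_def by blast
  have "f * b = 0" using vanD[OF assms(1) mult_n0[OF f ab(2)]] .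
  then have "f * b * a = 0" by simp
  then show "f = 0" using ab(3) e_right[OF f] by (simp add: mult.assoc)
qed

lemma van_iso_right: "van W Z n \<Longrightarrow> iso X Z \<Longrightarrow> van W X n"
  using van_retract_right iso_retract by blast

lemma van_iso_left: "van Z W n \<Longrightarrow> iso X Z \<Longrightarrow> van X W n"
  using van_retract_left iso_retract by blast

lemma van_bip_right:
  assumes "isbip X Y Z" "van W X n" "van W Y n" shows "van W Z n"
proof (rule vanI)
  fix f assume f: "f \<in> G W Z n"
  obtain i j p q where b: "bip X Y Z i j p q" using assms(1) unfolding isbip_def by blast
  have "p * f = 0" "q * f = 0"
    using vanD[OF assms(2) mult_0n[OF bip_in(3)[OF b] f]] vanD[OF assms(3) mult_0n[OF bip_in(4)[OF b] f]] by auto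
  moreover have "(i * p + j * q) * f = f" using b e_left[OF f] unfolding bip_def by simp
  ultimately show "f = 0" by (simp add: distrib_right mult.assoc)
qed

lemma van_bip_left:
  assumes "isbip X Y Z" "van X W n" "van Y W n" shows "van Z W n"
proof (rule vanI)
  fix f assume f: "f \<in> G Z W n"
  obtain i j p q where b: "bip X Y Z i j p q" using assms(1) unfolding isbip_def by blast
  have "f * i = 0" "f * j = 0"
    using vanD[OF assms(2) mult_n0[OF f bip_in(1)[OF b]]] vanD[OF assms(3) mult_n0[OF f bip_in(2)[OF b]]] by auto
  moreover have "f * (i * p + j * q) = f" using b e_right[OF f] unfolding bip_def by simp
  ultimately show "f = 0" by (simp add: distrib_left mult.assoc[symmetric])
qed

lemma van_zero: "zero_obj X \<Longrightarrow> van X Y n" "zero_obj Y \<Longrightarrow> van X Y n"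
  using zero_obj_hom unfolding van_def by blast+

lemma van_dsum_right: "\<lbrakk>dsum Ys Y; \<And>y. y \<in> set Ys \<Longrightarrow> van W y n\<rbrakk> \<Longrightarrow> van W Y n"
proof (induction Ys arbitrary: Y)
  case Nil
  then show ?case using van_zero by simp
next
  case (Cons a Ys)
  then obtain V where V: "dsum Ys V" "isbip a V Y" by auto
  show ?case by (rule van_bip_right[OF V(2) _ Cons.IH[OF V(1)]]) (use Cons.prems(2) in auto)
qed

lemma van_dsum_left: "\<lbrakk>dsum Ys Y; \<And>y. y \<in> set Ys \<Longrightarrow> van y W n\<rbrakk> \<Longrightarrow> van Y W n"
proof (induction Ys arbitrary: Y)
  case Nil
  then show ?case using van_zero by simp
next
  case (Cons a Ys)
  then obtain V where V: "dsum Ys V" "isbip a V Y" by auto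
  show ?case by (rule van_bip_left[OF V(2) _ Cons.IH[OF V(1)]]) (use Cons.prems(2) in auto)
qed

lemma van_addl_right: "\<lbrakk>addl Ls Y; \<And>l. l \<in> set Ls \<Longrightarrow> van W l n\<rbrakk> \<Longrightarrow> van W Y n"
  by (erule addl_list_obtain, erule van_dsum_right) auto

lemma van_addl_left: "\<lbrakk>addl Ls Y; \<And>l. l \<in> set Ls \<Longrightarrow> van l W n\<rbrakk> \<Longrightarrow> van Y W n"
  by (erule addl_list_obtain, erule van_dsum_left) auto

lemma van_addc_right:
  assumes "Y \<in> addc P" "van W P n" shows "van W Y n"
proof -
  obtain m Z V where Z: "dsum (replicate m P) Z" "isbip Y V Z" using assms(1) unfolding addc_def by blast
  have "van W Z n" by (rule van_dsum_right[OF Z(1)]) (use assms(2) in auto)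
  then show ?thesis using van_retract_right isbip_retract[OF Z(2)] by blast
qed

lemma van_addc_left:
  assumes "Y \<in> addc P" "van P W n" shows "van Y W n"
proof -
  obtain m Z V where Z: "dsum (replicate m P) Z" "isbip Y V Z" using assms(1) unfolding addc_def by blast
  have "van Z W n" by (rule van_dsum_left[OF Z(1)]) (use assms(2) in auto)
  then show ?thesis using van_retract_left isbip_retract[OF Z(2)] by blast
qed

lemma van_shift_left:
  assumes "X \<in> Ob" shows "van (sh k X) Y n \<longleftrightarrow> van X Y (n - k)"
proof -
  obtain a b where ab: "a \<in> G X (sh k X) (- k)" "b \<in> G (sh k X) X k" "b * a = e X" "a * b = e (sh k X)"
    using has_shift[OF assms] by blast
  show ?thesis
  proof
    assume v: "van (sh k X) Y n"
    show "van X Y (n - k)"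
    proof (rule vanI)
      fix f assume f: "f \<in> G X Y (n - k)"
      have "f * b = 0" using vanD[OF v, of "f * b"] mult_in[OF f ab(2)] by simp
      then have "f * b * a = 0" by simp
      then show "f = 0" using ab(3) e_right[OF f] by (simp add: mult.assoc)
    qed
  next
    assume v: "van X Y (n - k)"
    show "van (sh k X) Y n"
    proof (rule vanI)
      fix f assume f: "f \<in> G (sh k X) Y n"
      have "f * a = 0" using vanD[OF v, of "f * a"] mult_in[OF f ab(1)] by simp
      then have "f * a * b = 0" by simp
      then show "f = 0" using ab(4) e_right[OF f] by (simp add: mult.assoc)
    qed
  qed
qed

lemma van_shift_right:
  assumes "Y \<in> Ob" shows "van X (sh k Y) n \<longleftrightarrow> van X Y (n + k)"
proof -
  obtain a b where ab: "a \<in> G Y (sh k Y) (- k)" "b \<in> G (sh k Y) Y k" "b * a = e Y" "a * b = e (sh k Y)"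
    using has_shift[OF assms] by blast
  show ?thesis
  proof
    assume v: "van X (sh k Y) n"
    show "van X Y (n + k)"
    proof (rule vanI)
      fix f assume f: "f \<in> G X Y (n + k)"
      have "a * f = 0" using vanD[OF v, of "a * f"] mult_in[OF ab(1) f] by simp
      then have "b * (a * f) = 0" by simp
      then show "f = 0" using ab(3)[THEN assoc_rule] e_left[OF f] by simp
    qed
  next
    assume v: "van X Y (n + k)"
    show "van X (sh k Y) n"
    proof (rule vanI)
      fix f assume f: "f \<in> G X (sh k Y) n"
      have "b * f = 0" using vanD[OF v, of "b * f"] mult_in[OF ab(2) f] by (simp add: add.commute)
      then have "a * (b * f) = 0" by simp
      then show "f = 0" using ab(4)[THEN assoc_rule] e_left[OF f] by simp
    qed
  qed
qed

text \<open>An object that receives an invertible element of degree n from X is unique up to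
  isomorphism. This identifies iterated shifts and, later, the third cone of a rotated
  triangle.\<close>

lemma iso_of_shift_unit:
  assumes "a \<in> G X Y n" "b \<in> G Y X (- n)" "b * a = e X" "a * b = e Y"
    and "c \<in> G X Y' n" "d \<in> G Y' X (- n)" "d * c = e X" "c * d = e Y'"
  shows "iso Y Y'"
proof (rule isoI[of "c * b" _ _ "a * d"])
  show "c * b \<in> H Y Y'" "a * d \<in> H Y' Y" using mult_in[OF assms(5,2)] mult_in[OF assms(1,6)] by auto
  show "a * d * (c * b) = e Y"
    by (simp add: mult.assoc assms(7)[THEN assoc_rule] e_left[OF assms(2)] assms(4))
  show "c * b * (a * d) = e Y'"
    by (simp add: mult.assoc assms(3)[THEN assoc_rule] e_left[OF assms(6)] assms(8))
qed

lemma sh_sh: assumes "X \<in> Ob" shows "iso (sh k (sh l X)) (sh (k + l) X)"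
proof -
  obtain a b where ab: "a \<in> G X (sh l X) (- l)" "b \<in> G (sh l X) X l" "b * a = e X" "a * b = e (sh l X)"
    using has_shift[OF assms] by blast
  obtain c d where cd: "c \<in> G (sh l X) (sh k (sh l X)) (- k)" "d \<in> G (sh k (sh l X)) (sh l X) k"
    "d * c = e (sh l X)" "c * d = e (sh k (sh l X))"
    using has_shift[OF sh_in[OF assms]] by blast
  obtain u v where uv: "u \<in> G X (sh (k + l) X) (- (k + l))" "v \<in> G (sh (k + l) X) X (k + l)"
    "v * u = e X" "u * v = e (sh (k + l) X)"
    using has_shift[OF assms] by blast
  show ?thesis
  proof (rule iso_of_shift_unit[OF _ _ _ _ uv(1) _ uv(3,4)])
    show "c * a \<in> G X (sh k (sh l X)) (- (k + l))" using mult_in[OF cd(1) ab(1)] by (simp add: algebra_simps)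
    show "b * d \<in> G (sh k (sh l X)) X (- (- (k + l)))" using mult_in[OF ab(2) cd(2)] by (simp add: algebra_simps)
    show "v \<in> G (sh (k + l) X) X (- (- (k + l)))" using uv(2) by (simp only: minus_minus)
    show "b * d * (c * a) = e X" by (simp add: mult.assoc cd(3)[THEN assoc_rule] e_left[OF ab(1)] ab(3))
    show "c * a * (b * d) = e (sh k (sh l X))" by (simp add: mult.assoc ab(4)[THEN assoc_rule] e_left[OF cd(2)] cd(4))
  qed
qed

lemma sh_0: assumes "X \<in> Ob" shows "iso (sh 0 X) X"
proof -
  obtain a b where "a \<in> G X (sh 0 X) (- 0)" "b \<in> G (sh 0 X) X 0" "b * a = e X" "a * b = e (sh 0 X)"
    using has_shift[OF assms] by blast
  then show ?thesis by (intro isoI[of b _ _ a]) auto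
qed

lemma sh_inv: assumes "X \<in> Ob" shows "iso (sh (- k) (sh k X)) X" "iso (sh k (sh (- k) X)) X"
  using iso_trans[OF sh_sh[OF assms, of "- k" k]] iso_trans[OF sh_sh[OF assms, of k "- k"]] sh_0[OF assms] by auto

lemma iso_sh: assumes "iso X Y" shows "iso (sh k X) (sh k Y)"
proof -
  have ob: "X \<in> Ob" "Y \<in> Ob" using iso_ob[OF assms] by auto
  obtain f g where f: "f \<in> H X Y" "g \<in> H Y X" "g * f = e X" "f * g = e Y" using assms unfolding iso_def by blast
  obtain a b where ab: "a \<in> G X (sh k X) (- k)" "b \<in> G (sh k X) X k" "b * a = e X" "a * b = e (sh k X)"
    using has_shift[OF ob(1)] by blast
  obtain c d where cd: "c \<in> G Y (sh k Y) (- k)" "d \<in> G (sh k Y) Y k" "d * c = e Y" "c * d = e (sh k Y)"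
    using has_shift[OF ob(2)] by blast
  have 1: "d * c * f = f" "b * a * g = g" using f cd ab e_left by auto
  show ?thesis
  proof (rule isoI[of "c * f * b" _ _ "a * g * d"])
    show "c * f * b \<in> H (sh k X) (sh k Y)" using mult_in[OF mult_in[OF cd(1) f(1)] ab(2)] by simp
    show "a * g * d \<in> H (sh k Y) (sh k X)" using mult_in[OF mult_in[OF ab(1) f(2)] cd(2)] by simp
    show "a * g * d * (c * f * b) = e (sh k X)"
      by (simp add: mult.assoc cd(3)[THEN assoc_rule] mem_simps[OF f(1)] f(3)[THEN assoc_rule] e_left[OF ab(2)] ab(4))
    show "c * f * b * (a * g * d) = e (sh k Y)"
      by (simp add: mult.assoc ab(3)[THEN assoc_rule] mem_simps[OF f(2)] f(4)[THEN assoc_rule] e_left[OF cd(2)] cd(4))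
  qed
qed

lemma isbip_sh: assumes "isbip X Y Z" shows "isbip (sh k X) (sh k Y) (sh k Z)"
proof -
  have ob: "X \<in> Ob" "Y \<in> Ob" "Z \<in> Ob" using isbip_ob[OF assms] by auto
  obtain i j p q where b: "bip X Y Z i j p q" using assms unfolding isbip_def by blast
  note m = bip_in[OF b]
  obtain a a' where a: "a \<in> G X (sh k X) (- k)" "a' \<in> G (sh k X) X k" "a' * a = e X" "a * a' = e (sh k X)"
    using has_shift[OF ob(1)] by blast
  obtain c c' where c: "c \<in> G Y (sh k Y) (- k)" "c' \<in> G (sh k Y) Y k" "c' * c = e Y" "c * c' = e (sh k Y)"
    using has_shift[OF ob(2)] by blast
  obtain d d' where d: "d \<in> G Z (sh k Z) (- k)" "d' \<in> G (sh k Z) Z k" "d' * d = e Z" "d * d' = e (sh k Z)"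
    using has_shift[OF ob(3)] by blast
  note r = bip_simps[OF b] a(3,4)[THEN assoc_rule] c(3,4)[THEN assoc_rule] d(3,4)[THEN assoc_rule] a(3,4) c(3,4) d(3,4)
    mem_simps[OF a(1)] mem_simps[OF a(2)] mem_simps[OF c(1)] mem_simps[OF c(2)] mem_simps[OF d(1)] mem_simps[OF d(2)]
  have "bip (sh k X) (sh k Y) (sh k Z) (d * i * a') (d * j * c') (a * p * d') (c * q * d')"
    unfolding bip_def
  proof (intro conjI)
    show "d * i * a' \<in> H (sh k X) (sh k Z)" using mult_in[OF mult_in[OF d(1) m(1)] a(2)] by simp
    show "d * j * c' \<in> H (sh k Y) (sh k Z)" using mult_in[OF mult_in[OF d(1) m(2)] c(2)] by simp
    show "a * p * d' \<in> H (sh k Z) (sh k X)" using mult_in[OF mult_in[OF a(1) m(3)] d(2)] by simp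
    show "c * q * d' \<in> H (sh k Z) (sh k Y)" using mult_in[OF mult_in[OF c(1) m(4)] d(2)] by simp
    show "d * i * a' * (a * p * d') + d * j * c' * (c * q * d') = e (sh k Z)"
      by (simp add: mult.assoc r) (simp add: bip_sum[OF b] algebra_simps r)
  qed (simp_all add: mult.assoc r)
  then show ?thesis unfolding isbip_def by blast
qed

lemma dsum_sh: "dsum Xs X \<Longrightarrow> dsum (map (sh k) Xs) (sh k X)"
proof (induction Xs arbitrary: X)
  case Nil
  then have "zero_obj X" by simp
  then have "van (sh k X) (sh k X) 0" using van_shift_left van_zero unfolding zero_obj_def by blast
  then show ?case using Nil unfolding dsum.simps list.map zero_obj_def using sh_in e_in vanD by blast
next
  case (Cons a Xs)
  then obtain W where "dsum Xs W" "isbip a W X" by auto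
  then have "dsum (map (sh k) Xs) (sh k W)" "isbip (sh k a) (sh k W) (sh k X)" using Cons.IH isbip_sh by blast+
  then show ?case by auto
qed

end

section \<open>Triangles and their exactness properties\<close>

locale triangulated = graded_category +
  fixes tr :: "'a \<Rightarrow> 'a \<Rightarrow> 'a \<Rightarrow> 'b \<Rightarrow> 'b \<Rightarrow> 'b \<Rightarrow> bool"
  assumes tr_in: "tr X Y Z f j p \<Longrightarrow> f \<in> H X Y \<and> j \<in> H Y Z \<and> p \<in> G Z X 1"
    and tr_zero: "tr X Y Z f j p \<Longrightarrow> j * f = 0 \<and> p * j = 0 \<and> f * p = 0"
    and tr_exists: "f \<in> H X Y \<Longrightarrow> \<exists>Z j p. tr X Y Z f j p"
    and cov_Y: "\<lbrakk>tr X Y Z f j p; g \<in> H W Y; j * g = 0\<rbrakk> \<Longrightarrow> \<exists>h\<in>H W X. g = f * h"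
    and cov_Z: "\<lbrakk>tr X Y Z f j p; g \<in> H W Z; p * g = 0\<rbrakk> \<Longrightarrow> \<exists>h\<in>H W Y. g = j * h"
    and cov_X: "\<lbrakk>tr X Y Z f j p; g \<in> H W X; f * g = 0\<rbrakk> \<Longrightarrow> \<exists>h\<in>G W Z (- 1). g = p * h"
    and con_Y: "\<lbrakk>tr X Y Z f j p; g \<in> H Y W; g * f = 0\<rbrakk> \<Longrightarrow> \<exists>h\<in>H Z W. g = h * j"
    and con_Z: "\<lbrakk>tr X Y Z f j p; g \<in> H Z W; g * j = 0\<rbrakk> \<Longrightarrow> \<exists>h\<in>G X W (- 1). g = h * p"
    and con_X: "\<lbrakk>tr X Y Z f j p; g \<in> H X W; g * p = 0\<rbrakk> \<Longrightarrow> \<exists>h\<in>H Y W. g = h * f"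
    and tr_morphism: "\<lbrakk>tr X Y Z f j p; tr X' Y' Z' f' j' p'; a \<in> H X X'; b \<in> H Y Y'; b * f = f' * a\<rbrakk>
      \<Longrightarrow> \<exists>c\<in>H Z Z'. c * j = j' * b \<and> p' * c = a * p"
    and tr_rotate: "tr X Y Z f j p \<Longrightarrow> \<exists>W j' p'. tr Y Z W j j' p' \<and> iso W (sh 1 X)"
    and tr_shift: "tr X Y Z f j p \<Longrightarrow> \<exists>f' j' p'. tr (sh k X) (sh k Y) (sh k Z) f' j' p'"
    and tr_octahedral: "\<lbrakk>tr X Y A f j p; tr Y W B g j' p'; tr X W C (g * f) j'' p''\<rbrakk>
      \<Longrightarrow> \<exists>m n r B'. tr A C B' m n r \<and> iso B' B"
begin

lemmas trD = tr_in[THEN conjunct1] tr_in[THEN conjunct2, THEN conjunct1] tr_in[THEN conjunct2, THEN conjunct2]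

lemma tr_ob: "tr X Y Z f j p \<Longrightarrow> X \<in> Ob \<and> Y \<in> Ob \<and> Z \<in> Ob"
  using tr_in G_ob by meson

text \<open>Most arguments need to know only which objects form a triangle. Closing the third vertex
  under isomorphism suffices: \<open>tri_iso\<close> gives closure at the other two.\<close>

definition tri :: "'a \<Rightarrow> 'a \<Rightarrow> 'a \<Rightarrow> bool" where
  "tri X Y Z \<longleftrightarrow> (\<exists>f j p Z'. tr X Y Z' f j p \<and> iso Z' Z)"

lemma tri_ob: "tri X Y Z \<Longrightarrow> X \<in> Ob \<and> Y \<in> Ob \<and> Z \<in> Ob"
  unfolding tri_def using tr_ob iso_ob by meson

lemma triI: "tr X Y Z f j p \<Longrightarrow> tri X Y Z"
  unfolding tri_def using iso_refl tr_ob by blast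

text \<open>Composition with an invertible element of degree n turns arrows of degree n at W into
  arrows of degree 0 at W', so exactness in degree 0 yields the primed versions below.\<close>

lemma degree_reduce:
  assumes "W \<in> Ob"
  obtains W' a b where "a \<in> G W W' n" "b \<in> G W' W (- n)" "b * a = e W" "a * b = e W'"
  using has_shift[OF assms, of "- n"] that by fastforce

lemma cov_Y': assumes t: "tr X Y Z f j p" and g: "g \<in> G W Y n" "j * g = 0" shows "\<exists>h\<in>G W X n. g = f * h"
proof -
  obtain W' a b where ab: "a \<in> G W W' n" "b \<in> G W' W (- n)" "b * a = e W" "a * b = e W'"
    using degree_reduce G_ob[OF g(1)] by metis
  have gb: "g * b \<in> H W' Y" "j * (g * b) = 0" using mult_in[OF g(1) ab(2)] g(2) by (auto simp: mult.assoc[symmetric])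
  obtain h where h: "h \<in> H W' X" "g * b = f * h" using cov_Y[OF t gb] by blast
  have "g = f * (h * a)" using ab(3) e_right[OF g(1)] h(2) by (metis mult.assoc)
  moreover have "h * a \<in> G W X n" using mult_in[OF h(1) ab(1)] by simp
  ultimately show ?thesis by blast
qed

lemma cov_Z': assumes t: "tr X Y Z f j p" and g: "g \<in> G W Z n" "p * g = 0" shows "\<exists>h\<in>G W Y n. g = j * h"
proof -
  obtain W' a b where ab: "a \<in> G W W' n" "b \<in> G W' W (- n)" "b * a = e W" "a * b = e W'"
    using degree_reduce G_ob[OF g(1)] by metis
  have gb: "g * b \<in> H W' Z" "p * (g * b) = 0" using mult_in[OF g(1) ab(2)] g(2) by (auto simp: mult.assoc[symmetric])
  obtain h where h: "h \<in> H W' Y" "g * b = j * h" using cov_Z[OF t gb] by blast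
  have "g = j * (h * a)" using ab(3) e_right[OF g(1)] h(2) by (metis mult.assoc)
  moreover have "h * a \<in> G W Y n" using mult_in[OF h(1) ab(1)] by simp
  ultimately show ?thesis by blast
qed

lemma cov_X': assumes t: "tr X Y Z f j p" and g: "g \<in> G W X n" "f * g = 0" shows "\<exists>h\<in>G W Z (n - 1). g = p * h"
proof -
  obtain W' a b where ab: "a \<in> G W W' n" "b \<in> G W' W (- n)" "b * a = e W" "a * b = e W'"
    using degree_reduce G_ob[OF g(1)] by metis
  have gb: "g * b \<in> H W' X" "f * (g * b) = 0" using mult_in[OF g(1) ab(2)] g(2) by (auto simp: mult.assoc[symmetric])
  obtain h where h: "h \<in> G W' Z (- 1)" "g * b = p * h" using cov_X[OF t gb] by blast
  have "g = p * (h * a)" using ab(3) e_right[OF g(1)] h(2) by (metis mult.assoc)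
  moreover have "h * a \<in> G W Z (n - 1)" using mult_in[OF h(1) ab(1)] by (simp add: algebra_simps)
  ultimately show ?thesis by blast
qed

lemma con_Y': assumes t: "tr X Y Z f j p" and g: "g \<in> G Y W n" "g * f = 0" shows "\<exists>h\<in>G Z W n. g = h * j"
proof -
  obtain W' a b where ab: "a \<in> G W W' (- n)" "b \<in> G W' W n" "b * a = e W" "a * b = e W'"
    using degree_reduce[of W "- n"] G_ob[OF g(1)] by (metis minus_minus)
  have gb: "a * g \<in> H Y W'" "a * g * f = 0" using mult_in[OF ab(1) g(1)] g(2) by (auto simp: mult.assoc)
  obtain h where h: "h \<in> H Z W'" "a * g = h * j" using con_Y[OF t gb] by blast
  have "g = (b * h) * j" using ab(3) e_left[OF g(1)] h(2) by (metis mult.assoc)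
  moreover have "b * h \<in> G Z W n" using mult_in[OF ab(2) h(1)] by simp
  ultimately show ?thesis by blast
qed

lemma con_Z': assumes t: "tr X Y Z f j p" and g: "g \<in> G Z W n" "g * j = 0" shows "\<exists>h\<in>G X W (n - 1). g = h * p"
proof -
  obtain W' a b where ab: "a \<in> G W W' (- n)" "b \<in> G W' W n" "b * a = e W" "a * b = e W'"
    using degree_reduce[of W "- n"] G_ob[OF g(1)] by (metis minus_minus)
  have gb: "a * g \<in> H Z W'" "a * g * j = 0" using mult_in[OF ab(1) g(1)] g(2) by (auto simp: mult.assoc)
  obtain h where h: "h \<in> G X W' (- 1)" "a * g = h * p" using con_Z[OF t gb] by blast
  have "g = (b * h) * p" using ab(3) e_left[OF g(1)] h(2) by (metis mult.assoc)
  moreover have "b * h \<in> G X W (n - 1)" using mult_in[OF ab(2) h(1)] by (simp add: algebra_simps)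
  ultimately show ?thesis by blast
qed

lemma con_X': assumes t: "tr X Y Z f j p" and g: "g \<in> G X W n" "g * p = 0" shows "\<exists>h\<in>G Y W n. g = h * f"
proof -
  obtain W' a b where ab: "a \<in> G W W' (- n)" "b \<in> G W' W n" "b * a = e W" "a * b = e W'"
    using degree_reduce[of W "- n"] G_ob[OF g(1)] by (metis minus_minus)
  have gb: "a * g \<in> H X W'" "a * g * p = 0" using mult_in[OF ab(1) g(1)] g(2) by (auto simp: mult.assoc)
  obtain h where h: "h \<in> H Y W'" "a * g = h * f" using con_X[OF t gb] by blast
  have "g = (b * h) * f" using ab(3) e_left[OF g(1)] h(2) by (metis mult.assoc)
  moreover have "b * h \<in> G Y W n" using mult_in[OF ab(2) h(1)] by simp
  ultimately show ?thesis by blast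
qed

subsection \<open>Vanishing of Hom groups along triangles\<close>

lemma tri_van:
  assumes "tri X Y Z"
  shows "\<lbrakk>van W X n; van W Z n\<rbrakk> \<Longrightarrow> van W Y n"
    and "\<lbrakk>van W Y n; van W X (n + 1)\<rbrakk> \<Longrightarrow> van W Z n"
    and "\<lbrakk>van W Y n; van W Z (n - 1)\<rbrakk> \<Longrightarrow> van W X n"
    and "\<lbrakk>van X W n; van Z W n\<rbrakk> \<Longrightarrow> van Y W n"
    and "\<lbrakk>van Y W n; van X W (n - 1)\<rbrakk> \<Longrightarrow> van Z W n"
    and "\<lbrakk>van Y W n; van Z W (n + 1)\<rbrakk> \<Longrightarrow> van X W n"
proof -
  obtain f j p Z' where t: "tr X Y Z' f j p" and i: "iso Z' Z" using assms unfolding tri_def by blast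
  note m = trD[OF t]
  have Z: "van W Z n \<longleftrightarrow> van W Z' n" "van Z W n \<longleftrightarrow> van Z' W n" for W n
    using van_iso_right van_iso_left i iso_sym by blast+
  show "\<lbrakk>van W X n; van W Z n\<rbrakk> \<Longrightarrow> van W Y n"
    unfolding Z by (rule vanI) (metis cov_Y'[OF t] vanD mult_0n[OF m(2)] mult_zero_right)
  show "\<lbrakk>van W Y n; van W X (n + 1)\<rbrakk> \<Longrightarrow> van W Z n"
    unfolding Z by (rule vanI) (metis cov_Z'[OF t] vanD mult_in[OF m(3)] mult_zero_right add.commute)
  show "\<lbrakk>van W Y n; van W Z (n - 1)\<rbrakk> \<Longrightarrow> van W X n"
    unfolding Z by (rule vanI) (metis cov_X'[OF t] vanD mult_0n[OF m(1)] mult_zero_right)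
  show "\<lbrakk>van X W n; van Z W n\<rbrakk> \<Longrightarrow> van Y W n"
    unfolding Z by (rule vanI) (metis con_Y'[OF t] vanD mult_n0[OF _ m(1)] mult_zero_left)
  show "\<lbrakk>van Y W n; van X W (n - 1)\<rbrakk> \<Longrightarrow> van Z W n"
    unfolding Z by (rule vanI) (metis con_Z'[OF t] vanD mult_n0[OF _ m(2)] mult_zero_left)
  show "\<lbrakk>van Y W n; van Z W (n + 1)\<rbrakk> \<Longrightarrow> van X W n"
    unfolding Z by (rule vanI) (metis con_X'[OF t] vanD mult_in[OF _ m(3)] mult_zero_left)
qed

subsection \<open>Isomorphism invariance and rotation\<close>

lemma cone_zero_iso:
  assumes t: "tr X Y Z f j p" and Z: "zero_obj Z"
  shows "iso X Y"
proof -
  note m = trD[OF t]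
  have j: "j = 0" and p: "p = 0" using zero_obj_hom[OF Z] m by auto
  have ob: "X \<in> Ob" "Y \<in> Ob" using tr_ob[OF t] by auto
  obtain h where h: "h \<in> H Y X" "e Y = f * h" using cov_Y[OF t e_in[OF ob(2)]] j by auto
  have "f * (h * f - e X) = 0"
    using h(2)[symmetric, THEN assoc_rule] by (simp add: right_diff_distrib mem_simps[OF m(1)])
  moreover have "h * f - e X \<in> H X X" using h(1) m(1) e_in[OF ob(1)] by (blast intro: mult0 diff_in)
  ultimately have "h * f - e X = 0" using cov_X[OF t] p by fastforce
  then show ?thesis using isoI[OF m(1) h(1)] h(2) by simp
qed

lemma iso_cone_zero:
  assumes t: "tr X Y Z f j p" and g: "g \<in> H Y X" "g * f = e X" "f * g = e Y"
  shows "zero_obj Z"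
proof -
  note m = trD[OF t] tr_zero[OF t]
  have ob: "Z \<in> Ob" using tr_ob[OF t] by auto
  have "j = j * (f * g)" using g(3) e_right[OF m(2)] by simp
  also have "\<dots> = j * f * g" by (simp add: mult.assoc)
  also have "\<dots> = 0" using m(4) by simp
  finally have j: "j = 0" .
  have "p = g * f * p" using g(2) e_left[OF m(3)] by simp
  also have "\<dots> = g * (f * p)" by (simp add: mult.assoc)
  also have "\<dots> = 0" using m(4) by simp
  finally have p: "p = 0" .
  have "e Z = 0" using cov_Z[OF t e_in[OF ob]] j p by auto
  then show ?thesis using ob unfolding zero_obj_def by blast
qed

lemma tri_zero_left:
  assumes "tri X Y Z" "zero_obj X" shows "iso Y Z"
proof -
  obtain f j p Z' where t: "tr X Y Z' f j p" and i: "iso Z' Z" using assms unfolding tri_def by blast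
  note m = trD[OF t]
  have ob: "Y \<in> Ob" "Z' \<in> Ob" using tr_ob[OF t] by auto
  have f: "f = 0" and p: "p = 0" using zero_obj_hom[OF assms(2)] m by auto
  obtain h where h: "h \<in> H Z' Y" "e Z' = j * h" using cov_Z[OF t e_in[OF ob(2)]] p by auto
  have "j * (h * j - e Y) = 0"
    using h(2)[symmetric, THEN assoc_rule] by (simp add: right_diff_distrib mem_simps[OF m(2)])
  moreover have "h * j - e Y \<in> H Y Y" using h(1) m(2) e_in[OF ob(1)] by (blast intro: mult0 diff_in)
  ultimately have "h * j - e Y = 0" using cov_Y[OF t] f by fastforce
  then have "iso Y Z'" using isoI[OF m(2) h(1)] h(2) by simp
  then show ?thesis using i iso_trans by blast
qed

lemma tri_iso3: "tri X Y Z \<Longrightarrow> iso Z Z' \<Longrightarrow> tri X Y Z'"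
  unfolding tri_def using iso_trans by blast

text \<open>The cone of an isomorphism is zero, so the octahedron for the composite with it
  identifies the two cones.\<close>

lemma tri_iso2: assumes "tri X Y Z" "iso Y Y'" shows "tri X Y' Z"
proof -
  obtain f j p Z' where t: "tr X Y Z' f j p" and i: "iso Z' Z" using assms unfolding tri_def by blast
  obtain u v where u: "u \<in> H Y Y'" "v \<in> H Y' Y" "v * u = e Y" "u * v = e Y'" using assms(2) unfolding iso_def by blast
  obtain B j1 p1 where B: "tr Y Y' B u j1 p1" using tr_exists[OF u(1)] by blast
  obtain C j2 p2 where C: "tr X Y' C (u * f) j2 p2" using tr_exists[OF mult0[OF u(1) trD(1)[OF t]]] by blast
  obtain m n r B' where M: "tr Z' C B' m n r" "iso B' B" using tr_octahedral[OF t B C] by blast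
  have "zero_obj B'" using iso_zero[OF iso_sym[OF M(2)] iso_cone_zero[OF B u(2,3,4)]] .
  then have "iso C Z" using cone_zero_iso[OF M(1)] i iso_trans iso_sym by blast
  then show ?thesis using C unfolding tri_def by blast
qed

lemma tri_iso1: assumes "tri X Y Z" "iso X X'" shows "tri X' Y Z"
proof -
  obtain f j p Z' where t: "tr X Y Z' f j p" and i: "iso Z' Z" using assms unfolding tri_def by blast
  obtain u v where u: "u \<in> H X' X" "v \<in> H X X'" "v * u = e X'" "u * v = e X" using assms(2) unfolding iso_def by blast
  obtain B j1 p1 where B: "tr X' X B u j1 p1" using tr_exists[OF u(1)] by blast
  obtain C j2 p2 where C: "tr X' Y C (f * u) j2 p2" using tr_exists[OF mult0[OF trD(1)[OF t] u(1)]] by blast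
  obtain m n r B' where M: "tr B C B' m n r" "iso B' Z'" using tr_octahedral[OF B t C] by blast
  have "iso C B'" by (rule tri_zero_left[OF triI[OF M(1)] iso_cone_zero[OF B u(2,3,4)]])
  then show ?thesis using C M(2) i iso_trans unfolding tri_def by blast
qed

lemma tri_iso: "\<lbrakk>tri X Y Z; iso X X'; iso Y Y'; iso Z Z'\<rbrakk> \<Longrightarrow> tri X' Y' Z'"
  using tri_iso1 tri_iso2 tri_iso3 by blast

lemma tri_rotate: assumes "tri X Y Z" shows "tri Y Z (sh 1 X)"
proof -
  obtain f j p Z' where t: "tr X Y Z' f j p" and i: "iso Z' Z" using assms unfolding tri_def by blast
  obtain W j' p' where "tr Y Z' W j j' p'" "iso W (sh 1 X)" using tr_rotate[OF t] by blast
  then have "tri Y Z' (sh 1 X)" unfolding tri_def by blast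
  then show ?thesis using tri_iso2 i by blast
qed

lemma tri_shift: assumes "tri X Y Z" shows "tri (sh k X) (sh k Y) (sh k Z)"
proof -
  obtain f j p Z' where t: "tr X Y Z' f j p" and i: "iso Z' Z" using assms unfolding tri_def by blast
  obtain f' j' p' where "tr (sh k X) (sh k Y) (sh k Z') f' j' p'" using tr_shift[OF t] by blast
  then show ?thesis using iso_sh[OF i] unfolding tri_def by blast
qed

lemma tri_unshift: assumes "tri (sh k X) (sh k Y) (sh k Z)" "X \<in> Ob" "Y \<in> Ob" "Z \<in> Ob" shows "tri X Y Z"
  using tri_iso[OF tri_shift[OF assms(1), of "- k"] sh_inv(1)[OF assms(2)] sh_inv(1)[OF assms(3)] sh_inv(1)[OF assms(4)]] .

text \<open>Only forward rotation is an axiom. Rotating the given triangle twice more gives the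
  triangle on X, Y, Z shifted by 1, and that shift can be undone.\<close>

lemma tri_unrotate': assumes "tri Y Z (sh 1 X)" "X \<in> Ob" shows "tri X Y Z"
proof -
  have ob: "Y \<in> Ob" "Z \<in> Ob" using tri_ob[OF assms(1)] by auto
  have "tri (sh 1 X) (sh 1 Y) (sh 1 Z)" using tri_rotate[OF tri_rotate[OF assms(1)]] .
  then show ?thesis using tri_unshift assms(2) ob by blast
qed

lemma tri_unrotate: assumes "tri X Y Z" shows "tri (sh (- 1) Z) X Y"
proof (rule tri_unrotate')
  have "Z \<in> Ob" using tri_ob[OF assms] by blast
  then show "tri X Y (sh 1 (sh (- 1) Z))" "sh (- 1) Z \<in> Ob"
    using tri_iso3[OF assms iso_sym[OF sh_inv(2)]] sh_in by auto
qed

subsection \<open>Octahedra, splittings and pushouts\<close>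

lemma octahedron: assumes "tri X Y A" "tri Y W B" shows "\<exists>C. tri X W C \<and> tri A C B"
proof -
  obtain f j p A' where t: "tr X Y A' f j p" and i: "iso A' A" using assms unfolding tri_def by blast
  obtain g j' p' B' where t': "tr Y W B' g j' p'" and i': "iso B' B" using assms unfolding tri_def by blast
  obtain C j2 p2 where C: "tr X W C (g * f) j2 p2" using tr_exists[OF mult0[OF trD(1)[OF t'] trD(1)[OF t]]] by blast
  obtain m n r B'' where M: "tr A' C B'' m n r" "iso B'' B'" using tr_octahedral[OF t t' C] by blast
  have "tri A' C B" using M i' iso_trans unfolding tri_def by blast
  then show ?thesis using triI[OF C] tri_iso1 i by blast
qed

text \<open>The octahedron read on fibres: for Y \<rightarrow> Y1 \<rightarrow> Y2 the fibre E of
  the composite is an extension of the second fibre B by the first fibre A. It follows from the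
  version for cones by rotation.\<close>

lemma octahedron': assumes "tri A Y Y1" "tri B Y1 Y2" shows "\<exists>E. tri A E B \<and> tri E Y Y2"
proof -
  have ob: "A \<in> Ob" "B \<in> Ob" "Y \<in> Ob" using tri_ob assms by auto
  obtain C where C: "tri Y Y2 C" "tri (sh 1 A) C (sh 1 B)"
    using octahedron[OF tri_rotate[OF assms(1)] tri_rotate[OF assms(2)]] by blast
  have obC: "C \<in> Ob" using tri_ob[OF C(1)] by auto
  have "tri (sh 1 A) (sh 1 (sh (- 1) C)) (sh 1 B)" using tri_iso2[OF C(2) iso_sym[OF sh_inv(2)[OF obC]]] .
  then have "tri A (sh (- 1) C) B" using tri_unshift[OF _ ob(1) sh_in[OF obC] ob(2)] by blast
  then show ?thesis using tri_unrotate[OF C(1)] by blast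
qed

text \<open>E is the homotopy pushout of Y and Y' under X, obtained as the cone of the composite
  C[-1] \<rightarrow> X \<rightarrow> Y'.\<close>

lemma pushout: assumes "tri X Y C" "tri X Y' C'" shows "\<exists>E. tri Y E C' \<and> tri Y' E C"
proof -
  have ob: "C \<in> Ob" using tri_ob assms by auto
  obtain E where E: "tri (sh (- 1) C) Y' E" "tri Y E C'"
    using octahedron[OF tri_unrotate[OF assms(1)] assms(2)] by blast
  have "tri Y' E C" using tri_iso3[OF tri_rotate[OF E(1)] sh_inv(2)[OF ob]] .
  then show ?thesis using E(2) by blast
qed

text \<open>The biproduct has the arrows f and j of the triangle among its structure maps;
  \<open>tr_bip\<close> needs this in order to compare two biproducts with the same inclusion
  f.\<close>

lemma tr_split:
  assumes t: "tr X Y Z f j p" and p: "p = 0"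
  obtains g r where "bip X Z Y f g r j"
proof -
  note m = trD[OF t] tr_zero[OF t]
  have ob: "X \<in> Ob" "Y \<in> Ob" "Z \<in> Ob" using tr_ob[OF t] by auto
  obtain g where g: "g \<in> H Z Y" "e Z = j * g" using cov_Z[OF t e_in[OF ob(3)]] p by auto
  have "j * (e Y - g * j) = 0"
    using g(2)[symmetric, THEN assoc_rule] by (simp add: right_diff_distrib mem_simps[OF m(2)])
  moreover have "e Y - g * j \<in> H Y Y" using g m e_in[OF ob(2)] by (blast intro: mult0 diff_in)
  ultimately obtain r where r: "r \<in> H Y X" "e Y - g * j = f * r" using cov_Y[OF t] by blast
  have inj: "k = 0" if "k \<in> H W X" "f * k = 0" for k W using cov_X[OF t that] p by auto
  have frf: "f * (r * f) = f" "f * (r * g) = 0"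
    using m(4) r(2)[symmetric, THEN assoc_rule]
    by (auto simp: left_diff_distrib mult.assoc mem_simps[OF m(1)] mem_simps[OF g(1)] g(2)[symmetric])
  have "f * (r * f - e X) = 0" by (simp add: right_diff_distrib frf mem_simps[OF m(1)])
  moreover have "r * f - e X \<in> H X X" using r m e_in[OF ob(1)] by (blast intro: mult0 diff_in)
  ultimately have "r * f = e X" using inj by fastforce
  moreover have "r * g = 0" using inj[of "r * g" Z] frf(2) mult0[OF r(1) g(1)] by blast
  moreover have "f * r + g * j = e Y" by (simp add: r(2)[symmetric])
  ultimately have "bip X Z Y f g r j" unfolding bip_def using m g r by auto
  then show ?thesis using that by blast
qed

lemma tri_split: assumes "tri X Y Z" "van Z X 1" shows "isbip X Z Y"
proof -
  obtain f j p Z' where t: "tr X Y Z' f j p" and i: "iso Z' Z" using assms unfolding tri_def by blast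
  have "p = 0" using vanD[OF van_iso_left[OF assms(2) i] trD(3)[OF t]] .
  then have "isbip X Z' Y" using tr_split[OF t] unfolding isbip_def by metis
  then show ?thesis using isbip_iso_right i by blast
qed

lemma tr_bip:
  assumes t: "tr X Y Z f j p" and b: "bip X Z' Y f g r q"
  shows "iso Z Z'"
proof -
  note m = trD[OF t] tr_zero[OF t] and mb = bip_in[OF b]
  note s = bip_simps[OF b]
  have "p = r * (f * p)" using s mem_simps[OF m(3)] by simp
  then have p: "p = 0" using m(4) by simp
  obtain g' r' where b': "bip X Z Y f g' r' j" using tr_split[OF t p] .
  have "e X * (r' * f) = e X" using bip_simps[OF b'] by (simp add: mem_simps[OF e_in] bip_ob[OF b])
  then show ?thesis
    using bip_cancel[OF b' b, of "e X"] by (simp add: s bip_simps[OF b'] mem_simps[OF e_in] bip_ob[OF b] e_in)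
qed

lemma bip_tri: assumes "isbip X Z Y" shows "tri X Y Z"
proof -
  obtain f g r q where b: "bip X Z Y f g r q" using assms unfolding isbip_def by blast
  obtain C j p where t: "tr X Y C f j p" using tr_exists[OF bip_in(1)[OF b]] by blast
  show ?thesis using tr_bip[OF t b] t unfolding tri_def by blast
qed

text \<open>A direct sum of two triangles. It is assembled from two pushouts and an octahedron, and
  each of the three vanishing hypotheses splits one of the extensions that occur: X' by Y, then Y by
  Y', then Z' by Z.\<close>

lemma tri_bip:
  assumes "tri X Y Z" "tri X' Y' Z'" "isbip X X' A"
    and "van X' Y 1" "van Y Y' 1" "van Z' Z 1"
  shows "\<exists>F C. isbip Y' Y F \<and> isbip Z Z' C \<and> tri A F C"
proof -
  obtain E where E: "tri A E Z" "tri Y E X'" using pushout[OF bip_tri[OF assms(3)] assms(1)] by blast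
  have "isbip Y X' E" using tri_split[OF E(2) assms(4)] .
  then have "tri X' E Y" using bip_tri isbip_swap by blast
  then obtain F where F: "tri E F Z'" "tri Y' F Y" using pushout[OF _ assms(2)] by blast
  obtain C where C: "tri A F C" "tri Z C Z'" using octahedron[OF E(1) F(1)] by blast
  show ?thesis using tri_split[OF F(2) assms(5)] tri_split[OF C(2) assms(6)] C(1) by blast
qed

end

subsection \<open>The number of indecomposable summands\<close>

text \<open>Gaussian elimination over the integers. Equation m is eliminated by cross-multiplication
  with the pivot c k m, so no division occurs.\<close>

lemma homogeneous_solution:
  fixes c :: "'j \<Rightarrow> 'i \<Rightarrow> int"
  assumes "finite I" "finite J" "card I < card J"
  shows "\<exists>x. (\<exists>j\<in>J. x j \<noteq> 0) \<and> (\<forall>i\<in>I. (\<Sum>j\<in>J. x j * c j i) = 0)"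
  using assms
proof (induction I arbitrary: J c rule: finite_induct)
  case empty
  then show ?case by (intro exI[of _ "\<lambda>_. 1"]) (auto simp: card_gt_0_iff)
next
  case (insert m I)
  show ?case
  proof (cases "\<forall>j\<in>J. c j m = 0")
    case True
    have "card I < card J" using insert.hyps insert.prems by simp
    from insert.IH[OF insert.prems(1) this, of c]
    obtain x where x: "\<exists>j\<in>J. x j \<noteq> 0" "\<forall>i\<in>I. (\<Sum>j\<in>J. x j * c j i) = 0" by blast
    have "(\<Sum>j\<in>J. x j * c j m) = 0" using True by simp
    then show ?thesis using x by blast
  next
    case False
    then obtain k where k: "k \<in> J" "c k m \<noteq> 0" by blast
    let ?J = "J - {k}"
    have "card I < card ?J" using insert.hyps insert.prems k by (simp add: card_Diff_singleton)
    from insert.IH[OF _ this, of "\<lambda>j i. c k m * c j i - c j m * c k i"]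
    obtain y where y: "\<exists>j\<in>?J. y j \<noteq> 0"
      "\<And>i. i \<in> I \<Longrightarrow> (\<Sum>j\<in>?J. y j * (c k m * c j i - c j m * c k i)) = 0" using insert.prems(1) by auto
    \<comment> \<open>Scaling y by the nonzero pivot keeps the solution nontrivial, and the value at
      k is the one that makes equation m hold.\<close>
    define x where "x j = (if j = k then - (\<Sum>j\<in>?J. y j * c j m) else y j * c k m)" for j
    have sum: "(\<Sum>j\<in>J. x j * c j i) = (\<Sum>j\<in>?J. y j * (c k m * c j i - c j m * c k i))" for i
    proof -
      have "(\<Sum>j\<in>J. x j * c j i) = x k * c k i + (\<Sum>j\<in>?J. x j * c j i)"
        using k insert.prems(1) by (simp add: sum.remove)
      also have "(\<Sum>j\<in>?J. x j * c j i) = (\<Sum>j\<in>?J. y j * c k m * c j i)"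
        by (rule sum.cong) (auto simp: x_def)
      also have "x k * c k i = (\<Sum>j\<in>?J. - (y j * c j m * c k i))"
        by (simp add: x_def sum_distrib_right sum_negf)
      finally show ?thesis by (simp add: sum.distrib[symmetric] algebra_simps)
    qed
    have "(\<Sum>j\<in>J. x j * c j i) = 0" if "i \<in> insert m I" for i
      using that y(2) unfolding sum by (auto simp: mult.commute)
    moreover have "\<exists>j\<in>J. x j \<noteq> 0" using y(1) k by (auto simp: x_def)
    ultimately show ?thesis by blast
  qed
qed

text \<open>The identity matrix of size J factors through I. A nonzero row x with x c = 0, which
  exists if I is smaller, would give x = x c v = 0.\<close>

lemma card_le_of_factorization:
  fixes c :: "'j \<Rightarrow> 'i \<Rightarrow> int"
  assumes "finite I" "finite J"
    and eq: "\<And>j k. \<lbrakk>j \<in> J; k \<in> J\<rbrakk> \<Longrightarrow> (\<Sum>i\<in>I. c j i * v i k) = (if j = k then 1 else 0)"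
  shows "card J \<le> card I"
proof (rule ccontr)
  assume "\<not> card J \<le> card I"
  then obtain x where x: "\<exists>j\<in>J. x j \<noteq> 0" "\<And>i. i \<in> I \<Longrightarrow> (\<Sum>j\<in>J. x j * c j i) = 0"
    using homogeneous_solution[OF assms(1,2), of c] by auto
  have "x k = 0" if k: "k \<in> J" for k
  proof -
    have "x k = (\<Sum>j\<in>J. if j = k then x k else 0)" using assms(2) k by simp
    also have "\<dots> = (\<Sum>j\<in>J. x j * (\<Sum>i\<in>I. c j i * v i k))"
      by (rule sum.cong) (use eq k in auto)
    also have "\<dots> = (\<Sum>i\<in>I. (\<Sum>j\<in>J. x j * c j i) * v i k)"
      by (simp add: sum_distrib_left sum_distrib_right mult.assoc) (rule sum.swap)
    also have "\<dots> = 0" using x(2) by simp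
    finally show ?thesis .
  qed
  then show False using x(1) by blast
qed

lemma sum_list_count:
  fixes f :: "'x \<Rightarrow> int"
  assumes "finite S" "set xs \<subseteq> S"
  shows "(\<Sum>x\<leftarrow>xs. f x) = (\<Sum>x\<in>S. int (count_list xs x) * f x)"
  using assms(2)
proof (induction xs)
  case (Cons a xs)
  have "(\<Sum>x\<in>S. int (count_list (a # xs) x) * f x) =
    (\<Sum>x\<in>S. (if x = a then f a else 0) + int (count_list xs x) * f x)"
    by (rule sum.cong) (auto simp: algebra_simps)
  then show ?case using Cons assms(1) by (simp add: sum.distrib)
qed simp

context graded_category
begin

definition dec :: "'o list \<Rightarrow> 'o \<Rightarrow> bool" where
  "dec Ls X \<longleftrightarrow> dsum Ls X \<and> (\<forall>L\<in>set Ls. loc L)"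

definition mul :: "'o \<Rightarrow> 'o \<Rightarrow> nat" where
  "mul N X = (THE c. \<exists>Ls. dec Ls X \<and> c = cnt N Ls)"

lemma mul_eq: "dec Ls X \<Longrightarrow> mul N X = cnt N Ls"
  unfolding mul_def using Krull_Schmidt_unique(1) unfolding dec_def by (intro the_equality) blast+

lemma dec_bip: "\<lbrakk>dec Xs X; dec Ys Y; isbip X Y Z\<rbrakk> \<Longrightarrow> dec (Xs @ Ys) Z"
  unfolding dec_def using dsum_append[of Xs X Ys Y Z] by auto

lemma mul_bip: "\<lbrakk>dec Xs X; dec Ys Y; isbip X Y Z\<rbrakk> \<Longrightarrow> mul N Z = mul N X + mul N Y"
  using mul_eq[OF dec_bip] mul_eq[of Xs X] mul_eq[of Ys Y] by simp

lemma addl_dec: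
  assumes "addl Ns X" "\<forall>N\<in>set Ns. loc N"
  obtains Xs where "dec Xs X" "set Xs \<subseteq> set Ns"
proof -
  obtain Xs where "dsum Xs X" "set Xs \<subseteq> set Ns" using addl_list_obtain[OF assms(1)] .
  then show ?thesis using that[of Xs] assms(2) unfolding dec_def by blast
qed

end

context triangulated
begin

text \<open>The index of A relative to Ns: the coefficients of [D0] - [D1] for some coresolution. It
  is a relation, so independence of the coresolution need not be proved.\<close>

definition idx :: "'a list \<Rightarrow> 'a \<Rightarrow> ('a \<Rightarrow> int) \<Rightarrow> bool" where
  "idx Ns A w \<longleftrightarrow> (\<exists>D0 D1. tri A D0 D1 \<and> addl Ns D0 \<and> addl Ns D1 \<and>
     (\<forall>N\<in>set Ns. int (mul N D0) - int (mul N D1) = w N))"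

lemma idxI:
  "\<lbrakk>tri A D0 D1; addl Ns D0; addl Ns D1; \<And>N. N \<in> set Ns \<Longrightarrow> int (mul N D0) - int (mul N D1) = w N\<rbrakk> \<Longrightarrow> idx Ns A w"
  unfolding idx_def by blast

context
  fixes Ns Ms :: "'a list"
  assumes locs: "\<forall>N\<in>set Ns. loc N"
    and vNN: "\<And>N N'. \<lbrakk>N \<in> set Ns; N' \<in> set Ns\<rbrakk> \<Longrightarrow> van N N' 1"
    and vMN: "\<And>M N. \<lbrakk>M \<in> set Ms; N \<in> set Ns\<rbrakk> \<Longrightarrow> van M N 1"
begin

lemma van_addl_addl: "\<lbrakk>addl Ns X; addl Ns Y\<rbrakk> \<Longrightarrow> van X Y 1"
  using van_addl_left[of Ns X Y 1] van_addl_right[of Ns Y _ 1] vNN by blast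

lemma idx_dsum:
  assumes "\<And>M. M \<in> set Ms \<Longrightarrow> idx Ns M (v M)"
  shows "\<lbrakk>dsum As A; set As \<subseteq> set Ms\<rbrakk> \<Longrightarrow> idx Ns A (\<lambda>N. \<Sum>a\<leftarrow>As. v a N)"
proof (induction As arbitrary: A)
  case Nil
  then have A: "zero_obj A" by simp
  then have "tri A A A" using bip_tri[OF isbip_zero] unfolding zero_obj_def by blast
  then show ?case unfolding idx_def using addl_zero[OF A] by auto
next
  case (Cons a As)
  then obtain B where B: "dsum As B" "isbip a B A" by auto
  obtain D0 D1 where D: "tri a D0 D1" "addl Ns D0" "addl Ns D1"
    "\<forall>N\<in>set Ns. int (mul N D0) - int (mul N D1) = v a N"
    using assms[of a] Cons.prems unfolding idx_def by auto
  obtain E0 E1 where E: "tri B E0 E1" "addl Ns E0" "addl Ns E1"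
    "\<forall>N\<in>set Ns. int (mul N E0) - int (mul N E1) = (\<Sum>a\<leftarrow>As. v a N)"
    using Cons.IH[OF B(1)] Cons.prems unfolding idx_def by auto
  have "van B D0 1"
    by (rule van_dsum_left[OF B(1)]) (rule van_addl_right[OF D(2)], use Cons.prems vMN in auto)
  from tri_bip[OF D(1) E(1) B(2) this van_addl_addl[OF D(2) E(2)] van_addl_addl[OF E(3) D(3)]]
  obtain F C where F: "isbip E0 D0 F" "isbip D1 E1 C" "tri A F C" by blast
  obtain d0 d1 e0 e1 where "dec d0 D0" "dec d1 D1" "dec e0 E0" "dec e1 E1"
    using addl_dec[OF D(2) locs] addl_dec[OF D(3) locs] addl_dec[OF E(2) locs] addl_dec[OF E(3) locs] by metis
  then have m: "mul N F = mul N E0 + mul N D0" "mul N C = mul N D1 + mul N E1" for N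
    using mul_bip F by blast+
  show ?case
    by (rule idxI[OF F(3) addl_bip[OF E(2) D(2) F(1)] addl_bip[OF D(3) E(3) F(2)]])
      (use D(4) E(4) in \<open>simp add: m algebra_simps\<close>)
qed

text \<open>Pushing out \<open>A1 \<rightarrow> A0 \<rightarrow> B\<close> along coresolutions of \<open>A1\<close> and \<open>A0\<close> shows that the class of \<open>B\<close>
  is the difference of the indices.\<close>

lemma idx_resolution:
  assumes B: "B \<in> set Ns" and t: "tri A1 A0 B" and "idx Ns A1 w1" "idx Ns A0 w0" and N: "N \<in> set Ns"
  shows "int (mul N B) = w0 N - w1 N"
proof -
  obtain D0 D1 where D: "tri A1 D0 D1" "addl Ns D0" "addl Ns D1"
    "\<forall>N\<in>set Ns. int (mul N D0) - int (mul N D1) = w1 N" using assms(3) unfolding idx_def by blast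
  obtain C0 C1 where C: "tri A0 C0 C1" "addl Ns C0" "addl Ns C1"
    "\<forall>N\<in>set Ns. int (mul N C0) - int (mul N C1) = w0 N" using assms(4) unfolding idx_def by blast
  have B': "addl Ns B" using addl_member[OF B] tri_ob[OF t] by blast
  obtain E where E: "tri A0 E D1" "tri D0 E B" using pushout[OF t D(1)] by blast
  have E': "isbip D0 B E" using tri_split[OF E(2) van_addl_addl[OF B' D(2)]] .
  have aE: "addl Ns E" using addl_bip[OF D(2) B' E'] .
  obtain F where F: "tri E F C1" "tri C0 F D1" using pushout[OF E(1) C(1)] by blast
  have F': "isbip E C1 F" "isbip C0 D1 F"
    using tri_split[OF F(1) van_addl_addl[OF C(3) aE]] tri_split[OF F(2) van_addl_addl[OF D(3) C(2)]] by auto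
  obtain d0 d1 c0 c1 b where d: "dec d0 D0" "dec d1 D1" "dec c0 C0" "dec c1 C1" "dec b B"
    using addl_dec[OF D(2) locs] addl_dec[OF D(3) locs] addl_dec[OF C(2) locs] addl_dec[OF C(3) locs]
      addl_dec[OF B' locs] by metis
  \<comment> \<open>Both sides count N in F, which is the sum of D0, B and C1 as well as the sum of
    C0 and D1.\<close>
  have "mul N D0 + mul N B + mul N C1 = mul N C0 + mul N D1"
    using mul_bip[OF d(1,5) E'] mul_bip[OF dec_bip[OF d(1,5) E'] d(4) F'(1)] mul_bip[OF d(3,2) F'(2)] by simp
  then show ?thesis using C(4) D(4) N by force
qed

text \<open>The coefficients c of the resolutions of the N by Ms, multiplied with the indices v of
  the M relative to Ns, give the multiplicities of each N' in N. As the members of Ns are local and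
  pairwise non-isomorphic, this product is the identity matrix.\<close>

theorem card_le_of_resolutions:
  assumes dist: "\<And>N N'. \<lbrakk>N \<in> set Ns; N' \<in> set Ns; iso N N'\<rbrakk> \<Longrightarrow> N = N'"
    and res: "\<And>N. N \<in> set Ns \<Longrightarrow> \<exists>A1 A0. tri A1 A0 N \<and> addl Ms A1 \<and> addl Ms A0"
    and cores: "\<And>M. M \<in> set Ms \<Longrightarrow> \<exists>B0 B1. tri M B0 B1 \<and> addl Ns B0 \<and> addl Ns B1"
  shows "card (set Ns) \<le> card (set Ms)"
proof -
  have "\<exists>w. idx Ns M w" if M: "M \<in> set Ms" for M
  proof -
    obtain B0 B1 where "tri M B0 B1 \<and> addl Ns B0 \<and> addl Ns B1" using cores[OF M] by blast
    then show ?thesis using idxI[of M B0 B1 Ns "\<lambda>N. int (mul N B0) - int (mul N B1)"] by blast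
  qed
  then obtain v where v: "\<And>M. M \<in> set Ms \<Longrightarrow> idx Ns M (v M)" by metis
  have "\<exists>c. \<forall>N'\<in>set Ns. (\<Sum>M\<in>set Ms. c M * v M N') = (if N = N' then 1 else 0)" if N: "N \<in> set Ns" for N
  proof -
    obtain A1 A0 where A: "tri A1 A0 N" "addl Ms A1" "addl Ms A0" using res[OF N] by blast
    obtain As1 As0 where As: "dsum As1 A1" "set As1 \<subseteq> set Ms" "dsum As0 A0" "set As0 \<subseteq> set Ms"
      using addl_list_obtain[OF A(2)] addl_list_obtain[OF A(3)] by metis
    have locN: "loc N" "N \<in> Ob" using locs N tri_ob[OF A(1)] by auto
    then have "dec [N] N" using dsum_single unfolding dec_def by simp
    then have mul: "mul N' N = (if N = N' then 1 else 0)" if "N' \<in> set Ns" for N'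
      using mul_eq[of "[N]" N N'] dist[OF that N] iso_refl[OF locN(2)] by auto
    have "(\<Sum>M\<in>set Ms. (int (count_list As0 M) - int (count_list As1 M)) * v M N') = (if N = N' then 1 else 0)"
      if N': "N' \<in> set Ns" for N'
    proof -
      have "int (mul N' N) = (\<Sum>a\<leftarrow>As0. v a N') - (\<Sum>a\<leftarrow>As1. v a N')"
        using idx_resolution[OF N A(1) idx_dsum[OF v As(1,2)] idx_dsum[OF v As(3,4)] N'] by simp
      then show ?thesis
        using As mul[OF N'] by (simp add: sum_list_count[of "set Ms"] sum_subtractf left_diff_distrib split: if_splits)
    qed
    then show ?thesis by (intro exI[of _ "\<lambda>M. int (count_list As0 M) - int (count_list As1 M)"]) blast
  qed
  then obtain c where "\<And>N N'. \<lbrakk>N \<in> set Ns; N' \<in> set Ns\<rbrakk> \<Longrightarrow> (\<Sum>M\<in>set Ms. c N M * v M N') = (if N = N' then 1 else 0)"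
    by metis
  then show ?thesis by (intro card_le_of_factorization[where c = c and v = v]) auto
qed

end

subsection \<open>Filtrations by shifts of a presilting object\<close>

definition presil :: "'a \<Rightarrow> bool" where
  "presil T \<longleftrightarrow> T \<in> Ob \<and> (\<forall>n>0. van T T n)"

definition thk :: "'a set \<Rightarrow> bool" where
  "thk U \<longleftrightarrow> U \<subseteq> Ob \<and> U \<noteq> {} \<and> (\<forall>X\<in>U. \<forall>Y. iso X Y \<longrightarrow> Y \<in> U) \<and> (\<forall>X\<in>U. \<forall>k. sh k X \<in> U) \<and>
     (\<forall>X\<in>U. \<forall>Y\<in>U. \<forall>Z f j p. tr X Y Z f j p \<longrightarrow> Z \<in> U) \<and> (\<forall>X\<in>U. \<forall>Y W. isbip Y W X \<longrightarrow> Y \<in> U)"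

definition generates :: "'a \<Rightarrow> bool" where
  "generates T \<longleftrightarrow> (\<forall>U. thk U \<and> T \<in> U \<longrightarrow> U = Ob)"

text \<open>The list gives the shifts of T in a filtration of Y, read from the bottom: T[k] maps to
  Y and the rest of the list filters the cone.\<close>

fun flt :: "'a \<Rightarrow> int list \<Rightarrow> 'a \<Rightarrow> bool" where
  "flt T [] Y \<longleftrightarrow> zero_obj Y"
| "flt T (k # ks) Y \<longleftrightarrow> (\<exists>Y'. tri (sh k T) Y Y' \<and> flt T ks Y')"

lemma flt_iso: "flt T ks Y \<Longrightarrow> iso Y Y' \<Longrightarrow> flt T ks Y'"
proof (cases ks)
  case Nil
  then show "flt T ks Y \<Longrightarrow> iso Y Y' \<Longrightarrow> ?thesis" using iso_zero by simp
next
  case (Cons a list)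
  assume f: "flt T ks Y" and i: "iso Y Y'"
  then obtain Z where "tri (sh a T) Y Z" "flt T list Z" using Cons by auto
  then have "tri (sh a T) Y' Z" "flt T list Z" using tri_iso2[OF _ i] by auto
  then show ?thesis using Cons by auto
qed

lemma flt_ob: "T \<in> Ob \<Longrightarrow> flt T ks Y \<Longrightarrow> Y \<in> Ob"
  by (cases ks) (auto simp: zero_obj_def dest: tri_ob)

lemma flt_append: "\<lbrakk>flt T ks X; flt T ls Z; tri X Y Z\<rbrakk> \<Longrightarrow> flt T (ks @ ls) Y"
proof (induction ks arbitrary: X Y)
  case Nil
  then have "iso Y Z" using tri_zero_left by simp
  then show ?case using flt_iso[OF Nil(2) iso_sym] by simp
next
  case (Cons k ks)
  then obtain X' where X': "tri (sh k T) X X'" "flt T ks X'" by auto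
  obtain C where C: "tri (sh k T) Y C" "tri X' C Z" using octahedron[OF X'(1) Cons.prems(3)] by blast
  have "flt T (ks @ ls) C" using Cons.IH[OF X'(2) Cons.prems(2) C(2)] .
  then show ?case using C(1) by auto
qed

lemma flt_split: "\<lbrakk>flt T (ks @ ls) Y; T \<in> Ob\<rbrakk> \<Longrightarrow> \<exists>X Z. flt T ks X \<and> flt T ls Z \<and> tri X Y Z"
proof (induction ks arbitrary: Y)
  case Nil
  obtain O' where O': "O' \<in> Ob" "e O' = 0" using has_zero by blast
  have "tri O' Y Y" using bip_tri[OF isbip_swap[OF isbip_zero]] flt_ob[OF Nil(2,1)] O' unfolding zero_obj_def by simp
  then show ?case using Nil O' unfolding append.simps flt.simps zero_obj_def by blast
next
  case (Cons k ks)
  then obtain Y' where Y': "tri (sh k T) Y Y'" "flt T (ks @ ls) Y'" by auto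
  obtain X Z where X: "flt T ks X" "flt T ls Z" "tri X Y' Z" using Cons.IH[OF Y'(2) Cons.prems(2)] by blast
  obtain E where E: "tri (sh k T) E X" "tri E Y Z" using octahedron'[OF Y'(1) X(3)] by blast
  then show ?case using X by auto
qed

lemma van_sh_sh:
  assumes "presil T" "n + l > k" shows "van (sh k T) (sh l T) n"
proof -
  have T: "T \<in> Ob" using assms(1) unfolding presil_def by blast
  show ?thesis using assms unfolding van_shift_left[OF T] van_shift_right[OF T] presil_def by simp
qed

text \<open>For l at most k the extension of T[l] by T[k] splits, because Hom(T[l], T[k + 1])
  vanishes; its two factors may then be taken in the other order. So smaller shifts can be moved to
  the bottom of a filtration.\<close>

lemma flt_swap:
  assumes T: "presil T" and "l \<le> k" "flt T (k # l # ks) Y" shows "flt T (l # k # ks) Y"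
proof -
  obtain Y1 Y2 where Y: "tri (sh k T) Y Y1" "tri (sh l T) Y1 Y2" "flt T ks Y2" using assms(3) by auto
  obtain E where E: "tri (sh k T) E (sh l T)" "tri E Y Y2" using octahedron'[OF Y(1,2)] by blast
  have "isbip (sh k T) (sh l T) E" using tri_split[OF E(1) van_sh_sh[OF T]] assms(2) by simp
  then have "tri (sh l T) E (sh k T)" using bip_tri isbip_swap by blast
  then obtain C where "tri (sh l T) Y C" "tri (sh k T) C Y2" using octahedron[OF _ E(2)] by blast
  then show ?thesis using Y(3) by auto
qed

lemma flt_move: "\<lbrakk>presil T; \<forall>a\<in>set as. a \<le> k; flt T (k # as @ bs) Y\<rbrakk> \<Longrightarrow> flt T (as @ k # bs) Y"
proof (induction as arbitrary: Y)
  case (Cons a as)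
  have "flt T (a # k # as @ bs) Y" using flt_swap[OF Cons.prems(1)] Cons.prems(2,3) by simp
  then obtain Y' where "tri (sh a T) Y Y'" "flt T (k # as @ bs) Y'" by auto
  then show ?case using Cons.IH[OF Cons.prems(1)] Cons.prems(2) by auto
qed simp

lemma flt_partition:
  "\<lbrakk>presil T; flt T ks Y\<rbrakk> \<Longrightarrow> flt T (filter (\<lambda>k. k \<le> n) ks @ filter (\<lambda>k. \<not> k \<le> n) ks) Y"
proof (induction ks arbitrary: Y)
  case (Cons k ks)
  then obtain Y' where "tri (sh k T) Y Y'" "flt T ks Y'" by auto
  then have Y: "flt T (k # filter (\<lambda>k. k \<le> n) ks @ filter (\<lambda>k. \<not> k \<le> n) ks) Y" using Cons by auto
  show ?case
  proof (cases "k \<le> n")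
    case False
    then show ?thesis using flt_move[OF Cons.prems(1) _ Y] by auto
  qed (use Y in simp)
qed simp

lemma flt_van_right: "\<lbrakk>flt T ks Y; \<And>k. k \<in> set ks \<Longrightarrow> van W (sh k T) n\<rbrakk> \<Longrightarrow> van W Y n"
proof (induction ks arbitrary: Y)
  case Nil
  then show ?case using van_zero by simp
next
  case (Cons k ks)
  then obtain Y' where Y: "tri (sh k T) Y Y'" "flt T ks Y'" by auto
  show ?case by (rule tri_van(1)[OF Y(1)]) (use Cons Y in auto)
qed

lemma flt_van_left: "\<lbrakk>flt T ks Y; \<And>k. k \<in> set ks \<Longrightarrow> van (sh k T) W n\<rbrakk> \<Longrightarrow> van Y W n"
proof (induction ks arbitrary: Y)
  case Nil
  then show ?case using van_zero by simp
next
  case (Cons k ks)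
  then obtain Y' where Y: "tri (sh k T) Y Y'" "flt T ks Y'" by auto
  show ?case by (rule tri_van(4)[OF Y(1)]) (use Cons Y in auto)
qed

lemma flt_zero_shifts:
  "\<lbrakk>presil T; flt T ks Y; \<forall>k\<in>set ks. k = 0\<rbrakk> \<Longrightarrow> dsum (replicate (length ks) T) Y"
proof (induction ks arbitrary: Y)
  case (Cons k ks)
  have T: "T \<in> Ob" using Cons.prems(1) unfolding presil_def by blast
  obtain Y' where Y: "tri (sh 0 T) Y Y'" "flt T ks Y'" using Cons.prems by auto
  have "van Y' (sh 0 T) 1"
    by (rule flt_van_left[OF Y(2)], rule van_sh_sh[OF Cons.prems(1)]) (use Cons.prems(3) in auto)
  then have "isbip T Y' Y" using tri_split[OF Y(1)] isbip_iso_left sh_0[OF T] by blast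
  then show ?case using Cons.IH[OF Cons.prems(1) Y(2)] Cons.prems(3) by auto
qed simp

lemma flt_shift: "\<lbrakk>T \<in> Ob; flt T ks Y\<rbrakk> \<Longrightarrow> flt T (map ((+) k) ks) (sh k Y)"
proof (induction ks arbitrary: Y)
  case Nil
  have "dsum [] Y" using Nil by simp
  then have "dsum [] (sh k Y)" using dsum_sh[of "[]" Y k] by simp
  then show ?case by simp
next
  case (Cons l ks)
  then obtain Y' where Y: "tri (sh l T) Y Y'" "flt T ks Y'" by auto
  have "tri (sh (k + l) T) (sh k Y) (sh k Y')" using tri_iso1[OF tri_shift[OF Y(1)] sh_sh[OF Cons.prems(1)]] .
  then show ?case using Cons.IH[OF Cons.prems(1) Y(2)] by auto
qed

lemma retract_sh: assumes "retract X Y" shows "retract (sh k X) (sh k Y)"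
proof -
  obtain f g where f: "f \<in> H X Y" "g \<in> H Y X" "g * f = e X" using assms unfolding retract_def by blast
  have ob: "X \<in> Ob" "Y \<in> Ob" using G_ob f by auto
  obtain a b where ab: "a \<in> G X (sh k X) (- k)" "b \<in> G (sh k X) X k" "b * a = e X" "a * b = e (sh k X)"
    using has_shift[OF ob(1)] by blast
  obtain c d where cd: "c \<in> G Y (sh k Y) (- k)" "d \<in> G (sh k Y) Y k" "d * c = e Y" "c * d = e (sh k Y)"
    using has_shift[OF ob(2)] by blast
  have "c * f * b \<in> H (sh k X) (sh k Y)" using mult_in[OF mult_in[OF cd(1) f(1)] ab(2)] by simp
  moreover have "a * g * d \<in> H (sh k Y) (sh k X)" using mult_in[OF mult_in[OF ab(1) f(2)] cd(2)] by simp
  moreover have "a * g * d * (c * f * b) = e (sh k X)"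
    by (simp add: mult.assoc cd(3)[THEN assoc_rule] mem_simps[OF f(1)] f(3)[THEN assoc_rule] e_left[OF ab(2)] ab(4))
  ultimately show ?thesis unfolding retract_def by blast
qed

text \<open>An endomorphism of a triangle that is the identity at two vertices is unipotent at the third.\<close>

lemma retract_cone:
  assumes t: "tr X1 X2 Z f j p" and a: "a1 \<in> H X1 Y1" "b1 \<in> H Y1 X1" "b1 * a1 = e X1"
    and c: "a2 \<in> H X2 Y2" "b2 \<in> H Y2 X2" "b2 * a2 = e X2"
    and t': "tr Y1 Y2 W (a2 * f * b1) j' p'"
  shows "retract Z W"
proof -
  note m = trD[OF t] tr_zero[OF t]
  have ob: "Z \<in> Ob" using tr_ob[OF t] by auto
  have 1: "a2 * f = a2 * f * b1 * a1" using a(3) by (simp add: mult.assoc e_right[OF m(1)])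
  obtain u where u: "u \<in> H Z W" "u * j = j' * a2" "p' * u = a1 * p"
    using tr_morphism[OF t t' a(1) c(1) 1] by blast
  have 2: "b2 * (a2 * f * b1) = f * b1" using c(3)[THEN assoc_rule] by (simp add: mult.assoc mem_simps[OF m(1)])
  obtain v where v: "v \<in> H W Z" "v * j' = j * b2" "p * v = b1 * p'"
    using tr_morphism[OF t' t a(2) c(2) 2] by blast
  let ?n = "v * u - e Z"
  have n: "?n \<in> H Z Z" using u v e_in[OF ob] by (blast intro: mult0 diff_in)
  have "v * u * j = v * j' * a2" using u(2) by (simp add: mult.assoc)
  also have "\<dots> = j" using v(2) c(3) by (simp add: mult.assoc e_right[OF m(2)])
  finally have "?n * j = 0" by (simp add: left_diff_distrib e_left[OF m(2)])
  then obtain k where k: "?n = k * p" using con_Z[OF t n] by blast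
  have "p * (v * u) = b1 * a1 * p" using u(3) v(3)[THEN assoc_rule] by (simp add: mult.assoc)
  then have "p * ?n = 0" using a(3) by (simp add: right_diff_distrib e_left[OF m(3)] e_right[OF m(3)])
  then have "?n * ?n = 0" by (metis k mult.assoc mult_zero_right)
  \<comment> \<open>The inverse of \<open>e Z + ?n\<close> is \<open>e Z - ?n\<close>, as the square
    of \<open>?n\<close> is zero.\<close>
  then have "(e Z + e Z - v * u) * (v * u) = e Z"
    using mem_simps[OF e_in[OF ob]] mem_simps[OF mult0[OF v(1) u(1)]] by (simp add: algebra_simps)
  then have "((e Z + e Z - v * u) * v) * u = e Z" by (simp add: mult.assoc)
  moreover have "(e Z + e Z - v * u) * v \<in> H W Z" using u v e_in[OF ob] by (blast intro: mult0 diff_in add_in)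
  ultimately show ?thesis using u(1) unfolding retract_def by blast
qed

text \<open>The retracts of filtered objects form a thick class containing T. Closure under cones is
  the delicate point: an arrow between retracts is extended to the filtered objects, whose cone is
  again filtered, and \<open>retract_cone\<close> compares the cones.\<close>

lemma generates_filtration:
  assumes T: "T \<in> Ob" "generates T" and X: "X \<in> Ob"
  obtains ks Y where "flt T ks Y" "retract X Y"
proof -
  define R where "R = {X \<in> Ob. \<exists>ks Y. flt T ks Y \<and> retract X Y}"
  have "thk R"
    unfolding thk_def
  proof (intro conjI ballI allI impI)
    show "R \<subseteq> Ob" unfolding R_def by blast
    obtain O' where O': "O' \<in> Ob" "e O' = 0" using has_zero by blast
    have "tri (sh 0 T) T O'"
      using bip_tri[OF isbip_iso_left[OF isbip_zero[OF T(1)] iso_sym[OF sh_0[OF T(1)]]]] O' unfolding zero_obj_def by blast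
    then have "flt T [0] T" using O' unfolding flt.simps zero_obj_def by blast
    moreover have "retract T T" using iso_retract[OF iso_refl[OF T(1)]] .
    ultimately have TR: "T \<in> R" unfolding R_def using T by blast
    then show "R \<noteq> {}" by blast
    { fix X Y assume X: "X \<in> R" and "iso X Y"
      then have "retract Y X" "Y \<in> Ob" using iso_retract[OF iso_sym] iso_ob by auto
      then show "Y \<in> R" using X retract_trans[of Y X] unfolding R_def by blast }
    { fix X k assume X: "X \<in> R"
      then obtain ks Y where "X \<in> Ob" "flt T ks Y" "retract X Y" unfolding R_def by blast
      then show "sh k X \<in> R" using flt_shift[OF T(1)] retract_sh sh_in unfolding R_def by blast }
    { fix X Y W assume X: "X \<in> R" and "isbip Y W X"
      then have "retract Y X" "Y \<in> Ob" using isbip_retract(1) isbip_ob by auto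
      then show "Y \<in> R" using X retract_trans[of Y X] unfolding R_def by blast }
    { fix X1 X2 Z f j p assume X: "X1 \<in> R" "X2 \<in> R" and t: "tr X1 X2 Z f j p"
      obtain ks Y1 ls Y2 where Y: "flt T ks Y1" "retract X1 Y1" "flt T ls Y2" "retract X2 Y2"
        using X unfolding R_def by blast
      obtain a1 b1 where a: "a1 \<in> H X1 Y1" "b1 \<in> H Y1 X1" "b1 * a1 = e X1" using Y(2) unfolding retract_def by blast
      obtain a2 b2 where c: "a2 \<in> H X2 Y2" "b2 \<in> H Y2 X2" "b2 * a2 = e X2" using Y(4) unfolding retract_def by blast
      obtain W j' p' where t': "tr Y1 Y2 W (a2 * f * b1) j' p'"
        using tr_exists[OF mult0[OF mult0[OF c(1) trD(1)[OF t]] a(2)]] by blast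
      have "flt T (ls @ map ((+) 1) ks) W"
        by (rule flt_append[OF Y(3) flt_shift[OF T(1) Y(1)] tri_rotate[OF triI[OF t']]])
      then show "Z \<in> R" using retract_cone[OF t a c t'] tr_ob[OF t] unfolding R_def by blast }
  qed
  moreover have "T \<in> R"
  proof -
    obtain O' where O': "O' \<in> Ob" "e O' = 0" using has_zero by blast
    have "tri (sh 0 T) T O'"
      using bip_tri[OF isbip_iso_left[OF isbip_zero[OF T(1)] iso_sym[OF sh_0[OF T(1)]]]] O' unfolding zero_obj_def by blast
    then have "flt T [0] T" using O' unfolding flt.simps zero_obj_def by blast
    then show ?thesis unfolding R_def using T(1) iso_retract[OF iso_refl[OF T(1)]] by blast
  qed
  ultimately have "R = Ob" using T(2) unfolding generates_def by blast
  then show ?thesis using X that unfolding R_def by blast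
qed

text \<open>X is a retract of a filtered Y, whose filtration is sorted so that shifts at most 0 form
  the lower part L and positive shifts the upper part R. Since X has no nonzero map to R, it is a
  retract of L already. A second sorting separates the negative shifts, collected in L', from the
  copies of T itself, which add up to T0.\<close>

lemma approximation_data:
  assumes T: "presil T" "generates T" and X: "X \<in> Ob" "\<And>n. n > 0 \<Longrightarrow> van X T n"
  obtains L' L T0 n f t p a b where "tr L' L T0 f t p" "dsum (replicate n T) T0"
    "\<And>W. (\<And>k. k < 0 \<Longrightarrow> van (sh k T) W 0) \<Longrightarrow> van L' W 0"
    "a \<in> H X L" "b \<in> H L X" "b * a = e X"
proof -
  have TO: "T \<in> Ob" using T(1) unfolding presil_def by blast
  obtain ks Y where Y: "flt T ks Y" "retract X Y" using generates_filtration[OF TO T(2) X(1)] .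
  let ?ks = "filter (\<lambda>k. k \<le> 0) ks" and ?ls = "filter (\<lambda>k. \<not> k \<le> 0) ks"
  obtain L R where L: "flt T ?ks L" "flt T ?ls R" "tri L Y R"
    using flt_split[OF flt_partition[OF T(1) Y(1)] TO] by blast
  let ?ms = "filter (\<lambda>k. k \<le> - 1) ?ks" and ?ns = "filter (\<lambda>k. \<not> k \<le> - 1) ?ks"
  obtain L' T0 where L': "flt T ?ms L'" "flt T ?ns T0" "tri L' L T0"
    using flt_split[OF flt_partition[OF T(1) L(1)] TO] by blast
  obtain f t p T0' where t: "tr L' L T0' f t p" "iso T0' T0" using L'(3) unfolding tri_def by blast
  have T0: "dsum (replicate (length ?ns) T) T0'"
    using dsum_iso[OF flt_zero_shifts[OF T(1) L'(2)] iso_sym[OF t(2)]] by fastforce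
  have vR: "van X R 0"
    by (rule flt_van_right[OF L(2)]) (use X(2) van_shift_right[OF TO] in auto)
  obtain a b where ab: "a \<in> H X Y" "b \<in> H Y X" "b * a = e X" using Y(2) unfolding retract_def by blast
  obtain g h q R' where g: "tr L Y R' g h q" "iso R' R" using L(3) unfolding tri_def by blast
  have "h * a = 0" using vanD[OF van_iso_right[OF vR g(2)] mult0[OF trD(2)[OF g(1)] ab(1)]] .
  then obtain a' where a': "a' \<in> H X L" "a = g * a'" using cov_Y[OF g(1) ab(1)] by blast
  have "b * g \<in> H L X" "b * g * a' = e X" using ab a' trD(1)[OF g(1)] mult0 by (auto simp: mult.assoc)
  moreover have "van L' W 0" if "\<And>k. k < 0 \<Longrightarrow> van (sh k T) W 0" for W
    by (rule flt_van_left[OF L'(1)]) (use that in auto)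
  ultimately show ?thesis using that[OF t(1) T0 _ a'(1)] by blast
qed

text \<open>The retraction b from L to X vanishes on L', because X receives no maps from negative
  shifts of T. So b factors through T0 and X is a retract of a sum of copies of T.\<close>

lemma silting_maximal:
  assumes T: "presil T" "generates T" and Ts: "dec Ts T"
    and X: "X \<in> Ob" "\<And>n. n > 0 \<Longrightarrow> van X T n" "\<And>n. n > 0 \<Longrightarrow> van T X n"
  shows "X \<in> addc T"
proof -
  have TO: "T \<in> Ob" using T(1) unfolding presil_def by blast
  obtain L' L T0 n f t p a b where L: "tr L' L T0 f t p" "dsum (replicate n T) T0"
    "\<And>W. (\<And>k. k < 0 \<Longrightarrow> van (sh k T) W 0) \<Longrightarrow> van L' W 0"
    "a \<in> H X L" "b \<in> H L X" "b * a = e X"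
    using approximation_data[OF T X(1,2)] by metis
  have "van L' X 0" by (rule L(3)) (use X(3) van_shift_left[OF TO] in simp)
  then have "b * f = 0" using vanD mult0[OF L(5) trD(1)[OF L(1)]] by blast
  then obtain b' where b': "b' \<in> H T0 X" "b = b' * t" using con_Y[OF L(1,5)] by blast
  have "t * a \<in> H X T0" using mult0[OF trD(2)[OF L(1)] L(4)] .
  moreover have "b' * (t * a) = e X" using L(6) b'(2) by (simp add: mult.assoc)
  ultimately have r: "retract X T0" using b'(1) unfolding retract_def by blast
  have "addl Ts T" unfolding addl_def using Ts dsum_ob[of Ts T] iso_refl unfolding dec_def by blast
  then have "addl Ts T0" by (intro addl_dsum[OF L(2)]) auto
  then show ?thesis using addl_retract[OF _ _ r] addc_iff Ts unfolding dec_def by blast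
qed

end

section \<open>Closure properties of \<open>addc\<close> and indecomposable objects\<close>

context graded_category
begin

lemma dsum_retract: "\<lbrakk>dsum Xs X; x \<in> set Xs\<rbrakk> \<Longrightarrow> retract x X"
proof (induction Xs arbitrary: X)
  case (Cons a Xs)
  then obtain W where W: "dsum Xs W" "isbip a W X" by auto
  show ?case
  proof (cases "x = a")
    case True
    then show ?thesis using isbip_retract(1)[OF W(2)] by simp
  next
    case False
    then show ?thesis using Cons.IH[OF W(1)] Cons.prems(2) isbip_retract(2)[OF W(2)] retract_trans by auto
  qed
qed simp

lemma addc_ob: "Y \<in> addc X \<Longrightarrow> Y \<in> Ob"
  unfolding addc_def using isbip_ob by blast

lemma addc_self: "X \<in> Ob \<Longrightarrow> X \<in> addc X"
proof -
  assume X: "X \<in> Ob"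
  obtain O' where "O' \<in> Ob" "e O' = 0" using has_zero by blast
  then have "isbip X O' X" using isbip_zero[OF X] unfolding zero_obj_def by blast
  moreover have "dsum (replicate 1 X) X" using dsum_single[OF X] by simp
  ultimately show ?thesis unfolding addc_def by blast
qed

lemma addc_summand: assumes "Y \<in> addc X" "isbip A B Y" shows "A \<in> addc X"
proof -
  obtain n Z W where Z: "dsum (replicate n X) Z" "isbip Y W Z" using assms(1) unfolding addc_def by blast
  obtain V where "isbip A V Z" using isbip_assoc_ex[OF assms(2) Z(2)] by blast
  then show ?thesis using Z(1) unfolding addc_def by blast
qed

lemma addc_iso: assumes "Y \<in> addc X" "iso Y Y'" shows "Y' \<in> addc X"
proof -
  obtain n Z W where Z: "dsum (replicate n X) Z" "isbip Y W Z" using assms(1) unfolding addc_def by blast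
  then show ?thesis using isbip_iso_left[OF Z(2) assms(2)] unfolding addc_def by blast
qed

lemma addc_bip: assumes "A \<in> addc X" "B \<in> addc X" "isbip A B Y" shows "Y \<in> addc X"
proof -
  obtain n Z W where Z: "dsum (replicate n X) Z" "isbip A W Z" using assms(1) unfolding addc_def by blast
  obtain n' Z' W' where Z': "dsum (replicate n' X) Z'" "isbip B W' Z'" using assms(2) unfolding addc_def by blast
  obtain V where V: "isbip Z Z' V" using isbip_exists isbip_ob[OF Z(2)] isbip_ob[OF Z'(2)] by blast
  have "dsum (replicate (n + n') X) V" using dsum_append[OF Z(1) Z'(1) V] by (simp add: replicate_add)
  then show ?thesis using isbip_retracts[OF Z(2) Z'(2) assms(3) V] unfolding addc_def by blast
qed

lemma addc_zero: assumes "X \<in> Ob" "zero_obj Y" shows "Y \<in> addc X"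
proof -
  have "dsum (replicate 0 X) Y" using assms(2) by simp
  moreover have "isbip Y Y Y" using isbip_zero[OF _ assms(2)] assms(2) unfolding zero_obj_def by blast
  ultimately have "dsum (replicate 0 X) Y" "isbip Y Y Y" by auto
  then show ?thesis unfolding addc_def by blast
qed

lemma addc_dsum: "\<lbrakk>X \<in> Ob; dsum Ys Y; \<And>y. y \<in> set Ys \<Longrightarrow> y \<in> addc X\<rbrakk> \<Longrightarrow> Y \<in> addc X"
proof (induction Ys arbitrary: Y)
  case Nil
  then show ?case using addc_zero by simp
next
  case (Cons a Ys)
  then obtain W where W: "dsum Ys W" "isbip a W Y" by auto
  show ?case by (rule addc_bip[OF _ Cons.IH[OF _ W(1)] W(2)]) (use Cons.prems in auto)
qed

lemma addc_mono: assumes "X \<in> addc Y" "Y \<in> Ob" shows "addc X \<subseteq> addc Y"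
proof
  fix A assume "A \<in> addc X"
  then obtain n Z W where Z: "dsum (replicate n X) Z" "isbip A W Z" unfolding addc_def by blast
  have "Z \<in> addc Y" by (rule addc_dsum[OF assms(2) Z(1)]) (use assms(1) in auto)
  then show "A \<in> addc Y" using addc_summand[OF _ Z(2)] by blast
qed

lemma addc_addl: "\<lbrakk>X \<in> Ob; addl Ls Y; \<And>l. l \<in> set Ls \<Longrightarrow> l \<in> addc X\<rbrakk> \<Longrightarrow> Y \<in> addc X"
  by (erule addl_list_obtain, erule addc_dsum[rotated]) auto

lemma dsum_single_iso: assumes "dsum [y] Y" shows "iso y Y"
proof -
  obtain W where "zero_obj W" "isbip y W Y" using assms by auto
  then show ?thesis using isbip_zero_iso by blast
qed

lemma loc_addl:
  assumes "loc N" "addl Ls N" "\<forall>L\<in>set Ls. loc L"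
  obtains L where "L \<in> set Ls" "iso N L"
proof -
  obtain Ys where Ys: "dec Ys N" "set Ys \<subseteq> set Ls" using addl_dec[OF assms(2,3)] .
  have "dsum [N] N" using dsum_single assms(1) unfolding loc_def by blast
  then have "length Ys = 1" using Krull_Schmidt_unique(2)[of "[N]" N Ys] Ys(1) assms(1) unfolding dec_def by simp
  then obtain y where "Ys = [y]" by (auto simp: length_Suc_conv)
  then show ?thesis using that[of y] Ys dsum_single_iso iso_sym unfolding dec_def by auto
qed

definition indec :: "'o \<Rightarrow> bool" where
  "indec X \<longleftrightarrow> X \<in> Ob \<and> \<not> zero_obj X \<and> (\<forall>Y Z. isbip Y Z X \<longrightarrow> zero_obj Y \<or> zero_obj Z)"

lemma idempotent_invertible: assumes "invertible X u" "u \<in> H X X" "u * u = u" shows "u = e X"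
proof -
  obtain b where b: "b \<in> H X X" "b * u = e X" using assms(1) unfolding invertible_def by blast
  have "e X = b * (u * u)" using b(2) assms(3) by simp
  also have "\<dots> = e X * u" using b(2) by (simp add: mult.assoc[symmetric])
  finally show ?thesis using e_left[OF assms(2)] by simp
qed

lemma loc_indec: assumes "loc X" shows "indec X"
proof -
  have "zero_obj Y \<or> zero_obj Z" if YZ: "isbip Y Z X" for Y Z
  proof -
    obtain i j p q where b: "bip Y Z X i j p q" using YZ unfolding isbip_def by blast
    note m = bip_in[OF b]
    have in': "i * p \<in> H X X" "j * q \<in> H X X" using m mult0 by auto
    have jq: "j * q = e X - i * p" by (rule bip_sum(1)[OF b])
    have id: "i * p * (i * p) = i * p" "j * q * (j * q) = j * q" by (simp_all add: mult.assoc bip_simps[OF b])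
    consider "invertible X (i * p)" | "invertible X (j * q)"
      using assms in'(1) unfolding jq loc_def by blast
    then show ?thesis
    proof cases
      case 1
      then have "j * q = 0" using idempotent_invertible[OF 1 in'(1) id(1)] jq by simp
      then have "q * (j * q) * j = 0" by simp
      then have "e Z = 0" by (simp add: mult.assoc bip_simps[OF b])
      then show ?thesis using bip_ob[OF b] unfolding zero_obj_def by blast
    next
      case 2
      then have "i * p = 0" using idempotent_invertible[OF 2 in'(2) id(2)] jq by simp
      then have "p * (i * p) * i = 0" by simp
      then have "e Y = 0" by (simp add: mult.assoc bip_simps[OF b])
      then show ?thesis using bip_ob[OF b] unfolding zero_obj_def by blast
    qed
  qed
  then show ?thesis using assms unfolding indec_def loc_def zero_obj_def by blast
qed

lemma representatives:
  "set Xs \<subseteq> Ob \<Longrightarrow> \<exists>Ns. set Ns \<subseteq> set Xs \<and> (\<forall>x\<in>set Xs. \<exists>n\<in>set Ns. iso x n) \<and>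
     (\<forall>n\<in>set Ns. \<forall>n'\<in>set Ns. iso n n' \<longrightarrow> n = n')"
proof (induction Xs)
  case (Cons x Xs)
  then obtain Ns where Ns: "set Ns \<subseteq> set Xs" "\<forall>x\<in>set Xs. \<exists>n\<in>set Ns. iso x n"
    "\<forall>n\<in>set Ns. \<forall>n'\<in>set Ns. iso n n' \<longrightarrow> n = n'" by auto
  show ?case
  proof (cases "\<exists>n\<in>set Ns. iso x n")
    case True
    then show ?thesis using Ns by (intro exI[of _ Ns]) auto
  next
    case False
    have "iso x x" using Cons.prems iso_refl by auto
    moreover have "\<not> iso n x" if "n \<in> set Ns" for n using False that iso_sym by blast
    ultimately show ?thesis using Ns False by (intro exI[of _ "x # Ns"]) auto
  qed
qed simp

end

section \<open>Thick classes, approximations and mutation\<close>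

context triangulated
begin

definition silt :: "'a \<Rightarrow> bool" where "silt T \<longleftrightarrow> presil T \<and> generates T"

lemma thk_tri: assumes "thk U" "tri X Y Z" "X \<in> U" "Y \<in> U" shows "Z \<in> U"
proof -
  obtain f j p Z' where t: "tr X Y Z' f j p" "iso Z' Z" using assms(2) unfolding tri_def by blast
  have "Z' \<in> U" using t(1) assms(1,3,4) unfolding thk_def by blast
  then show ?thesis using t(2) assms(1) unfolding thk_def by blast
qed

lemma thk_sh: "thk U \<Longrightarrow> X \<in> U \<Longrightarrow> sh k X \<in> U"
  unfolding thk_def by blast

lemma thk_extension: assumes U: "thk U" "tri X Y Z" "X \<in> U" "Z \<in> U" shows "Y \<in> U"
  using thk_tri[OF U(1) tri_unrotate[OF U(2)]] thk_sh[OF U(1)] U by blast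

lemma thk_first: assumes U: "thk U" "tri X Y Z" "Y \<in> U" "Z \<in> U" shows "X \<in> U"
  using thk_extension[OF U(1) tri_unrotate[OF U(2)]] thk_sh[OF U(1)] U by blast

lemma thk_bip: "\<lbrakk>thk U; isbip X Y Z; X \<in> U; Y \<in> U\<rbrakk> \<Longrightarrow> Z \<in> U"
  using thk_extension[OF _ bip_tri] by blast

lemma thk_summand: "\<lbrakk>thk U; isbip X Y Z; Z \<in> U\<rbrakk> \<Longrightarrow> X \<in> U"
  unfolding thk_def by blast

lemma thk_zero: assumes "thk U" "zero_obj Z" shows "Z \<in> U"
proof -
  obtain X where X: "X \<in> U" "X \<in> Ob" using assms(1) unfolding thk_def by blast
  show ?thesis using thk_summand[OF assms(1) isbip_swap[OF isbip_zero[OF X(2) assms(2)]] X(1)] .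
qed

lemma thk_dsum: "\<lbrakk>thk U; dsum Xs X; set Xs \<subseteq> U\<rbrakk> \<Longrightarrow> X \<in> U"
proof (induction Xs arbitrary: X)
  case Nil
  then show ?case using thk_zero by simp
next
  case (Cons a Xs)
  then obtain W where "dsum Xs W" "isbip a W X" by auto
  then show ?case using Cons thk_bip by auto
qed

lemma thk_addc: assumes "thk U" "X \<in> U" "Y \<in> addc X" shows "Y \<in> U"
proof -
  obtain n Z W where Z: "dsum (replicate n X) Z" "isbip Y W Z" using assms(3) unfolding addc_def by blast
  have "Z \<in> U" by (rule thk_dsum[OF assms(1) Z(1)]) (use assms(2) in auto)
  then show ?thesis using thk_summand[OF assms(1) Z(2)] by blast
qed

text \<open>If f has a section \<alpha>, then j = 0 and the fibre of f, the cone shifted by -1, is a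
  complement of X in Y. The projection onto it is the h with e Y - \<alpha> * f = p * h.\<close>

lemma split_epi:
  assumes t: "tr Y X A f j p" and \<alpha>: "\<alpha> \<in> H X Y" "f * \<alpha> = e X"
  shows "isbip X (sh (- 1) A) Y"
proof -
  note m = trD[OF t] tr_zero[OF t]
  have ob: "X \<in> Ob" "Y \<in> Ob" "A \<in> Ob" using tr_ob[OF t] by auto
  have "j = j * (f * \<alpha>)" using \<alpha>(2) e_right[OF m(2)] by simp
  also have "\<dots> = j * f * \<alpha>" by (simp add: mult.assoc)
  finally have j: "j = 0" using m(4) by simp
  have 1: "e Y - \<alpha> * f \<in> H Y Y" using \<alpha>(1) m(1) e_in[OF ob(2)] by (blast intro: mult0 diff_in)
  have "f * (e Y - \<alpha> * f) = 0"
    by (simp add: right_diff_distrib mult.assoc[symmetric] \<alpha>(2) e_left[OF m(1)] e_right[OF m(1)])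
  then obtain h where h: "h \<in> G Y A (- 1)" "e Y - \<alpha> * f = p * h" using cov_X[OF t 1] by blast
  have inj: "x = 0" if "x \<in> G W A n" "p * x = 0" for x W n using cov_Z'[OF t that] j by auto
  have "p * (h * p) = (e Y - \<alpha> * f) * p" using h(2) by (simp add: mult.assoc)
  also have "\<dots> = p" using m(4) by (simp add: left_diff_distrib mult.assoc e_left[OF m(3)])
  finally have "p * (h * p - e A) = 0" by (simp add: right_diff_distrib e_right[OF m(3)])
  moreover have "h * p - e A \<in> H A A" using mult_in[OF h(1) m(3)] e_in[OF ob(3)] by (auto intro: diff_in)
  ultimately have hp: "h * p = e A" using inj by fastforce
  have "p * (h * \<alpha>) = (e Y - \<alpha> * f) * \<alpha>" using h(2) by (simp add: mult.assoc)
  also have "\<dots> = 0" by (simp add: left_diff_distrib mult.assoc \<alpha>(2) e_left[OF \<alpha>(1)] e_right[OF \<alpha>(1)])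
  finally have ha: "h * \<alpha> = 0" using inj mult_in[OF h(1) \<alpha>(1)] by blast
  obtain a b where ab: "a \<in> G A (sh (- 1) A) 1" "b \<in> G (sh (- 1) A) A (- 1)" "b * a = e A" "a * b = e (sh (- 1) A)"
    using has_shift[OF ob(3), of "- 1"] by auto
  have "bip X (sh (- 1) A) Y \<alpha> (p * b) f (a * h)"
    unfolding bip_def
  proof (intro conjI \<alpha> m(1))
    show "p * b \<in> H (sh (- 1) A) Y" "a * h \<in> H Y (sh (- 1) A)" using mult_in[OF m(3) ab(2)] mult_in[OF ab(1) h(1)] by auto
    show "a * h * (p * b) = e (sh (- 1) A)"
      by (simp add: mult.assoc hp[THEN assoc_rule] e_left[OF ab(2)] ab(4))
    show "a * h * \<alpha> = 0" by (simp add: mult.assoc ha)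
    show "f * (p * b) = 0" using m(4) by (simp add: mult.assoc[symmetric])
    show "\<alpha> * f + p * b * (a * h) = e Y"
      using h(2) by (simp add: mult.assoc ab(3)[THEN assoc_rule] e_left[OF h(1)] algebra_simps)
  qed
  then show ?thesis unfolding isbip_def by blast
qed

definition right_app :: "'a set \<Rightarrow> 'a \<Rightarrow> 'a \<Rightarrow> 'b \<Rightarrow> bool" where
  "right_app U Q X f \<longleftrightarrow> Q \<in> U \<and> f \<in> H Q X \<and> (\<forall>W\<in>U. \<forall>h\<in>H W X. \<exists>g\<in>H W Q. h = f * g)"

definition left_app :: "'a set \<Rightarrow> 'a \<Rightarrow> 'a \<Rightarrow> 'b \<Rightarrow> bool" where
  "left_app U X Q f \<longleftrightarrow> Q \<in> U \<and> f \<in> H X Q \<and> (\<forall>W\<in>U. \<forall>h\<in>H X W. \<exists>g\<in>H Q W. h = g * f)"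

lemma left_appI:
  assumes "tr X Q Z f j p" "Q \<in> U" "\<And>W. W \<in> U \<Longrightarrow> van Z W 1" shows "left_app U X Q f"
  unfolding left_app_def
proof (intro conjI ballI)
  note m = trD[OF assms(1)]
  show "f \<in> H X Q" by fact
  fix W h assume "W \<in> U" and h: "h \<in> H X W"
  then have "h * p = 0" using vanD[OF assms(3)] mult_in[OF h m(3)] by simp
  then show "\<exists>g\<in>H Q W. h = g * f" using con_X[OF assms(1) h] by blast
qed fact

lemma right_appI:
  assumes "tr Q X Z f j p" "Q \<in> U" "\<And>W. W \<in> U \<Longrightarrow> van W Z 0" shows "right_app U Q X f"
  unfolding right_app_def
proof (intro conjI ballI)
  note m = trD[OF assms(1)]
  show "f \<in> H Q X" by fact
  fix W h assume "W \<in> U" and h: "h \<in> H W X"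
  then have "j * h = 0" using vanD[OF assms(3)] mult0[OF m(2) h] by simp
  then show "\<exists>g\<in>H W Q. h = f * g" using cov_Y[OF assms(1) h] by blast
qed fact

definition mutation :: "'a \<Rightarrow> 'a \<Rightarrow> bool" where
  "mutation S T \<longleftrightarrow> (\<exists>X Y U X' f Z V j p. isbip X Y U \<and> silt U \<and>
     (\<forall>W\<in>addc X \<inter> addc Y. zero_obj W) \<and> indec Y \<and> left_app (addc X) Y X' f \<and> tr Y X' Z f j p \<and>
     isbip X Z V \<and> addc S = addc U \<and> addc T = addc V)"

end

section \<open>Two-term objects in a triangulated category\<close>

text \<open>The interface through which the main argument sees complexes: L is the ring placed in
  degree 0, \<open>lit\<close> singles out complexes that are literally two-term, and
  \<open>st\<close> those concentrated in degree 0. As \<open>lit\<close> need not be closed under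
  isomorphism, \<open>two\<close> is introduced as its closure.\<close>

locale two_term = triangulated +
  fixes L :: 'a and lit st :: "'a \<Rightarrow> bool"
  assumes lit_dec: "lit X \<Longrightarrow> \<exists>Xs. dec Xs X \<and> (\<forall>x\<in>set Xs. lit x)"
    and lit_bip: "\<lbrakk>lit X; lit Y\<rbrakk> \<Longrightarrow> \<exists>Z. lit Z \<and> isbip X Y Z"
    and lit_zero: "\<exists>Z. lit Z \<and> zero_obj Z"
    and lit_van: "\<lbrakk>lit X; lit Y; n \<ge> 2\<rbrakk> \<Longrightarrow> van X Y n"
    and lit_L: "lit L" and st_L: "st L"
    and L_van: "\<lbrakk>lit X; n \<ge> 1\<rbrakk> \<Longrightarrow> van L X n"
    and lit_tri: "lit X \<Longrightarrow> \<exists>M1 M0. st M1 \<and> st M0 \<and> tri M1 M0 X"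
    and tri_lit: "\<lbrakk>st M1; st M0; tri M1 M0 X\<rbrakk> \<Longrightarrow> \<exists>X'. lit X' \<and> iso X' X"
    and st_addc: "st M \<Longrightarrow> M \<in> addc L"
    and st_bip: "\<lbrakk>st M; st N\<rbrakk> \<Longrightarrow> \<exists>K. st K \<and> isbip M N K"
    and L_generates: "generates L"
begin

lemma lit_ob: "lit X \<Longrightarrow> X \<in> Ob"
  using lit_dec dsum_ob unfolding dec_def by blast

definition two :: "'a \<Rightarrow> bool" where "two X \<longleftrightarrow> (\<exists>X'. lit X' \<and> iso X' X)"

lemma lit_two: "lit X \<Longrightarrow> two X"
  unfolding two_def using iso_refl lit_ob by blast

lemma two_bip: assumes "two X" "two Y" "isbip X Y Z" shows "two Z"
proof -
  obtain X' Y' where X: "lit X'" "iso X' X" "lit Y'" "iso Y' Y" using assms unfolding two_def by blast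
  obtain Z' where "lit Z'" "isbip X' Y' Z'" using lit_bip[OF X(1,3)] by blast
  then show ?thesis using isbip_map[OF _ assms(3) X(2,4)] unfolding two_def by blast
qed

lemma two_dsum: "\<lbrakk>dsum Xs X; \<And>x. x \<in> set Xs \<Longrightarrow> two x\<rbrakk> \<Longrightarrow> two X"
proof (induction Xs arbitrary: X)
  case Nil
  then have "zero_obj X" by simp
  then show ?case using lit_zero zero_obj_iso[of _ X] unfolding two_def by blast
next
  case (Cons a Xs)
  then obtain W where W: "dsum Xs W" "isbip a W X" by auto
  show ?case by (rule two_bip[OF _ Cons.IH[OF W(1)] W(2)]) (use Cons.prems in auto)
qed

lemma two_van: assumes "two X" "two Y" "n \<ge> 2" shows "van X Y n"
proof -
  obtain X' Y' where X: "lit X'" "iso X' X" "lit Y'" "iso Y' Y" using assms unfolding two_def by blast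
  show ?thesis
    using van_iso_left[OF van_iso_right[OF lit_van[OF X(1,3) assms(3)] iso_sym[OF X(4)]] iso_sym[OF X(2)]] .
qed

lemma L_two_van: assumes "two X" "n \<ge> 1" shows "van L X n"
proof -
  obtain X' where X: "lit X'" "iso X' X" using assms unfolding two_def by blast
  show ?thesis using van_iso_right[OF L_van[OF X(1) assms(2)] iso_sym[OF X(2)]] .
qed

text \<open>One representative for each isomorphism class of indecomposable summands;
  \<open>card (set Ns)\<close> is |X| by \<open>card_classes\<close>.\<close>

definition reps :: "'a list \<Rightarrow> 'a \<Rightarrow> bool" where
  "reps Ns X \<longleftrightarrow> (\<exists>Xs. dec Xs X \<and> (\<forall>x\<in>set Xs. lit x) \<and> set Ns \<subseteq> set Xs \<and> (\<forall>x\<in>set Xs. \<exists>n\<in>set Ns. iso x n)) \<and>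
     (\<forall>n\<in>set Ns. \<forall>n'\<in>set Ns. iso n n' \<longrightarrow> n = n')"

lemma reps_exists: assumes "lit X" shows "\<exists>Ns. reps Ns X"
proof -
  obtain Xs where Xs: "dec Xs X" "\<forall>x\<in>set Xs. lit x" using lit_dec[OF assms] by blast
  have "set Xs \<subseteq> Ob" using dsum_ob Xs(1) unfolding dec_def by blast
  then obtain Ns where "set Ns \<subseteq> set Xs" "\<forall>x\<in>set Xs. \<exists>n\<in>set Ns. iso x n"
    "\<forall>n\<in>set Ns. \<forall>n'\<in>set Ns. iso n n' \<longrightarrow> n = n'" using representatives[of Xs] by blast
  then have "reps Ns X" unfolding reps_def using Xs by (intro conjI exI[of _ Xs])
  then show ?thesis by blast
qed

lemma repsD:
  assumes "reps Ns X"
  shows "\<forall>N\<in>set Ns. loc N" "N \<in> set Ns \<Longrightarrow> lit N" "N \<in> set Ns \<Longrightarrow> retract N X" "addl Ns X"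
    "\<lbrakk>N \<in> set Ns; N' \<in> set Ns; iso N N'\<rbrakk> \<Longrightarrow> N = N'" "Y \<in> addc X \<longleftrightarrow> addl Ns Y" "X \<in> Ob"
proof -
  obtain Xs where Xs: "dec Xs X" "\<forall>x\<in>set Xs. lit x" "set Ns \<subseteq> set Xs" "\<forall>x\<in>set Xs. \<exists>n\<in>set Ns. iso x n"
    using assms unfolding reps_def by blast
  have d: "dsum Xs X" "\<forall>x\<in>set Xs. loc x" using Xs(1) unfolding dec_def by auto
  show 1: "\<forall>N\<in>set Ns. loc N" "N \<in> set Ns \<Longrightarrow> lit N" "N \<in> set Ns \<Longrightarrow> retract N X"
    using d Xs dsum_retract by auto
  show "addl Ns X" unfolding addl_def using d(1) Xs(4) by blast
  show "\<lbrakk>N \<in> set Ns; N' \<in> set Ns; iso N N'\<rbrakk> \<Longrightarrow> N = N'" using assms unfolding reps_def by blast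
  show "X \<in> Ob" using dsum_ob[OF d(1)] by blast
  have "addl Xs Y \<longleftrightarrow> addl Ns Y"
  proof
    assume "addl Xs Y"
    then show "addl Ns Y"
    proof (rule addl_trans)
      fix x assume "x \<in> set Xs"
      then obtain n where n: "n \<in> set Ns" "iso x n" using Xs(4) by blast
      have "addl Ns n" using addl_member[OF n(1)] iso_ob[OF n(2)] by blast
      then show "addl Ns x" using addl_iso[OF _ iso_sym[OF n(2)]] by blast
    qed
  next
    assume "addl Ns Y"
    then show "addl Xs Y" unfolding addl_def using Xs(3) by blast
  qed
  then show "Y \<in> addc X \<longleftrightarrow> addl Ns Y" using addc_iff[OF d] by blast
qed

lemma reps_addc: "\<lbrakk>reps Ns X; N \<in> set Ns\<rbrakk> \<Longrightarrow> N \<in> addc X"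
  using repsD(6)[of Ns X N] addl_member repsD(2) lit_ob by blast

lemma reps_retract: "\<lbrakk>reps Ns X; Y \<in> addc X; retract Z Y\<rbrakk> \<Longrightarrow> Z \<in> addc X"
  using addl_retract[of Ns Y Z] repsD(1,6)[of Ns X] by blast

lemma addc_two: assumes "lit X" "Y \<in> addc X" shows "two Y"
proof -
  obtain Ns where Ns: "reps Ns X" using reps_exists[OF assms(1)] by blast
  obtain Ys where Ys: "dsum Ys Y" "set Ys \<subseteq> set Ns" using addl_list_obtain repsD(6)[OF Ns] assms(2) by blast
  show ?thesis by (rule two_dsum[OF Ys(1)]) (use Ys(2) repsD(2)[OF Ns] lit_two in blast)
qed

lemma addc_van: "\<lbrakk>van X Y n; A \<in> addc X; B \<in> addc Y\<rbrakk> \<Longrightarrow> van A B n"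
  using van_addc_left[of A X B n] van_addc_right[of B Y X n] by blast

lemma presilD: "presil T \<Longrightarrow> n > 0 \<Longrightarrow> van T T n" "presil T \<Longrightarrow> T \<in> Ob"
  unfolding presil_def by auto

subsection \<open>Two-term silting objects have the same number of summands\<close>

text \<open>The count needs coresolutions of the single summands of L. The pushout E of C and T0
  under Q' is an extension of T1 by T0, hence splits and lies in \<open>addc T\<close>; it is also
  an extension of C' by C, and Hom(C', C[1]) = 0 makes C a summand of it.\<close>

lemma coresolution_summand:
  assumes T: "lit T" "presil T" and t: "tri L T0 T1" "T0 \<in> addc T" "T1 \<in> addc T" and Q: "isbip Q Q' L"
  shows "\<exists>C\<in>addc T. tri Q T0 C"
proof -
  obtain Ts where Ts: "reps Ts T" using reps_exists[OF T(1)] by blast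
  obtain C where C: "tri Q T0 C" "tri Q' C T1" using octahedron[OF bip_tri[OF Q] t(1)] by blast
  obtain C' where C': "tri Q' T0 C'" "tri Q C' T1" using octahedron[OF bip_tri[OF isbip_swap[OF Q]] t(1)] by blast
  obtain E where E: "tri C E C'" "tri T0 E T1" using pushout[OF C(2) C'(1)] by blast
  have QL: "Q \<in> addc L" using addc_summand[OF addc_self Q] lit_ob lit_L by blast
  have 1: "van T T 1" using presilD(1)[OF T(2)] by simp
  have "isbip T0 T1 E" using tri_split[OF E(2) addc_van[OF 1 t(3,2)]] .
  then have "E \<in> addc T" using addc_bip t by blast
  moreover have "van C' C 1"
  proof (rule tri_van(2)[OF C(1)])
    show "van C' T0 1"
      using tri_van(4)[OF C'(2) addc_van[OF L_van[OF T(1), of 1] QL t(2)] addc_van[OF 1 t(3,2)]] by simp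
    show "van C' Q (1 + 1)"
      using tri_van(4)[OF C'(2) addc_van[OF L_van[OF lit_L] QL QL] addc_van[OF lit_van[OF T(1) lit_L] t(3) QL]] by simp
  qed
  then have "isbip C C' E" using tri_split[OF E(1)] by blast
  ultimately have "C \<in> addc T" using addc_summand by blast
  then show ?thesis using C(1) by blast
qed

text \<open>Two applications of \<open>card_le_of_resolutions\<close>. The first resolves summands
  of T by those of L and coresolves summands of L by those of T. The second replaces T by T[-1]: a
  coresolution Q \<rightarrow> C0 \<rightarrow> C1 rotates to the resolution C0[-1] \<rightarrow>
  C1[-1] \<rightarrow> Q, and a resolution M1 \<rightarrow> M0 \<rightarrow> X to the coresolution
  X[-1] \<rightarrow> M1 \<rightarrow> M0. The required vanishing in degree 1 for T[-1] is that in
  degree 2 for T.\<close>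

theorem card_reps_eq:
  assumes T: "lit T" "presil T" and t: "tri L T0 T1" "T0 \<in> addc T" "T1 \<in> addc T"
    and Ts: "reps Ts T" and Qs: "reps Qs L"
  shows "card (set Ts) = card (set Qs)"
proof (rule antisym)
  have TT: "van T T 1" using presilD(1)[OF T(2)] by simp
  have tQ: "Q \<in> set Qs \<Longrightarrow> Q \<in> addc L" for Q using reps_addc[OF Qs] .
  have tT: "X \<in> set Ts \<Longrightarrow> X \<in> addc T" for X using reps_addc[OF Ts] .
  have cores: "\<exists>C0 C1. tri Q C0 C1 \<and> C0 \<in> addc T \<and> C1 \<in> addc T" if Q: "Q \<in> set Qs" for Q
  proof -
    obtain Xs where "dec Xs L" using lit_dec[OF lit_L] by blast
    then obtain Q' where "isbip Q Q' L" using retract_dsum[of Xs L Q] repsD(3)[OF Qs Q] unfolding dec_def by metis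
    then show ?thesis using coresolution_summand[OF T t] t(2) by blast
  qed
  have res: "\<exists>M1 M0. tri M1 M0 X \<and> addl Qs M1 \<and> addl Qs M0" if "lit X" for X
    using lit_tri[OF that] st_addc repsD(6)[OF Qs] by blast
  show "card (set Ts) \<le> card (set Qs)"
  proof (rule card_le_of_resolutions)
    show "\<forall>N\<in>set Ts. loc N" using repsD(1)[OF Ts] .
    show "van N N' 1" if "N \<in> set Ts" "N' \<in> set Ts" for N N' using addc_van[OF TT tT tT] that by blast
    show "van M N 1" if "M \<in> set Qs" "N \<in> set Ts" for M N using addc_van[OF L_van[OF T(1)] tQ tT] that by simp
    show "N = N'" if "N \<in> set Ts" "N' \<in> set Ts" "iso N N'" for N N' using repsD(5)[OF Ts that] .
    show "\<exists>A1 A0. tri A1 A0 N \<and> addl Qs A1 \<and> addl Qs A0" if "N \<in> set Ts" for N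
      using res[OF repsD(2)[OF Ts that]] .
    show "\<exists>B0 B1. tri M B0 B1 \<and> addl Ts B0 \<and> addl Ts B1" if "M \<in> set Qs" for M
      using cores[OF that] repsD(6)[OF Ts] by blast
  qed
  have obT: "X \<in> set Ts \<Longrightarrow> X \<in> Ob" for X using lit_ob repsD(2)[OF Ts] by blast
  have "card (set Qs) \<le> card (set (map (sh (- 1)) Ts))"
  proof (rule card_le_of_resolutions)
    show "\<forall>N\<in>set Qs. loc N" using repsD(1)[OF Qs] .
    show "van N N' 1" if "N \<in> set Qs" "N' \<in> set Qs" for N N' using addc_van[OF L_van[OF lit_L] tQ tQ] that by simp
    show "van M N 1" if M: "M \<in> set (map (sh (- 1)) Ts)" and N: "N \<in> set Qs" for M N
    proof -
      obtain X where X: "X \<in> set Ts" "M = sh (- 1) X" using M by auto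
      have "van X N 2" using addc_van[OF lit_van[OF T(1) lit_L] tT[OF X(1)] tQ[OF N]] by simp
      then show ?thesis using van_shift_left[OF obT[OF X(1)], of "- 1" N 1] X(2) by simp
    qed
    show "N = N'" if "N \<in> set Qs" "N' \<in> set Qs" "iso N N'" for N N' using repsD(5)[OF Qs that] .
    show "\<exists>A1 A0. tri A1 A0 Q \<and> addl (map (sh (- 1)) Ts) A1 \<and> addl (map (sh (- 1)) Ts) A0"
      if Q: "Q \<in> set Qs" for Q
    proof -
      obtain C0 C1 where C: "tri Q C0 C1" "C0 \<in> addc T" "C1 \<in> addc T" using cores[OF Q] by blast
      have sh: "addl (map (sh (- 1)) Ts) (sh (- 1) C)" if "C \<in> addc T" for C
      proof -
        obtain Ys where Ys: "dsum Ys C" "set Ys \<subseteq> set Ts" using addl_list_obtain repsD(6)[OF Ts] \<open>C \<in> addc T\<close> by blast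
        show ?thesis
          unfolding addl_def
          using dsum_sh[OF Ys(1), of "- 1"] Ys(2) iso_refl[OF sh_in[OF obT]] by (intro exI[of _ "map (sh (- 1)) Ys"]) auto
      qed
      show ?thesis using tri_unrotate[OF tri_unrotate[OF C(1)]] sh C by blast
    qed
    show "\<exists>B0 B1. tri M B0 B1 \<and> addl Qs B0 \<and> addl Qs B1" if M: "M \<in> set (map (sh (- 1)) Ts)" for M
    proof -
      obtain X where X: "X \<in> set Ts" "M = sh (- 1) X" using M by auto
      show ?thesis using res[OF repsD(2)[OF Ts X(1)]] tri_unrotate X(2) by blast
    qed
  qed
  also have "\<dots> \<le> card (set Ts)" by (simp add: card_image_le)
  finally show "card (set Qs) \<le> card (set Ts)" .
qed

subsection \<open>Minimal coresolutions\<close>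

text \<open>L is a retract, through a and b, of A with L' \<rightarrow> A \<rightarrow> T0. For k
  from L to T the map k * b vanishes on L', hence factors through t, so k factors through t * a.
  Thus t * a is a left approximation; its cone C is orthogonal to T on both sides in positive
  degrees and lies in \<open>addc T\<close> by maximality.\<close>

lemma coresolution_exists:
  assumes T: "lit T" "silt T"
  shows "\<exists>T0\<in>addc T. \<exists>T1\<in>addc T. tri L T0 T1"
proof -
  have TO: "T \<in> Ob" using lit_ob[OF T(1)] .
  have LO: "L \<in> Ob" using lit_ob[OF lit_L] .
  have pT: "presil T" "generates T" using T(2) unfolding silt_def by auto
  have LT: "van L T n" if "n > 0" for n using L_van[OF T(1)] that by simp
  obtain L' A T0 m f t p a b where A: "tr L' A T0 f t p" "dsum (replicate m T) T0"
    "\<And>W. (\<And>k. k < 0 \<Longrightarrow> van (sh k T) W 0) \<Longrightarrow> van L' W 0"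
    "a \<in> H L A" "b \<in> H A L" "b * a = e L"
    using approximation_data[OF pT LO LT] by metis
  have T0: "T0 \<in> addc T" by (rule addc_dsum[OF TO A(2)]) (use addc_self[OF TO] in auto)
  obtain C j q where C: "tr L T0 C (t * a) j q" using tr_exists[OF mult0[OF trD(2)[OF A(1)] A(4)]] by blast
  note mC = trD[OF C] tr_zero[OF C]
  have TT: "van T T n" if "n > 0" for n using presilD(1)[OF pT(1)] that .
  have vL': "van L' T 0" by (rule A(3)) (use TT van_shift_left[OF TO] in simp)
  have "van C T n" if n: "n > 0" for n
  proof (cases "n = 1")
    case True
    show ?thesis unfolding True
    proof (rule vanI)
      fix g assume g: "g \<in> G C T 1"
      have "g * j = 0" using vanD[OF van_addc_left[OF T0 TT[of 1]] mult_n0[OF g mC(2)]] by simp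
      then obtain k where k: "k \<in> H L T" "g = k * q" using con_Z'[OF C g] by auto
      have "k * b * f = 0" using vanD[OF vL' mult0[OF mult0[OF k(1) A(5)] trD(1)[OF A(1)]]] .
      then obtain k' where k': "k * b = k' * t" using con_Y[OF A(1) mult0[OF k(1) A(5)]] by blast
      have "k = k * (b * a)" using A(6) e_right[OF k(1)] by simp
      also have "\<dots> = k' * (t * a)" using k' by (simp add: mult.assoc[symmetric])
      finally have "g = k' * (t * a * q)" using k(2) by (simp add: mult.assoc)
      then show "g = 0" using mC(4) by simp
    qed
  next
    case False
    show ?thesis
      by (rule tri_van(5)[OF triI[OF C]]) (use n False van_addc_left[OF T0 TT] LT in auto)
  qed
  moreover have "van T C n" if "n > 0" for n
    by (rule tri_van(2)[OF triI[OF C]]) (use that van_addc_right[OF T0 TT] lit_van[OF T(1) lit_L] in auto)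
  moreover obtain Ts where "dec Ts T" using lit_dec[OF T(1)] by blast
  ultimately have "C \<in> addc T" using silting_maximal[OF pT] tr_ob[OF C] by blast
  then show ?thesis using T0 triI[OF C] by blast
qed

text \<open>Let h map T0 to T1' through X. As Hom(L, L[1]) and Hom(T1', T0[1]) vanish, h can be
  written as j * k' + l * j with j the map of the triangle. Hence \<open>e X\<close> is the sum of
  p1 * j * k' * i0 and p1 * l * j * i0, and locality of X makes one of them invertible. Either way j
  restricts to an isomorphism between copies of X, which can be removed from both terms.\<close>

lemma coresolution_cancel:
  assumes T: "lit T" "presil T" and t: "tri L T0 T1" "T0 \<in> addc T" "T1 \<in> addc T"
    and X: "loc X" "retract X T0" "retract X T1"
  shows "\<exists>D0\<in>addc T. \<exists>D1\<in>addc T. tri L D0 D1 \<and> isbip X D0 T0"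
proof -
  obtain Ts where Ts: "reps Ts T" using reps_exists[OF T(1)] by blast
  have XO: "X \<in> Ob" using X(1) unfolding loc_def by blast
  obtain c j q T1' where C: "tr L T0 T1' c j q" "iso T1' T1" using t(1) unfolding tri_def by blast
  note mC = trD[OF C(1)] tr_zero[OF C(1)]
  have T1': "T1' \<in> addc T" using addc_iso[OF t(3) iso_sym[OF C(2)]] .
  obtain i0 p0 where 0: "i0 \<in> H X T0" "p0 \<in> H T0 X" "p0 * i0 = e X" using X(2) unfolding retract_def by blast
  have "retract X T1'" using retract_trans[OF X(3) iso_retract[OF iso_sym[OF C(2)]]] .
  then obtain i1 p1 where 1: "i1 \<in> H X T1'" "p1 \<in> H T1' X" "p1 * i1 = e X" unfolding retract_def by blast
  let ?h = "i1 * p0"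
  have h: "?h \<in> H T0 T1'" using mult0[OF 1(1) 0(2)] .
  have "q * (?h * c) = 0" using vanD[OF L_van[OF lit_L, of 1]] mult_in[OF mC(3) mult0[OF h mC(1)]] by simp
  then obtain k where k: "k \<in> H L T0" "?h * c = j * k" using cov_Z[OF C(1) mult0[OF h mC(1)]] by blast
  have TT: "van T T 1" using presilD(1)[OF T(2)] by simp
  have "k * q = 0" using vanD[OF addc_van[OF TT T1' t(2)]] mult_in[OF k(1) mC(3)] by simp
  then obtain k' where k': "k' \<in> H T0 T0" "k = k' * c" using con_X[OF C(1) k(1)] by blast
  have "(?h - j * k') * c = 0" using k(2) k'(2) by (simp add: left_diff_distrib mult.assoc)
  then obtain l where l: "l \<in> H T1' T1'" "?h - j * k' = l * j"
    using con_Y[OF C(1) diff_in[OF h mult0[OF mC(2) k'(1)]]] by blast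
  have hh: "?h = j * k' + l * j" using l(2) by (simp add: algebra_simps)
  have "p1 * ?h * i0 = e X" using 0 1 by (simp add: mult.assoc 1(3)[THEN assoc_rule] e_left[OF e_in[OF XO]])
  then have sum: "e X - p1 * j * k' * i0 = p1 * l * j * i0" unfolding hh by (simp add: algebra_simps)
  have in1: "p1 * j * k' * i0 \<in> H X X" using 0 1 k' mC by (blast intro: mult0)
  obtain \<alpha> \<beta> where ab: "\<alpha> \<in> H X T0" "\<beta> \<in> H T1' X" "\<beta> * j * \<alpha> = e X"
  proof -
    consider "invertible X (p1 * j * k' * i0)" | "invertible X (p1 * l * j * i0)"
      using X(1) in1 sum unfolding loc_def by metis
    then show ?thesis
    proof cases
      case 1
      then obtain b where b: "b \<in> H X X" "b * (p1 * j * k' * i0) = e X" unfolding invertible_def by blast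
      show ?thesis
        by (rule that[of "k' * i0" "b * p1"]) (use b 0 \<open>p1 \<in> H T1' X\<close> k' mult0 in \<open>auto simp: mult.assoc\<close>)
    next
      case 2
      then obtain b where b: "b \<in> H X X" "b * (p1 * l * j * i0) = e X" unfolding invertible_def by blast
      have "b * p1 * l \<in> H T1' X" using b 1 l by (blast intro: mult0)
      then show ?thesis by (rule that[OF 0(1)]) (use b in \<open>simp add: mult.assoc\<close>)
    qed
  qed
  \<comment> \<open>The complements of X in T0 and T1' are the fibres of the split epimorphisms
    \<beta> * j and \<beta>. The octahedron for this composite puts their cones into a triangle
    starting with the cone of j, which is L[1].\<close>
  obtain W j' q' where W: "tr T0 T1' W j j' q'" "iso W (sh 1 L)" using tr_rotate[OF C(1)] by blast
  obtain B jB qB where B: "tr T1' X B \<beta> jB qB" using tr_exists[OF ab(2)] by blast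
  obtain A jA qA where A: "tr T0 X A (\<beta> * j) jA qA" using tr_exists[OF mult0[OF ab(2) mC(2)]] by blast
  obtain m n r B' where M: "tr W A B' m n r" "iso B' B" using tr_octahedral[OF W(1) B A] by blast
  have "tri (sh 1 L) A B" using tri_iso1[OF _ W(2)] M unfolding tri_def by blast
  then have "tri L (sh (- 1) A) (sh (- 1) B)"
    using tri_iso1[OF tri_shift sh_inv(1)] lit_ob[OF lit_L] by blast
  moreover have 2: "isbip X (sh (- 1) A) T0" using split_epi[OF A ab(1)] ab(3) by simp
  moreover have 3: "isbip X (sh (- 1) B) T1'"
    using split_epi[OF B mult0[OF mC(2) ab(1)]] ab(3) by (simp add: mult.assoc)
  moreover have "sh (- 1) A \<in> addc T" "sh (- 1) B \<in> addc T"
    using addc_summand[OF t(2) isbip_swap[OF 2]] addc_summand[OF T1' isbip_swap[OF 3]] by auto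
  ultimately show ?thesis by blast
qed

text \<open>Each cancellation shortens the decomposition of the middle term by one, and its length
  is well defined by Krull-Schmidt.\<close>

lemma minimal_coresolution:
  assumes T: "lit T" "presil T" and t: "tri L T0 T1" "T0 \<in> addc T" "T1 \<in> addc T"
  shows "\<exists>D0\<in>addc T. \<exists>D1\<in>addc T. tri L D0 D1 \<and> (\<forall>X. loc X \<longrightarrow> \<not> (retract X D0 \<and> retract X D1))"
proof -
  obtain Ts where Ts: "reps Ts T" using reps_exists[OF T(1)] by blast
  have decomp: "\<exists>Ls. dec Ls D" if "D \<in> addc T" for D
    using addl_dec[of Ts D] repsD(1,6)[OF Ts] that by metis
  have "dec Ls T0 \<Longrightarrow> ?thesis" for Ls
    using t
  proof (induction "length Ls" arbitrary: Ls T0 T1 rule: less_induct)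
    case less
    show ?case
    proof (cases "\<exists>X. loc X \<and> retract X T0 \<and> retract X T1")
      case True
      then obtain X where X: "loc X" "retract X T0" "retract X T1" by blast
      obtain D0 D1 where D: "D0 \<in> addc T" "D1 \<in> addc T" "tri L D0 D1" "isbip X D0 T0"
        using coresolution_cancel[OF T less.prems(2-4) X] by blast
      obtain Ks where Ks: "dec Ks D0" using decomp[OF D(1)] by blast
      have "dec [X] X" using X(1) dsum_single unfolding dec_def loc_def by simp
      from dec_bip[OF this Ks D(4)] have "length Ls = length ([X] @ Ks)"
        using Krull_Schmidt_unique(2) less.prems(1) unfolding dec_def by blast
      then show ?thesis using less.hyps[OF _ Ks D(3,1,2)] by simp
    next
      case False
      then show ?thesis using less.prems by blast
    qed
  qed
  then show ?thesis using decomp[OF t(2)] by blast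
qed

section \<open>Completions of an almost complete object\<close>

definition bongartz :: "'a \<Rightarrow> 'a \<Rightarrow> bool" where
  "bongartz P S \<longleftrightarrow> (\<exists>Q f Z j p. right_app (addc P) Q (sh 1 L) f \<and> tr Q (sh 1 L) Z f j p \<and> isbip P (sh (- 1) Z) S)"

definition cobongartz :: "'a \<Rightarrow> 'a \<Rightarrow> bool" where
  "cobongartz P S \<longleftrightarrow> (\<exists>Q g Z j p. left_app (addc P) L Q g \<and> tr L Q Z g j p \<and> isbip P Z S)"

context
  fixes P :: 'a and Ps Qs :: "'a list"
  assumes P: "lit P" "presil P" and Ps: "reps Ps P" and Qs: "reps Qs L"
    and card: "card (set Qs) = card (set Ps) + 1"
begin

lemma PO: "P \<in> Ob" and LO: "L \<in> Ob"
  using lit_ob P lit_L by auto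

text \<open>A presilting object with a coresolution of L has as many summands as L by
  \<open>card_reps_eq\<close>, while P has one fewer.\<close>

lemma no_coresolution: "\<not> (tri L T0 T1 \<and> T0 \<in> addc P \<and> T1 \<in> addc P)"
  using card_reps_eq[OF P _ _ _ Ps Qs] card by force

lemma extra_summand:
  assumes Ts: "reps Ts T" and c: "card (set Ts) = card (set Qs)" and PT: "P \<in> addc T"
  obtains X where "X \<in> set Ts" "\<And>t. t \<in> set Ts \<Longrightarrow> t \<noteq> X \<Longrightarrow> t \<in> addc P" "X \<notin> addc P"
proof -
  have "\<exists>t\<in>set Ts. iso p t" if p: "p \<in> set Ps" for p
  proof -
    have "addl Ts p" using reps_retract[OF Ts PT repsD(3)[OF Ps p]] repsD(6)[OF Ts] by blast
    then show ?thesis using loc_addl[of p Ts] repsD(1)[OF Ps] repsD(1)[OF Ts] p by metis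
  qed
  then obtain h where h: "\<And>p. p \<in> set Ps \<Longrightarrow> h p \<in> set Ts \<and> iso p (h p)" by metis
  have "inj_on h (set Ps)"
  proof (rule inj_onI)
    fix p q assume pq: "p \<in> set Ps" "q \<in> set Ps" "h p = h q"
    then have "iso p (h q)" "iso q (h q)" using h by metis+
    then have "iso p q" using iso_trans[OF _ iso_sym] by blast
    then show "p = q" using repsD(5)[OF Ps pq(1,2)] by blast
  qed
  then have "card (h ` set Ps) = card (set Ps)" by (rule card_image)
  moreover have sub: "h ` set Ps \<subseteq> set Ts" using h by blast
  ultimately have "card (set Ts - h ` set Ps) = 1" using c card by (simp add: card_Diff_subset)
  then obtain X where X: "set Ts - h ` set Ps = {X}" by (auto simp: card_1_singleton_iff)
  have "t \<in> addc P" if "t \<in> set Ts" "t \<noteq> X" for t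
  proof -
    obtain p where p: "p \<in> set Ps" "t = h p" using X \<open>t \<in> set Ts\<close> \<open>t \<noteq> X\<close> by blast
    then have "iso p t" using h by blast
    then show ?thesis using addc_iso[OF reps_addc[OF Ps p(1)]] by blast
  qed
  moreover have "X \<notin> addc P"
  proof
    assume "X \<in> addc P"
    then have "addl Ps X" using repsD(6)[OF Ps] by blast
    moreover have XT: "X \<in> set Ts" using X by blast
    ultimately obtain p where p: "p \<in> set Ps" "iso X p" using loc_addl[of X Ps] repsD(1)[OF Ps] repsD(1)[OF Ts] by metis
    then have "iso X (h p)" "h p \<in> set Ts" using h iso_trans[of X p] by blast+
    then have "X = h p" using repsD(5)[OF Ts XT] by blast
    then show False using X p(1) by blast
  qed
  ultimately show ?thesis using that X by blast
qed

lemma completion_bongartz: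
  assumes T: "lit T" "silt T" and PT: "P \<in> addc T"
  shows "(\<exists>S. bongartz P S \<and> addc T = addc S) \<or> (\<exists>S. cobongartz P S \<and> addc T = addc S)"
proof -
  have pT: "presil T" using T(2) unfolding silt_def by blast
  have TO: "T \<in> Ob" using lit_ob T by blast
  obtain Ts where Ts: "reps Ts T" using reps_exists[OF T(1)] by blast
  obtain T0 T1 where T01: "T0 \<in> addc T" "T1 \<in> addc T" "tri L T0 T1"
    and min: "\<And>X. loc X \<Longrightarrow> \<not> (retract X T0 \<and> retract X T1)"
    using minimal_coresolution[OF T(1) pT] coresolution_exists[OF T] by metis
  have TT: "van T T 1" using presilD(1)[OF pT] by simp
  obtain X where X: "X \<in> set Ts" "\<And>t. t \<in> set Ts \<Longrightarrow> t \<noteq> X \<Longrightarrow> t \<in> addc P"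
    using extra_summand[OF Ts card_reps_eq[OF T(1) pT T01(3,1,2) Ts Qs] PT] by metis
  have inP: "Y \<in> addc P" if Y: "Y \<in> addc T" and n: "\<not> retract X Y" for Y
  proof -
    obtain Ys where Ys: "dsum Ys Y" "set Ys \<subseteq> set Ts" using addl_list_obtain repsD(6)[OF Ts] Y by blast
    have "X \<notin> set Ys" using dsum_retract[OF Ys(1)] n by blast
    then show ?thesis using addc_dsum[OF PO Ys(1)] X(2) Ys(2) by blast
  qed
  \<comment> \<open>X is the only summand of T outside \<open>addc P\<close>, so P together with any
    D in \<open>addc T\<close> that contains X already generates \<open>addc T\<close>.\<close>
  have eq: "addc T = addc S" if S: "isbip P D S" and D: "D \<in> addc T" "retract X D" for S D
  proof
    have SO: "S \<in> Ob" using isbip_ob[OF S] by blast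
    obtain Ds where Ds: "dec Ds D" using addl_dec[of Ts D] repsD(1,6)[OF Ts] D(1) by metis
    have "P \<in> addc S" using addc_summand[OF addc_self[OF SO] S] .
    then have PS: "addc P \<subseteq> addc S" using addc_mono SO by blast
    have "D \<in> addc S" using addc_summand[OF addc_self[OF SO] isbip_swap[OF S]] .
    moreover obtain V where "isbip X V D" using retract_dsum[of Ds D X] Ds D(2) unfolding dec_def by metis
    ultimately have XS: "X \<in> addc S" using addc_summand by blast
    have "t \<in> addc S" if "t \<in> set Ts" for t using X(2)[OF that] XS PS by (cases "t = X") auto
    then have "T \<in> addc S" by (rule addc_addl[OF SO repsD(4)[OF Ts]])
    then show "addc T \<subseteq> addc S" using addc_mono SO by blast
    have "S \<in> addc T" using addc_bip[OF PT D(1) S] .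
    then show "addc S \<subseteq> addc T" using addc_mono TO by blast
  qed
  have locX: "loc X" using repsD(1)[OF Ts] X(1) by blast
  have ob: "T0 \<in> Ob" "T1 \<in> Ob" using tri_ob[OF T01(3)] by auto
  show ?thesis
  proof (cases "retract X T1")
    case False
    then have T1: "T1 \<in> addc P" using inP T01 by blast
    \<comment> \<open>If X occurred in neither term, both terms would lie in \<open>addc P\<close>,
      against \<open>no_coresolution\<close>.\<close>
    then have X0: "retract X T0" using inP[OF T01(1)] no_coresolution T01(3) by blast
    obtain f j p Z where Z: "tr T1 (sh 1 L) Z f j p" "iso Z (sh 1 T0)"
      using tri_rotate[OF tri_rotate[OF T01(3)]] tri_rotate[OF T01(3)] unfolding tri_def by blast
    have ZO: "Z \<in> Ob" using iso_ob[OF Z(2)] by blast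
    have i: "iso (sh (- 1) Z) T0" using iso_trans[OF iso_sh[OF Z(2)] sh_inv(1)[OF ob(1)]] .
    have "van W Z 0" if W: "W \<in> addc P" for W
    proof -
      have "van P T0 1" using addc_van[OF TT PT T01(1)] .
      then have "van W (sh 1 T0) 0" using van_addc_left[OF W] van_shift_right[OF ob(1)] by simp
      then show ?thesis using van_iso_right Z(2) by blast
    qed
    then have app: "right_app (addc P) T1 (sh 1 L) f" using right_appI[OF Z(1) T1] by blast
    obtain S where S: "isbip P (sh (- 1) Z) S" using isbip_exists[OF PO sh_in[OF ZO]] by blast
    have "addc T = addc S"
      by (rule eq[OF S addc_iso[OF T01(1) iso_sym[OF i]]]) (rule retract_trans[OF X0 iso_retract[OF iso_sym[OF i]]])
    then show ?thesis using app Z(1) S unfolding bongartz_def by blast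
  next
    case True
    then have T0: "T0 \<in> addc P" using inP[OF T01(1)] min[OF locX] by blast
    obtain f j p Z where Z: "tr L T0 Z f j p" "iso Z T1" using T01(3) unfolding tri_def by blast
    have ZO: "Z \<in> Ob" using iso_ob[OF Z(2)] by blast
    have "van Z W 1" if W: "W \<in> addc P" for W
      using van_iso_left[OF van_addc_right[OF W addc_van[OF TT T01(2) PT]] Z(2)] .
    then have app: "left_app (addc P) L T0 f" using left_appI[OF Z(1) T0] by blast
    obtain S where S: "isbip P Z S" using isbip_exists[OF PO ZO] by blast
    have "addc T = addc S"
      by (rule eq[OF S addc_iso[OF T01(2) iso_sym[OF Z(2)]]]) (rule retract_trans[OF True iso_retract[OF iso_sym[OF Z(2)]]])
    then show ?thesis using app Z(1) S unfolding cobongartz_def by blast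
  qed
qed

text \<open>Z is the cone of a left approximation of X by \<open>addc P\<close>: by
  \<open>left_appI\<close> the vanishing condition is what makes X \<rightarrow> E an
  approximation.\<close>

definition approximable :: "'a \<Rightarrow> 'a \<Rightarrow> bool" where
  "approximable X Z \<longleftrightarrow> (\<exists>E\<in>addc P. tri X E Z) \<and> van Z P 1"

lemma PP: "van P P 1"
  using presilD(1)[OF P(2)] by simp

lemma approximable_bip:
  assumes X: "approximable X Z" and X': "approximable X' Z'" and A: "isbip X X' A"
    and v: "van X' P 1" "van X' X 1" "two X" "two P"
  shows "\<exists>C. isbip Z Z' C \<and> approximable A C"
proof -
  obtain E where E: "E \<in> addc P" "tri X E Z" "van Z P 1" using X unfolding approximable_def by blast
  obtain E' where E': "E' \<in> addc P" "tri X' E' Z'" "van Z' P 1" using X' unfolding approximable_def by blast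
  have 1: "van X' E 1" using van_addc_right[OF E(1) v(1)] .
  have 2: "van E E' 1" using addc_van[OF PP E(1) E'(1)] .
  have 3: "van Z' Z 1"
  proof (rule tri_van(2)[OF E(2)])
    show "van Z' E 1" using van_addc_right[OF E(1) E'(3)] .
    show "van Z' X (1 + 1)"
      by (rule tri_van(5)[OF E'(2)]) (use van_addc_left[OF E'(1) two_van[OF v(4,3)]] v(2) in auto)
  qed
  obtain F C where F: "isbip E' E F" "isbip Z Z' C" "tri A F C"
    using tri_bip[OF E(2) E'(2) A 1 2 3] by blast
  have "approximable A C"
    unfolding approximable_def using F(3) addc_bip[OF E'(1) E(1) F(1)] van_bip_left[OF F(2) E(3) E'(3)] by blast
  then show ?thesis using F(2) by blast
qed

text \<open>Schanuel's lemma: the pushout of the two approximations splits in both directions, so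
  the cones agree up to summands from \<open>addc P\<close>.\<close>

lemma approximable_unique:
  assumes X: "approximable X Z" and X': "approximable X Z'"
  obtains E E' F where "E \<in> addc P" "E' \<in> addc P" "isbip E Z' F" "isbip E' Z F"
proof -
  obtain E where E: "E \<in> addc P" "tri X E Z" "van Z P 1" using X unfolding approximable_def by blast
  obtain E' where E': "E' \<in> addc P" "tri X E' Z'" "van Z' P 1" using X' unfolding approximable_def by blast
  obtain F where F: "tri E F Z'" "tri E' F Z" using pushout[OF E(2) E'(2)] by blast
  have "isbip E Z' F" using tri_split[OF F(1) van_addc_right[OF E(1) E'(3)]] .
  moreover have "isbip E' Z F" using tri_split[OF F(2) van_addc_right[OF E'(1) E(3)]] .
  ultimately show ?thesis using that E(1) E'(1) by blast
qed

lemma approximable_self: assumes "X \<in> addc P" obtains O' where "approximable X O'" "zero_obj O'"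
proof -
  obtain O' where O': "O' \<in> Ob" "e O' = 0" using has_zero by blast
  have "tri X X O'" using bip_tri[OF isbip_zero] addc_ob[OF assms] O' unfolding zero_obj_def by blast
  then show ?thesis using that[of O'] van_zero(1)[of O' P 1] assms O' unfolding approximable_def zero_obj_def by blast
qed

text \<open>With Y the new summand of S, it remains to compare the cone C obtained from B with the
  cone N' of an approximation of Y alone. B is the sum of Y and an object B2 whose summands are Y or
  lie in \<open>addc P\<close>, so B also has an approximation whose cone is built from copies of
  N'. By \<open>approximable_unique\<close> it differs from C only by objects of
  \<open>addc P\<close>.\<close>

lemma bongartz_mutation:
  assumes S: "bongartz P S" and T: "cobongartz P T"
  shows "mutation S T"
proof -
  have twoP: "two P" using lit_two P by blast
  have PP': "van P P n" if "n > 0" for n using presilD(1)[OF P(2) that] .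
  obtain Q f Z j p where Q: "right_app (addc P) Q (sh 1 L) f" "tr Q (sh 1 L) Z f j p" "isbip P (sh (- 1) Z) S"
    using S unfolding bongartz_def by blast
  obtain Q' g C j' p' where Q': "left_app (addc P) L Q' g" "tr L Q' C g j' p'" "isbip P C T"
    using T unfolding cobongartz_def by blast
  have QP: "Q \<in> addc P" "Q' \<in> addc P" using Q(1) Q'(1) unfolding right_app_def left_app_def by auto
  have SO: "S \<in> Ob" and TO: "T \<in> Ob" and ZO: "Z \<in> Ob" using isbip_ob[OF Q(3)] isbip_ob[OF Q'(3)] tr_ob[OF Q(2)] by auto
  define B where "B = sh (- 1) Z"
  have PBS: "isbip P B S" using Q(3) unfolding B_def .
  have tB: "tri L B Q"
  proof -
    have "tri (sh (- 1) (sh 1 L)) B (sh (- 1) (sh 1 Q))"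
      unfolding B_def by (rule tri_shift[OF tri_rotate[OF triI[OF Q(2)]]])
    then show ?thesis using tri_iso[OF _ sh_inv(1)[OF LO] iso_refl sh_inv(1)] sh_in[OF ZO] addc_ob[OF QP(1)] B_def by blast
  qed
  \<comment> \<open>\<open>B\<close> is again a two-term complex: it is the cone of a map from a stalk to a sum of two stalks.\<close>
  have twoB: "two B"
  proof -
    obtain Q2 where Q2: "lit Q2" "iso Q2 Q" using addc_two[OF P(1) QP(1)] unfolding two_def by blast
    obtain M1 M0 where M: "st M1" "st M0" "tri M1 M0 Q2" using lit_tri[OF Q2(1)] by blast
    have "tri M1 M0 Q" using tri_iso3[OF M(3) Q2(2)] .
    then obtain F where F: "tri L F M0" "tri M1 F B" using pushout[OF tri_unrotate[OF tB] tri_unrotate] by blast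
    have "van M0 L 1" using van_addc_left[OF st_addc[OF M(2)] L_van[OF lit_L]] by simp
    then have "isbip L M0 F" using tri_split[OF F(1)] by blast
    moreover obtain F' where F': "st F'" "isbip L M0 F'" using st_bip[OF st_L M(2)] by blast
    ultimately have "iso F F'" using isbip_map[OF _ F'(2)] iso_refl LO tri_ob[OF F(1)] by blast
    then have "tri M1 F' B" using tri_iso2[OF F(2)] by blast
    then show ?thesis using tri_lit[OF M(1) F'(1)] unfolding two_def by blast
  qed
  have PB: "van P B n" if n: "n > 0" for n
  proof (cases "n = 1")
    case True
    \<comment> \<open>The approximation property of f amounts to Hom(P, Z) = 0, where Z is B[1]:
      each map from P to Z lifts to L[1], factors through f and is therefore killed by j.\<close>
    have "van P Z 0"
    proof (rule vanI)
      fix x assume x: "x \<in> H P Z"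
      have "p * x = 0" using vanD[OF van_addc_right[OF QP(1) PP]] mult_in[OF trD(3)[OF Q(2)] x] by simp
      then obtain y where y: "y \<in> H P (sh 1 L)" "x = j * y" using cov_Z[OF Q(2) x] by blast
      then obtain z where "y = f * z" using Q(1) addc_self[OF PO] unfolding right_app_def by blast
      then show "x = 0" using y(2) tr_zero[OF Q(2)] by (simp add: mult.assoc[symmetric])
    qed
    then show ?thesis unfolding B_def True van_shift_right[OF ZO] by simp
  qed (use two_van[OF twoP twoB] n in auto)
  have BP: "van B P n" if n: "n > 0" for n
    by (rule tri_van(4)[OF tB]) (use L_van[OF P(1)] van_addc_left[OF QP(1) PP'] n in auto)
  have BB: "van B B n" if n: "n > 0" for n
    by (rule tri_van(4)[OF tB]) (use L_two_van[OF twoB] van_addc_left[OF QP(1) PB] n in auto)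
  have SS: "van S S n" if n: "n > 0" for n
    using van_bip_left[OF PBS van_bip_right[OF PBS PP'[OF n] PB[OF n]] van_bip_right[OF PBS BP[OF n] BB[OF n]]] .
  \<comment> \<open>Decompositions are available for literal two-term complexes only, so S is
    exchanged for an isomorphic one.\<close>
  obtain S' where S': "lit S'" "iso S' S" using two_bip[OF twoP twoB PBS] unfolding two_def by blast
  have S'O: "S' \<in> Ob" using lit_ob[OF S'(1)] .
  have S'S: "addc S' = addc S"
    using addc_mono addc_iso[OF addc_self S'(2)] addc_iso[OF addc_self iso_sym[OF S'(2)]] SO S'O by blast
  have pS': "presil S'"
    unfolding presil_def using van_iso_left[OF van_iso_right[OF SS S'(2)] S'(2)] S'O by blast
  obtain Ss where Ss: "reps Ss S'" using reps_exists[OF S'(1)] by blast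
  have inS: "P \<in> addc S'" "B \<in> addc S'"
    unfolding S'S using addc_summand[OF addc_self[OF SO] PBS] addc_summand[OF addc_self[OF SO] isbip_swap[OF PBS]] by auto
  have PS: "addc P \<subseteq> addc S'" using addc_mono[OF inS(1) S'O] .
  obtain Y where Y: "Y \<in> set Ss" "\<And>s. s \<in> set Ss \<Longrightarrow> s \<noteq> Y \<Longrightarrow> s \<in> addc P" "Y \<notin> addc P"
    using extra_summand[OF Ss card_reps_eq[OF S'(1) pS' tB inS(2) _ Ss Qs] inS(1)] QP(1) PS by blast
  have YS: "Y \<in> addc S'" using reps_addc[OF Ss Y(1)] .
  have locY: "loc Y" using repsD(1)[OF Ss] Y(1) by blast
  have YO: "Y \<in> Ob" using addc_ob[OF YS] .
  have sS: "s \<in> addc S'" if "s \<in> set Ss" for s using reps_addc[OF Ss that] .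
  have vS: "van A A' 1" if "A \<in> addc S'" "A' \<in> addc S'" for A A'
    using addc_van[OF _ that] presilD(1)[OF pS'] by simp
  obtain U where U: "isbip P Y U" using isbip_exists[OF PO YO] by blast
  have UO: "U \<in> Ob" using isbip_ob[OF U] by blast
  have US: "addc U = addc S'"
  proof
    show "addc U \<subseteq> addc S'" using addc_mono[OF addc_bip[OF inS(1) YS U] S'O] .
    have 1: "P \<in> addc U" "Y \<in> addc U"
      using addc_summand[OF addc_self[OF UO] U] addc_summand[OF addc_self[OF UO] isbip_swap[OF U]] by auto
    have "s \<in> addc U" if "s \<in> set Ss" for s
      using Y(2)[OF that] 1 addc_mono[OF 1(1) UO] by (cases "s = Y") auto
    then have "S' \<in> addc U" by (rule addc_addl[OF UO repsD(4)[OF Ss]])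
    then show "addc S' \<subseteq> addc U" using addc_mono UO by blast
  qed
  have UU: "U \<in> addc S'" using addc_self[OF UO] US by blast
  have siltU: "silt U"
  proof -
    have "presil U"
      unfolding presil_def using addc_van[OF presilD(1)[OF pS'] UU UU] UO by blast
    moreover have "generates U"
      unfolding generates_def
    proof (intro allI impI)
      fix V assume V: "thk V \<and> U \<in> V"
      then have "B \<in> V" "Q \<in> V" using thk_addc[of V U] inS(2) QP(1) PS US by blast+
      then have "L \<in> V" using thk_first[OF _ tB] V by blast
      then show "V = Ob" using L_generates V unfolding generates_def by blast
    qed
    ultimately show ?thesis unfolding silt_def by blast
  qed
  have disj: "zero_obj W" if W: "W \<in> addc P \<inter> addc Y" for W
  proof -
    have "dsum [Y] Y" "\<forall>y\<in>set [Y]. loc y" using dsum_single[OF YO] locY by auto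
    then have "addl [Y] W" using addc_iff W by blast
    then obtain Ws where Ws: "dsum Ws W" "set Ws \<subseteq> {Y}" using addl_list_obtain by force
    show ?thesis
    proof (cases Ws)
      case (Cons a Ws')
      then have "retract Y W" using dsum_retract[OF Ws(1)] Ws(2) by auto
      then show ?thesis using reps_retract[OF Ps] W Y(3) by blast
    qed (use Ws in simp)
  qed
  have CP: "van C P 1"
  proof (rule vanI)
    fix x assume x: "x \<in> G C P 1"
    note mC = trD[OF Q'(2)] tr_zero[OF Q'(2)]
    have "x * j' = 0" using vanD[OF van_addc_left[OF QP(2) PP] mult_n0[OF x mC(2)]] .
    then obtain k where k: "k \<in> H L P" "x = k * p'" using con_Z'[OF Q'(2) x] by auto
    then obtain k' where "k = k' * g" using Q'(1) addc_self[OF PO] unfolding left_app_def by blast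
    then show "x = 0" using k(2) mC(4) by (simp add: mult.assoc)
  qed
  obtain E where E: "tri B E C" "tri Q' E Q" using pushout[OF tB triI[OF Q'(2)]] by blast
  have EP: "E \<in> addc P"
    using addc_bip[OF QP(2,1) tri_split[OF E(2) addc_van[OF PP QP]]] .
  have BC: "approximable B C" unfolding approximable_def using E(1) EP CP by blast
  \<comment> \<open>Without Y all summands of B lie in \<open>addc P\<close>, and then L
    \<rightarrow> B \<rightarrow> Q would be a coresolution inside \<open>addc P\<close>.\<close>
  have YB: "retract Y B"
  proof (rule ccontr)
    assume n: "\<not> retract Y B"
    obtain Bs where Bs: "dsum Bs B" "set Bs \<subseteq> set Ss" using addl_list_obtain repsD(6)[OF Ss] inS(2) by blast
    have "Y \<notin> set Bs" using dsum_retract[OF Bs(1)] n by blast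
    then have "B \<in> addc P" using addc_dsum[OF PO Bs(1)] Y(2) Bs(2) by blast
    then show False using no_coresolution tB QP(1) by blast
  qed
  obtain Bs where Bs: "dec Bs B" "set Bs \<subseteq> set Ss"
    using addl_dec[of Ss B] repsD(1,6)[OF Ss] inS(2) by metis
  obtain B2 Zs where B2: "isbip Y B2 B" "dsum Zs B2" "set Zs \<subseteq> set Bs"
    using retract_dsum[of Bs B Y] Bs(1) YB unfolding dec_def by (metis Un_upper2)
  have B2S: "B2 \<in> addc S'" using addc_summand[OF inS(2) isbip_swap[OF B2(1)]] .
  \<comment> \<open>Restricting B \<rightarrow> E to the summand Y changes the cone from C to an
    extension N of C by B2, so Hom(N, P[1]) still vanishes and the restriction is again an
    approximation.\<close>
  obtain N where N: "tri Y E N" "tri B2 N C" using octahedron[OF bip_tri[OF B2(1)] E(1)] by blast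
  have NP: "van N P 1" by (rule tri_van(4)[OF N(2) vS[OF B2S inS(1)] CP])
  obtain f2 j2 p2 N' where N': "tr Y E N' f2 j2 p2" "iso N' N" using N(1) unfolding tri_def by blast
  have N'P: "van N' P 1" using van_iso_left[OF NP N'(2)] .
  have lapp: "left_app (addc P) Y E f2" using left_appI[OF N'(1) EP van_addc_right[OF _ N'P]] by blast
  have YN: "approximable Y N'" unfolding approximable_def using triI[OF N'(1)] EP N'P by blast
  have N'O: "N' \<in> Ob" using tr_ob[OF N'(1)] by blast
  have twos: "two s" if "s \<in> set Ss" for s using lit_two[OF repsD(2)[OF Ss that]] .
  \<comment> \<open>Summands in \<open>addc P\<close> contribute an identity with zero cone, and
    each copy of Y contributes a copy of N'.\<close>
  have "\<exists>W. approximable A W \<and> addl [N'] W" if "dsum As A" "set As \<subseteq> set Ss" for A As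
    using that
  proof (induction As arbitrary: A)
    case Nil
    then obtain O' where "approximable A O'" "zero_obj O'" using approximable_self addc_zero[OF PO, of A] by auto
    then show ?case using addl_zero by blast
  next
    case (Cons a As)
    then obtain D where D: "dsum As D" "isbip a D A" by auto
    obtain W where W: "approximable D W" "addl [N'] W" using Cons.IH[OF D(1)] Cons.prems by auto
    obtain V where V: "approximable a V" "addl [N'] V"
    proof (cases "a = Y")
      case True
      then show ?thesis using that YN addl_member[of N' "[N']"] N'O by simp
    next
      case False
      then have "a \<in> addc P" using Y(2) Cons.prems by simp
      then obtain O' where "approximable a O'" "zero_obj O'" using approximable_self by blast
      then show ?thesis using that addl_zero by blast
    qed
    have DS: "D \<in> addc S'" by (rule addc_dsum[OF S'O D(1)]) (use Cons.prems sS in auto)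
    have aS: "a \<in> addc S'" "two a" using Cons.prems sS twos by auto
    obtain X where "isbip V W X" "approximable A X"
      using approximable_bip[OF V(1) W(1) D(2) vS[OF DS inS(1)] vS[OF DS aS(1)] aS(2) twoP] by blast
    then show ?case using addl_bip[OF V(2) W(2)] by blast
  qed
  then obtain W where W: "approximable B2 W" "addl [N'] W" using B2(2,3) Bs(2) by blast
  obtain X where X: "isbip N' W X" "approximable B X"
    using approximable_bip[OF YN W(1) B2(1) vS[OF B2S inS(1)] vS[OF B2S YS] twos[OF Y(1)] twoP] by blast
  obtain D D' F where F: "D \<in> addc P" "D' \<in> addc P" "isbip D X F" "isbip D' C F"
    using approximable_unique[OF BC X(2)] .
  obtain V where V: "isbip P N' V" using isbip_exists[OF PO N'O] by blast
  have VO: "V \<in> Ob" using isbip_ob[OF V] by blast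
  have inV: "P \<in> addc V" "N' \<in> addc V"
    using addc_summand[OF addc_self[OF VO] V] addc_summand[OF addc_self[OF VO] isbip_swap[OF V]] by auto
  have inT: "P \<in> addc T" "C \<in> addc T"
    using addc_summand[OF addc_self[OF TO] Q'(3)] addc_summand[OF addc_self[OF TO] isbip_swap[OF Q'(3)]] by auto
  have "addc T = addc V"
  proof
    have "W \<in> addc V" by (rule addc_addl[OF VO W(2)]) (use inV in auto)
    then have "X \<in> addc V" using addc_bip[OF inV(2) _ X(1)] by blast
    then have "F \<in> addc V" using addc_bip[OF _ _ F(3)] F(1) addc_mono[OF inV(1) VO] by blast
    then have "C \<in> addc V" using addc_summand[OF _ isbip_swap[OF F(4)]] by blast
    then show "addc T \<subseteq> addc V" using addc_mono[OF addc_bip[OF inV(1) _ Q'(3)] VO] by blast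
    have "F \<in> addc T" using addc_bip[OF _ inT(2) F(4)] F(2) addc_mono[OF inT(1) TO] by blast
    then have "X \<in> addc T" using addc_summand[OF _ isbip_swap[OF F(3)]] by blast
    then have "N' \<in> addc T" using addc_summand[OF _ X(1)] by blast
    then show "addc V \<subseteq> addc T" using addc_mono[OF addc_bip[OF inT(1) _ V] TO] by blast
  qed
  moreover have "addc S = addc U" using US S'S by simp
  ultimately show ?thesis
    unfolding mutation_def using U siltU disj loc_indec[OF locY] lapp N'(1) V by blast
qed

end

end

section \<open>Complexes with the differential as a ring element\<close>

context preadd
begin

lemma neg_neg: assumes "X \<in> Obj C" "Y \<in> Obj C" "f \<in> Hom C X Y" shows "Neg C (Neg C f) = f"
proof -
  note n = neg_in[OF assms(3,1,2)]
  have "E X Y (Neg C (Neg C f)) = E X Y f" using E_neg[OF assms(1,2) n] E_neg[OF assms] by simp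
  then show ?thesis using E_inject[OF assms(1,2) neg_in[OF n assms(1,2)] assms(3)] by simp
qed

lemma cmp_neg_left:
  assumes "X \<in> Obj C" "Y \<in> Obj C" "Z \<in> Obj C" "f \<in> Hom C X Y" "g \<in> Hom C Y Z"
  shows "Cmp C (Neg C g) f = Neg C (Cmp C g f)"
proof -
  note n = neg_in[OF assms(5,2,3)] and c = cmp_in[OF assms(5,4,1,2,3)]
  have "E X Z (Cmp C (Neg C g) f) = E X Z (Neg C (Cmp C g f))"
    using E_mult[OF assms(1-4) n] E_mult[OF assms] E_neg[OF assms(2,3,5)] E_neg[OF assms(1,3) c]
    by (metis mult_minus_left)
  then show ?thesis
    using E_inject[OF assms(1,3) cmp_in[OF n assms(4,1,2,3)] neg_in[OF c assms(1,3)]] by simp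
qed

lemma cmp_neg_right:
  assumes "X \<in> Obj C" "Y \<in> Obj C" "Z \<in> Obj C" "f \<in> Hom C X Y" "g \<in> Hom C Y Z"
  shows "Cmp C g (Neg C f) = Neg C (Cmp C g f)"
proof -
  note n = neg_in[OF assms(4,1,2)] and c = cmp_in[OF assms(5,4,1,2,3)]
  have "E X Z (Cmp C g (Neg C f)) = E X Z (Neg C (Cmp C g f))"
    using E_mult[OF assms(1-3) n assms(5)] E_mult[OF assms] E_neg[OF assms(1,2,4)] E_neg[OF assms(1,3) c]
    by (metis mult_minus_right)
  then show ?thesis
    using E_inject[OF assms(1,3) cmp_in[OF assms(5) n assms(1-3)] neg_in[OF c assms(1,3)]] by simp
qed

lemma neg_zer: assumes "X \<in> Obj C" "Y \<in> Obj C" shows "Neg C (Zer C X Y) = Zer C X Y"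
proof -
  note z = zer_in[OF assms]
  have "E X Y (Neg C (Zer C X Y)) = E X Y (Zer C X Y)" using E_neg[OF assms z] E_zer[OF assms] by simp
  then show ?thesis using E_inject[OF assms neg_in[OF z assms] z] by simp
qed

lemma hom_zero_object:
  assumes "zero_object C X \<or> zero_object C Y" "X \<in> Obj C" "Y \<in> Obj C" "f \<in> Hom C X Y"
  shows "f = Zer C X Y"
  using assms(1)
proof
  assume "zero_object C X"
  then show ?thesis using idn_right[OF assms(4,2,3)] cmp_zer_right[OF assms(2,2,3,4)] unfolding zero_object_def by metis
next
  assume "zero_object C Y"
  then show ?thesis using idn_left[OF assms(4,2,3)] cmp_zer_left[OF assms(2,3,3,4)] unfolding zero_object_def by metis
qed

end

text \<open>Complexes with arbitrary families of arrows of degree \<open>0\<close> between them; the shift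
  automorphism makes this the graded category in which a complex has its differential as an
  endomorphism of degree \<open>1\<close>.\<close>

definition graded_cat :: "('o, 'f) precat \<Rightarrow>
    (('o, 'f) cplx, ('o, 'f) cplx \<times> (int \<Rightarrow> 'f) \<times> ('o, 'f) cplx) precat" where
  "graded_cat A = \<lparr>Obj = {X. bounded_complex A X},
     Hom = (\<lambda>X Y. {(X, \<phi>, Y) | \<phi>. \<forall>n. \<phi> n \<in> Hom A (cob X n) (cob Y n)}),
     Cmp = (\<lambda>(Y', \<psi>, Z) (X, \<phi>, Y). (X, \<lambda>n. Cmp A (\<psi> n) (\<phi> n), Z)),
     Idn = (\<lambda>X. (X, \<lambda>n. Idn A (cob X n), X)),
     Add = (\<lambda>(X, \<phi>, Y) (X', \<psi>, Y'). (X, \<lambda>n. Add A (\<phi> n) (\<psi> n), Y)),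
     Neg = (\<lambda>(X, \<phi>, Y). (X, \<lambda>n. Neg A (\<phi> n), Y)),
     Zer = (\<lambda>X Y. (X, \<lambda>n. Zer A (cob X n) (cob Y n), Y))\<rparr>"

definition graded_shift :: "('o, 'f) precat \<Rightarrow> int \<Rightarrow> ('o, 'f) cplx \<times> (int \<Rightarrow> 'f) \<times> ('o, 'f) cplx \<Rightarrow>
    ('o, 'f) cplx \<times> (int \<Rightarrow> 'f) \<times> ('o, 'f) cplx" where
  "graded_shift A k = (\<lambda>(X, \<phi>, Y). (shift A k X, \<lambda>n. \<phi> (n + k), shift A k Y))"

locale additive_cat = preadd A for A :: "('o, 'f) precat" +
  assumes zero_object_exists: "\<exists>Z. zero_object A Z"
    and biproduct_exists: "\<lbrakk>X \<in> Obj A; Y \<in> Obj A\<rbrakk> \<Longrightarrow> \<exists>Z. biproduct A X Y Z"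
begin

abbreviation bdd :: "('o, 'f) cplx \<Rightarrow> bool" where "bdd \<equiv> bounded_complex A"

lemma bdd_obj: "bdd X \<Longrightarrow> cob X n \<in> Obj A"
  and bdd_dif: "bdd X \<Longrightarrow> dif X n \<in> Hom A (cob X n) (cob X (n + 1))"
  and bdd_dif_dif: "bdd X \<Longrightarrow> Cmp A (dif X (n + 1)) (dif X n) = Zer A (cob X n) (cob X (n + 1 + 1))"
  unfolding bounded_complex_def by auto

lemma shift_cob [simp]: "cob (shift A k X) n = cob X (n + k)"
  by (simp add: shift_def)

lemma shift_dif: "dif (shift A k X) n = (if even k then dif X (n + k) else Neg A (dif X (n + k)))"
  by (simp add: shift_def)

lemma bdd_shift: assumes "bdd X" shows "bdd (shift A k X)"
  unfolding bounded_complex_def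
proof (intro conjI allI)
  fix n
  have o: "cob X m \<in> Obj A" for m using bdd_obj[OF assms] .
  have d: "dif X (n + k) \<in> Hom A (cob X (n + k)) (cob X (n + 1 + k))"
    "dif X (n + 1 + k) \<in> Hom A (cob X (n + 1 + k)) (cob X (n + 1 + 1 + k))"
    using bdd_dif[OF assms, of "n + k"] bdd_dif[OF assms, of "n + k + 1"] by (simp_all add: algebra_simps)
  have dd: "Cmp A (dif X (n + 1 + k)) (dif X (n + k)) = Zer A (cob X (n + k)) (cob X (n + 1 + 1 + k))"
    using bdd_dif_dif[OF assms, of "n + k"] by (simp add: algebra_simps)
  show "cob (shift A k X) n \<in> Obj A" using o by simp
  show "dif (shift A k X) n \<in> Hom A (cob (shift A k X) n) (cob (shift A k X) (n + 1))"
    using d neg_in[OF d(1) o o] by (simp add: shift_dif)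
  show "Cmp A (dif (shift A k X) (n + 1)) (dif (shift A k X) n) =
     Zer A (cob (shift A k X) n) (cob (shift A k X) (n + 1 + 1))"
    using dd cmp_neg_left[OF o o o neg_in[OF d(1) o o] d(2)] cmp_neg_right[OF o o o d]
      neg_neg[OF o o cmp_in[OF d(2,1) o o o]] by (simp add: shift_dif)
next
  have "{n. \<not> zero_object A (cob X (n + k))} = (\<lambda>n. n - k) ` {n. \<not> zero_object A (cob X n)}"
    by (force simp: image_def intro: exI[of _ "_ + k"])
  then show "finite {n. \<not> zero_object A (cob (shift A k X) n)}"
    using assms unfolding bounded_complex_def by simp
qed

lemma shift_shift: assumes "bdd X" shows "shift A k (shift A l X) = shift A (k + l) X"
proof -
  have "Neg A (Neg A (dif X n)) = dif X n" for n
    using neg_neg bdd_obj[OF assms] bdd_dif[OF assms] by blast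
  then show ?thesis by (auto simp: shift_def fun_eq_iff algebra_simps)
qed

lemma shift_0: "shift A 0 X = (X :: ('o, 'f) cplx)"
  by (simp add: shift_def)

lemma preadd_graded: "preadd (graded_cat A)"
proof (unfold_locales, goal_cases)
  case 1 then show ?case by (auto simp: graded_cat_def) (rule cmp_in, (blast intro: bdd_obj)+)
next
  case 2 then show ?case by (auto simp: graded_cat_def fun_eq_iff) (rule cmp_assoc, (blast intro: bdd_obj)+)
next
  case 3 then show ?case by (auto simp: graded_cat_def bdd_obj intro!: idn_in)
next
  case 4 then show ?case by (auto simp: graded_cat_def fun_eq_iff) (rule idn_left, (blast intro: bdd_obj)+)
next
  case 5 then show ?case by (auto simp: graded_cat_def fun_eq_iff) (rule idn_right, (blast intro: bdd_obj)+)
next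
  case 6 then show ?case by (auto simp: graded_cat_def) (rule add_in, (blast intro: bdd_obj)+)
next
  case 7 then show ?case by (auto simp: graded_cat_def bdd_obj intro!: zer_in)
next
  case 8 then show ?case by (auto simp: graded_cat_def) (rule neg_in, (blast intro: bdd_obj)+)
next
  case 9 then show ?case by (auto simp: graded_cat_def fun_eq_iff) (rule add_assoc, (blast intro: bdd_obj)+)
next
  case 10 then show ?case by (auto simp: graded_cat_def fun_eq_iff) (rule add_comm, (blast intro: bdd_obj)+)
next
  case 11 then show ?case by (auto simp: graded_cat_def fun_eq_iff) (rule add_zer, (blast intro: bdd_obj)+)
next
  case 12 then show ?case by (auto simp: graded_cat_def fun_eq_iff) (rule add_neg, (blast intro: bdd_obj)+)
next
  case 13 then show ?case by (auto simp: graded_cat_def fun_eq_iff) (rule cmp_add_left, (blast intro: bdd_obj)+)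
next
  case 14 then show ?case by (auto simp: graded_cat_def fun_eq_iff) (rule cmp_add_right, (blast intro: bdd_obj)+)
qed

lemma shift_category_graded: "shift_category (graded_cat A) (shift A) (graded_shift A)"
proof -
  interpret gr: preadd "graded_cat A" by (rule preadd_graded)
  show ?thesis
    by unfold_locales
      (auto simp: graded_cat_def graded_shift_def bdd_shift shift_shift shift_0 add.assoc ac_simps)
qed

sublocale gr: shift_category "graded_cat A" "shift A" "graded_shift A"
  by (rule shift_category_graded)

subsection \<open>The graded ring of families of arrows\<close>

definition fam :: "('o, 'f) cplx \<Rightarrow> ('o, 'f) cplx \<Rightarrow> int \<Rightarrow> (int \<Rightarrow> 'f) \<Rightarrow> bool" where
  "fam X Y n \<phi> \<longleftrightarrow> (\<forall>m. \<phi> m \<in> Hom A (cob X m) (cob Y (m + n)))"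

definition el where
  "el X Y n \<phi> = gr.gel X Y n (X, \<phi>, shift A n Y)"

text \<open>Arrows of \<open>graded_cat A\<close> need not commute with differentials, so the
  differential is an ordinary element of degree 1; commuting with it up to sign becomes an equation
  in the ring.\<close>

definition dd where
  "dd X = el X X 1 (dif X)"

lemma obj_graded [simp]: "X \<in> Obj (graded_cat A) \<longleftrightarrow> bdd X"
  by (simp add: graded_cat_def)

lemma fam_hom: "fam X Y n \<phi> \<longleftrightarrow> (X, \<phi>, shift A n Y) \<in> Hom (graded_cat A) X (shift A n Y)"
  by (simp add: graded_cat_def fam_def)

lemma el_in: "\<lbrakk>bdd X; bdd Y; fam X Y n \<phi>\<rbrakk> \<Longrightarrow> el X Y n \<phi> \<in> gr.G X Y n"
  unfolding el_def by (rule gr.gel_in) (simp_all add: fam_hom)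

lemma G_el:
  assumes "x \<in> gr.G X Y n"
  obtains \<phi> where "bdd X" "bdd Y" "fam X Y n \<phi>" "x = el X Y n \<phi>"
proof -
  obtain f where f: "bdd X" "bdd Y" "f \<in> Hom (graded_cat A) X (shift A n Y)" "x = gr.gel X Y n f"
    using assms by (auto elim!: gr.G_E)
  then obtain \<phi> where "f = (X, \<phi>, shift A n Y)" by (auto simp: graded_cat_def)
  then show ?thesis using f that[of \<phi>] unfolding fam_hom el_def by simp
qed

lemma el_inject: "\<lbrakk>bdd X; bdd Y; fam X Y n \<phi>; fam X Y n \<psi>\<rbrakk> \<Longrightarrow> el X Y n \<phi> = el X Y n \<psi> \<longleftrightarrow> \<phi> = \<psi>"
  unfolding el_def fam_hom by (subst gr.gel_inject) auto

lemma el_mult: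
  "\<lbrakk>bdd X; bdd Y; bdd Z; fam X Y n \<phi>; fam Y Z m \<psi>\<rbrakk> \<Longrightarrow>
   el Y Z m \<psi> * el X Y n \<phi> = el X Z (m + n) (\<lambda>k. Cmp A (\<psi> (k + n)) (\<phi> k))"
  unfolding el_def fam_hom
  by (subst gr.gel_mult) (auto simp: graded_shift_def shift_shift graded_cat_def ac_simps)

lemma el_add:
  "\<lbrakk>bdd X; bdd Y; fam X Y n \<phi>; fam X Y n \<psi>\<rbrakk> \<Longrightarrow> el X Y n \<phi> + el X Y n \<psi> = el X Y n (\<lambda>k. Add A (\<phi> k) (\<psi> k))"
  unfolding el_def fam_hom by (subst gr.gel_add) (auto simp: graded_cat_def)

lemma el_neg: "\<lbrakk>bdd X; bdd Y; fam X Y n \<phi>\<rbrakk> \<Longrightarrow> - el X Y n \<phi> = el X Y n (\<lambda>k. Neg A (\<phi> k))"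
  unfolding el_def fam_hom by (subst gr.gel_neg) (auto simp: graded_cat_def)

lemma el_zero: "\<lbrakk>bdd X; bdd Y\<rbrakk> \<Longrightarrow> el X Y n (\<lambda>k. Zer A (cob X k) (cob Y (k + n))) = 0"
  unfolding el_def using gr.gel_zer[of X Y n] by (simp add: graded_cat_def)

lemma el_unit: "bdd X \<Longrightarrow> el X X 0 (\<lambda>k. Idn A (cob X k)) = gr.unit X"
  unfolding el_def using gr.unit_eq_gel[of X] by (simp add: graded_cat_def shift_0)

lemma fam_mult:
  assumes "bdd X" "bdd Y" "bdd Z" "fam X Y n \<phi>" "fam Y Z m \<psi>"
  shows "fam X Z (m + n) (\<lambda>k. Cmp A (\<psi> (k + n)) (\<phi> k))"
  unfolding fam_def
proof
  fix k
  have "\<psi> (k + n) \<in> Hom A (cob Y (k + n)) (cob Z (k + n + m))" "\<phi> k \<in> Hom A (cob X k) (cob Y (k + n))"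
    using assms(4,5) unfolding fam_def by auto
  note h = this
  have "k + (m + n) = k + n + m" by simp
  then show "Cmp A (\<psi> (k + n)) (\<phi> k) \<in> Hom A (cob X k) (cob Z (k + (m + n)))"
    using cmp_in[OF h] assms(1-3) bdd_obj by metis
qed

lemma fam_add: "\<lbrakk>bdd X; bdd Y; fam X Y n \<phi>; fam X Y n \<psi>\<rbrakk> \<Longrightarrow> fam X Y n (\<lambda>k. Add A (\<phi> k) (\<psi> k))"
  unfolding fam_def by (intro allI, rule add_in) (auto simp: bdd_obj)

lemma fam_neg: "\<lbrakk>bdd X; bdd Y; fam X Y n \<phi>\<rbrakk> \<Longrightarrow> fam X Y n (\<lambda>k. Neg A (\<phi> k))"
  unfolding fam_def by (intro allI, rule neg_in) (auto simp: bdd_obj)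

lemma fam_zero: "\<lbrakk>bdd X; bdd Y\<rbrakk> \<Longrightarrow> fam X Y n (\<lambda>k. Zer A (cob X k) (cob Y (k + n)))"
  unfolding fam_def by (auto simp: bdd_obj intro!: zer_in)

lemma fam_unit: "bdd X \<Longrightarrow> fam X X 0 (\<lambda>k. Idn A (cob X k))"
  unfolding fam_def by (auto simp: bdd_obj intro!: idn_in)

lemma fam_dif: "bdd X \<Longrightarrow> fam X X 1 (dif X)"
  unfolding fam_def by (simp add: bdd_dif)

lemma dd_in: "bdd X \<Longrightarrow> dd X \<in> gr.G X X 1"
  unfolding dd_def by (rule el_in) (simp_all add: fam_dif)

lemma dd_dd: assumes "bdd X" shows "dd X * dd X = 0"
proof -
  have "dd X * dd X = el X X 2 (\<lambda>k. Zer A (cob X k) (cob X (k + 2)))"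
    unfolding dd_def using assms fam_dif[OF assms] bdd_dif_dif[OF assms] by (simp add: el_mult add.commute)
  then show ?thesis using el_zero[OF assms assms, of 2] by simp
qed

end

section \<open>Closed elements and boundaries\<close>

text \<open>The Koszul sign (-1)^n.\<close>

definition sg :: "int \<Rightarrow> 'r :: ring \<Rightarrow> 'r" where "sg n x = (if even n then x else - x)"

lemma UN_UN_const:
  assumes "a \<in> F" "b \<in> G" "\<And>x y. \<lbrakk>x \<in> F; y \<in> G\<rbrakk> \<Longrightarrow> h x y = c"
  shows "(\<Union>x\<in>F. \<Union>y\<in>G. h x y) = c"
proof -
  have "(\<Union>x\<in>F. \<Union>y\<in>G. h x y) = (\<Union>x\<in>F. \<Union>y\<in>G. c)" using assms(3) by (intro SUP_cong refl) auto
  then show ?thesis using assms(1,2) by auto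
qed

context additive_cat
begin

abbreviation "KA \<equiv> Kb A"

text \<open>The cycles of the Hom complex, whose differential sends x of degree n to dd Y * x -
  (-1)^n x * dd X. In \<open>bdry\<close> the element s has degree n - 1, which turns the sign into
  + (-1)^n.\<close>

definition closed where
  "closed X Y n x \<longleftrightarrow> x \<in> gr.G X Y n \<and> dd Y * x = sg n (x * dd X)"

definition bdry where
  "bdry X Y n x \<longleftrightarrow> (\<exists>s\<in>gr.G X Y (n - 1). x = dd Y * s + sg n (s * dd X))"

lemma el_cong: "(\<And>k. \<phi> k = \<psi> k) \<Longrightarrow> el X Y n \<phi> = el X Y n \<psi>"
  by (metis ext)

lemma dd_el: assumes "bdd X" "bdd Y" "fam X Y n \<phi>"
  shows "dd Y * el X Y n \<phi> = el X Y (n + 1) (\<lambda>k. Cmp A (dif Y (k + n)) (\<phi> k))"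
  unfolding dd_def using el_mult[OF assms(1,2,2,3) fam_dif[OF assms(2)]] by (simp add: add.commute)

lemma el_dd: assumes "bdd X" "bdd Y" "fam X Y n \<phi>"
  shows "el X Y n \<phi> * dd X = el X Y (n + 1) (\<lambda>k. Cmp A (\<phi> (k + 1)) (dif X k))"
  unfolding dd_def using el_mult[OF assms(1,1,2) fam_dif[OF assms(1)] assms(3)] by simp

lemma fam_dd_el: assumes "bdd X" "bdd Y" "fam X Y n \<phi>"
  shows "fam X Y (n + 1) (\<lambda>k. Cmp A (dif Y (k + n)) (\<phi> k))"
  using fam_mult[OF assms(1,2,2,3) fam_dif[OF assms(2)]] by (simp add: add.commute)

lemma fam_el_dd: assumes "bdd X" "bdd Y" "fam X Y n \<phi>"
  shows "fam X Y (n + 1) (\<lambda>k. Cmp A (\<phi> (k + 1)) (dif X k))"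
  using fam_mult[OF assms(1,1,2) fam_dif[OF assms(1)] assms(3)] .

lemma fam_sg: "\<lbrakk>bdd X; bdd Y; fam X Y m \<phi>\<rbrakk> \<Longrightarrow> fam X Y m (\<lambda>k. if even (n :: int) then \<phi> k else Neg A (\<phi> k))"
  using fam_neg[of X Y m \<phi>] by (cases "even n") auto

lemma el_sg: "\<lbrakk>bdd X; bdd Y; fam X Y m \<phi>\<rbrakk> \<Longrightarrow> sg n (el X Y m \<phi>) = el X Y m (\<lambda>k. if even n then \<phi> k else Neg A (\<phi> k))"
  using el_neg[of X Y m \<phi>] by (cases "even n") (auto simp: sg_def)

lemma sg_sg [simp]: "sg n (sg n x) = x"
  by (simp add: sg_def)

lemma chain_map_fam: "chain_map A X (shift A n Y) \<phi> \<Longrightarrow> fam X Y n \<phi>"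
  unfolding chain_map_def fam_def by simp

text \<open>The sign (-1)^n in the differential of Y[n] is precisely the Koszul sign in
  \<open>closed\<close>.\<close>

lemma chain_map_iff:
  assumes "bdd X" "bdd Y"
  shows "chain_map A X (shift A n Y) \<phi> \<longleftrightarrow> fam X Y n \<phi> \<and> closed X Y n (el X Y n \<phi>)"
proof (cases "fam X Y n \<phi>")
  case True
  have "chain_map A X (shift A n Y) \<phi> \<longleftrightarrow>
      (\<forall>k. (if even n then Cmp A (dif Y (k + n)) (\<phi> k) else Neg A (Cmp A (dif Y (k + n)) (\<phi> k))) = Cmp A (\<phi> (k + 1)) (dif X k))"
  proof -
    have "Cmp A (Neg A (dif Y (k + n))) (\<phi> k) = Neg A (Cmp A (dif Y (k + n)) (\<phi> k))" for k
      by (rule cmp_neg_left[of "cob X k" "cob Y (k + n)" "cob Y (k + n + 1)"])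
        (use True bdd_dif[OF assms(2)] in \<open>auto simp: fam_def bdd_obj assms\<close>)
    then show ?thesis using True unfolding chain_map_def fam_def by (auto simp: shift_dif)
  qed
  also have "\<dots> \<longleftrightarrow> sg n (dd Y * el X Y n \<phi>) = el X Y n \<phi> * dd X"
    unfolding dd_el[OF assms True] el_dd[OF assms True] el_sg[OF assms fam_dd_el[OF assms True]]
    using el_inject[OF assms fam_sg[OF assms fam_dd_el[OF assms True]] fam_el_dd[OF assms True]] by (simp add: fun_eq_iff)
  also have "\<dots> \<longleftrightarrow> dd Y * el X Y n \<phi> = sg n (el X Y n \<phi> * dd X)"
    using sg_sg by metis
  finally show ?thesis using True el_in[OF assms True] unfolding closed_def by simp
qed (auto dest: chain_map_fam)

lemma homotopic_iff:
  assumes "bdd X" "bdd Y" and \<phi>: "fam X Y n \<phi>" and \<psi>: "fam X Y n \<psi>"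
  shows "homotopic A X (shift A n Y) \<phi> \<psi> \<longleftrightarrow> bdry X Y n (el X Y n \<phi> - el X Y n \<psi>)"
proof -
  have d: "el X Y n \<phi> - el X Y n \<psi> = el X Y n (\<lambda>k. Add A (\<phi> k) (Neg A (\<psi> k)))"
    using el_neg[OF assms(1,2) \<psi>] el_add[OF assms(1,2) \<phi> fam_neg[OF assms(1,2) \<psi>]]
    by (simp only: diff_conv_add_uminus)
  have f: "fam X Y n (\<lambda>k. Add A (\<phi> k) (Neg A (\<psi> k)))" using fam_add[OF assms(1,2) \<phi> fam_neg[OF assms(1,2) \<psi>]] .
  have eq: "(\<forall>k. Add A (\<phi> k) (Neg A (\<psi> k)) =
        Add A (Cmp A (dif (shift A n Y) (k - 1)) (s k)) (Cmp A (s (k + 1)) (dif X k))) \<longleftrightarrow>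
      el X Y n \<phi> - el X Y n \<psi> = sg n (dd Y * el X Y (n - 1) s) + el X Y (n - 1) s * dd X"
    if s: "fam X Y (n - 1) s" for s
  proof -
    have n: "n - 1 + 1 = n" by simp
    note fs = fam_dd_el[OF assms(1,2) s, unfolded n] fam_el_dd[OF assms(1,2) s, unfolded n]
    have c: "Cmp A (dif (shift A n Y) (k - 1)) (s k) =
        (if even n then Cmp A (dif Y (k + (n - 1))) (s k) else Neg A (Cmp A (dif Y (k + (n - 1))) (s k)))" for k
    proof -
      have "s k \<in> Hom A (cob X k) (cob Y (k + (n - 1)))" using s unfolding fam_def by blast
      then show ?thesis
        using cmp_neg_left[OF _ _ _ _ bdd_dif[OF assms(2), of "k + (n - 1)"], of "cob X k" "s k"] bdd_obj[OF assms(1)] bdd_obj[OF assms(2)]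
        by (simp add: shift_dif algebra_simps)
    qed
    have "sg n (dd Y * el X Y (n - 1) s) + el X Y (n - 1) s * dd X =
       el X Y n (\<lambda>k. Add A (Cmp A (dif (shift A n Y) (k - 1)) (s k)) (Cmp A (s (k + 1)) (dif X k)))"
      unfolding dd_el[OF assms(1,2) s] el_dd[OF assms(1,2) s] n el_sg[OF assms(1,2) fs(1)]
        el_add[OF assms(1,2) fam_sg[OF assms(1,2) fs(1)] fs(2)] c by simp
    moreover have "fam X Y n (\<lambda>k. Add A (Cmp A (dif (shift A n Y) (k - 1)) (s k)) (Cmp A (s (k + 1)) (dif X k)))"
      using fam_add[OF assms(1,2) fam_sg[OF assms(1,2) fs(1), of n] fs(2)] unfolding c .
    ultimately show ?thesis using el_inject[OF assms(1,2) f] unfolding d by (simp add: fun_eq_iff)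
  qed
  have hf: "(\<forall>k. s k \<in> Hom A (cob X k) (cob (shift A n Y) (k - 1))) \<longleftrightarrow> fam X Y (n - 1) s" for s
    unfolding fam_def by (simp add: algebra_simps)
  have im: "gr.G X Y (n - 1) = el X Y (n - 1) ` {s. fam X Y (n - 1) s}" using el_in[OF assms(1,2)] by (auto elim!: G_el)
  have "homotopic A X (shift A n Y) \<phi> \<psi> \<longleftrightarrow>
      (\<exists>s. fam X Y (n - 1) s \<and> el X Y n \<phi> - el X Y n \<psi> = sg n (dd Y * el X Y (n - 1) s) + el X Y (n - 1) s * dd X)"
    unfolding homotopic_def hf using eq by blast
  also have "\<dots> \<longleftrightarrow> (\<exists>t\<in>gr.G X Y (n - 1). el X Y n \<phi> - el X Y n \<psi> = sg n (dd Y * t) + t * dd X)"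
    unfolding im by blast
  also have "\<dots> \<longleftrightarrow> bdry X Y n (el X Y n \<phi> - el X Y n \<psi>)"
  proof -
    \<comment> \<open>In \<open>homotopic\<close> the sign sits on dd Y * t, in \<open>bdry\<close>
      on t * dd X; replacing t by (-1)^n t passes from one convention to the other.\<close>
    have "sg n t \<in> gr.G X Y (n - 1)" if "t \<in> gr.G X Y (n - 1)" for t using that gr.G_neg by (simp add: sg_def)
    moreover have "dd Y * sg n t + sg n (sg n t * dd X) = sg n (dd Y * t) + t * dd X"
      "sg n (dd Y * sg n t) + sg n t * dd X = dd Y * t + sg n (t * dd X)" for t by (auto simp: sg_def)
    ultimately show ?thesis unfolding bdry_def by metis
  qed
  finally show ?thesis .
qed

lemma chain_map_iff0: "\<lbrakk>bdd X; bdd Y\<rbrakk> \<Longrightarrow> chain_map A X Y \<phi> \<longleftrightarrow> fam X Y 0 \<phi> \<and> closed X Y 0 (el X Y 0 \<phi>)"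
  using chain_map_iff[of X Y 0] by (simp add: shift_0)

lemma homotopic_iff0: "\<lbrakk>bdd X; bdd Y; fam X Y 0 \<phi>; fam X Y 0 \<psi>\<rbrakk> \<Longrightarrow>
    homotopic A X Y \<phi> \<psi> \<longleftrightarrow> bdry X Y 0 (el X Y 0 \<phi> - el X Y 0 \<psi>)"
  using homotopic_iff[of X Y 0] by (simp add: shift_0)

lemma closed_G: "closed X Y n x \<Longrightarrow> x \<in> gr.G X Y n"
  unfolding closed_def by blast

lemma closed_add: "closed X Y n x \<Longrightarrow> closed X Y n y \<Longrightarrow> closed X Y n (x + y)"
  unfolding closed_def by (auto simp: gr.G_add sg_def algebra_simps)

lemma closed_neg: "closed X Y n x \<Longrightarrow> closed X Y n (- x)"
  unfolding closed_def by (auto simp: gr.G_neg sg_def)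

lemma closed_diff: "closed X Y n x \<Longrightarrow> closed X Y n y \<Longrightarrow> closed X Y n (x - y)"
  using closed_add[OF _ closed_neg] by (metis add_uminus_conv_diff)

lemma closed_mult: assumes "closed X Y n x" "closed Y Z m y" shows "closed X Z (m + n) (y * x)"
proof -
  have "dd Z * (y * x) = sg m (y * dd Y) * x" using assms(2) unfolding closed_def by (simp add: mult.assoc[symmetric])
  also have "\<dots> = sg m (y * (dd Y * x))" by (simp add: sg_def mult.assoc)
  also have "\<dots> = sg (m + n) (y * x * dd X)" using assms(1) unfolding closed_def by (auto simp: sg_def mult.assoc)
  finally show ?thesis using assms gr.G_mult unfolding closed_def by blast
qed

lemma closed_unit: assumes "bdd X" shows "closed X X 0 (gr.unit X)"
  unfolding closed_def using assms gr.G_unit[of X] gr.G_unit_left[OF dd_in] gr.G_unit_right[OF dd_in] by (simp add: sg_def)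

lemma closed_zero: "bdd X \<Longrightarrow> bdd Y \<Longrightarrow> closed X Y n 0"
  unfolding closed_def using gr.G_zero[of X Y n] by (simp add: sg_def)

lemma bdry_zero: "bdd X \<Longrightarrow> bdd Y \<Longrightarrow> bdry X Y n 0"
  unfolding bdry_def using gr.G_zero[of X Y "n - 1"] by (intro bexI[of _ 0]) (auto simp: sg_def)

lemma bdry_add: assumes "bdry X Y n x" "bdry X Y n y" shows "bdry X Y n (x + y)"
proof -
  obtain s t where "s \<in> gr.G X Y (n - 1)" "x = dd Y * s + sg n (s * dd X)" "t \<in> gr.G X Y (n - 1)" "y = dd Y * t + sg n (t * dd X)"
    using assms unfolding bdry_def by blast
  then show ?thesis unfolding bdry_def by (intro bexI[of _ "s + t"]) (auto simp: sg_def algebra_simps gr.G_add)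
qed

lemma bdry_neg: assumes "bdry X Y n x" shows "bdry X Y n (- x)"
proof -
  obtain s where "s \<in> gr.G X Y (n - 1)" "x = dd Y * s + sg n (s * dd X)" using assms unfolding bdry_def by blast
  then show ?thesis unfolding bdry_def by (intro bexI[of _ "- s"]) (auto simp: sg_def algebra_simps gr.G_neg)
qed

lemma bdry_mult_left: assumes "closed Y Z 0 y" "bdry X Y 0 x" shows "bdry X Z 0 (y * x)"
proof -
  obtain s where s: "s \<in> gr.G X Y (- 1)" "x = dd Y * s + s * dd X" using assms(2) unfolding bdry_def sg_def by auto
  have y: "y \<in> gr.G Y Z 0" "dd Z * y = y * dd Y" using assms(1) unfolding closed_def sg_def by auto
  have "y * s \<in> gr.G X Z (0 - 1)" using gr.G_mult[OF y(1) s(1)] by simp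
  moreover have "y * x = dd Z * (y * s) + sg 0 (y * s * dd X)"
    unfolding s(2) using y(2)[THEN assoc_rule, of s] by (simp add: sg_def algebra_simps)
  ultimately show ?thesis unfolding bdry_def by blast
qed

lemma bdry_mult_right: assumes "closed X Y 0 x" "bdry Y Z 0 y" shows "bdry X Z 0 (y * x)"
proof -
  obtain s where s: "s \<in> gr.G Y Z (- 1)" "y = dd Z * s + s * dd Y" using assms(2) unfolding bdry_def sg_def by auto
  have x: "x \<in> gr.G X Y 0" "dd Y * x = x * dd X" using assms(1) unfolding closed_def sg_def by auto
  have "s * x \<in> gr.G X Z (0 - 1)" using gr.G_mult[OF s(1) x(1)] by simp
  moreover have "y * x = dd Z * (s * x) + sg 0 (s * x * dd X)"
    unfolding s(2) using x(2) by (simp add: sg_def algebra_simps)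
  ultimately show ?thesis unfolding bdry_def by blast
qed

subsection \<open>The homotopy category\<close>

definition kap :: "('o, 'f) cplx \<Rightarrow> ('o, 'f) cplx \<Rightarrow> (int \<Rightarrow> 'f) \<Rightarrow> ('o, 'f) karr" where
  "kap X Y \<phi> = (X, homotopy_class A X Y \<phi>, Y)"

lemma homotopicI: "\<lbrakk>bdd X; bdd Y; chain_map A X Y \<phi>; chain_map A X Y \<psi>; bdry X Y 0 (el X Y 0 \<phi> - el X Y 0 \<psi>)\<rbrakk> \<Longrightarrow>
    homotopic A X Y \<phi> \<psi>"
  by (simp add: homotopic_iff0 chain_map_iff0)

lemma homotopic_refl: "\<lbrakk>bdd X; bdd Y; chain_map A X Y \<phi>\<rbrakk> \<Longrightarrow> homotopic A X Y \<phi> \<phi>"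
  by (simp add: homotopic_iff0 chain_map_iff0 bdry_zero)

lemma homotopic_sym: "\<lbrakk>bdd X; bdd Y; chain_map A X Y \<phi>; chain_map A X Y \<psi>; homotopic A X Y \<phi> \<psi>\<rbrakk> \<Longrightarrow> homotopic A X Y \<psi> \<phi>"
  using bdry_neg by (fastforce simp: homotopic_iff0 chain_map_iff0)

lemma homotopic_trans: "\<lbrakk>bdd X; bdd Y; chain_map A X Y \<phi>; chain_map A X Y \<psi>; chain_map A X Y \<chi>;
    homotopic A X Y \<phi> \<psi>; homotopic A X Y \<psi> \<chi>\<rbrakk> \<Longrightarrow> homotopic A X Y \<phi> \<chi>"
  using bdry_add by (fastforce simp: homotopic_iff0 chain_map_iff0)

lemma class_eq:
  assumes "bdd X" "bdd Y" "chain_map A X Y \<phi>" "chain_map A X Y \<psi>"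
  shows "homotopy_class A X Y \<phi> = homotopy_class A X Y \<psi> \<longleftrightarrow> homotopic A X Y \<phi> \<psi>"
proof
  assume "homotopy_class A X Y \<phi> = homotopy_class A X Y \<psi>"
  moreover have "\<psi> \<in> homotopy_class A X Y \<psi>" unfolding homotopy_class_def using assms homotopic_refl by blast
  ultimately show "homotopic A X Y \<phi> \<psi>" unfolding homotopy_class_def by blast
next
  assume "homotopic A X Y \<phi> \<psi>"
  then show "homotopy_class A X Y \<phi> = homotopy_class A X Y \<psi>"
    unfolding homotopy_class_def using homotopic_trans[OF assms(1,2)] homotopic_sym[OF assms(1,2)] assms(3,4) by blast
qed

lemma class_self: "\<lbrakk>bdd X; bdd Y; chain_map A X Y \<phi>\<rbrakk> \<Longrightarrow> \<phi> \<in> homotopy_class A X Y \<phi>"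
  unfolding homotopy_class_def using homotopic_refl by blast

lemma kap_eq: "\<lbrakk>bdd X; bdd Y; chain_map A X Y \<phi>; chain_map A X Y \<psi>\<rbrakk> \<Longrightarrow> kap X Y \<phi> = kap X Y \<psi> \<longleftrightarrow> homotopic A X Y \<phi> \<psi>"
  unfolding kap_def using class_eq by simp

lemma chain_map_cmp:
  assumes "bdd X" "bdd Y" "bdd Z" "chain_map A X Y \<phi>" "chain_map A Y Z \<gamma>"
  shows "chain_map A X Z (\<lambda>n. Cmp A (\<gamma> n) (\<phi> n))"
    "el X Z 0 (\<lambda>n. Cmp A (\<gamma> n) (\<phi> n)) = el Y Z 0 \<gamma> * el X Y 0 \<phi>"
proof -
  have f: "fam X Y 0 \<phi>" "closed X Y 0 (el X Y 0 \<phi>)" "fam Y Z 0 \<gamma>" "closed Y Z 0 (el Y Z 0 \<gamma>)"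
    using assms chain_map_iff0 by auto
  show 1: "el X Z 0 (\<lambda>n. Cmp A (\<gamma> n) (\<phi> n)) = el Y Z 0 \<gamma> * el X Y 0 \<phi>" using el_mult[OF assms(1-3) f(1,3)] by simp
  show "chain_map A X Z (\<lambda>n. Cmp A (\<gamma> n) (\<phi> n))"
    unfolding chain_map_iff0[OF assms(1,3)] 1 using closed_mult[OF f(2,4)] fam_mult[OF assms(1-3) f(1,3)] by simp
qed

lemma chain_map_add:
  assumes "bdd X" "bdd Y" "chain_map A X Y \<phi>" "chain_map A X Y \<gamma>"
  shows "chain_map A X Y (\<lambda>n. Add A (\<phi> n) (\<gamma> n))"
    "el X Y 0 (\<lambda>n. Add A (\<phi> n) (\<gamma> n)) = el X Y 0 \<phi> + el X Y 0 \<gamma>"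
proof -
  have f: "fam X Y 0 \<phi>" "closed X Y 0 (el X Y 0 \<phi>)" "fam X Y 0 \<gamma>" "closed X Y 0 (el X Y 0 \<gamma>)"
    using assms chain_map_iff0 by auto
  show 1: "el X Y 0 (\<lambda>n. Add A (\<phi> n) (\<gamma> n)) = el X Y 0 \<phi> + el X Y 0 \<gamma>" using el_add[OF assms(1,2) f(1,3)] by simp
  show "chain_map A X Y (\<lambda>n. Add A (\<phi> n) (\<gamma> n))"
    unfolding chain_map_iff0[OF assms(1,2)] 1 using closed_add[OF f(2,4)] fam_add[OF assms(1,2) f(1,3)] by simp
qed

lemma chain_map_neg:
  assumes "bdd X" "bdd Y" "chain_map A X Y \<phi>"
  shows "chain_map A X Y (\<lambda>n. Neg A (\<phi> n))" "el X Y 0 (\<lambda>n. Neg A (\<phi> n)) = - el X Y 0 \<phi>"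
proof -
  have f: "fam X Y 0 \<phi>" "closed X Y 0 (el X Y 0 \<phi>)" using assms chain_map_iff0 by auto
  show 1: "el X Y 0 (\<lambda>n. Neg A (\<phi> n)) = - el X Y 0 \<phi>" using el_neg[OF assms(1,2) f(1)] by simp
  show "chain_map A X Y (\<lambda>n. Neg A (\<phi> n))"
    unfolding chain_map_iff0[OF assms(1,2)] 1 using closed_neg[OF f(2)] fam_neg[OF assms(1,2) f(1)] by simp
qed

lemma chain_map_zero:
  assumes "bdd X" "bdd Y" shows "chain_map A X Y (\<lambda>n. Zer A (cob X n) (cob Y n))"
  unfolding chain_map_iff0[OF assms] using fam_zero[OF assms, of 0] el_zero[OF assms, of 0] closed_zero[OF assms, of 0] by simp

lemma chain_map_unit:
  assumes "bdd X" shows "chain_map A X X (\<lambda>n. Idn A (cob X n))"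
  unfolding chain_map_iff0[OF assms assms] using fam_unit[OF assms] el_unit[OF assms] closed_unit[OF assms] by simp

text \<open>The union over representatives is a single class, since the difference of two composites
  telescopes into (g - g') * f + g' * (f - f').\<close>

lemma K_cmp_kap:
  assumes b: "bdd X" "bdd Y" "bdd Z" and c: "chain_map A X Y \<phi>" "chain_map A Y Z \<gamma>"
  shows "Cmp KA (kap Y Z \<gamma>) (kap X Y \<phi>) = kap X Z (\<lambda>n. Cmp A (\<gamma> n) (\<phi> n))"
proof -
  have "homotopy_class A X Z (\<lambda>n. Cmp A (\<gamma>' n) (\<phi>' n)) = homotopy_class A X Z (\<lambda>n. Cmp A (\<gamma> n) (\<phi> n))"
    if "\<phi>' \<in> homotopy_class A X Y \<phi>" "\<gamma>' \<in> homotopy_class A Y Z \<gamma>" for \<phi>' \<gamma>'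
  proof -
    have c': "chain_map A X Y \<phi>'" "chain_map A Y Z \<gamma>'" "homotopic A X Y \<phi> \<phi>'" "homotopic A Y Z \<gamma> \<gamma>'"
      using that unfolding homotopy_class_def by auto
    note m = chain_map_cmp(1)[OF b c] chain_map_cmp(1)[OF b c'(1,2)]
    let ?f = "el X Y 0 \<phi>" and ?f' = "el X Y 0 \<phi>'" and ?g = "el Y Z 0 \<gamma>" and ?g' = "el Y Z 0 \<gamma>'"
    have d: "bdry X Y 0 (?f - ?f')" "bdry Y Z 0 (?g - ?g')" "closed X Y 0 ?f" "closed Y Z 0 ?g'"
      using c c' by (simp_all add: homotopic_iff0 chain_map_iff0 b)
    have "bdry X Z 0 ((?g - ?g') * ?f + ?g' * (?f - ?f'))"
      by (rule bdry_add[OF bdry_mult_right[OF d(3,2)] bdry_mult_left[OF d(4,1)]])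
    then have "bdry X Z 0 (?g * ?f - ?g' * ?f')" by (simp add: algebra_simps)
    then have "homotopic A X Z (\<lambda>n. Cmp A (\<gamma> n) (\<phi> n)) (\<lambda>n. Cmp A (\<gamma>' n) (\<phi>' n))"
      by (intro homotopicI[OF b(1,3) m]) (simp only: chain_map_cmp(2)[OF b c] chain_map_cmp(2)[OF b c'(1,2)])
    then show ?thesis using class_eq[OF b(1,3) m] by simp
  qed
  from UN_UN_const[OF class_self[OF b(1,2) c(1)] class_self[OF b(2,3) c(2)] this]
  show ?thesis unfolding kap_def Kb_def by simp
qed

lemma K_add_kap:
  assumes b: "bdd X" "bdd Y" and c: "chain_map A X Y \<phi>" "chain_map A X Y \<gamma>"
  shows "Add KA (kap X Y \<phi>) (kap X Y \<gamma>) = kap X Y (\<lambda>n. Add A (\<phi> n) (\<gamma> n))"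
proof -
  have "homotopy_class A X Y (\<lambda>n. Add A (\<phi>' n) (\<gamma>' n)) = homotopy_class A X Y (\<lambda>n. Add A (\<phi> n) (\<gamma> n))"
    if "\<phi>' \<in> homotopy_class A X Y \<phi>" "\<gamma>' \<in> homotopy_class A X Y \<gamma>" for \<phi>' \<gamma>'
  proof -
    have c': "chain_map A X Y \<phi>'" "chain_map A X Y \<gamma>'" "homotopic A X Y \<phi> \<phi>'" "homotopic A X Y \<gamma> \<gamma>'"
      using that unfolding homotopy_class_def by auto
    note m = chain_map_add(1)[OF b c] chain_map_add(1)[OF b c'(1,2)]
    let ?f = "el X Y 0 \<phi>" and ?f' = "el X Y 0 \<phi>'" and ?g = "el X Y 0 \<gamma>" and ?g' = "el X Y 0 \<gamma>'"
    have "bdry X Y 0 (?f - ?f')" "bdry X Y 0 (?g - ?g')" using c c' by (simp_all add: homotopic_iff0 chain_map_iff0 b)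
    from bdry_add[OF this] have "bdry X Y 0 ((?f + ?g) - (?f' + ?g'))" by (simp add: algebra_simps)
    then have "homotopic A X Y (\<lambda>n. Add A (\<phi> n) (\<gamma> n)) (\<lambda>n. Add A (\<phi>' n) (\<gamma>' n))"
      by (intro homotopicI[OF b m]) (simp only: chain_map_add(2)[OF b c] chain_map_add(2)[OF b c'(1,2)])
    then show ?thesis using class_eq[OF b m] by simp
  qed
  from UN_UN_const[OF class_self[OF b c(1)] class_self[OF b c(2)] this]
  show ?thesis unfolding kap_def Kb_def by simp
qed

lemma K_neg_kap:
  assumes b: "bdd X" "bdd Y" and c: "chain_map A X Y \<phi>"
  shows "Neg KA (kap X Y \<phi>) = kap X Y (\<lambda>n. Neg A (\<phi> n))"
proof -
  have "homotopy_class A X Y (\<lambda>n. Neg A (\<phi>' n)) = homotopy_class A X Y (\<lambda>n. Neg A (\<phi> n))"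
    if "\<phi>' \<in> homotopy_class A X Y \<phi>" for \<phi>'
  proof -
    have c': "chain_map A X Y \<phi>'" "homotopic A X Y \<phi> \<phi>'" using that unfolding homotopy_class_def by auto
    note m = chain_map_neg(1)[OF b c] chain_map_neg(1)[OF b c'(1)]
    let ?f = "el X Y 0 \<phi>" and ?f' = "el X Y 0 \<phi>'"
    have "bdry X Y 0 (?f - ?f')" using c c' by (simp add: homotopic_iff0 chain_map_iff0 b)
    from bdry_neg[OF this] have "bdry X Y 0 (- ?f - - ?f')" by simp
    then have "homotopic A X Y (\<lambda>n. Neg A (\<phi> n)) (\<lambda>n. Neg A (\<phi>' n))"
      by (intro homotopicI[OF b m]) (simp only: chain_map_neg(2)[OF b c] chain_map_neg(2)[OF b c'(1)])
    then show ?thesis using class_eq[OF b m] by simp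
  qed
  then have "(\<Union>\<phi>'\<in>homotopy_class A X Y \<phi>. homotopy_class A X Y (\<lambda>n. Neg A (\<phi>' n))) =
      (\<Union>\<phi>'\<in>homotopy_class A X Y \<phi>. homotopy_class A X Y (\<lambda>n. Neg A (\<phi> n)))"
    by (intro SUP_cong refl) auto
  then show ?thesis unfolding kap_def Kb_def using class_self[OF b c] by auto
qed

lemma Kb_obj [simp]: "X \<in> Obj KA \<longleftrightarrow> bdd X"
  by (simp add: Kb_def)

lemma Kb_homE: assumes "f \<in> Hom KA X Y" obtains \<phi> where "f = kap X Y \<phi>" "chain_map A X Y \<phi>"
  using assms unfolding Kb_def kap_def by auto

lemma Kb_homI: "chain_map A X Y \<phi> \<Longrightarrow> kap X Y \<phi> \<in> Hom KA X Y"
  unfolding Kb_def kap_def by auto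

lemma Kb_idn: "Idn KA X = kap X X (\<lambda>n. Idn A (cob X n))"
  and Kb_zer: "Zer KA X Y = kap X Y (\<lambda>n. Zer A (cob X n) (cob Y n))"
  unfolding Kb_def kap_def by auto

lemma chain_map_hom: "chain_map A X Y \<phi> \<Longrightarrow> \<phi> n \<in> Hom A (cob X n) (cob Y n)"
  unfolding chain_map_def by blast

lemma kap_cong: "(\<And>n. \<phi> n = \<psi> n) \<Longrightarrow> kap X Y \<phi> = kap X Y \<psi>"
  by (metis ext)

lemma preadd_Kb: "preadd KA"
proof (unfold_locales, goal_cases)
  case 1 then show ?case by (auto elim!: Kb_homE simp: K_cmp_kap intro!: Kb_homI chain_map_cmp)
next
  case 2 then show ?case
    by (auto elim!: Kb_homE simp: K_cmp_kap chain_map_cmp intro!: kap_cong cmp_assoc[OF chain_map_hom chain_map_hom chain_map_hom] bdd_obj)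
next
  case 3 then show ?case by (auto simp: Kb_idn intro!: Kb_homI chain_map_unit)
next
  case 4 then show ?case by (auto elim!: Kb_homE simp: Kb_idn K_cmp_kap chain_map_unit intro!: kap_cong idn_left[OF chain_map_hom] bdd_obj)
next
  case 5 then show ?case by (auto elim!: Kb_homE simp: Kb_idn K_cmp_kap chain_map_unit intro!: kap_cong idn_right[OF chain_map_hom] bdd_obj)
next
  case 6 then show ?case by (auto elim!: Kb_homE simp: K_add_kap intro!: Kb_homI chain_map_add)
next
  case 7 then show ?case by (auto simp: Kb_zer intro!: Kb_homI chain_map_zero)
next
  case 8 then show ?case by (auto elim!: Kb_homE simp: K_neg_kap intro!: Kb_homI chain_map_neg)
next
  case 9 then show ?case by (auto elim!: Kb_homE simp: K_add_kap chain_map_add intro!: kap_cong add_assoc[OF chain_map_hom chain_map_hom chain_map_hom] bdd_obj)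
next
  case 10 then show ?case by (auto elim!: Kb_homE simp: K_add_kap intro!: kap_cong add_comm[OF chain_map_hom chain_map_hom] bdd_obj)
next
  case 11 then show ?case by (auto elim!: Kb_homE simp: Kb_zer K_add_kap chain_map_zero intro!: kap_cong add_zer[OF chain_map_hom] bdd_obj)
next
  case 12 then show ?case by (auto elim!: Kb_homE simp: Kb_zer K_add_kap K_neg_kap chain_map_neg intro!: kap_cong add_neg[OF chain_map_hom] bdd_obj)
next
  case 13 then show ?case by (auto elim!: Kb_homE simp: K_add_kap K_cmp_kap chain_map_add chain_map_cmp
      intro!: kap_cong cmp_add_left[OF chain_map_hom chain_map_hom chain_map_hom] bdd_obj)
next
  case 14 then show ?case by (auto elim!: Kb_homE simp: K_add_kap K_cmp_kap chain_map_add chain_map_cmp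
      intro!: kap_cong cmp_add_right[OF chain_map_hom chain_map_hom chain_map_hom] bdd_obj)
qed

end

section \<open>The shift on the homotopy category and classes of closed elements\<close>

definition Kb_shift :: "('o, 'f) precat \<Rightarrow> int \<Rightarrow> ('o, 'f) karr \<Rightarrow> ('o, 'f) karr" where
  "Kb_shift A k = (\<lambda>(X, F, Y). (shift A k X, (\<lambda>\<phi> n. \<phi> (n + k)) ` F, shift A k Y))"

context additive_cat
begin

lemma chain_map_shift:
  assumes b: "bdd X" "bdd Y" and c: "chain_map A X Y \<phi>"
  shows "chain_map A (shift A k X) (shift A k Y) (\<lambda>n. \<phi> (n + k))"
  unfolding chain_map_def
proof (intro allI conjI)
  fix n
  have h: "\<phi> m \<in> Hom A (cob X m) (cob Y m)" "Cmp A (dif Y m) (\<phi> m) = Cmp A (\<phi> (m + 1)) (dif X m)" for m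
    using c unfolding chain_map_def by auto
  show "\<phi> (n + k) \<in> Hom A (cob (shift A k X) n) (cob (shift A k Y) n)" using h by simp
  have "Cmp A (Neg A (dif Y (n + k))) (\<phi> (n + k)) = Neg A (Cmp A (dif Y (n + k)) (\<phi> (n + k)))"
    by (rule cmp_neg_left[OF _ _ _ h(1) bdd_dif[OF b(2)]]) (use b bdd_obj in auto)
  moreover have "Cmp A (\<phi> (n + k + 1)) (Neg A (dif X (n + k))) = Neg A (Cmp A (\<phi> (n + k + 1)) (dif X (n + k)))"
    by (rule cmp_neg_right[OF _ _ _ bdd_dif[OF b(1)] h(1)]) (use b bdd_obj in auto)
  moreover have e: "n + 1 + k = n + k + 1" by simp
  ultimately show "Cmp A (dif (shift A k Y) n) (\<phi> (n + k)) = Cmp A (\<phi> (n + 1 + k)) (dif (shift A k X) n)"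
    unfolding e using h(2)[of "n + k"] by (simp add: shift_dif)
qed

lemma homotopic_shift:
  assumes b: "bdd X" "bdd Y" and h: "homotopic A X Y \<phi> \<psi>"
  shows "homotopic A (shift A k X) (shift A k Y) (\<lambda>n. \<phi> (n + k)) (\<lambda>n. \<psi> (n + k))"
proof -
  obtain s where s: "\<And>n. s n \<in> Hom A (cob X n) (cob Y (n - 1))"
    "\<And>n. Add A (\<phi> n) (Neg A (\<psi> n)) = Add A (Cmp A (dif Y (n - 1)) (s n)) (Cmp A (s (n + 1)) (dif X n))"
    using h unfolding homotopic_def by blast
  let ?t = "\<lambda>n. if even k then s (n + k) else Neg A (s (n + k))"
  note o = bdd_obj[OF b(1)] bdd_obj[OF b(2)]
  have d: "dif Y (n - 1) \<in> Hom A (cob Y (n - 1)) (cob Y n)" for n using bdd_dif[OF b(2), of "n - 1"] by simp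
  have s1: "s (n + 1) \<in> Hom A (cob X (n + 1)) (cob Y n)" for n using s(1)[of "n + 1"] by simp
  have t: "?t n \<in> Hom A (cob (shift A k X) n) (cob (shift A k Y) (n - 1))" for n
    using s(1)[of "n + k"] neg_in[OF s(1)[of "n + k"] o] by (simp add: algebra_simps)
  have n1: "Cmp A (Neg A (dif Y (n - 1))) (Neg A (s n)) = Cmp A (dif Y (n - 1)) (s n)" for n
    using cmp_neg_left[OF o(1) o(2) o(2) neg_in[OF s(1) o] d] cmp_neg_right[OF o(1) o(2) o(2) s(1) d]
      neg_neg[OF o cmp_in[OF d s(1) o(1) o(2) o(2)]] by simp
  have n2: "Cmp A (Neg A (s (n + 1))) (Neg A (dif X n)) = Cmp A (s (n + 1)) (dif X n)" for n
    using cmp_neg_left[OF o(1) o(1) o(2) neg_in[OF bdd_dif[OF b(1)] o(1) o(1)] s1]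
      cmp_neg_right[OF o(1) o(1) o(2) bdd_dif[OF b(1)] s1] neg_neg[OF o cmp_in[OF s1 bdd_dif[OF b(1)] o(1) o(1) o(2)]] by simp
  have "Add A (\<phi> (n + k)) (Neg A (\<psi> (n + k))) =
      Add A (Cmp A (dif (shift A k Y) (n - 1)) (?t n)) (Cmp A (?t (n + 1)) (dif (shift A k X) n))" for n
  proof -
    have e: "n - 1 + k = n + k - 1" "n + 1 + k = n + k + 1" by auto
    show ?thesis unfolding s(2)[of "n + k"] shift_dif e using n1[of "n + k"] n2[of "n + k"] by simp
  qed
  then show ?thesis unfolding homotopic_def by (intro exI[of _ ?t] conjI allI t) auto
qed

lemma Kb_shift_kap:
  assumes b: "bdd X" "bdd Y" and c: "chain_map A X Y \<phi>"
  shows "Kb_shift A k (kap X Y \<phi>) = kap (shift A k X) (shift A k Y) (\<lambda>n. \<phi> (n + k))"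
proof -
  have "(\<lambda>\<phi> n. \<phi> (n + k)) ` homotopy_class A X Y \<phi> = homotopy_class A (shift A k X) (shift A k Y) (\<lambda>n. \<phi> (n + k))"
  proof
    show "(\<lambda>\<phi> n. \<phi> (n + k)) ` homotopy_class A X Y \<phi> \<subseteq> homotopy_class A (shift A k X) (shift A k Y) (\<lambda>n. \<phi> (n + k))"
      unfolding homotopy_class_def using chain_map_shift[OF b] homotopic_shift[OF b] by blast
    show "homotopy_class A (shift A k X) (shift A k Y) (\<lambda>n. \<phi> (n + k)) \<subseteq> (\<lambda>\<phi> n. \<phi> (n + k)) ` homotopy_class A X Y \<phi>"
    proof
      fix \<chi> assume "\<chi> \<in> homotopy_class A (shift A k X) (shift A k Y) (\<lambda>n. \<phi> (n + k))"
      then have \<chi>: "chain_map A (shift A k X) (shift A k Y) \<chi>" "homotopic A (shift A k X) (shift A k Y) (\<lambda>n. \<phi> (n + k)) \<chi>"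
        unfolding homotopy_class_def by auto
      let ?\<psi> = "\<lambda>n. \<chi> (n + - k)"
      have "chain_map A X Y ?\<psi>"
        using chain_map_shift[OF bdd_shift[OF b(1)] bdd_shift[OF b(2)] \<chi>(1), of "- k"] by (simp add: shift_shift b shift_0)
      moreover have "homotopic A X Y \<phi> ?\<psi>"
        using homotopic_shift[OF bdd_shift[OF b(1)] bdd_shift[OF b(2)] \<chi>(2), of "- k"] by (simp add: shift_shift b shift_0)
      moreover have "\<chi> = (\<lambda>n. ?\<psi> (n + k))" by simp
      ultimately show "\<chi> \<in> (\<lambda>\<phi> n. \<phi> (n + k)) ` homotopy_class A X Y \<phi>"
        unfolding homotopy_class_def by (intro image_eqI[of _ _ ?\<psi>] CollectI conjI)
    qed
  qed
  then show ?thesis unfolding Kb_shift_def kap_def by simp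
qed

lemma shift_category_Kb: "shift_category KA (shift A) (Kb_shift A)"
proof (intro shift_category.intro preadd_Kb, unfold_locales, goal_cases)
  case 1 then show ?case by (simp add: bdd_shift)
next
  case 2 then show ?case by (simp add: shift_shift)
next
  case 3 then show ?case by (simp add: shift_0)
next
  case 4 then show ?case by (auto elim!: Kb_homE simp: Kb_shift_kap intro!: Kb_homI chain_map_shift)
next
  case 5 then show ?case by (auto elim!: Kb_homE simp: Kb_shift_kap chain_map_shift bdd_shift shift_shift add.assoc)
next
  case 6 then show ?case by (auto elim!: Kb_homE simp: Kb_shift_kap shift_0)
next
  case 7 then show ?case by (auto elim!: Kb_homE simp: Kb_shift_kap K_cmp_kap chain_map_cmp chain_map_shift bdd_shift)
next
  case 8 then show ?case by (auto elim!: Kb_homE simp: Kb_shift_kap K_add_kap chain_map_add chain_map_shift bdd_shift)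
next
  case 9 then show ?case by (auto simp: Kb_idn Kb_shift_kap chain_map_unit)
qed

sublocale kb: shift_category "Kb A" "shift A" "Kb_shift A"
  by (rule shift_category_Kb)

text \<open>The class in the homotopy category of a closed element of the graded ring.\<close>

definition family_of where
  "family_of X Y n x = (THE \<phi>. fam X Y n \<phi> \<and> x = el X Y n \<phi>)"

definition cls where
  "cls X Y n x = kb.gel X Y n (kap X (shift A n Y) (family_of X Y n x))"

lemma family_of_el: "\<lbrakk>bdd X; bdd Y; fam X Y n \<phi>\<rbrakk> \<Longrightarrow> family_of X Y n (el X Y n \<phi>) = \<phi>"
  unfolding family_of_def using el_inject[of X Y n] by (intro the_equality) auto

lemma closedE:
  assumes "closed X Y n x"
  obtains \<phi> where "bdd X" "bdd Y" "fam X Y n \<phi>" "x = el X Y n \<phi>" "chain_map A X (shift A n Y) \<phi>"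
    "cls X Y n x = kb.gel X Y n (kap X (shift A n Y) \<phi>)"
proof -
  obtain \<phi> where f: "bdd X" "bdd Y" "fam X Y n \<phi>" "x = el X Y n \<phi>" using G_el closed_G[OF assms] by blast
  then have "chain_map A X (shift A n Y) \<phi>" using chain_map_iff assms by blast
  then show ?thesis using that[OF f] family_of_el[OF f(1-3)] unfolding cls_def f(4) by simp
qed

lemma cls_el: "\<lbrakk>bdd X; bdd Y; fam X Y n \<phi>\<rbrakk> \<Longrightarrow> cls X Y n (el X Y n \<phi>) = kb.gel X Y n (kap X (shift A n Y) \<phi>)"
  unfolding cls_def by (simp add: family_of_el)

lemma cls_in: "closed X Y n x \<Longrightarrow> cls X Y n x \<in> kb.G X Y n"
  by (erule closedE) (auto intro!: kb.gel_in Kb_homI)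

lemma cls_surj:
  assumes "u \<in> kb.G X Y n"
  obtains x where "closed X Y n x" "u = cls X Y n x"
proof -
  obtain f where f: "bdd X" "bdd Y" "f \<in> Hom KA X (shift A n Y)" "u = kb.gel X Y n f"
    using assms by (auto elim!: kb.G_E)
  then obtain \<phi> where \<phi>: "f = kap X (shift A n Y) \<phi>" "chain_map A X (shift A n Y) \<phi>" by (auto elim!: Kb_homE)
  then have "fam X Y n \<phi>" "closed X Y n (el X Y n \<phi>)" using chain_map_iff f by auto
  then show ?thesis using that[of "el X Y n \<phi>"] cls_el f \<phi> by simp
qed

lemma cls_mult:
  assumes "closed X Y n x" "closed Y Z m y"
  shows "cls Y Z m y * cls X Y n x = cls X Z (m + n) (y * x)"
proof -
  obtain \<phi> where f: "bdd X" "bdd Y" "fam X Y n \<phi>" "x = el X Y n \<phi>" "chain_map A X (shift A n Y) \<phi>"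
    "cls X Y n x = kb.gel X Y n (kap X (shift A n Y) \<phi>)" using closedE[OF assms(1)] .
  obtain \<psi> where g: "bdd Y" "bdd Z" "fam Y Z m \<psi>" "y = el Y Z m \<psi>" "chain_map A Y (shift A m Z) \<psi>"
    "cls Y Z m y = kb.gel Y Z m (kap Y (shift A m Z) \<psi>)" using closedE[OF assms(2)] .
  have "cls Y Z m y * cls X Y n x =
      kb.gel X Z (m + n) (Cmp KA (Kb_shift A n (kap Y (shift A m Z) \<psi>)) (kap X (shift A n Y) \<phi>))"
    unfolding f(6) g(6) by (rule kb.gel_mult) (use f g in \<open>auto intro: Kb_homI\<close>)
  also have "Kb_shift A n (kap Y (shift A m Z) \<psi>) = kap (shift A n Y) (shift A (m + n) Z) (\<lambda>k. \<psi> (k + n))"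
    using Kb_shift_kap[OF g(1) bdd_shift[OF g(2)] g(5)] g(2) by (simp add: shift_shift add.commute)
  also have "Cmp KA \<dots> (kap X (shift A n Y) \<phi>) = kap X (shift A (m + n) Z) (\<lambda>k. Cmp A (\<psi> (k + n)) (\<phi> k))"
    using chain_map_shift[OF g(1) bdd_shift[OF g(2)] g(5), of n] f g
    by (intro K_cmp_kap) (auto simp: bdd_shift shift_shift add.commute)
  also have "kb.gel X Z (m + n) \<dots> = cls X Z (m + n) (y * x)"
    unfolding f(4) g(4) el_mult[OF f(1,2) g(2) f(3) g(3)]
    using cls_el[OF f(1) g(2) fam_mult[OF f(1,2) g(2) f(3) g(3)]] by simp
  finally show ?thesis .
qed

lemma cls_add:
  assumes "closed X Y n x" "closed X Y n y"
  shows "cls X Y n (x + y) = cls X Y n x + cls X Y n y"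
proof -
  obtain \<phi> where f: "bdd X" "bdd Y" "fam X Y n \<phi>" "x = el X Y n \<phi>" "chain_map A X (shift A n Y) \<phi>"
    "cls X Y n x = kb.gel X Y n (kap X (shift A n Y) \<phi>)" using closedE[OF assms(1)] .
  obtain \<psi> where g: "fam X Y n \<psi>" "y = el X Y n \<psi>" "chain_map A X (shift A n Y) \<psi>"
    "cls X Y n y = kb.gel X Y n (kap X (shift A n Y) \<psi>)" using closedE[OF assms(2)] .
  have "cls X Y n x + cls X Y n y = kb.gel X Y n (Add KA (kap X (shift A n Y) \<phi>) (kap X (shift A n Y) \<psi>))"
    unfolding f(6) g(4) by (rule kb.gel_add) (use f g in \<open>auto intro: Kb_homI\<close>)
  also have "\<dots> = kb.gel X Y n (kap X (shift A n Y) (\<lambda>k. Add A (\<phi> k) (\<psi> k)))"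
    using f g by (simp add: K_add_kap bdd_shift)
  also have "\<dots> = cls X Y n (x + y)"
    unfolding f(4) g(2) el_add[OF f(1,2,3) g(1)] using cls_el[OF f(1,2) fam_add[OF f(1,2,3) g(1)]] by simp
  finally show ?thesis by simp
qed

lemma cls_zero_iff:
  assumes "closed X Y n x" shows "cls X Y n x = 0 \<longleftrightarrow> bdry X Y n x"
proof -
  obtain \<phi> where f: "bdd X" "bdd Y" "fam X Y n \<phi>" "x = el X Y n \<phi>" "chain_map A X (shift A n Y) \<phi>"
    "cls X Y n x = kb.gel X Y n (kap X (shift A n Y) \<phi>)" using closedE[OF assms] .
  let ?z = "\<lambda>k. Zer A (cob X k) (cob Y (k + n))"
  have z: "fam X Y n ?z" "el X Y n ?z = 0" using fam_zero el_zero f by auto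
  have cz: "chain_map A X (shift A n Y) ?z" using chain_map_zero[OF f(1) bdd_shift[OF f(2)], of n] by simp
  have "cls X Y n x = 0 \<longleftrightarrow> kb.gel X Y n (kap X (shift A n Y) \<phi>) = kb.gel X Y n (kap X (shift A n Y) ?z)"
    unfolding f(6) using kb.gel_zer[of X Y n] f(1,2) by (simp add: Kb_zer)
  also have "\<dots> \<longleftrightarrow> kap X (shift A n Y) \<phi> = kap X (shift A n Y) ?z"
    by (rule kb.gel_inject) (use f cz in \<open>auto intro: Kb_homI\<close>)
  also have "\<dots> \<longleftrightarrow> homotopic A X (shift A n Y) \<phi> ?z" using kap_eq[OF f(1) bdd_shift[OF f(2)] f(5) cz] .
  also have "\<dots> \<longleftrightarrow> bdry X Y n x" using homotopic_iff[OF f(1-3) z(1)] unfolding f(4) z(2) by simp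
  finally show ?thesis .
qed

lemma cls_neg: assumes "closed X Y n x" shows "cls X Y n (- x) = - cls X Y n x"
proof -
  have "bdd X" "bdd Y" using closedE[OF assms] by auto
  then have "cls X Y n (x + - x) = 0" using cls_zero_iff[OF closed_zero] bdry_zero by simp
  then have "cls X Y n x + cls X Y n (- x) = 0" using cls_add[OF assms closed_neg[OF assms]] by simp
  then show ?thesis by (simp add: add_eq_0_iff)
qed

lemma cls_diff: "\<lbrakk>closed X Y n x; closed X Y n y\<rbrakk> \<Longrightarrow> cls X Y n (x - y) = cls X Y n x - cls X Y n y"
  using cls_add[of X Y n x "- y"] cls_neg[of X Y n y] closed_neg[of X Y n y] by simp

lemma cls_eq_iff: "\<lbrakk>closed X Y n x; closed X Y n y\<rbrakk> \<Longrightarrow> cls X Y n x = cls X Y n y \<longleftrightarrow> bdry X Y n (x - y)"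
  using cls_zero_iff[OF closed_diff] cls_diff by force

lemma cls_unit: "bdd X \<Longrightarrow> cls X X 0 (gr.unit X) = kb.unit X"
  using cls_el[of X X 0 "\<lambda>k. Idn A (cob X k)"] fam_unit[of X] el_unit[of X] kb.unit_eq_gel[of X]
  by (simp add: Kb_idn shift_0)

lemma mem_gr:
  assumes "f \<in> gr.G X Y n"
  shows "gr.unit Y * f = f" "f * gr.unit X = f" "gr.unit Y * (f * w) = f * w" "f * (gr.unit X * w) = f * w"
  using gr.G_unit_left[OF assms] gr.G_unit_right[OF assms]
    gr.G_unit_left[OF assms, THEN assoc_rule] gr.G_unit_right[OF assms, THEN assoc_rule] by auto

section \<open>Mapping cones with a chosen splitting\<close>

text \<open>Z is a cone of x together with a degreewise splitting. The inclusion i and the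
  projection p belong to X[1] and so have degrees -1 and 1, while j and q belong to Y. In this
  decomposition \<open>dd Z\<close> is the matrix with entries -dd X, x and dd Y.\<close>

definition cdata where
  "cdata X Y Z x i j p q \<longleftrightarrow> bdd X \<and> bdd Y \<and> bdd Z \<and> closed X Y 0 x \<and>
     i \<in> gr.G X Z (- 1) \<and> j \<in> gr.G Y Z 0 \<and> p \<in> gr.G Z X 1 \<and> q \<in> gr.G Z Y 0 \<and>
     p * i = gr.unit X \<and> q * j = gr.unit Y \<and> q * i = 0 \<and> p * j = 0 \<and> i * p + j * q = gr.unit Z \<and>
     dd Z = j * x * p + j * dd Y * q - i * dd X * p"

lemma closed0: "closed X Y 0 x \<Longrightarrow> dd Y * x = x * dd X" "closed X Y 0 x \<Longrightarrow> dd Y * (x * w) = x * (dd X * w)"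
  using assoc_rule[of "dd Y" x "x * dd X" w] unfolding closed_def by (auto simp: sg_def mult.assoc)

context
  fixes X Y Z x i j p q
  assumes c: "cdata X Y Z x i j p q"
begin

lemma cd_in: "i \<in> gr.G X Z (- 1)" "j \<in> gr.G Y Z 0" "p \<in> gr.G Z X 1" "q \<in> gr.G Z Y 0" "closed X Y 0 x" "x \<in> gr.G X Y 0"
  "bdd X" "bdd Y" "bdd Z"
  using c unfolding cdata_def closed_def by auto

lemma cd_basic: "p * i = gr.unit X" "q * j = gr.unit Y" "q * i = 0" "p * j = 0"
  using c unfolding cdata_def by auto

lemma cd_sum: "j * q = gr.unit Z - i * p" "j * (q * w) = gr.unit Z * w - i * (p * w)"
proof -
  have "i * p + j * q = gr.unit Z" using c unfolding cdata_def by auto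
  then show 1: "j * q = gr.unit Z - i * p" by (metis add_diff_cancel_left')
  show "j * (q * w) = gr.unit Z * w - i * (p * w)" using 1[THEN assoc_rule, of w] by (simp add: left_diff_distrib mult.assoc)
qed

text \<open>The maps j and p are closed, whereas i and q fail to be closed by exactly the term
  containing x. Moving \<open>dd Z\<close> past the structure maps in this way reduces the later
  verifications to rewriting.\<close>

lemma cd_d: "dd Z * i = j * x - i * dd X" "dd Z * j = j * dd Y" "p * dd Z = - (dd X * p)" "q * dd Z = dd Y * q + x * p"
proof -
  have d: "dd Z = j * x * p + j * dd Y * q - i * dd X * p" using c unfolding cdata_def by auto
  note r = cd_basic cd_basic[THEN assoc_rule] mem_gr[OF cd_in(6)] mem_gr[OF dd_in[OF cd_in(7)]] mem_gr[OF dd_in[OF cd_in(8)]]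
  show "dd Z * i = j * x - i * dd X" "dd Z * j = j * dd Y" "p * dd Z = - (dd X * p)" "q * dd Z = dd Y * q + x * p"
    unfolding d by (simp_all add: algebra_simps r)
qed

lemmas cd_simps = cd_basic cd_basic[THEN assoc_rule] cd_d cd_d[THEN assoc_rule]
  mem_gr[OF cd_in(1)] mem_gr[OF cd_in(2)] mem_gr[OF cd_in(3)] mem_gr[OF cd_in(4)] mem_gr[OF cd_in(6)]
  mem_gr[OF dd_in[OF cd_in(7)]] mem_gr[OF dd_in[OF cd_in(8)]] mem_gr[OF dd_in[OF cd_in(9)]]

lemma cd_closed: "closed Y Z 0 j" "closed Z X 1 p"
  unfolding closed_def using cd_in cd_d by (auto simp: sg_def)

end

lemma closedI: "\<lbrakk>x \<in> gr.G X Y n; dd Y * x = sg n (x * dd X)\<rbrakk> \<Longrightarrow> closed X Y n x"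
  unfolding closed_def by blast

lemma closed0I: "\<lbrakk>x \<in> gr.G X Y 0; dd Y * x = x * dd X\<rbrakk> \<Longrightarrow> closed X Y 0 x"
  unfolding closed_def by (simp add: sg_def)

lemma bdry0I: "\<lbrakk>s \<in> gr.G X Y (- 1); x = dd Y * s + s * dd X\<rbrakk> \<Longrightarrow> bdry X Y 0 x"
  unfolding bdry_def by (auto simp: sg_def)

lemma bdry1I: "\<lbrakk>s \<in> gr.G X Y 0; x = dd Y * s - s * dd X\<rbrakk> \<Longrightarrow> bdry X Y 1 x"
  unfolding bdry_def by (auto simp: sg_def)

lemma bdry0E: assumes "bdry X Y 0 x" obtains s where "s \<in> gr.G X Y (- 1)" "x = dd Y * s + s * dd X"
  using assms unfolding bdry_def by (auto simp: sg_def)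

lemma bdry1E: assumes "bdry X Y 1 x" obtains s where "s \<in> gr.G X Y 0" "x = dd Y * s - s * dd X"
  using assms unfolding bdry_def by (auto simp: sg_def)

lemma diff_gr: "x \<in> gr.G X Y n \<Longrightarrow> y \<in> gr.G X Y n \<Longrightarrow> x - y \<in> gr.G X Y n"
  using gr.G_add[OF _ gr.G_neg] by (metis add_uminus_conv_diff)

lemma mult_gr: "y \<in> gr.G Y Z m \<Longrightarrow> x \<in> gr.G X Y n \<Longrightarrow> m + n = k \<Longrightarrow> y * x \<in> gr.G X Z k"
  using gr.G_mult by blast

lemma sg_simps [simp]: "sg 0 x = x" "sg 1 x = - x" "sg (- 1) x = - x"
  by (simp_all add: sg_def)

definition triangle where
  "triangle X Y Z f j p \<longleftrightarrow> (\<exists>x i j' p' q. cdata X Y Z x i j' p' q \<and>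
     f = cls X Y 0 x \<and> j = cls Y Z 0 j' \<and> p = cls Z X 1 p')"

lemma triangleE:
  assumes "triangle X Y Z f j p"
  obtains x i j' p' q where "cdata X Y Z x i j' p' q" "f = cls X Y 0 x" "j = cls Y Z 0 j'" "p = cls Z X 1 p'"
  using assms unfolding triangle_def by blast

subsection \<open>Exactness\<close>

lemma triangle_in: assumes "triangle X Y Z f j p" shows "f \<in> kb.G X Y 0 \<and> j \<in> kb.G Y Z 0 \<and> p \<in> kb.G Z X 1"
  using assms by (elim triangleE) (auto intro!: cls_in dest: cd_closed cd_in)

lemma triangle_zero: assumes "triangle X Y Z f j p" shows "j * f = 0 \<and> p * j = 0 \<and> f * p = 0"
proof -
  obtain x i j' p' q where c: "cdata X Y Z x i j' p' q" and e: "f = cls X Y 0 x" "j = cls Y Z 0 j'" "p = cls Z X 1 p'"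
    using triangleE[OF assms] .
  note m = cd_in[OF c] cd_closed[OF c]
  have "bdry X Z 0 (j' * x)" by (rule bdry0I[OF m(1)]) (simp add: cd_d[OF c])
  then have "j * f = 0" unfolding e using cls_mult[OF m(5,10)] cls_zero_iff[OF closed_mult[OF m(5,10)]] by simp
  moreover have "p * j = 0"
    unfolding e using cls_mult[OF m(10,11)] cls_zero_iff[OF closed_mult[OF m(10,11)]] bdry_zero[OF m(8,7)] by (simp add: cd_basic[OF c])
  moreover have "bdry Z Y 1 (x * p')"
    by (rule bdry1I[OF gr.G_neg[OF m(4)]]) (simp add: cd_d[OF c])
  then have "f * p = 0" unfolding e using cls_mult[OF m(11,5)] cls_zero_iff[OF closed_mult[OF m(11,5)]] by simp
  ultimately show ?thesis by blast
qed

lemma cls_mult_zero: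
  assumes "closed X Y n x" "closed Y Z m y" "cls Y Z m y * cls X Y n x = 0" shows "bdry X Z (m + n) (y * x)"
  using cls_mult[OF assms(1,2)] cls_zero_iff[OF closed_mult[OF assms(1,2)]] assms(3) by simp

lemma cls_eqI: "\<lbrakk>closed X Y n x; closed X Y n y; bdry X Y n (x - y)\<rbrakk> \<Longrightarrow> cls X Y n x = cls X Y n y"
  using cls_eq_iff by blast

text \<open>A null-homotopy s of j * g takes values in the cone. Its X-component p' * s is the
  factorisation through f, and its Y-component q * s is the homotopy that witnesses it.\<close>

lemma triangle_cov_Y:
  assumes t: "triangle X Y Z f j p" and g: "g \<in> kb.G W Y 0" "j * g = 0" shows "\<exists>h\<in>kb.G W X 0. g = f * h"
proof -
  obtain x i j' p' q where c: "cdata X Y Z x i j' p' q" and e: "f = cls X Y 0 x" "j = cls Y Z 0 j'" "p = cls Z X 1 p'"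
    using triangleE[OF t] .
  note m = cd_in[OF c] cd_closed[OF c]
  obtain y where y: "closed W Y 0 y" "g = cls W Y 0 y" using cls_surj[OF g(1)] .
  have "bdry W Z 0 (j' * y)" using cls_mult_zero[OF y(1) m(10)] g(2) unfolding e y(2) by simp
  then obtain s where s: "s \<in> gr.G W Z (- 1)" "j' * y = dd Z * s + s * dd W" by (rule bdry0E)
  have ds: "dd Z * s = j' * y - s * dd W" using s(2) by (simp add: algebra_simps)
  note r = cd_simps[OF c] closed0[OF y(1)] closed0[OF m(5)] ds ds[THEN assoc_rule] mem_gr[OF closed_G[OF y(1)]]
  have h: "closed W X 0 (p' * s)"
  proof (rule closed0I)
    show "p' * s \<in> gr.G W X 0" by (rule mult_gr[OF m(3) s(1)]) simp
    have "dd X * (p' * s) = - (p' * (dd Z * s))" using cd_d(3)[OF c, THEN assoc_rule, of s] by (simp add: mult.assoc)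
    also have "\<dots> = p' * s * dd W" by (simp add: algebra_simps r)
    finally show "dd X * (p' * s) = p' * s * dd W" .
  qed
  have "bdry W Y 0 (y - x * (p' * s))"
  proof (rule bdry0I)
    show "q * s \<in> gr.G W Y (- 1)" by (rule mult_gr[OF m(4) s(1)]) simp
    have "dd Y * (q * s) = q * (dd Z * s) - x * (p' * s)"
      using cd_d(4)[OF c, THEN assoc_rule, of s] by (simp add: algebra_simps)
    then show "y - x * (p' * s) = dd Y * (q * s) + q * s * dd W" by (simp add: algebra_simps r)
  qed
  then have "g = f * cls W X 0 (p' * s)"
    unfolding y(2) e cls_mult[OF h m(5)] using cls_eqI[OF y(1)] closed_mult[OF h m(5)] by simp
  then show ?thesis using cls_in[OF h] by blast
qed

text \<open>A null-homotopy s of p * g allows the X-component of y to be removed by the homotopy -(i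
  * s), which leaves x * s + q * y in Y.\<close>

lemma triangle_cov_Z:
  assumes t: "triangle X Y Z f j p" and g: "g \<in> kb.G W Z 0" "p * g = 0" shows "\<exists>h\<in>kb.G W Y 0. g = j * h"
proof -
  obtain x i j' p' q where c: "cdata X Y Z x i j' p' q" and e: "f = cls X Y 0 x" "j = cls Y Z 0 j'" "p = cls Z X 1 p'"
    using triangleE[OF t] .
  note m = cd_in[OF c] cd_closed[OF c]
  obtain y where y: "closed W Z 0 y" "g = cls W Z 0 y" using cls_surj[OF g(1)] .
  have "bdry W X 1 (p' * y)" using cls_mult_zero[OF y(1) m(11)] g(2) unfolding e y(2) by simp
  then obtain s where s: "s \<in> gr.G W X 0" "p' * y = dd X * s - s * dd W" by (rule bdry1E)
  note r = cd_simps[OF c] closed0[OF y(1)] closed0[OF m(5)] s(2) s(2)[THEN assoc_rule] mem_gr[OF closed_G[OF y(1)]]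
  have dq: "dd Y * (q * y) = q * (dd Z * y) - x * (p' * y)"
    using cd_d(4)[OF c, THEN assoc_rule, of y] by (simp add: algebra_simps)
  have h: "closed W Y 0 (x * s + q * y)"
  proof (rule closed0I)
    show "x * s + q * y \<in> gr.G W Y 0"
      using mult_gr[OF m(6) s(1)] mult_gr[OF m(4) closed_G[OF y(1)]] gr.G_add by simp
    show "dd Y * (x * s + q * y) = (x * s + q * y) * dd W"
      by (simp add: distrib_left dq) (simp add: algebra_simps r)
  qed
  have "bdry W Z 0 (y - j' * (x * s + q * y))"
  proof (rule bdry0I)
    show "- (i * s) \<in> gr.G W Z (- 1)" using mult_gr[OF m(1) s(1)] gr.G_neg by simp
    show "y - j' * (x * s + q * y) = dd Z * - (i * s) + - (i * s) * dd W"
      by (simp add: algebra_simps r cd_sum[OF c])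
  qed
  then have "g = j * cls W Y 0 (x * s + q * y)"
    unfolding y(2) e cls_mult[OF h m(10)] using cls_eqI[OF y(1)] closed_mult[OF h m(10)] by simp
  then show ?thesis using cls_in[OF h] by blast
qed

text \<open>A closed map of degree -1 into the cone is a closed y into X with a null-homotopy s of x
  * y, assembled as i * y - j' * s.\<close>

lemma triangle_cov_X:
  assumes t: "triangle X Y Z f j p" and g: "g \<in> kb.G W X 0" "f * g = 0" shows "\<exists>h\<in>kb.G W Z (- 1). g = p * h"
proof -
  obtain x i j' p' q where c: "cdata X Y Z x i j' p' q" and e: "f = cls X Y 0 x" "j = cls Y Z 0 j'" "p = cls Z X 1 p'"
    using triangleE[OF t] .
  note m = cd_in[OF c] cd_closed[OF c]
  obtain y where y: "closed W X 0 y" "g = cls W X 0 y" using cls_surj[OF g(1)] .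
  have "bdry W Y 0 (x * y)" using cls_mult_zero[OF y(1) m(5)] g(2) unfolding e y(2) by simp
  then obtain s where s: "s \<in> gr.G W Y (- 1)" "x * y = dd Y * s + s * dd W" by (rule bdry0E)
  note r = cd_simps[OF c] closed0[OF y(1)] s(2) s(2)[THEN assoc_rule] mem_gr[OF closed_G[OF y(1)]]
  have h: "closed W Z (- 1) (i * y - j' * s)"
  proof (rule closedI)
    show "i * y - j' * s \<in> gr.G W Z (- 1)"
      using mult_gr[OF m(1) closed_G[OF y(1)]] mult_gr[OF m(2) s(1)] diff_gr by simp
    show "dd Z * (i * y - j' * s) = sg (- 1) ((i * y - j' * s) * dd W)"
      by (simp add: algebra_simps r)
  qed
  have "p' * (i * y - j' * s) = y" by (simp add: algebra_simps r)
  then have "g = p * cls W Z (- 1) (i * y - j' * s)" unfolding y(2) e cls_mult[OF h m(11)] by simp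
  then show ?thesis using cls_in[OF h] by blast
qed

text \<open>A map out of the cone is a map y on Y with a null-homotopy s of y * x, assembled as y *
  q + s * p'.\<close>

lemma triangle_con_Y:
  assumes t: "triangle X Y Z f j p" and g: "g \<in> kb.G Y W 0" "g * f = 0" shows "\<exists>h\<in>kb.G Z W 0. g = h * j"
proof -
  obtain x i j' p' q where c: "cdata X Y Z x i j' p' q" and e: "f = cls X Y 0 x" "j = cls Y Z 0 j'" "p = cls Z X 1 p'"
    using triangleE[OF t] .
  note m = cd_in[OF c] cd_closed[OF c]
  obtain y where y: "closed Y W 0 y" "g = cls Y W 0 y" using cls_surj[OF g(1)] .
  have "bdry X W 0 (y * x)" using cls_mult_zero[OF m(5) y(1)] g(2) unfolding e y(2) by simp
  then obtain s where s: "s \<in> gr.G X W (- 1)" "y * x = dd W * s + s * dd X" by (rule bdry0E)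
  have ds: "dd W * s = y * x - s * dd X" using s(2) by (simp add: algebra_simps)
  note r = cd_simps[OF c] closed0[OF y(1)] ds ds[THEN assoc_rule] mem_gr[OF closed_G[OF y(1)]]
  have h: "closed Z W 0 (y * q + s * p')"
  proof (rule closed0I)
    show "y * q + s * p' \<in> gr.G Z W 0"
      using mult_gr[OF closed_G[OF y(1)] m(4)] mult_gr[OF s(1) m(3)] gr.G_add by simp
    show "dd W * (y * q + s * p') = (y * q + s * p') * dd Z" by (simp add: algebra_simps r)
  qed
  have "(y * q + s * p') * j' = y" by (simp add: algebra_simps r)
  then have "g = cls Z W 0 (y * q + s * p') * j" unfolding y(2) e cls_mult[OF m(10) h] by simp
  then show ?thesis using cls_in[OF h] by blast
qed

text \<open>A null-homotopy s of y * j' is extended by q to all of Z; subtracting its boundary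
  leaves a map that factors through p', with factor y * i - s * x.\<close>

lemma triangle_con_Z:
  assumes t: "triangle X Y Z f j p" and g: "g \<in> kb.G Z W 0" "g * j = 0" shows "\<exists>h\<in>kb.G X W (- 1). g = h * p"
proof -
  obtain x i j' p' q where c: "cdata X Y Z x i j' p' q" and e: "f = cls X Y 0 x" "j = cls Y Z 0 j'" "p = cls Z X 1 p'"
    using triangleE[OF t] .
  note m = cd_in[OF c] cd_closed[OF c]
  obtain y where y: "closed Z W 0 y" "g = cls Z W 0 y" using cls_surj[OF g(1)] .
  have "bdry Y W 0 (y * j')" using cls_mult_zero[OF m(10) y(1)] g(2) unfolding e y(2) by simp
  then obtain s where s: "s \<in> gr.G Y W (- 1)" "y * j' = dd W * s + s * dd Y" by (rule bdry0E)
  have ds: "dd W * s = y * j' - s * dd Y" using s(2) by (simp add: algebra_simps)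
  note r = cd_simps[OF c] closed0[OF y(1)] closed0[OF m(5)] ds ds[THEN assoc_rule] mem_gr[OF closed_G[OF y(1)]]
  have h: "closed X W (- 1) (y * i - s * x)"
  proof (rule closedI)
    show "y * i - s * x \<in> gr.G X W (- 1)"
      using mult_gr[OF closed_G[OF y(1)] m(1)] mult_gr[OF s(1) m(6)] diff_gr by simp
    show "dd W * (y * i - s * x) = sg (- 1) ((y * i - s * x) * dd X)" by (simp add: algebra_simps r)
  qed
  have "bdry Z W 0 (y - (y * i - s * x) * p')"
  proof (rule bdry0I)
    show "s * q \<in> gr.G Z W (- 1)" by (rule mult_gr[OF s(1) m(4)]) simp
    show "y - (y * i - s * x) * p' = dd W * (s * q) + s * q * dd Z"
      by (simp add: algebra_simps r cd_sum[OF c])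
  qed
  then have "g = cls X W (- 1) (y * i - s * x) * p"
    unfolding y(2) e cls_mult[OF m(11) h] using cls_eqI[OF y(1)] closed_mult[OF m(11) h] by simp
  then show ?thesis using cls_in[OF h] by blast
qed

text \<open>A null-homotopy s of g * p lives on the cone: along j' it gives, up to sign, the
  extension of g to Y, and along i the homotopy that compares them.\<close>

lemma triangle_con_X:
  assumes t: "triangle X Y Z f j p" and g: "g \<in> kb.G X W 0" "g * p = 0" shows "\<exists>h\<in>kb.G Y W 0. g = h * f"
proof -
  obtain x i j' p' q where c: "cdata X Y Z x i j' p' q" and e: "f = cls X Y 0 x" "j = cls Y Z 0 j'" "p = cls Z X 1 p'"
    using triangleE[OF t] .
  note m = cd_in[OF c] cd_closed[OF c]
  obtain y where y: "closed X W 0 y" "g = cls X W 0 y" using cls_surj[OF g(1)] .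
  have "bdry Z W 1 (y * p')" using cls_mult_zero[OF m(11) y(1)] g(2) unfolding e y(2) by simp
  then obtain s where s: "s \<in> gr.G Z W 0" "y * p' = dd W * s - s * dd Z" by (rule bdry1E)
  have ds: "dd W * s = y * p' + s * dd Z" using s(2) by (simp add: algebra_simps)
  note r = cd_simps[OF c] closed0[OF y(1)] closed0[OF m(5)] ds ds[THEN assoc_rule] mem_gr[OF closed_G[OF y(1)]]
  have h: "closed Y W 0 (- (s * j'))"
  proof (rule closed0I)
    show "- (s * j') \<in> gr.G Y W 0" using mult_gr[OF s(1) m(2)] gr.G_neg by simp
    show "dd W * - (s * j') = - (s * j') * dd Y" by (simp add: algebra_simps r)
  qed
  have "bdry X W 0 (y - - (s * j') * x)"
  proof (rule bdry0I)
    show "s * i \<in> gr.G X W (- 1)" by (rule mult_gr[OF s(1) m(1)]) simp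
    show "y - - (s * j') * x = dd W * (s * i) + s * i * dd X" by (simp add: algebra_simps r)
  qed
  then have "g = cls Y W 0 (- (s * j')) * f"
    unfolding y(2) e cls_mult[OF m(5) h] using cls_eqI[OF y(1)] closed_mult[OF m(5) h] by simp
  then show ?thesis using cls_in[OF h] by blast
qed

subsection \<open>Morphisms of triangles and the octahedron\<close>

text \<open>The square commutes only up to a homotopy s. The induced map of cones has y and z as
  diagonal entries and s as off-diagonal entry, and both outer squares then commute
  strictly.\<close>

lemma triangle_morphism:
  assumes t: "triangle X Y Z f j p" and t': "triangle X' Y' Z' f' j' p'"
    and a: "a \<in> kb.G X X' 0" and b: "b \<in> kb.G Y Y' 0" and ab: "b * f = f' * a"
  shows "\<exists>c\<in>kb.G Z Z' 0. c * j = j' * b \<and> p' * c = a * p"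
proof -
  obtain x i1 j1 p1 q1 where c: "cdata X Y Z x i1 j1 p1 q1" and e: "f = cls X Y 0 x" "j = cls Y Z 0 j1" "p = cls Z X 1 p1"
    using triangleE[OF t] .
  obtain x' i2 j2 p2 q2 where c': "cdata X' Y' Z' x' i2 j2 p2 q2" and e': "f' = cls X' Y' 0 x'" "j' = cls Y' Z' 0 j2" "p' = cls Z' X' 1 p2"
    using triangleE[OF t'] .
  note m = cd_in[OF c] cd_closed[OF c] and m' = cd_in[OF c'] cd_closed[OF c']
  obtain y where y: "closed X X' 0 y" "a = cls X X' 0 y" using cls_surj[OF a] .
  obtain z where z: "closed Y Y' 0 z" "b = cls Y Y' 0 z" using cls_surj[OF b] .
  have "bdry X Y' 0 (z * x - x' * y)"
    using ab cls_mult[OF m(5) z(1)] cls_mult[OF y(1) m'(5)] cls_eq_iff closed_mult[OF m(5) z(1)] closed_mult[OF y(1) m'(5)]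
    unfolding e e' y(2) z(2) by fastforce
  then obtain s where s: "s \<in> gr.G X Y' (- 1)" "z * x - x' * y = dd Y' * s + s * dd X" by (rule bdry0E)
  have ds: "dd Y' * s = z * x - x' * y - s * dd X" using s(2) by (simp add: algebra_simps)
  note my = closed_G[OF y(1)] closed_G[OF z(1)]
  note r = cd_simps[OF c] cd_simps[OF c'] closed0[OF y(1)] closed0[OF z(1)] ds ds[THEN assoc_rule] mem_gr[OF my(1)] mem_gr[OF my(2)] mem_gr[OF s(1)]
  let ?m = "j2 * z * q1 + i2 * y * p1 + j2 * s * p1"
  have "closed Z Z' 0 ?m"
  proof (rule closed0I)
    have "j2 * z * q1 \<in> gr.G Z Z' 0" "i2 * y * p1 \<in> gr.G Z Z' 0" "j2 * s * p1 \<in> gr.G Z Z' 0"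
      using gr.G_mult[OF gr.G_mult[OF m'(2) my(2)] m(4)] gr.G_mult[OF gr.G_mult[OF m'(1) my(1)] m(3)]
        gr.G_mult[OF gr.G_mult[OF m'(2) s(1)] m(3)] by auto
    then show "?m \<in> gr.G Z Z' 0" using gr.G_add by blast
    show "dd Z' * ?m = ?m * dd Z" by (simp add: algebra_simps r)
  qed
  note cm = this
  have "?m * j1 = j2 * z" "p2 * ?m = y * p1" by (simp_all add: algebra_simps r)
  then have "cls Z Z' 0 ?m * j = j' * b" "p' * cls Z Z' 0 ?m = a * p"
    unfolding e e' y(2) z(2)
    using cls_mult[OF m(10) cm] cls_mult[OF z(1) m'(10)] cls_mult[OF cm m'(11)] cls_mult[OF m(11) y(1)] by auto
  then show ?thesis using cls_in[OF cm] by blast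
qed

definition kiso where
  "kiso X Y \<longleftrightarrow> (\<exists>f\<in>kb.G X Y 0. \<exists>g\<in>kb.G Y X 0. g * f = kb.unit X \<and> f * g = kb.unit Y)"

text \<open>The same complex Z is a cone of every map homotopic to x: a homotopy s only shears the
  splitting.\<close>

lemma cdata_change:
  assumes c: "cdata X Y Z x i j p q" and y: "closed X Y 0 y" and s: "s \<in> gr.G X Y (- 1)" "x - y = dd Y * s + s * dd X"
  shows "cdata X Y Z y (i - j * s) j p (q + s * p)"
proof -
  note m = cd_in[OF c]
  note r = cd_simps[OF c] mem_gr[OF s(1)]
  have x: "x = y + dd Y * s + s * dd X" using s(2) by (simp add: algebra_simps)
  have d: "dd Z = j * x * p + j * dd Y * q - i * dd X * p" using c unfolding cdata_def by blast
  have "i - j * s \<in> gr.G X Z (- 1)" "q + s * p \<in> gr.G Z Y 0"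
    using mult_gr[OF m(2) s(1)] mult_gr[OF s(1) m(3)] m gr.G_add diff_gr by auto
  moreover have "dd Z = j * y * p + j * dd Y * (q + s * p) - (i - j * s) * dd X * p"
    unfolding d x by (simp add: algebra_simps)
  moreover have "(i - j * s) * p + j * (q + s * p) = gr.unit Z" by (simp add: algebra_simps cd_sum[OF c])
  moreover have "p * (i - j * s) = gr.unit X" "(q + s * p) * j = gr.unit Y" "(q + s * p) * (i - j * s) = 0"
    by (simp_all add: algebra_simps r)
  ultimately show ?thesis using m y cd_basic[OF c] unfolding cdata_def by auto
qed

text \<open>The cone M of D \<rightarrow> C has blocks X[2], Y[1], X[1] and W. The two X blocks
  cancel and Y[1] with W form B. Here rr * t is the unit on the nose, and the homotopy i * i1 * p3 *
  q, which carries the X block of C to that of D, contracts the rest.\<close>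

lemma cdata_octahedral:
  assumes c1: "cdata X Y D x i1 j1 p1 q1" and c2: "cdata Y W B y i2 j2 p2 q2" and c3: "cdata X W C (y * x) i3 j3 p3 q3"
    and c: "cdata D C M (i3 * p1 + j3 * y * q1) i j p q"
  shows "kiso M B"
proof -
  note m1 = cd_in[OF c1] and m2 = cd_in[OF c2] and m3 = cd_in[OF c3] and m = cd_in[OF c]
  note r = cd_simps[OF c1] cd_simps[OF c2] cd_simps[OF c3] cd_simps[OF c] closed0[OF m1(5)] closed0[OF m2(5)]
  define n where "n = i2 * x * p3 + j2 * q3"
  define rr where "rr = n * q + i2 * q1 * p"
  define t where "t = j * j3 * q2 + i * j1 * p2"
  have n: "n \<in> gr.G C B 0"
    unfolding n_def using gr.G_mult[OF gr.G_mult[OF m2(1) m1(6)] m3(3)] gr.G_mult[OF m2(2) m3(4)] gr.G_add by simp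
  have rr: "closed M B 0 rr"
  proof (rule closed0I)
    show "rr \<in> gr.G M B 0"
      unfolding rr_def using gr.G_mult[OF n m(4)] gr.G_mult[OF gr.G_mult[OF m2(1) m1(4)] m(3)] gr.G_add by simp
    show "dd B * rr = rr * dd M" unfolding rr_def n_def by (simp add: algebra_simps r)
  qed
  have t: "closed B M 0 t"
  proof (rule closed0I)
    show "t \<in> gr.G B M 0"
      unfolding t_def using gr.G_mult[OF gr.G_mult[OF m(2) m3(2)] m2(4)] gr.G_mult[OF gr.G_mult[OF m(1) m1(2)] m2(3)] gr.G_add by simp
    show "dd M * t = t * dd B" unfolding t_def by (simp add: algebra_simps r)
  qed
  have 1: "rr * t = gr.unit B"
    unfolding rr_def t_def n_def by (simp add: algebra_simps r cd_sum[OF c2])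
  have H: "i * i1 * p3 * q \<in> gr.G M M (- 1)"
    using gr.G_mult[OF gr.G_mult[OF gr.G_mult[OF m(1) m1(1)] m3(3)] m(4)] by simp
  \<comment> \<open>The unit is expanded over all four blocks so that both sides of the next
    equation reduce to the same products.\<close>
  have u: "gr.unit M = i * (i1 * p1 + j1 * q1) * p + j * (i3 * p3 + j3 * q3) * q"
    by (simp add: cd_sum[OF c1] cd_sum[OF c3] r) (simp add: cd_sum[OF c])
  have "gr.unit M - t * rr = dd M * (i * i1 * p3 * q) + i * i1 * p3 * q * dd M"
    unfolding u t_def rr_def n_def by (simp add: algebra_simps r)
  then have "bdry M M 0 (gr.unit M - t * rr)" using bdry0I[OF H] by blast
  then have "cls M M 0 (gr.unit M) = cls M M 0 (t * rr)"
    using cls_eqI[OF closed_unit[OF m(9)]] closed_mult[OF rr t] by simp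
  then have 2: "cls B M 0 t * cls M B 0 rr = kb.unit M" using cls_mult[OF rr t] cls_unit[OF m(9)] by simp
  have 3: "cls M B 0 rr * cls B M 0 t = kb.unit B" using cls_mult[OF t rr] 1 cls_unit[OF m2(9)] by simp
  show ?thesis unfolding kiso_def using 2 3 cls_in[OF rr] cls_in[OF t] by blast
qed

lemma closed_octahedral_map:
  assumes c1: "cdata X Y D x i1 j1 p1 q1" and y: "closed Y W 0 y" and c3: "cdata X W C (y * x) i3 j3 p3 q3"
  shows "closed D C 0 (i3 * p1 + j3 * y * q1)"
proof (rule closed0I)
  note m1 = cd_in[OF c1] and m3 = cd_in[OF c3]
  note r = cd_simps[OF c1] cd_simps[OF c3] closed0[OF m1(5)] closed0[OF y] mem_gr[OF closed_G[OF y]]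
  show "i3 * p1 + j3 * y * q1 \<in> gr.G D C 0"
    using gr.G_mult[OF m3(1) m1(3)] gr.G_mult[OF gr.G_mult[OF m3(2) closed_G[OF y]] m1(4)] gr.G_add by simp
  show "dd C * (i3 * p1 + j3 * y * q1) = (i3 * p1 + j3 * y * q1) * dd D" by (simp add: algebra_simps r)
qed

text \<open>In the cone W of j the two copies of Y cancel through the homotopy i2 * q * q2, leaving
  X[1]. The term i2 * x corrects j2 * i, which is not closed because i is not.\<close>

lemma cdata_rotate:
  assumes c: "cdata X Y Z x i j p q" and c2: "cdata Y Z W j i2 j2 p2 q2"
  shows "\<exists>a\<in>kb.G X W (- 1). \<exists>b\<in>kb.G W X 1. b * a = kb.unit X \<and> a * b = kb.unit W"
proof -
  note m = cd_in[OF c] and m2 = cd_in[OF c2]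
  note r = cd_simps[OF c] cd_simps[OF c2] closed0[OF m(5)]
  have u: "closed X W (- 1) (j2 * i - i2 * x)"
  proof (rule closedI)
    show "j2 * i - i2 * x \<in> gr.G X W (- 1)" using gr.G_mult[OF m2(2) m(1)] gr.G_mult[OF m2(1) m(6)] diff_gr by simp
    show "dd W * (j2 * i - i2 * x) = sg (- 1) ((j2 * i - i2 * x) * dd X)" by (simp add: algebra_simps r)
  qed
  have v: "closed W X 1 (p * q2)"
  proof (rule closedI)
    show "p * q2 \<in> gr.G W X 1" using gr.G_mult[OF m(3) m2(4)] by simp
    have "p * q2 * dd W = - (dd X * (p * q2))" by (simp add: algebra_simps r)
    then show "dd X * (p * q2) = sg 1 (p * q2 * dd W)" by simp
  qed
  have 1: "(p * q2) * (j2 * i - i2 * x) = gr.unit X" by (simp add: algebra_simps r)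
  have s: "i2 * q * q2 \<in> gr.G W W (- 1)" using gr.G_mult[OF gr.G_mult[OF m2(1) m(4)] m2(4)] by simp
  have "gr.unit W = i2 * p2 + j2 * (i * p + j * q) * q2"
    by (simp add: cd_sum[OF c] r) (simp add: cd_sum[OF c2])
  then have "gr.unit W - (j2 * i - i2 * x) * (p * q2) = dd W * (i2 * q * q2) + i2 * q * q2 * dd W"
    by (simp add: algebra_simps r)
  then have "bdry W W 0 (gr.unit W - (j2 * i - i2 * x) * (p * q2))" using bdry0I[OF s] by blast
  then have "cls W W 0 (gr.unit W) = cls W W 0 ((j2 * i - i2 * x) * (p * q2))"
    using cls_eqI[OF closed_unit[OF m2(9)]] closed_mult[OF v u] by simp
  then have "cls X W (- 1) (j2 * i - i2 * x) * cls W X 1 (p * q2) = kb.unit W"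
    using cls_mult[OF v u] cls_unit[OF m2(9)] by simp
  moreover have "cls W X 1 (p * q2) * cls X W (- 1) (j2 * i - i2 * x) = kb.unit X"
    using cls_mult[OF u v] 1 cls_unit[OF m(7)] by simp
  ultimately show ?thesis using cls_in[OF u] cls_in[OF v] by blast
qed

section \<open>Degreewise cones as ring data\<close>

abbreviation "nul X n \<equiv> zero_object A (cob X n)"

definition cone_dif where
  "cone_dif X Y \<phi> i j p q n =
     Add A (Cmp A (i (n + 1)) (Cmp A (Neg A (dif X (n + 1))) (p n)))
       (Add A (Cmp A (j (n + 1)) (Cmp A (\<phi> (n + 1)) (p n))) (Cmp A (j (n + 1)) (Cmp A (dif Y n) (q n))))"

definition deg_biproduct where
  "deg_biproduct X Y Z i j p q \<longleftrightarrow>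
     (\<forall>n. biproduct_diagram A (cob X (n + 1)) (cob Y n) (cob Z n) (i n) (j n) (p n) (q n))"

lemma chain_cone_alt:
  "chain_cone A X Y \<phi> Z \<longleftrightarrow> (\<exists>i j p q. deg_biproduct X Y Z i j p q \<and> (\<forall>n. dif Z n = cone_dif X Y \<phi> i j p q n))"
  unfolding chain_cone_def deg_biproduct_def cone_dif_def by blast

lemma zero_family: "\<lbrakk>bdd X; bdd Y\<rbrakk> \<Longrightarrow> (\<And>k. \<phi> k = Zer A (cob X k) (cob Y (k + n))) \<Longrightarrow> el X Y n \<phi> = 0"
  using el_zero[of X Y n] el_cong[of \<phi> "\<lambda>k. Zer A (cob X k) (cob Y (k + n))"] by auto

lemma unit_family: "\<lbrakk>bdd X\<rbrakk> \<Longrightarrow> (\<And>k. \<phi> k = Idn A (cob X k)) \<Longrightarrow> el X X 0 \<phi> = gr.unit X"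
  using el_unit[of X] el_cong[of \<phi> "\<lambda>k. Idn A (cob X k)"] by auto

context
  fixes X Y Z :: "('o, 'f) cplx" and i j p q
  assumes b: "bdd X" "bdd Y" "bdd Z" and d: "deg_biproduct X Y Z i j p q"
begin

text \<open>Families are indexed by the degree of their source, whereas i n has source of degree n +
  1; hence the shift of the index.\<close>

abbreviation "I1 \<equiv> \<lambda>m. i (m - 1)"

lemma deg_biproductD:
  "i n \<in> Hom A (cob X (n + 1)) (cob Z n)" "j n \<in> Hom A (cob Y n) (cob Z n)"
  "p n \<in> Hom A (cob Z n) (cob X (n + 1))" "q n \<in> Hom A (cob Z n) (cob Y n)"
  "Cmp A (p n) (i n) = Idn A (cob X (n + 1))" "Cmp A (q n) (j n) = Idn A (cob Y n)"
  "Cmp A (q n) (i n) = Zer A (cob X (n + 1)) (cob Y n)" "Cmp A (p n) (j n) = Zer A (cob Y n) (cob X (n + 1))"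
  "Add A (Cmp A (i n) (p n)) (Cmp A (j n) (q n)) = Idn A (cob Z n)"
  using d unfolding deg_biproduct_def biproduct_diagram_def by auto

lemma I1_in: "i (m - 1) \<in> Hom A (cob X m) (cob Z (m - 1))"
  using deg_biproductD(1)[of "m - 1"] by simp

lemma deg_fam: "fam X Z (- 1) I1" "fam Y Z 0 j" "fam Z X 1 p" "fam Z Y 0 q"
  unfolding fam_def using deg_biproductD I1_in by auto

lemma deg_relations:
  "el Z X 1 p * el X Z (- 1) I1 = gr.unit X" "el Z Y 0 q * el Y Z 0 j = gr.unit Y"
  "el Z Y 0 q * el X Z (- 1) I1 = 0" "el Z X 1 p * el Y Z 0 j = 0"
  "el X Z (- 1) I1 * el Z X 1 p + el Y Z 0 j * el Z Y 0 q = gr.unit Z"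
proof -
  have e: "Cmp A (p (k - 1)) (i (k - 1)) = Idn A (cob X k)" "Cmp A (q (k - 1)) (i (k - 1)) = Zer A (cob X k) (cob Y (k - 1))" for k
    using deg_biproductD(5,7)[of "k - 1"] by auto
  show "el Z X 1 p * el X Z (- 1) I1 = gr.unit X"
    using el_mult[OF b(1,3,1) deg_fam(1,3)] e(1) by (simp add: unit_family b)
  show "el Z Y 0 q * el Y Z 0 j = gr.unit Y"
    using el_mult[OF b(2,3,2) deg_fam(2,4)] deg_biproductD(6) by (simp add: unit_family b)
  show "el Z Y 0 q * el X Z (- 1) I1 = 0"
    using el_mult[OF b(1,3,2) deg_fam(1,4)] e(2) by (simp add: zero_family b)
  show "el Z X 1 p * el Y Z 0 j = 0"
    using el_mult[OF b(2,3,1) deg_fam(2,3)] deg_biproductD(8) by (simp add: zero_family b)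
  have m: "el X Z (- 1) I1 * el Z X 1 p = el Z Z 0 (\<lambda>k. Cmp A (i k) (p k))"
    "el Y Z 0 j * el Z Y 0 q = el Z Z 0 (\<lambda>k. Cmp A (j k) (q k))"
    using el_mult[OF b(3,1,3) deg_fam(3,1)] el_mult[OF b(3,2,3) deg_fam(4,2)] by auto
  have f: "fam Z Z 0 (\<lambda>k. Cmp A (i k) (p k))" "fam Z Z 0 (\<lambda>k. Cmp A (j k) (q k))"
    using fam_mult[OF b(3,1,3) deg_fam(3,1)] fam_mult[OF b(3,2,3) deg_fam(4,2)] by auto
  show "el X Z (- 1) I1 * el Z X 1 p + el Y Z 0 j * el Z Y 0 q = gr.unit Z"
    unfolding m el_add[OF b(3,3) f] using deg_biproductD(9) by (simp add: unit_family b)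
qed

lemma cone_dif_el:
  assumes \<phi>: "fam X Y 0 \<phi>"
  shows "fam Z Z 1 (cone_dif X Y \<phi> i j p q)"
    "el Z Z 1 (cone_dif X Y \<phi> i j p q) =
       el Y Z 0 j * el X Y 0 \<phi> * el Z X 1 p + el Y Z 0 j * dd Y * el Z Y 0 q - el X Z (- 1) I1 * dd X * el Z X 1 p"
proof -
  note nd = fam_neg[OF b(1,1) fam_dif[OF b(1)]]
  have 1: "fam Z X 2 (\<lambda>k. Cmp A (Neg A (dif X (k + 1))) (p k))"
    "- dd X * el Z X 1 p = el Z X 2 (\<lambda>k. Cmp A (Neg A (dif X (k + 1))) (p k))"
    using fam_mult[OF b(3,1,1) deg_fam(3) nd] el_mult[OF b(3,1,1) deg_fam(3) nd] el_neg[OF b(1,1) fam_dif[OF b(1)]]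
    unfolding dd_def by auto
  have 2: "fam Z Z 1 (\<lambda>k. Cmp A (i (k + 1)) (Cmp A (Neg A (dif X (k + 1))) (p k)))"
    "el X Z (- 1) I1 * (- dd X * el Z X 1 p) = el Z Z 1 (\<lambda>k. Cmp A (i (k + 1)) (Cmp A (Neg A (dif X (k + 1))) (p k)))"
    unfolding 1(2) using fam_mult[OF b(3,1,3) 1(1) deg_fam(1)] el_mult[OF b(3,1,3) 1(1) deg_fam(1)] by (simp_all add: algebra_simps)
  have 3: "fam Z Y 1 (\<lambda>k. Cmp A (\<phi> (k + 1)) (p k))" "el X Y 0 \<phi> * el Z X 1 p = el Z Y 1 (\<lambda>k. Cmp A (\<phi> (k + 1)) (p k))"
    using fam_mult[OF b(3,1,2) deg_fam(3) \<phi>] el_mult[OF b(3,1,2) deg_fam(3) \<phi>] by auto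
  have 4: "fam Z Z 1 (\<lambda>k. Cmp A (j (k + 1)) (Cmp A (\<phi> (k + 1)) (p k)))"
    "el Y Z 0 j * (el X Y 0 \<phi> * el Z X 1 p) = el Z Z 1 (\<lambda>k. Cmp A (j (k + 1)) (Cmp A (\<phi> (k + 1)) (p k)))"
    unfolding 3(2) using fam_mult[OF b(3,2,3) 3(1) deg_fam(2)] el_mult[OF b(3,2,3) 3(1) deg_fam(2)] by auto
  have 5: "fam Z Y 1 (\<lambda>k. Cmp A (dif Y k) (q k))" "dd Y * el Z Y 0 q = el Z Y 1 (\<lambda>k. Cmp A (dif Y k) (q k))"
    using fam_mult[OF b(3,2,2) deg_fam(4) fam_dif[OF b(2)]] el_mult[OF b(3,2,2) deg_fam(4) fam_dif[OF b(2)]] unfolding dd_def by auto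
  have 6: "fam Z Z 1 (\<lambda>k. Cmp A (j (k + 1)) (Cmp A (dif Y k) (q k)))"
    "el Y Z 0 j * (dd Y * el Z Y 0 q) = el Z Z 1 (\<lambda>k. Cmp A (j (k + 1)) (Cmp A (dif Y k) (q k)))"
    unfolding 5(2) using fam_mult[OF b(3,2,3) 5(1) deg_fam(2)] el_mult[OF b(3,2,3) 5(1) deg_fam(2)] by auto
  have cd: "cone_dif X Y \<phi> i j p q = (\<lambda>n. Add A (Cmp A (i (n + 1)) (Cmp A (Neg A (dif X (n + 1))) (p n)))
       (Add A (Cmp A (j (n + 1)) (Cmp A (\<phi> (n + 1)) (p n))) (Cmp A (j (n + 1)) (Cmp A (dif Y n) (q n)))))"
    unfolding cone_dif_def by (rule ext) simp
  note 7 = fam_add[OF b(3,3) 4(1) 6(1)]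
  show "fam Z Z 1 (cone_dif X Y \<phi> i j p q)" unfolding cd by (rule fam_add[OF b(3,3) 2(1) 7])
  have "el Z Z 1 (cone_dif X Y \<phi> i j p q) =
     el X Z (- 1) I1 * (- dd X * el Z X 1 p) + (el Y Z 0 j * (el X Y 0 \<phi> * el Z X 1 p) + el Y Z 0 j * (dd Y * el Z Y 0 q))"
    unfolding cd 2(2) 4(2) 6(2) el_add[OF b(3,3) 4(1) 6(1)] el_add[OF b(3,3) 2(1) 7] by simp
  then show "el Z Z 1 (cone_dif X Y \<phi> i j p q) =
       el Y Z 0 j * el X Y 0 \<phi> * el Z X 1 p + el Y Z 0 j * dd Y * el Z Y 0 q - el X Z (- 1) I1 * dd X * el Z X 1 p"
    by (simp add: algebra_simps)
qed

end

lemma chain_cone_cdata: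
  assumes b: "bdd X" "bdd Y" "bdd Z" and c: "chain_map A X Y \<phi>" and cc: "chain_cone A X Y \<phi> Z"
  shows "\<exists>i j p q. cdata X Y Z (el X Y 0 \<phi>) i j p q"
proof -
  obtain i j p q where d: "deg_biproduct X Y Z i j p q" and e: "\<And>n. dif Z n = cone_dif X Y \<phi> i j p q n"
    using cc unfolding chain_cone_alt by blast
  have \<phi>: "fam X Y 0 \<phi>" "closed X Y 0 (el X Y 0 \<phi>)" using chain_map_iff0[OF b(1,2)] c by auto
  have "dif Z = cone_dif X Y \<phi> i j p q" using e by blast
  then have "dd Z = el Z Z 1 (cone_dif X Y \<phi> i j p q)" unfolding dd_def by simp
  then have "cdata X Y Z (el X Y 0 \<phi>) (el X Z (- 1) (\<lambda>m. i (m - 1))) (el Y Z 0 j) (el Z X 1 p) (el Z Y 0 q)"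
    unfolding cdata_def using b \<phi>(2) deg_relations[OF b d] cone_dif_el(2)[OF b d \<phi>(1)]
      el_in[OF b(1,3) deg_fam(1)[OF b d]] el_in[OF b(2,3) deg_fam(2)[OF b d]] el_in[OF b(3,1) deg_fam(3)[OF b d]]
      el_in[OF b(3,2) deg_fam(4)[OF b d]]
    by (intro conjI) (assumption | simp)+
  then show ?thesis by blast
qed

lemma el_mult_eqD:
  assumes "bdd X" "bdd Y" "bdd Z" "fam X Y n \<phi>" "fam Y Z m \<psi>" "fam X Z (m + n) \<chi>" "el Y Z m \<psi> * el X Y n \<phi> = el X Z (m + n) \<chi>"
  shows "Cmp A (\<psi> (k + n)) (\<phi> k) = \<chi> k"
  using assms(7) el_inject[OF assms(1,3) fam_mult[OF assms(1-5)] assms(6)] unfolding el_mult[OF assms(1-5)] by (simp add: fun_eq_iff)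

lemma cdata_chain_cone:
  assumes c: "cdata X Y Z (el X Y 0 \<phi>) i j p q" and \<phi>: "fam X Y 0 \<phi>"
  shows "chain_cone A X Y \<phi> Z"
proof -
  note b = cd_in(7,8,9)[OF c] and m = cd_in[OF c]
  obtain i' where i: "fam X Z (- 1) i'" "i = el X Z (- 1) i'" using G_el[OF m(1)] .
  obtain j' where j: "fam Y Z 0 j'" "j = el Y Z 0 j'" using G_el[OF m(2)] .
  obtain p' where p: "fam Z X 1 p'" "p = el Z X 1 p'" using G_el[OF m(3)] .
  obtain q' where q: "fam Z Y 0 q'" "q = el Z Y 0 q'" using G_el[OF m(4)] .
  note rel = cd_basic[OF c, unfolded i(2) j(2) p(2) q(2)]
  let ?i = "\<lambda>n. i' (n + 1)"
  have ih: "?i n \<in> Hom A (cob X (n + 1)) (cob Z n)" for n using i(1)[unfolded fam_def, rule_format, of "n + 1"] by simp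
  have pi: "Cmp A (p' n) (?i n) = Idn A (cob X (n + 1))" for n
    using el_mult_eqD[OF b(1,3,1) i(1) p(1), of "\<lambda>k. Idn A (cob X k)" "n + 1"] fam_unit[OF b(1)] el_unit[OF b(1)] rel(1) by simp
  have qi: "Cmp A (q' n) (?i n) = Zer A (cob X (n + 1)) (cob Y n)" for n
    using el_mult_eqD[OF b(1,3,2) i(1) q(1), of "\<lambda>k. Zer A (cob X k) (cob Y (k + - 1))" "n + 1"] fam_zero[OF b(1,2), of "- 1"]
      el_zero[OF b(1,2), of "- 1"] rel(3) by simp
  have qj: "Cmp A (q' n) (j' n) = Idn A (cob Y n)" for n
    using el_mult_eqD[OF b(2,3,2) j(1) q(1), of "\<lambda>k. Idn A (cob Y k)" n] fam_unit[OF b(2)] el_unit[OF b(2)] rel(2) by simp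
  have pj: "Cmp A (p' n) (j' n) = Zer A (cob Y n) (cob X (n + 1))" for n
    using el_mult_eqD[OF b(2,3,1) j(1) p(1), of "\<lambda>k. Zer A (cob Y k) (cob X (k + 1))" n] fam_zero[OF b(2,1), of 1]
      el_zero[OF b(2,1), of 1] rel(4) by simp
  have f: "fam Z Z 0 (\<lambda>k. Cmp A (i' (k + 1)) (p' k))" "fam Z Z 0 (\<lambda>k. Cmp A (j' k) (q' k))"
    using fam_mult[OF b(3,1,3) p(1) i(1)] fam_mult[OF b(3,2,3) q(1) j(1)] by auto
  have "i * p + j * q = gr.unit Z" using c unfolding cdata_def by blast
  then have s: "Add A (Cmp A (?i n) (p' n)) (Cmp A (j' n) (q' n)) = Idn A (cob Z n)" for n
    using el_mult[OF b(3,1,3) p(1) i(1)] el_mult[OF b(3,2,3) q(1) j(1)] el_add[OF b(3,3) f] el_unit[OF b(3)]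
      el_inject[OF b(3,3) fam_add[OF b(3,3) f] fam_unit[OF b(3)]] unfolding i j p q by (simp add: fun_eq_iff)
  have d: "deg_biproduct X Y Z ?i j' p' q'"
    unfolding deg_biproduct_def biproduct_diagram_def using b[THEN bdd_obj] ih j(1) p(1) q(1) pi qi qj pj s unfolding fam_def by simp
  have "el Z Z 1 (dif Z) = el Z Z 1 (cone_dif X Y \<phi> ?i j' p' q')"
    unfolding cone_dif_el(2)[OF b d \<phi>] using c unfolding cdata_def dd_def i j p q by simp
  then have "dif Z = cone_dif X Y \<phi> ?i j' p' q'"
    using el_inject[OF b(3,3) fam_dif[OF b(3)] cone_dif_el(1)[OF b d \<phi>]] by blast
  then show ?thesis unfolding chain_cone_alt using d by auto
qed

lemma zero_object_biproduct:
  assumes "biproduct_diagram A X Y Z i j p q" "zero_object A X" "zero_object A Y" shows "zero_object A Z"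
proof -
  have m: "X \<in> Obj A" "Y \<in> Obj A" "Z \<in> Obj A" "i \<in> Hom A X Z" "j \<in> Hom A Y Z" "p \<in> Hom A Z X" "q \<in> Hom A Z Y"
    "Add A (Cmp A i p) (Cmp A j q) = Idn A Z" using assms(1) unfolding biproduct_diagram_def by auto
  have "p = Zer A Z X" "q = Zer A Z Y" using hom_zero_object m assms(2,3) by blast+
  then have "Cmp A i p = Zer A Z Z" "Cmp A j q = Zer A Z Z" using cmp_zer_right m by auto
  then show ?thesis using m(3,8) add_zer[OF zer_in] unfolding zero_object_def by auto
qed

lemma chain_cone_exists:
  assumes b: "bdd X" "bdd Y" and c: "chain_map A X Y \<phi>"
  shows "\<exists>Z. bdd Z \<and> chain_cone A X Y \<phi> Z"
proof -
  have \<phi>: "fam X Y 0 \<phi>" "closed X Y 0 (el X Y 0 \<phi>)" using chain_map_iff0[OF b(1,2)] c by auto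
  have o: "cob X n \<in> Obj A" "cob Y n \<in> Obj A" for n using b bdd_obj by auto
  have "\<exists>Z i j p q. biproduct_diagram A (cob X (n + 1)) (cob Y n) Z i j p q" for n
    using biproduct_exists[OF o(1)[of "n + 1"] o(2)[of n]] unfolding biproduct_def by blast
  then obtain Z i j p q where Z: "\<And>n. biproduct_diagram A (cob X (n + 1)) (cob Y n) (Z n) (i n) (j n) (p n) (q n)" by metis
  have oZ: "Z n \<in> Obj A" for n using Z[of n] unfolding biproduct_diagram_def by blast
  have "{n. \<not> zero_object A (Z n)} \<subseteq> {n. \<not> zero_object A (cob (shift A 1 X) n)} \<union> {n. \<not> nul Y n}"
    using zero_object_biproduct[OF Z] by auto
  then have fin: "finite {n. \<not> zero_object A (Z n)}"
    by (rule finite_subset) (use bdd_shift[OF b(1), of 1] b(2) in \<open>auto simp only: bounded_complex_def finite_Un\<close>)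
  \<comment> \<open>The rules for \<open>el\<close> ask for bounded complexes, but families of
    arrows depend on the objects only. So the square of the cone differential is computed over the
    same objects with zero differential, and only then is \<open>?Z\<close> known to be a
    complex.\<close>
  let ?Z0 = "\<lparr>cob = Z, dif = \<lambda>n. Zer A (Z n) (Z (n + 1))\<rparr>"
  have b0: "bdd ?Z0" unfolding bounded_complex_def using oZ zer_in cmp_zer_right[OF oZ oZ oZ zer_in[OF oZ oZ]] fin by simp
  note bb = b b0
  have d0: "deg_biproduct X Y ?Z0 i j p q" unfolding deg_biproduct_def using Z by simp
  let ?\<delta> = "cone_dif X Y \<phi> i j p q"
  note f = cone_dif_el(1)[OF bb d0 \<phi>(1)]
  let ?I = "el X ?Z0 (- 1) (\<lambda>m. i (m - 1))" and ?J = "el Y ?Z0 0 j" and ?P = "el ?Z0 X 1 p" and ?Q = "el ?Z0 Y 0 q" and ?x = "el X Y 0 \<phi>"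
  note r0 = deg_relations(1-4)[OF bb d0]
  note r = r0 r0[THEN assoc_rule] closed0[OF \<phi>(2)] dd_dd[OF b(1)] dd_dd[OF b(2)]
    dd_dd[OF b(1), THEN assoc_rule] dd_dd[OF b(2), THEN assoc_rule]
    mem_gr[OF dd_in[OF b(1)]] mem_gr[OF dd_in[OF b(2)]] mem_gr[OF closed_G[OF \<phi>(2)]]
    mem_gr[OF el_in[OF bb(3,1) deg_fam(3)[OF bb d0]]] mem_gr[OF el_in[OF bb(3,2) deg_fam(4)[OF bb d0]]]
  have "el ?Z0 ?Z0 1 ?\<delta> * el ?Z0 ?Z0 1 ?\<delta> = 0"
    unfolding cone_dif_el(2)[OF bb d0 \<phi>(1)] by (simp add: algebra_simps r)
  then have "el ?Z0 ?Z0 2 (\<lambda>k. Cmp A (?\<delta> (k + 1)) (?\<delta> k)) = el ?Z0 ?Z0 2 (\<lambda>k. Zer A (cob ?Z0 k) (cob ?Z0 (k + 2)))"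
    using el_mult[OF b0 b0 b0 f f] el_zero[OF b0 b0, of 2] by simp
  then have "(\<lambda>k. Cmp A (?\<delta> (k + 1)) (?\<delta> k)) = (\<lambda>k. Zer A (cob ?Z0 k) (cob ?Z0 (k + 2)))"
    using el_inject[OF b0 b0] fam_mult[OF b0 b0 b0 f f] fam_zero[OF b0 b0, of 2] by simp
  from fun_cong[OF this] have dd0: "Cmp A (?\<delta> (k + 1)) (?\<delta> k) = Zer A (Z k) (Z (k + 1 + 1))" for k
    by (simp add: add.assoc)
  let ?Z = "\<lparr>cob = Z, dif = ?\<delta>\<rparr>"
  have "bdd ?Z" unfolding bounded_complex_def using oZ f dd0 fin unfolding fam_def by simp
  moreover have "chain_cone A X Y \<phi> ?Z" unfolding chain_cone_alt deg_biproduct_def using Z by (auto simp: cone_dif_def)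
  ultimately show ?thesis by blast
qed

lemma cdata_exists:
  assumes "closed X Y 0 x" shows "\<exists>Z i j p q. cdata X Y Z x i j p q"
proof -
  obtain \<phi> where f: "bdd X" "bdd Y" "fam X Y 0 \<phi>" "x = el X Y 0 \<phi>" "chain_map A X (shift A 0 Y) \<phi>" using closedE[OF assms] .
  then have c: "chain_map A X Y \<phi>" by (simp add: shift_0)
  obtain Z where "bdd Z" "chain_cone A X Y \<phi> Z" using chain_cone_exists[OF f(1,2) c] by blast
  then show ?thesis using chain_cone_cdata[OF f(1,2) _ c] f(4) by blast
qed

subsection \<open>Shifting cones\<close>

text \<open>Identity families, read in degrees -k and k. The last property says that t is closed; it
  comes from the sign of the shifted differential.\<close>

lemma shift_units:
  assumes b: "bdd X"
  obtains t t' where "t \<in> gr.G X (shift A k X) (- k)" "t' \<in> gr.G (shift A k X) X k" "t' * t = gr.unit X"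
    "t * t' = gr.unit (shift A k X)" "dd (shift A k X) * t = sg k (t * dd X)"
proof -
  let ?Y = "shift A k X"
  note bY = bdd_shift[OF b, of k]
  have o: "cob X n \<in> Obj A" for n using b bdd_obj by auto
  let ?t = "\<lambda>m. Idn A (cob X m)" and ?t' = "\<lambda>m. Idn A (cob X (m + k))"
  have f: "fam X ?Y (- k) ?t" "fam ?Y X k ?t'" unfolding fam_def using idn_in o by auto
  have ii: "Cmp A (Idn A (cob X n)) (Idn A (cob X n)) = Idn A (cob X n)" for n using idn_left[OF idn_in] o by simp
  have "el ?Y X k ?t' * el X ?Y (- k) ?t = gr.unit X"
    using el_mult[OF b bY b f] ii by (simp add: unit_family b)
  moreover have "el X ?Y (- k) ?t * el ?Y X k ?t' = gr.unit ?Y"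
    using el_mult[OF bY b bY f(2,1)] ii by (simp add: unit_family bY)
  moreover have "dd ?Y * el X ?Y (- k) ?t = sg k (el X ?Y (- k) ?t * dd X)"
  proof -
    have 1: "Cmp A (dif ?Y (m + - k)) (?t m) = (if even k then dif X m else Neg A (dif X m))" for m
      using idn_right[OF bdd_dif[OF b] o o] idn_right[OF neg_in[OF bdd_dif[OF b] o o] o o] by (simp add: shift_dif)
    have 2: "Cmp A (?t (m + 1)) (dif X m) = dif X m" for m using idn_left[OF bdd_dif[OF b] o o] .
    have g: "fam X ?Y (- k + 1) (dif X)" using fam_el_dd[OF b bY f(1)] unfolding 2 .
    show ?thesis unfolding dd_el[OF b bY f(1)] el_dd[OF b bY f(1)] 1 2 el_sg[OF b bY g] ..
  qed
  ultimately show ?thesis using that[OF el_in[OF b bY f(1)] el_in[OF bY b f(2)]] by blast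
qed

lemma sg_mult: "sg k x * y = sg k (x * y)" "y * sg k x = sg k (y * x)" "sg k (x + z) = sg k x + sg k z" "sg k (x - z) = sg k x - sg k z"
  by (auto simp: sg_def algebra_simps)

lemma triangle_shift:
  assumes "triangle X Y Z f j p" shows "\<exists>f' j' p'. triangle (shift A k X) (shift A k Y) (shift A k Z) f' j' p'"
proof -
  obtain x i j p q where c: "cdata X Y Z x i j p q" using assms by (auto elim!: triangleE)
  note m = cd_in[OF c]
  obtain a a' where a: "a \<in> gr.G X (shift A k X) (- k)" "a' \<in> gr.G (shift A k X) X k" "a' * a = gr.unit X"
    "a * a' = gr.unit (shift A k X)" "dd (shift A k X) * a = sg k (a * dd X)" using shift_units[OF m(7)] .
  obtain b b' where b: "b \<in> gr.G Y (shift A k Y) (- k)" "b' \<in> gr.G (shift A k Y) Y k" "b' * b = gr.unit Y"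
    "b * b' = gr.unit (shift A k Y)" "dd (shift A k Y) * b = sg k (b * dd Y)" using shift_units[OF m(8)] .
  obtain d d' where d: "d \<in> gr.G Z (shift A k Z) (- k)" "d' \<in> gr.G (shift A k Z) Z k" "d' * d = gr.unit Z"
    "d * d' = gr.unit (shift A k Z)" "dd (shift A k Z) * d = sg k (d * dd Z)" using shift_units[OF m(9)] .
  note r = cd_basic[OF c] cd_basic[OF c, THEN assoc_rule] mem_gr[OF m(1)] mem_gr[OF m(2)] mem_gr[OF m(3)] mem_gr[OF m(4)] mem_gr[OF m(6)]
    mem_gr[OF dd_in[OF m(7)]] mem_gr[OF dd_in[OF m(8)]] mem_gr[OF dd_in[OF m(9)]]
    a(3,4) b(3,4) d(3,4) a(3,4)[THEN assoc_rule] b(3,4)[THEN assoc_rule] d(3,4)[THEN assoc_rule]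
    mem_gr[OF a(1)] mem_gr[OF a(2)] mem_gr[OF b(1)] mem_gr[OF b(2)] mem_gr[OF d(1)] mem_gr[OF d(2)]
  have D: "dd (shift A k X) = sg k (a * dd X * a')" "dd (shift A k Y) = sg k (b * dd Y * b')" "dd (shift A k Z) = sg k (d * dd Z * d')"
  proof -
    have "dd (shift A k X) = dd (shift A k X) * (a * a')" using a(4) gr.G_unit_right[OF dd_in[OF bdd_shift[OF m(7)]]] by simp
    then show "dd (shift A k X) = sg k (a * dd X * a')" using a(5) by (simp add: mult.assoc[symmetric] sg_mult)
    have "dd (shift A k Y) = dd (shift A k Y) * (b * b')" using b(4) gr.G_unit_right[OF dd_in[OF bdd_shift[OF m(8)]]] by simp
    then show "dd (shift A k Y) = sg k (b * dd Y * b')" using b(5) by (simp add: mult.assoc[symmetric] sg_mult)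
    have "dd (shift A k Z) = dd (shift A k Z) * (d * d')" using d(4) gr.G_unit_right[OF dd_in[OF bdd_shift[OF m(9)]]] by simp
    then show "dd (shift A k Z) = sg k (d * dd Z * d')" using d(5) by (simp add: mult.assoc[symmetric] sg_mult)
  qed
  have dZ: "dd Z = j * x * p + j * dd Y * q - i * dd X * p" and s: "i * p + j * q = gr.unit Z" using c unfolding cdata_def by auto
  \<comment> \<open>The sign on the projection gives the x-term of the differential its factor
    (-1)^k; the inclusion must carry it too, so that their product remains a unit.\<close>
  let ?x = "b * x * a'" and ?i = "sg k (d * i * a')" and ?j = "d * j * b'" and ?p = "sg k (a * p * d')" and ?q = "b * q * d'"
  have sgG: "z \<in> gr.G U V n \<Longrightarrow> sg k z \<in> gr.G U V n" for z U V n using gr.G_neg by (simp add: sg_def)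
  have "cdata (shift A k X) (shift A k Y) (shift A k Z) ?x ?i ?j ?p ?q"
    unfolding cdata_def
  proof (intro conjI)
    show "bdd (shift A k X)" "bdd (shift A k Y)" "bdd (shift A k Z)" using m bdd_shift by auto
    show "closed (shift A k X) (shift A k Y) 0 ?x"
    proof (rule closed0I)
      show "?x \<in> gr.G (shift A k X) (shift A k Y) 0" using gr.G_mult[OF gr.G_mult[OF b(1) m(6)] a(2)] by simp
      show "dd (shift A k Y) * ?x = ?x * dd (shift A k X)"
        unfolding D by (simp add: sg_mult mult.assoc r closed0[OF m(5)])
    qed
    show "?i \<in> gr.G (shift A k X) (shift A k Z) (- 1)" using gr.G_mult[OF gr.G_mult[OF d(1) m(1)] a(2)] sgG by simp
    show "?j \<in> gr.G (shift A k Y) (shift A k Z) 0" using gr.G_mult[OF gr.G_mult[OF d(1) m(2)] b(2)] by simp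
    show "?p \<in> gr.G (shift A k Z) (shift A k X) 1" using gr.G_mult[OF gr.G_mult[OF a(1) m(3)] d(2)] sgG by simp
    show "?q \<in> gr.G (shift A k Z) (shift A k Y) 0" using gr.G_mult[OF gr.G_mult[OF b(1) m(4)] d(2)] by simp
    show "?p * ?i = gr.unit (shift A k X)" "?q * ?j = gr.unit (shift A k Y)" "?q * ?i = 0" "?p * ?j = 0"
      by (simp_all add: sg_mult mult.assoc r) (simp_all add: sg_def)
    have "?i * ?p + ?j * ?q = d * (i * p + j * q) * d'" by (simp add: sg_mult mult.assoc r algebra_simps)
    then show "?i * ?p + ?j * ?q = gr.unit (shift A k Z)" unfolding s by (simp add: r)
    show "dd (shift A k Z) = ?j * ?x * ?p + ?j * dd (shift A k Y) * ?q - ?i * dd (shift A k X) * ?p"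
      unfolding D dZ by (simp add: sg_mult mult.assoc r algebra_simps)
  qed
  then show ?thesis unfolding triangle_def by blast
qed

subsection \<open>The homotopy category is triangulated\<close>

text \<open>Direct sums are cones of zero maps X[-1] \<rightarrow> Y. For x = 0 the maps i and q are
  closed as well, so the splitting descends to the homotopy category.\<close>

lemma zero_cone_biproduct:
  assumes b: "bdd X" "bdd Y" and c: "cdata (shift A (- 1) X) Y Z 0 i j p q"
  shows "\<exists>i\<in>kb.G X Z 0. \<exists>j\<in>kb.G Y Z 0. \<exists>p\<in>kb.G Z X 0. \<exists>q\<in>kb.G Z Y 0.
      p * i = kb.unit X \<and> q * j = kb.unit Y \<and> q * i = 0 \<and> p * j = 0 \<and> i * p + j * q = kb.unit Z"
proof -
  let ?X = "shift A (- 1) X"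
  note bX = bdd_shift[OF b(1), of "- 1"]
  note m = cd_in[OF c] cd_closed[OF c]
  have i: "closed ?X Z (- 1) i" by (rule closedI[OF m(1)]) (simp add: cd_d[OF c])
  have q: "closed Z Y 0 q" by (rule closed0I[OF m(4)]) (simp add: cd_d[OF c])
  obtain s s' where s: "s \<in> kb.G X ?X 1" "s' \<in> kb.G ?X X (- 1)" "s' * s = kb.unit X" "s * s' = kb.unit ?X"
    using kb.G_shift[of X "- 1"] b(1) by auto
  let ?i = "cls ?X Z (- 1) i" and ?j = "cls Y Z 0 j" and ?p = "cls Z ?X 1 p" and ?q = "cls Z Y 0 q"
  have "i * p + j * q = gr.unit Z" using c unfolding cdata_def by blast
  then have sum: "?i * ?p + ?j * ?q = kb.unit Z"
    using cls_mult[OF m(11) i] cls_mult[OF q m(10)] cls_add[OF closed_mult[OF m(11) i], of "j * q"] closed_mult[OF q m(10)] cls_unit[OF m(9)]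
    by simp
  have 0: "cls U V n 0 = 0" if "bdd U" "bdd V" for U V n using cls_zero_iff[OF closed_zero[OF that]] bdry_zero[OF that] by blast
  have pi: "?p * ?i = kb.unit ?X" "?q * ?j = kb.unit Y" "?q * ?i = 0" "?p * ?j = 0"
    using cls_mult[OF i m(11)] cls_mult[OF m(10) q] cls_mult[OF i q] cls_mult[OF m(10,11)] cls_unit[OF bX] cls_unit[OF b(2)]
    by (simp_all add: cd_basic[OF c] 0 bX b)
  note r = pi pi[THEN assoc_rule] s(3,4) s(3,4)[THEN assoc_rule] kb.G_unit_left[OF s(1)] kb.G_unit_right[OF s(1)]
    kb.G_unit_left[OF cls_in[OF m(11)]] kb.G_unit_left[OF cls_in[OF m(11)], THEN assoc_rule]
  have "?i * s \<in> kb.G X Z 0" "s' * ?p \<in> kb.G Z X 0" using kb.G_mult[OF cls_in[OF i] s(1)] kb.G_mult[OF s(2) cls_in[OF m(11)]] by auto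
  moreover have "s' * ?p * (?i * s) = kb.unit X" "?q * (?i * s) = 0" "s' * ?p * ?j = 0" "?i * s * (s' * ?p) + ?j * ?q = kb.unit Z"
    using sum by (simp_all add: mult.assoc r)
  ultimately show ?thesis using pi(2) cls_in[OF m(10)] cls_in[OF q] by blast
qed

lemma Kb_graded_category: "graded_category (Obj KA) kb.G kb.unit (shift A)"
proof (unfold_locales, goal_cases)
  case 1 then show ?case by (rule kb.G_obj)
next
  case 2 then show ?case by (rule kb.G_unit)
next
  case 3 then show ?case by (rule kb.G_zero)
next
  case 4 then show ?case by (rule kb.G_add)
next
  case 5 then show ?case by (rule kb.G_neg)
next
  case 6 then show ?case by (rule kb.G_mult)
next
  case 7 then show ?case by (rule kb.G_unit_left)
next
  case 8 then show ?case by (rule kb.G_unit_right)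
next
  case 9
  obtain z where z: "zero_object A z" using zero_object_exists by blast
  have zO: "z \<in> Obj A" and zI: "Idn A z = Zer A z z" using z unfolding zero_object_def by auto
  let ?Z = "\<lparr>cob = \<lambda>_. z, dif = \<lambda>_. Zer A z z\<rparr>"
  have b: "bdd ?Z" unfolding bounded_complex_def using zO z zer_in cmp_zer_right[OF zO zO zO zer_in[OF zO zO]] by simp
  have "gr.unit ?Z = 0" using el_unit[OF b] el_zero[OF b b, of 0] zI by simp
  then have "kb.unit ?Z = 0" using cls_unit[OF b] cls_zero_iff[OF closed_zero[OF b b]] bdry_zero[OF b b] by simp
  then show ?case using b by auto
next
  case (10 X Y)
  have b: "bdd X" "bdd Y" using 10 by auto
  obtain Z i j p q where c: "cdata (shift A (- 1) X) Y Z 0 i j p q" using cdata_exists[OF closed_zero[OF bdd_shift[OF b(1)] b(2)]] by blast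
  show ?case using zero_cone_biproduct[OF b c] cd_in(9)[OF c] by (intro bexI[of _ Z]) simp_all
next
  case 11 then show ?case by (rule kb.G_shift)
qed

sublocale K: graded_category "Obj KA" kb.G kb.unit "shift A"
  by (rule Kb_graded_category)

lemma triangle_exists: assumes "f \<in> kb.G X Y 0" shows "\<exists>Z j p. triangle X Y Z f j p"
proof -
  obtain x where "closed X Y 0 x" "f = cls X Y 0 x" using cls_surj[OF assms] .
  then show ?thesis using cdata_exists[of X Y x] unfolding triangle_def by blast
qed

lemma triangle_rotate: assumes "triangle X Y Z f j p" shows "\<exists>W j' p'. triangle Y Z W j j' p' \<and> K.iso W (shift A 1 X)"
proof -
  obtain x i j1 p1 q where c: "cdata X Y Z x i j1 p1 q" and e: "j = cls Y Z 0 j1" using triangleE[OF assms] .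
  obtain W i2 j2 p2 q2 where c2: "cdata Y Z W j1 i2 j2 p2 q2" using cdata_exists[OF cd_closed(1)[OF c]] by blast
  obtain a b where ab: "a \<in> kb.G X W (- 1)" "b \<in> kb.G W X 1" "b * a = kb.unit X" "a * b = kb.unit W"
    using cdata_rotate[OF c c2] by blast
  have "X \<in> Obj KA" using cd_in(7)[OF c] by simp
  then obtain s s' where s: "s \<in> kb.G X (shift A 1 X) (- 1)" "s' \<in> kb.G (shift A 1 X) X 1" "s' * s = kb.unit X" "s * s' = kb.unit (shift A 1 X)"
    using kb.G_shift[of X 1] by blast
  have "K.iso W (shift A 1 X)"
    by (rule K.iso_of_shift_unit[OF ab(1) _ ab(3,4) s(1) _ s(3,4)]) (use ab s in auto)
  then show ?thesis using c2 e unfolding triangle_def by blast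
qed

lemma triangle_octahedral:
  assumes t1: "triangle X Y D f j p" and t2: "triangle Y W B g j' p'" and t3: "triangle X W C (g * f) j'' p''"
  shows "\<exists>m n r B'. triangle D C B' m n r \<and> K.iso B' B"
proof -
  obtain x i1 j1 p1 q1 where c1: "cdata X Y D x i1 j1 p1 q1" and e1: "f = cls X Y 0 x" using triangleE[OF t1] .
  obtain y i2 j2 p2 q2 where c2: "cdata Y W B y i2 j2 p2 q2" and e2: "g = cls Y W 0 y" using triangleE[OF t2] .
  obtain z i3 j3 p3 q3 where c3: "cdata X W C z i3 j3 p3 q3" and e3: "g * f = cls X W 0 z" using triangleE[OF t3] .
  note x = cd_in(5)[OF c1] and y = cd_in(5)[OF c2] and z = cd_in(5)[OF c3]
  have yx: "closed X W 0 (y * x)" using closed_mult[OF x y] by simp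
  have "cls X W 0 z = cls X W 0 (y * x)" using e1 e2 e3 cls_mult[OF x y] by simp
  then have "bdry X W 0 (z - y * x)" using cls_eq_iff[OF z yx] by blast
  then obtain s where s: "s \<in> gr.G X W (- 1)" "z - y * x = dd W * s + s * dd X" by (rule bdry0E)
  note c3' = cdata_change[OF c3 yx s]
  obtain M i j p q where c: "cdata D C M ((i3 - j3 * s) * p1 + j3 * y * q1) i j p q"
    using cdata_exists[OF closed_octahedral_map[OF c1 y c3']] by blast
  have "K.iso M B" using cdata_octahedral[OF c1 c2 c3' c] unfolding kiso_def K.iso_def .
  then show ?thesis using c unfolding triangle_def by blast
qed

lemma Kb_triangulated: "triangulated (Obj KA) kb.G kb.unit (shift A) triangle"
  by unfold_locales (rule triangle_in triangle_zero triangle_exists triangle_cov_Y triangle_cov_Z triangle_cov_X triangle_con_Y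
    triangle_con_Z triangle_con_X triangle_morphism triangle_rotate triangle_shift triangle_octahedral; assumption)+

sublocale K: triangulated "Obj KA" kb.G kb.unit "shift A" triangle
  by (rule Kb_triangulated)

subsection \<open>Arrows of the homotopy category as ring elements\<close>

definition arr where "arr X Y f = kb.gel X Y 0 f"

lemma arr_in: "f \<in> Hom KA X Y \<Longrightarrow> bdd X \<Longrightarrow> bdd Y \<Longrightarrow> arr X Y f \<in> kb.G X Y 0"
  unfolding arr_def by (rule kb.gel_in) (auto simp: shift_0)

lemma arrE: assumes "u \<in> kb.G X Y 0" obtains f where "f \<in> Hom KA X Y" "u = arr X Y f" "bdd X" "bdd Y"
  using kb.G_E[OF assms] unfolding arr_def shift_0 by (metis Kb_obj)

lemma arr_mult:
  assumes "bdd X" "bdd Y" "bdd Z" "f \<in> Hom KA X Y" "g \<in> Hom KA Y Z"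
  shows "arr Y Z g * arr X Y f = arr X Z (Cmp KA g f)"
  using kb.gel_mult[of X Y Z f 0 g 0] kb.sA_0[OF assms(5)] assms unfolding arr_def by (simp add: shift_0)

lemma arr_add:
  assumes "bdd X" "bdd Y" "f \<in> Hom KA X Y" "g \<in> Hom KA X Y"
  shows "arr X Y f + arr X Y g = arr X Y (Add KA f g)"
  using kb.gel_add[of X Y f 0 g] assms unfolding arr_def by (simp add: shift_0)

lemma arr_zero: "bdd X \<Longrightarrow> bdd Y \<Longrightarrow> arr X Y (Zer KA X Y) = 0"
  using kb.gel_zer[of X Y 0] unfolding arr_def by (simp add: shift_0)

lemma arr_unit: "bdd X \<Longrightarrow> arr X X (Idn KA X) = kb.unit X"
  using kb.unit_eq_gel[of X] unfolding arr_def by simp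

lemma arr_inject:
  "\<lbrakk>bdd X; bdd Y; f \<in> Hom KA X Y; g \<in> Hom KA X Y\<rbrakk> \<Longrightarrow> arr X Y f = arr X Y g \<longleftrightarrow> f = g"
  unfolding arr_def by (rule kb.gel_inject) (auto simp: shift_0)

lemma Kb_cmp_in: "\<lbrakk>bdd X; bdd Y; bdd Z; f \<in> Hom KA X Y; g \<in> Hom KA Y Z\<rbrakk> \<Longrightarrow> Cmp KA g f \<in> Hom KA X Z"
  using kb.cmp_in[of g Y Z f X] by simp

lemma Kb_add_in: "\<lbrakk>bdd X; bdd Y; f \<in> Hom KA X Y; g \<in> Hom KA X Y\<rbrakk> \<Longrightarrow> Add KA f g \<in> Hom KA X Y"
  using kb.add_in[of f X Y g] by simp

lemma Kb_zer_in: "bdd X \<Longrightarrow> bdd Y \<Longrightarrow> Zer KA X Y \<in> Hom KA X Y"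
  using kb.zer_in[of X Y] by simp

lemma Kb_idn_in: "bdd X \<Longrightarrow> Idn KA X \<in> Hom KA X X"
  using kb.idn_in[of X] by simp

lemma cmp_idn_iff:
  assumes "bdd X" "bdd Y" "f \<in> Hom KA X Y" "g \<in> Hom KA Y X"
  shows "Cmp KA g f = Idn KA X \<longleftrightarrow> arr Y X g * arr X Y f = kb.unit X"
  using arr_inject[OF assms(1,1) Kb_cmp_in[OF assms(1,2,1,3,4)] Kb_idn_in[OF assms(1)]] assms
  by (simp add: arr_mult arr_unit)

lemma cmp_zer_iff:
  assumes "bdd X" "bdd Y" "bdd Z" "f \<in> Hom KA X Y" "g \<in> Hom KA Y Z"
  shows "Cmp KA g f = Zer KA X Z \<longleftrightarrow> arr Y Z g * arr X Y f = 0"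
  using arr_inject[OF assms(1,3) Kb_cmp_in[OF assms] Kb_zer_in[OF assms(1,3)]] assms
  by (simp add: arr_mult arr_zero)

lemma arr_image: "\<lbrakk>bdd X; bdd Y\<rbrakk> \<Longrightarrow> kb.G X Y 0 = arr X Y ` Hom KA X Y"
  using arr_in arrE by blast

lemma isomorphic_iff: "isomorphic KA X Y \<longleftrightarrow> K.iso X Y"
proof (cases "bdd X \<and> bdd Y")
  case True
  then have "Cmp KA g f = Idn KA X \<longleftrightarrow> arr Y X g * arr X Y f = kb.unit X"
    "Cmp KA f g = Idn KA Y \<longleftrightarrow> arr X Y f * arr Y X g = kb.unit Y"
    if "f \<in> Hom KA X Y" "g \<in> Hom KA Y X" for f g using cmp_idn_iff that by auto
  with True show ?thesis unfolding isomorphic_def K.iso_def by (simp add: arr_image cong: bex_cong)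
next
  case False
  then show ?thesis using K.iso_ob[of X Y] unfolding isomorphic_def by auto
qed

lemma zero_object_iff: "zero_object KA X \<longleftrightarrow> K.zero_obj X"
  unfolding zero_object_def K.zero_obj_def
  using arr_inject[of X X "Idn KA X" "Zer KA X X"] by (auto simp: Kb_idn_in Kb_zer_in arr_unit arr_zero)

lemma biproduct_diagram_iff:
  assumes b: "bdd X" "bdd Y" "bdd Z" and h: "i \<in> Hom KA X Z" "j \<in> Hom KA Y Z" "p \<in> Hom KA Z X" "q \<in> Hom KA Z Y"
  shows "biproduct_diagram KA X Y Z i j p q \<longleftrightarrow> K.bip X Y Z (arr X Z i) (arr Y Z j) (arr Z X p) (arr Z Y q)"
proof -
  note ip = Kb_cmp_in[OF b(3,1,3) h(3,1)] and jq = Kb_cmp_in[OF b(3,2,3) h(4,2)]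
  have "Add KA (Cmp KA i p) (Cmp KA j q) = Idn KA Z \<longleftrightarrow>
      arr X Z i * arr Z X p + arr Y Z j * arr Z Y q = kb.unit Z"
    using arr_inject[OF b(3,3) Kb_add_in[OF b(3,3) ip jq] Kb_idn_in[OF b(3)]] arr_add[OF b(3,3) ip jq]
      arr_mult[OF b(3,1,3) h(3,1)] arr_mult[OF b(3,2,3) h(4,2)] arr_unit[OF b(3)] by simp
  then show ?thesis
    unfolding biproduct_diagram_def K.bip_def
    using b h cmp_idn_iff[OF b(1,3) h(1,3)] cmp_idn_iff[OF b(2,3) h(2,4)] cmp_zer_iff[OF b(1,3,2) h(1,4)] cmp_zer_iff[OF b(2,3,1) h(2,3)]
      arr_in[OF h(1) b(1,3)] arr_in[OF h(2) b(2,3)] arr_in[OF h(3) b(3,1)] arr_in[OF h(4) b(3,2)]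
    by simp
qed

lemma biproduct_iff: "biproduct KA X Y Z \<longleftrightarrow> K.isbip X Y Z"
proof
  assume "biproduct KA X Y Z"
  then obtain i j p q where d: "biproduct_diagram KA X Y Z i j p q" unfolding biproduct_def by blast
  then have h: "bdd X" "bdd Y" "bdd Z" "i \<in> Hom KA X Z" "j \<in> Hom KA Y Z" "p \<in> Hom KA Z X" "q \<in> Hom KA Z Y"
    unfolding biproduct_diagram_def by auto
  show "K.isbip X Y Z" using biproduct_diagram_iff[OF h] d unfolding K.isbip_def by blast
next
  assume "K.isbip X Y Z"
  then obtain i j p q where d: "K.bip X Y Z i j p q" unfolding K.isbip_def by blast
  note m = K.bip_in[OF d]
  obtain i' where i: "i' \<in> Hom KA X Z" "i = arr X Z i'" and b: "bdd X" "bdd Z" using arrE[OF m(1)] .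
  obtain j' where j: "j' \<in> Hom KA Y Z" "j = arr Y Z j'" and bY: "bdd Y" using arrE[OF m(2)] .
  obtain p' where p: "p' \<in> Hom KA Z X" "p = arr Z X p'" using arrE[OF m(3)] .
  obtain q' where q: "q' \<in> Hom KA Z Y" "q = arr Z Y q'" using arrE[OF m(4)] .
  show "biproduct KA X Y Z"
    using biproduct_diagram_iff[OF b(1) bY b(2) i(1) j(1) p(1) q(1)] d unfolding i(2) j(2) p(2) q(2) biproduct_def by blast
qed

lemma direct_sum_iff: "direct_sum KA Xs Z \<longleftrightarrow> K.dsum Xs Z"
  by (induction Xs arbitrary: Z) (simp_all add: zero_object_iff biproduct_iff)

lemma add_cat_eq: "add_cat KA X = K.addc X"
  unfolding add_cat_def K.addc_def summand_def by (auto simp: direct_sum_iff biproduct_iff)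

lemma indecomposable_iff: "indecomposable KA X \<longleftrightarrow> K.indec X"
  unfolding indecomposable_def K.indec_def by (simp add: zero_object_iff biproduct_iff)

text \<open>The sum of a and its complement is the identity, a unit, so the two cannot both be
  non-units.\<close>

lemma local_ring_loc:
  assumes X: "bdd X" and l: "local_ring (End_ring KA X)" shows "K.loc X"
  unfolding K.loc_def
proof (intro conjI ballI)
  let ?E = "End_ring KA X"
  have E: "carrier ?E = Hom KA X X" "monoid.mult ?E = Cmp KA" "one ?E = Idn KA X" "zero ?E = Zer KA X X" "add ?E = Add KA"
    unfolding End_ring_def by simp_all
  have l1: "\<one>\<^bsub>?E\<^esub> \<noteq> \<zero>\<^bsub>?E\<^esub>" "\<And>a b. \<lbrakk>a \<in> carrier ?E - Units ?E; b \<in> carrier ?E - Units ?E\<rbrakk> \<Longrightarrow> a \<oplus>\<^bsub>?E\<^esub> b \<notin> Units ?E"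
    and r: "ring ?E" using l unfolding local_ring_def by auto
  show "X \<in> Obj KA" using X by simp
  show "kb.unit X \<noteq> 0"
    using l1(1) arr_inject[OF X X Kb_idn_in[OF X] Kb_zer_in[OF X X]] unfolding E by (simp add: arr_unit arr_zero X)
  fix a assume a: "a \<in> kb.G X X 0"
  obtain f where f: "f \<in> Hom KA X X" "a = arr X X f" using arrE[OF a] .
  obtain g where g: "g \<in> Hom KA X X" "kb.unit X - a = arr X X g" using arrE[OF K.diff_in[OF K.e_in a]] X by auto
  have inv: "K.invertible X (arr X X u)" if u: "u \<in> Units ?E" for u
  proof -
    obtain v where v: "u \<in> Hom KA X X" "v \<in> Hom KA X X" "Cmp KA v u = Idn KA X" "Cmp KA u v = Idn KA X"
      using u unfolding Units_def E by auto
    then show ?thesis unfolding K.invertible_def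
      using cmp_idn_iff[OF X X v(1,2)] cmp_idn_iff[OF X X v(2,1)] arr_in[OF v(2) X X] by blast
  qed
  have "arr X X (Add KA f g) = arr X X (Idn KA X)"
    using arr_add[OF X X f(1) g(1)] unfolding f(2)[symmetric] g(2)[symmetric] arr_unit[OF X] by simp
  then have "Add KA f g = Idn KA X" using arr_inject[OF X X Kb_add_in[OF X X f(1) g(1)] Kb_idn_in[OF X]] by simp
  moreover have "\<one>\<^bsub>?E\<^esub> \<in> Units ?E" using ring.is_monoid[OF r] monoid.Units_one_closed by blast
  ultimately have "f \<in> Units ?E \<or> g \<in> Units ?E" using l1(2)[of f g] f(1) g(1) unfolding E by auto
  then show "K.invertible X a \<or> K.invertible X (kb.unit X - a)" using inv[of f] inv[of g] unfolding f(2)[symmetric] g(2)[symmetric] by blast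
qed

lemma right_approx_iff:
  assumes U: "U \<subseteq> Obj KA" and X: "bdd X"
  shows "right_approx KA U Q X f \<longleftrightarrow> f \<in> Hom KA Q X \<and> K.right_app U Q X (arr Q X f)"
proof (cases "Q \<in> U \<and> f \<in> Hom KA Q X")
  case True
  have b: "bdd W" if "W \<in> U" for W using that U by auto
  have "(\<exists>g\<in>Hom KA W Q. h = Cmp KA f g) \<longleftrightarrow> (\<exists>g\<in>Hom KA W Q. arr W X h = arr Q X f * arr W Q g)"
    if "W \<in> U" "h \<in> Hom KA W X" for W h
    using arr_inject[OF b[OF that(1)] X that(2) Kb_cmp_in] arr_mult[of W Q X] b[OF that(1)] b[of Q] X True by auto
  then show ?thesis unfolding right_approx_def K.right_app_def using True X b arr_in by (simp add: arr_image)
qed (auto simp: right_approx_def K.right_app_def)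

lemma left_approx_iff:
  assumes U: "U \<subseteq> Obj KA" and X: "bdd X"
  shows "left_approx KA U X Q f \<longleftrightarrow> f \<in> Hom KA X Q \<and> K.left_app U X Q (arr X Q f)"
proof (cases "Q \<in> U \<and> f \<in> Hom KA X Q")
  case True
  have b: "bdd W" if "W \<in> U" for W using that U by auto
  have "(\<exists>g\<in>Hom KA Q W. h = Cmp KA g f) \<longleftrightarrow> (\<exists>g\<in>Hom KA Q W. arr X W h = arr Q W g * arr X Q f)"
    if "W \<in> U" "h \<in> Hom KA X W" for W h
    using arr_inject[OF X b[OF that(1)] that(2) Kb_cmp_in] arr_mult[of X Q W] b[OF that(1)] b[of Q] X True by auto
  then show ?thesis unfolding left_approx_def K.left_app_def using True X b arr_in by (simp add: arr_image)
qed (auto simp: left_approx_def K.left_app_def)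

lemma arr_cls: "\<lbrakk>bdd X; bdd Y; chain_map A X Y \<phi>\<rbrakk> \<Longrightarrow> arr X Y (kap X Y \<phi>) = cls X Y 0 (el X Y 0 \<phi>)"
  unfolding arr_def using cls_el[of X Y 0 \<phi>] chain_map_iff0[of X Y \<phi>] by (simp add: shift_0)

lemma cone_iff: "cone A X Y f Z \<longleftrightarrow> f \<in> Hom KA X Y \<and> (\<exists>j p. triangle X Y Z (arr X Y f) j p)"
proof
  assume c: "cone A X Y f Z"
  then obtain \<phi> where b: "bdd X" "bdd Y" "bdd Z" and f: "f \<in> Hom KA X Y" and \<phi>: "\<phi> \<in> fst (snd f)" "chain_cone A X Y \<phi> Z"
    unfolding cone_def by auto
  obtain \<psi> where p: "f = kap X Y \<psi>" "chain_map A X Y \<psi>" using Kb_homE[OF f] .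
  have h: "chain_map A X Y \<phi>" "homotopic A X Y \<psi> \<phi>" using \<phi>(1) unfolding p(1) kap_def homotopy_class_def by auto
  have e: "f = kap X Y \<phi>" using kap_eq[OF b(1,2) p(2) h(1)] h(2) p(1) by blast
  obtain i j q r where "cdata X Y Z (el X Y 0 \<phi>) i j q r" using chain_cone_cdata[OF b h(1) \<phi>(2)] by blast
  then have "triangle X Y Z (arr X Y f) (cls Y Z 0 j) (cls Z X 1 q)" unfolding triangle_def e arr_cls[OF b(1,2) h(1)] by blast
  then show "f \<in> Hom KA X Y \<and> (\<exists>j p. triangle X Y Z (arr X Y f) j p)" using f by blast
next
  assume "f \<in> Hom KA X Y \<and> (\<exists>j p. triangle X Y Z (arr X Y f) j p)"
  then obtain j p where f: "f \<in> Hom KA X Y" and t: "triangle X Y Z (arr X Y f) j p" by blast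
  obtain x i j' p' q where c: "cdata X Y Z x i j' p' q" and e: "arr X Y f = cls X Y 0 x" using triangleE[OF t] .
  note b = cd_in(7,8,9)[OF c]
  obtain \<phi> where \<phi>: "fam X Y 0 \<phi>" "x = el X Y 0 \<phi>" using closedE[OF cd_in(5)[OF c]] by metis
  have cm: "chain_map A X Y \<phi>" using chain_map_iff0[OF b(1,2)] \<phi> cd_in(5)[OF c] by simp
  have "f = kap X Y \<phi>" using arr_inject[OF b(1,2) f Kb_homI[OF cm]] e unfolding \<phi>(2) arr_cls[OF b(1,2) cm] by blast
  then have "\<phi> \<in> fst (snd f)" using class_self[OF b(1,2) cm] by (simp add: kap_def)
  then show "cone A X Y f Z" unfolding cone_def using b f cdata_chain_cone[OF c[unfolded \<phi>(2)] \<phi>(1)] by auto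
qed

lemma triangle_cone:
  assumes "triangle X Y Z u j p" obtains f where "cone A X Y f Z" "u = arr X Y f"
proof -
  have "u \<in> kb.G X Y 0" using triangle_in[OF assms] by blast
  then obtain f where "f \<in> Hom KA X Y" "u = arr X Y f" using arrE by metis
  then show ?thesis using that cone_iff assms by blast
qed

subsection \<open>Silting complexes\<close>

lemma van_iff: assumes "bdd X" "bdd Y" shows "Hom KA X (shift A k Y) = {Zer KA X (shift A k Y)} \<longleftrightarrow> K.van X Y k"
proof -
  note b = assms and bs = bdd_shift[OF assms(2), of k]
  have z: "f = Zer KA X (shift A k Y) \<longleftrightarrow> kb.gel X Y k f = 0" if "f \<in> Hom KA X (shift A k Y)" for f
    using kb.gel_inject[of X Y f k "Zer KA X (shift A k Y)"] kb.gel_zer[of X Y k] that b Kb_zer_in[OF b(1) bs] by simp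
  show ?thesis
  proof
    assume h: "Hom KA X (shift A k Y) = {Zer KA X (shift A k Y)}"
    show "K.van X Y k"
    proof (rule K.vanI)
      fix u assume "u \<in> kb.G X Y k"
      then obtain f where "f \<in> Hom KA X (shift A k Y)" "u = kb.gel X Y k f" using kb.G_E by metis
      then show "u = 0" using z h by blast
    qed
  next
    assume v: "K.van X Y k"
    have "f = Zer KA X (shift A k Y)" if f: "f \<in> Hom KA X (shift A k Y)" for f
      using z[OF f] K.vanD[OF v kb.gel_in[OF _ _ f]] b by simp
    then show "Hom KA X (shift A k Y) = {Zer KA X (shift A k Y)}" using Kb_zer_in[OF b(1) bs] by blast
  qed
qed

lemma presilting_iff: "presilting A P \<longleftrightarrow> K.presil P"
  unfolding presilting_def K.presil_def using van_iff[of P P] by auto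

lemma thick_iff: "thick A U \<longleftrightarrow> K.thk U"
proof -
  have "(\<forall>X\<in>U. \<forall>Y\<in>U. \<forall>f Z. cone A X Y f Z \<longrightarrow> Z \<in> U) \<longleftrightarrow> (\<forall>X\<in>U. \<forall>Y\<in>U. \<forall>Z f j p. triangle X Y Z f j p \<longrightarrow> Z \<in> U)"
    using triangle_cone cone_iff by meson
  then show ?thesis unfolding thick_def K.thk_def summand_def isomorphic_iff biproduct_iff by simp
qed

lemma thk_all: "K.thk (Obj KA)"
  unfolding K.thk_def
proof (intro conjI ballI allI impI)
  show "Obj KA \<noteq> {}" using K.has_zero by blast
qed (use K.iso_ob K.sh_in K.tr_ob K.isbip_ob in blast)+

lemma silting_iff: "silting A P \<longleftrightarrow> K.silt P"
proof -
  have "thick_closure A P = Obj KA \<longleftrightarrow> K.generates P" if "P \<in> Obj KA"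
  proof
    assume t: "thick_closure A P = Obj KA"
    show "K.generates P" unfolding K.generates_def
    proof (intro allI impI)
      fix U assume U: "K.thk U \<and> P \<in> U"
      then have "thick_closure A P \<subseteq> U" unfolding thick_closure_def thick_iff by blast
      then show "U = Obj KA" using t U unfolding K.thk_def by blast
    qed
  next
    assume "K.generates P"
    then have "{U. thick A U \<and> P \<in> U} = {Obj KA}" using thk_all that unfolding K.generates_def thick_iff by blast
    then show "thick_closure A P = Obj KA" unfolding thick_closure_def by simp
  qed
  then show ?thesis unfolding silting_def K.silt_def presilting_iff K.presil_def by blast
qed

lemma addc_sub: "K.addc X \<subseteq> Obj KA"
  using K.addc_ob by blast

lemma mutation_irreducible: assumes "K.mutation S T" shows "irreducible_left_mutation A S T"
proof -
  obtain X Y U X' u Z V j p where m: "K.isbip X Y U" "K.silt U" "\<forall>W\<in>K.addc X \<inter> K.addc Y. K.zero_obj W" "K.indec Y"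
    "K.left_app (K.addc X) Y X' u" "triangle Y X' Z u j p" "K.isbip X Z V" "K.addc S = K.addc U" "K.addc T = K.addc V"
    using assms unfolding K.mutation_def by blast
  obtain f where f: "cone A Y X' f Z" "u = arr Y X' f" using triangle_cone[OF m(6)] .
  have "left_approx KA (K.addc X) Y X' f"
    using m(4,5) f left_approx_iff[OF addc_sub, of Y] cone_iff unfolding K.indec_def by simp
  then show ?thesis
    unfolding irreducible_left_mutation_def biproduct_iff silting_iff add_cat_eq zero_object_iff indecomposable_iff additively_equivalent_def
    using m f(1) by blast
qed

subsection \<open>Complexes with small support\<close>

lemma van_support:
  assumes b: "bdd X" "bdd Y" and z: "\<And>k. nul X k \<or> nul Y (k + n)"
  shows "K.van X Y n"
proof (rule K.vanI)
  fix u assume "u \<in> kb.G X Y n"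
  then obtain x where x: "closed X Y n x" "u = cls X Y n x" using cls_surj by metis
  obtain \<phi> where \<phi>: "fam X Y n \<phi>" "x = el X Y n \<phi>" using closedE[OF x(1)] by metis
  have "\<phi> k = Zer A (cob X k) (cob Y (k + n))" for k
    by (rule hom_zero_object[OF z bdd_obj[OF b(1)] bdd_obj[OF b(2)]]) (use \<phi>(1) in \<open>simp add: fam_def\<close>)
  then have "x = 0" unfolding \<phi>(2) by (rule zero_family[OF b])
  then show "u = 0" using x cls_zero_iff[OF x(1)] bdry_zero[OF b] by simp
qed

lemma zero_complex: assumes "bdd X" "\<And>k. nul X k" shows "K.zero_obj X"
  using K.vanD[OF van_support[of X X 0] K.e_in] assms unfolding K.zero_obj_def by simp

lemma triangle_support:
  assumes t: "triangle X Y Z f j p" and z: "nul X (n + 1)" "nul Y n"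
  shows "nul Z n"
proof -
  obtain g where "cone A X Y g Z" using triangle_cone[OF t] .
  then show ?thesis using zero_object_biproduct[OF _ z] unfolding cone_def chain_cone_def by blast
qed

lemma chain_cone_zero_biproduct:
  assumes b: "bdd X" "bdd Y" "bdd Z"
    and c: "chain_cone A (shift A (- 1) X) Y (\<lambda>n. Zer A (cob (shift A (- 1) X) n) (cob Y n)) Z"
  shows "K.isbip X Y Z"
proof -
  note bX = bdd_shift[OF b(1), of "- 1"]
  obtain i j p q where "cdata (shift A (- 1) X) Y Z 0 i j p q"
    using chain_cone_cdata[OF bX b(2,3) chain_map_zero[OF bX b(2)] c] el_zero[OF bX b(2), of 0] by auto
  then show ?thesis using zero_cone_biproduct[OF b(1,2)] unfolding K.isbip_def K.bip_def by meson
qed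

lemma biproduct_support:
  assumes b: "bdd X" "bdd Y"
  obtains Z where "bdd Z" "K.isbip X Y Z" "\<forall>n. nul X n \<longrightarrow> nul Y n \<longrightarrow> nul Z n"
proof -
  note bX = bdd_shift[OF b(1), of "- 1"]
  obtain Z where Z: "bdd Z" "chain_cone A (shift A (- 1) X) Y (\<lambda>n. Zer A (cob (shift A (- 1) X) n) (cob Y n)) Z"
    using chain_cone_exists[OF bX b(2) chain_map_zero[OF bX b(2)]] by blast
  have "nul Z n" if "nul X n" "nul Y n" for n
    using Z(2) zero_object_biproduct that unfolding chain_cone_def by fastforce
  then show ?thesis using that Z(1) chain_cone_zero_biproduct[OF b Z] by blast
qed

definition conc :: "('o, 'f) cplx \<Rightarrow> bool" where
  "conc X \<longleftrightarrow> bdd X \<and> (\<forall>n. n \<noteq> 0 \<longrightarrow> nul X n)"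

definition lit :: "('o, 'f) cplx \<Rightarrow> bool" where
  "lit X \<longleftrightarrow> bdd X \<and> (\<forall>n. n \<noteq> 0 \<and> n \<noteq> - 1 \<longrightarrow> nul X n)"

lemma conc_lit: "conc X \<Longrightarrow> lit X"
  unfolding conc_def lit_def by blast

lemma bdd_zero_dif:
  assumes o: "\<And>n. C n \<in> Obj A" and f: "finite {n. \<not> zero_object A (C n)}"
  shows "bdd \<lparr>cob = C, dif = \<lambda>n. Zer A (C n) (C (n + 1))\<rparr>"
  unfolding bounded_complex_def using o f zer_in[OF o o] cmp_zer_right[OF o o o zer_in[OF o o]] by simp

definition point :: "'o \<Rightarrow> 'o \<Rightarrow> ('o, 'f) cplx" where
  "point z c = (let C = (\<lambda>n :: int. if n = 0 then c else z) in \<lparr>cob = C, dif = \<lambda>n. Zer A (C n) (C (n + 1))\<rparr>)"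

lemma conc_point: assumes "zero_object A z" "c \<in> Obj A" shows "conc (point z c)" "cob (point z c) 0 = c"
proof -
  have "z \<in> Obj A" "c \<in> Obj A" using assms unfolding zero_object_def by auto
  then have "bdd (point z c)" unfolding point_def Let_def
    by (intro bdd_zero_dif) (use assms in \<open>auto intro: finite_subset[of _ "{0}"]\<close>)
  then show "conc (point z c)" "cob (point z c) 0 = c" unfolding conc_def using assms by (simp_all add: point_def)
qed

lemma biproduct_zero_objects:
  assumes "zero_object A a" "zero_object A b" "zero_object A c"
  shows "biproduct_diagram A a b c (Zer A a c) (Zer A b c) (Zer A c a) (Zer A c b)"
proof -
  have o: "a \<in> Obj A" "b \<in> Obj A" "c \<in> Obj A" and i: "Idn A a = Zer A a a" "Idn A b = Zer A b b" "Idn A c = Zer A c c"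
    using assms unfolding zero_object_def by auto
  have c: "Cmp A (Zer A u v) (Zer A w u) = Zer A w v" if "u \<in> Obj A" "v \<in> Obj A" "w \<in> Obj A" for u v w
    using cmp_zer_right[OF that(3,1,2) zer_in[OF that(1,2)]] .
  show ?thesis unfolding biproduct_diagram_def i using o by (simp add: c zer_in add_zer)
qed

lemma biproduct_zero_right:
  assumes "a \<in> Obj A" "zero_object A z" shows "biproduct_diagram A a z a (Idn A a) (Zer A z a) (Idn A a) (Zer A a z)"
proof -
  have o: "a \<in> Obj A" "z \<in> Obj A" and i: "Idn A z = Zer A z z" using assms unfolding zero_object_def by auto
  note I = idn_in[OF o(1)]
  have "Add A (Idn A a) (Zer A a a) = Idn A a" using add_zer[OF I o(1,1)] add_comm[OF I zer_in[OF o(1,1)] o(1,1)] by simp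
  then show ?thesis unfolding biproduct_diagram_def i using o I
    cmp_zer_right[OF o(2,1,2) zer_in[OF o(1,2)]] cmp_zer_right[OF o(1,2,1) zer_in[OF o(2,1)]]
    by (simp add: zer_in idn_left[OF I] idn_left[OF zer_in] idn_right[OF zer_in])
qed

lemma biproduct_diagram_swap: "biproduct_diagram A a b c i j p q \<Longrightarrow> biproduct_diagram A b a c j i q p"
  using add_comm[OF cmp_in[of i a c p c] cmp_in[of j b c q c]] unfolding biproduct_diagram_def by simp

text \<open>The degreewise biproduct exhibits Z as a cone of the zero map X[-1] \<rightarrow> Y: the
  differential of Z and the cone differential agree, since each has a zero object at one
  end.\<close>

lemma conc_biproduct:
  assumes X: "conc X" and Y: "conc Y" and Z: "conc Z" and bp: "biproduct A (cob X 0) (cob Y 0) (cob Z 0)"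
  shows "K.isbip X Y Z"
proof -
  have b: "bdd X" "bdd Y" "bdd Z" and z: "\<And>n. n \<noteq> 0 \<Longrightarrow> nul X n" "\<And>n. n \<noteq> 0 \<Longrightarrow> nul Y n"
    "\<And>n. n \<noteq> 0 \<Longrightarrow> nul Z n" using X Y Z unfolding conc_def by auto
  let ?X = "shift A (- 1) X"
  note bX = bdd_shift[OF b(1), of "- 1"]
  have "\<exists>i j p q. biproduct_diagram A (cob X n) (cob Y n) (cob Z n) i j p q" for n
    using bp biproduct_zero_objects[OF z(1,2,3)[of n]] unfolding biproduct_def by (cases "n = 0") blast+
  then obtain i j p q where d: "\<And>n. biproduct_diagram A (cob X n) (cob Y n) (cob Z n) (i n) (j n) (p n) (q n)" by metis
  have db: "deg_biproduct ?X Y Z i j p q" unfolding deg_biproduct_def using d by simp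
  let ?\<phi> = "\<lambda>n. Zer A (cob ?X n) (cob Y n)"
  have \<phi>: "fam ?X Y 0 ?\<phi>" using fam_zero[OF bX b(2), of 0] by simp
  have "dif Z n = cone_dif ?X Y ?\<phi> i j p q n" for n
  proof -
    have zz: "nul Z n \<or> nul Z (n + 1)" by (cases "n = 0") (auto intro: z(3))
    have "cone_dif ?X Y ?\<phi> i j p q n \<in> Hom A (cob Z n) (cob Z (n + 1))"
      using cone_dif_el(1)[OF bX b(2,3) db \<phi>] unfolding fam_def by blast
    then show ?thesis using hom_zero_object[OF zz bdd_obj[OF b(3)] bdd_obj[OF b(3)]] bdd_dif[OF b(3)] by metis
  qed
  then have "chain_cone A ?X Y ?\<phi> Z" unfolding chain_cone_alt using db by blast
  then show ?thesis by (rule chain_cone_zero_biproduct[OF b])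
qed

text \<open>The brutal truncation of \<open>X\<close>, whose lowest degree is \<open>a\<close>: \<open>X\<close> is the cone of the differential
  from its lowest term, placed in degree \<open>a + 1\<close>, to the rest.\<close>

lemma truncation:
  assumes b: "bdd X" and low: "\<And>n. n < a \<Longrightarrow> nul X n"
  obtains M1 M0 where "bdd M1" "bdd M0" "K.tri M1 M0 X" "\<And>n. n \<noteq> a + 1 \<Longrightarrow> nul M1 n"
    "\<And>n. n \<le> a \<Longrightarrow> nul M0 n" "\<And>n. nul X n \<Longrightarrow> nul M0 n"
proof -
  obtain z where z: "zero_object A z" using zero_object_exists by blast
  have zo: "z \<in> Obj A" using z unfolding zero_object_def by blast
  have o: "cob X n \<in> Obj A" for n using bdd_obj[OF b] .
  let ?c1 = "\<lambda>n. if n = a + 1 then cob X a else z" and ?c0 = "\<lambda>n. if n \<le> a then z else cob X n"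
  let ?M1 = "\<lparr>cob = ?c1, dif = \<lambda>n. Zer A (?c1 n) (?c1 (n + 1))\<rparr>"
  let ?M0 = "\<lparr>cob = ?c0, dif = \<lambda>n. if n \<le> a then Zer A (?c0 n) (?c0 (n + 1)) else dif X n\<rparr>"
  have o1: "cob ?M1 n \<in> Obj A" and o0: "cob ?M0 n \<in> Obj A" for n using o zo by auto
  have b1: "bdd ?M1"
    by (rule bdd_zero_dif) (use zo o z in \<open>auto intro: finite_subset[of _ "{a + 1}"]\<close>)
  have d0: "dif ?M0 n \<in> Hom A (cob ?M0 n) (cob ?M0 (n + 1))" for n
  proof (cases "n \<le> a")
    case True
    then have e: "dif ?M0 n = Zer A (cob ?M0 n) (cob ?M0 (n + 1))" by simp
    show ?thesis unfolding e by (rule zer_in[OF o0 o0])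
  next
    case False then show ?thesis using bdd_dif[OF b, of n] by simp
  qed
  have b0: "bdd ?M0"
    unfolding bounded_complex_def
  proof (intro conjI allI)
    have "finite {n. \<not> nul X n}" using b unfolding bounded_complex_def by blast
    then show "finite {n. \<not> nul ?M0 n}" by (rule finite_subset[rotated]) (use z in auto)
    fix n show "cob ?M0 n \<in> Obj A" "dif ?M0 n \<in> Hom A (cob ?M0 n) (cob ?M0 (n + 1))" by (rule o0, rule d0)
    show "Cmp A (dif ?M0 (n + 1)) (dif ?M0 n) = Zer A (cob ?M0 n) (cob ?M0 (n + 1 + 1))"
    proof (cases "n \<le> a")
      case True
      then have e: "dif ?M0 n = Zer A (cob ?M0 n) (cob ?M0 (n + 1))" by simp
      show ?thesis unfolding e by (rule cmp_zer_right[OF o0 o0 o0 d0])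
    next
      case False then show ?thesis using bdd_dif_dif[OF b, of n] by simp
    qed
  qed
  let ?\<phi> = "\<lambda>n. if n = a + 1 then dif X a else Zer A (cob ?M1 n) (cob ?M0 n)"
  have \<phi>: "?\<phi> n \<in> Hom A (cob ?M1 n) (cob ?M0 n)" for n
  proof (cases "n = a + 1")
    case True then show ?thesis using bdd_dif[OF b, of a] by simp
  next
    case False
    then have e: "?\<phi> n = Zer A (cob ?M1 n) (cob ?M0 n)" by simp
    show ?thesis unfolding e by (rule zer_in[OF o1 o0])
  qed
  have cm: "chain_map A ?M1 ?M0 ?\<phi>"
    unfolding chain_map_def
  proof (intro allI conjI)
    fix n
    show "?\<phi> n \<in> Hom A (cob ?M1 n) (cob ?M0 n)" by (rule \<phi>)
    have r: "Cmp A (?\<phi> (n + 1)) (dif ?M1 n) = Zer A (cob ?M1 n) (cob ?M0 (n + 1))"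
    proof -
      have e: "dif ?M1 n = Zer A (cob ?M1 n) (cob ?M1 (n + 1))" by simp
      show ?thesis unfolding e by (rule cmp_zer_right[OF o1 o1 o0 \<phi>])
    qed
    have l: "Cmp A (dif ?M0 n) (?\<phi> n) = Zer A (cob ?M1 n) (cob ?M0 (n + 1))"
    proof (cases "n = a + 1")
      case True then show ?thesis using bdd_dif_dif[OF b, of a] by simp
    next
      case False
      then have e: "?\<phi> n = Zer A (cob ?M1 n) (cob ?M0 n)" by simp
      show ?thesis unfolding e by (rule cmp_zer_right[OF o1 o0 o0 d0])
    qed
    show "Cmp A (dif ?M0 n) (?\<phi> n) = Cmp A (?\<phi> (n + 1)) (dif ?M1 n)" unfolding l r ..
  qed
  let ?i = "\<lambda>n. if n = a then Idn A (cob X a) else Zer A (cob ?M1 (n + 1)) (cob X n)"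
  let ?j = "\<lambda>n. if a < n then Idn A (cob X n) else Zer A (cob ?M0 n) (cob X n)"
  let ?p = "\<lambda>n. if n = a then Idn A (cob X a) else Zer A (cob X n) (cob ?M1 (n + 1))"
  let ?q = "\<lambda>n. if a < n then Idn A (cob X n) else Zer A (cob X n) (cob ?M0 n)"
  have db: "deg_biproduct ?M1 ?M0 X ?i ?j ?p ?q"
    unfolding deg_biproduct_def
  proof
    fix n
    consider "n = a" | "n > a" | "n < a" by linarith
    then show "biproduct_diagram A (cob ?M1 (n + 1)) (cob ?M0 n) (cob X n) (?i n) (?j n) (?p n) (?q n)"
    proof cases
      case 1 then show ?thesis using biproduct_zero_right[OF o z, of a] by simp
    next
      case 2 then show ?thesis using biproduct_diagram_swap[OF biproduct_zero_right[OF o z, of n]] by simp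
    next
      case 3 then show ?thesis using biproduct_zero_objects[OF z z low[OF 3]] by simp
    qed
  qed
  note dbD = deg_biproductD[OF b1 b0 b db]
  have "dif X n = cone_dif ?M1 ?M0 ?\<phi> ?i ?j ?p ?q n" for n
  proof -
    have M: "?j (n + 1) \<in> Hom A (cob ?M0 (n + 1)) (cob X (n + 1))" "?p n \<in> Hom A (cob X n) (cob ?M1 (n + 1))"
      "?i (n + 1) \<in> Hom A (cob ?M1 (n + 1 + 1)) (cob X (n + 1))" "?q n \<in> Hom A (cob X n) (cob ?M0 n)" by (rule dbD)+
    have zero: "Cmp A g (Cmp A (Zer A u v) f) = Zer A (cob X n) (cob X (n + 1))"
      if "f \<in> Hom A (cob X n) u" "g \<in> Hom A v (cob X (n + 1))" "u \<in> Obj A" "v \<in> Obj A" for f g u v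
      using cmp_zer_left[OF o that(3,4,1)] cmp_zer_right[OF o that(4) o that(2)] by simp
    let ?Z = "Zer A (cob X n) (cob X (n + 1))"
    have 1: "Cmp A (?i (n + 1)) (Cmp A (Neg A (dif ?M1 (n + 1))) (?p n)) = ?Z"
    proof -
      have "dif ?M1 (n + 1) = Zer A (cob ?M1 (n + 1)) (cob ?M1 (n + 1 + 1))" by simp
      then have e: "Neg A (dif ?M1 (n + 1)) = Zer A (cob ?M1 (n + 1)) (cob ?M1 (n + 1 + 1))"
        using neg_zer[OF o1 o1, of "n + 1" "n + 1 + 1"] by (simp only:)
      show ?thesis unfolding e by (rule zero[OF M(2,3) o1 o1])
    qed
    have P: "Cmp A (?j (n + 1)) (Cmp A (?\<phi> (n + 1)) (?p n)) = ?Z" if "n \<noteq> a"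
    proof -
      have e: "?\<phi> (n + 1) = Zer A (cob ?M1 (n + 1)) (cob ?M0 (n + 1))" using that by simp
      show ?thesis unfolding e by (rule zero[OF M(2,1) o1 o0])
    qed
    have Q: "Cmp A (?j (n + 1)) (Cmp A (dif ?M0 n) (?q n)) = ?Z" if "n \<le> a"
    proof -
      have e: "dif ?M0 n = Zer A (cob ?M0 n) (cob ?M0 (n + 1))" using that by simp
      show ?thesis unfolding e by (rule zero[OF M(4,1) o0 o0])
    qed
    have zer_l: "Add A ?Z f = f" if "f \<in> Hom A (cob X n) (cob X (n + 1))" for f using add_zer[OF that o o] .
    have zer_r: "Add A f ?Z = f" if "f \<in> Hom A (cob X n) (cob X (n + 1))" for f
      using zer_l[OF that] add_comm[OF that zer_in[OF o o] o o] by simp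
    have dd: "Cmp A (Idn A (cob X (n + 1))) (Cmp A (dif X n) (Idn A (cob X n))) = dif X n"
      using idn_right[OF bdd_dif[OF b] o o] idn_left[OF bdd_dif[OF b] o o] by simp
    have Zin: "?Z \<in> Hom A (cob X n) (cob X (n + 1))" using zer_in[OF o o] .
    consider "n = a" | "n > a" | "n < a" by linarith
    then show ?thesis
    proof cases
      case c: 1
      have 3: "Cmp A (?j (n + 1)) (Cmp A (dif ?M0 n) (?q n)) = ?Z" by (rule Q) (use c in simp)
      have 2: "Cmp A (?j (n + 1)) (Cmp A (?\<phi> (n + 1)) (?p n)) = dif X n" using dd c by simp
      show ?thesis unfolding cone_dif_def 1 2 3 zer_r[OF bdd_dif[OF b]] zer_l[OF bdd_dif[OF b]] ..
    next
      case c: 2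
      have 2: "Cmp A (?j (n + 1)) (Cmp A (?\<phi> (n + 1)) (?p n)) = ?Z" by (rule P) (use c in simp)
      have 3: "Cmp A (?j (n + 1)) (Cmp A (dif ?M0 n) (?q n)) = dif X n" using dd c by simp
      show ?thesis unfolding cone_dif_def 1 2 3 zer_l[OF bdd_dif[OF b]] ..
    next
      case c: 3
      have 2: "Cmp A (?j (n + 1)) (Cmp A (?\<phi> (n + 1)) (?p n)) = ?Z" by (rule P) (use c in simp)
      have 3: "Cmp A (?j (n + 1)) (Cmp A (dif ?M0 n) (?q n)) = ?Z" by (rule Q) (use c in simp)
      have "dif X n = ?Z" using hom_zero_object[OF _ o o bdd_dif[OF b], of n] low[OF c] by blast
      then show ?thesis unfolding cone_dif_def 1 2 3 zer_l[OF Zin] by simp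
    qed
  qed
  then have "chain_cone A ?M1 ?M0 ?\<phi> X" unfolding chain_cone_alt using db by blast
  then have "cone A ?M1 ?M0 (kap ?M1 ?M0 ?\<phi>) X"
    unfolding cone_def using b b1 b0 Kb_homI[OF cm] class_self[OF b1 b0 cm] by (auto simp only: kap_def Kb_obj fst_conv snd_conv)
  then have t: "K.tri ?M1 ?M0 X" using K.triI unfolding cone_iff by blast
  show ?thesis by (rule that[OF b1 b0 t]) (use z in auto)
qed

lemma K2_obj: "X \<in> Obj (K2 A) \<longleftrightarrow> lit X"
  unfolding K2_def full_subcat_def lit_def by auto

lemma K2_sel: "Hom (K2 A) = Hom KA" "Cmp (K2 A) = Cmp KA" "Idn (K2 A) = Idn KA" "Zer (K2 A) = Zer KA"
    "Add (K2 A) = Add KA"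
  and lit_obj: "lit X \<Longrightarrow> X \<in> Obj KA"
  by (simp_all add: K2_def full_subcat_def lit_def)

lemma K2_biproduct: "biproduct (K2 A) X Y Z \<longleftrightarrow> lit X \<and> lit Y \<and> lit Z \<and> K.isbip X Y Z"
proof -
  have "biproduct_diagram (K2 A) X Y Z i j p q \<longleftrightarrow> lit X \<and> lit Y \<and> lit Z \<and> biproduct_diagram KA X Y Z i j p q" for i j p q
    unfolding biproduct_diagram_def K2_obj K2_sel using lit_obj by blast
  then show ?thesis using biproduct_iff[of X Y Z] unfolding biproduct_def by blast
qed

lemma K2_isomorphic: "isomorphic (K2 A) X Y \<longleftrightarrow> lit X \<and> lit Y \<and> K.iso X Y"
  unfolding isomorphic_iff[symmetric] isomorphic_def K2_obj K2_sel using lit_obj by blast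

lemma K2_zero_object: "zero_object (K2 A) X \<longleftrightarrow> lit X \<and> K.zero_obj X"
  unfolding zero_object_iff[symmetric] zero_object_def K2_obj K2_sel using lit_obj by blast

lemma K2_direct_sum: "direct_sum (K2 A) Xs X \<Longrightarrow> K.dsum Xs X"
  by (induction Xs arbitrary: X) (auto simp: K2_zero_object K2_biproduct)

section \<open>The homotopy category as an instance of \<open>two_term\<close>\<close>

context
  fixes L :: "('o, 'f) cplx"
  assumes L: "conc L" and gen: "Obj A \<subseteq> add_cat A (cob L 0)"
begin

text \<open>A presentation of the degree 0 term as a summand of a power of that of L is copied to
  stalk complexes, where \<open>conc_biproduct\<close> turns each biproduct of objects into one of
  complexes.\<close>

lemma conc_addc: assumes M: "conc M" shows "M \<in> K.addc L"
proof -
  obtain z where z: "zero_object A z" using zero_object_exists by blast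
  have "cob M 0 \<in> Obj A" using M bdd_obj unfolding conc_def by blast
  then obtain n c d where c: "direct_sum A (replicate n (cob L 0)) c" "biproduct A (cob M 0) d c"
    using gen unfolding add_cat_def summand_def by blast
  have ob: "biproduct A u v w \<Longrightarrow> u \<in> Obj A \<and> v \<in> Obj A \<and> w \<in> Obj A" for u v w unfolding biproduct_def biproduct_diagram_def by blast
  note o = ob[OF c(2)]
  have ds: "direct_sum A (replicate n (cob L 0)) c \<Longrightarrow> K.dsum (replicate n L) (point z c)" for n c
  proof (induction n arbitrary: c)
    case 0
    then have "zero_object A c" by simp
    then have "K.zero_obj (point z c)" by (intro zero_complex) (use conc_point[OF z, of c] z in \<open>auto simp: conc_def zero_object_def point_def\<close>)
    then show ?case by simp
  next
    case (Suc n)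
    then obtain w where w: "direct_sum A (replicate n (cob L 0)) w" "biproduct A (cob L 0) w c" by auto
    note ow = ob[OF w(2)]
    have "K.isbip L (point z w) (point z c)"
      by (rule conc_biproduct[OF L]) (use ow conc_point[OF z] w(2) in auto)
    then show ?case using Suc.IH[OF w(1)] by auto
  qed
  have "K.isbip M (point z d) (point z c)" by (rule conc_biproduct[OF M]) (use o conc_point[OF z] c(2) in auto)
  then show ?thesis unfolding K.addc_def using ds[OF c(1)] by blast
qed

text \<open>Induction on the number of nonzero terms. \<open>truncation\<close> removes the lowest
  one, and a complex with a single nonzero term is a shift of a complex in degree 0, which lies in
  \<open>addc L\<close>.\<close>

lemma generates_conc: "K.generates L"
  unfolding K.generates_def
proof (intro allI impI)
  fix U assume U: "K.thk U \<and> L \<in> U"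
  have st: "X \<in> U" if X: "bdd X" "\<And>n. n \<noteq> a \<Longrightarrow> nul X n" for X a
  proof -
    have "conc (shift A a X)" unfolding conc_def using bdd_shift[OF X(1)] X(2) by simp
    then have "shift A a X \<in> U" using K.thk_addc[OF conjunct1[OF U] conjunct2[OF U]] conc_addc by blast
    then have "shift A (- a) (shift A a X) \<in> U" using K.thk_sh[OF conjunct1[OF U]] by blast
    then show ?thesis using shift_shift[OF X(1)] shift_0 by simp
  qed
  have "X \<in> U" if "bdd X" "card {n. \<not> nul X n} = m" for X m
    using that
  proof (induction m arbitrary: X rule: less_induct)
    case (less m)
    let ?N = "{n. \<not> nul X n}"
    have fin: "finite ?N" using less.prems(1) unfolding bounded_complex_def by blast
    show ?case
    proof (cases "?N = {}")
      case True
      then show ?thesis using K.thk_zero[OF conjunct1[OF U]] zero_complex[OF less.prems(1)] by blast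
    next
      case False
      have low: "nul X n" if "n < Min ?N" for n using Min_le[OF fin, of n] that by auto
      obtain M1 M0 where M: "bdd M1" "bdd M0" "K.tri M1 M0 X" "\<And>n. n \<noteq> Min ?N + 1 \<Longrightarrow> nul M1 n"
        "\<And>n. n \<le> Min ?N \<Longrightarrow> nul M0 n" "\<And>n. nul X n \<Longrightarrow> nul M0 n"
        using truncation[OF less.prems(1) low] by blast
      have "{n. \<not> nul M0 n} \<subset> ?N" using M(5)[of "Min ?N"] M(6) Min_in[OF fin False] by blast
      then have "card {n. \<not> nul M0 n} < m" using psubset_card_mono[OF fin] less.prems(2) by metis
      then have "M0 \<in> U" using less.IH[OF _ M(2) refl] by blast
      then show ?thesis using K.thk_tri[OF conjunct1[OF U] M(3)] st[OF M(1,4)] by blast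
    qed
  qed
  then have "Obj KA \<subseteq> U" using Kb_obj by blast
  moreover have "U \<subseteq> Obj KA" using U unfolding K.thk_def by blast
  ultimately show "U = Obj KA" by blast
qed

lemma two_term_K2:
  assumes KS: "Krull_Schmidt (K2 A)"
  shows "two_term (Obj KA) kb.G kb.unit (shift A) triangle L lit conc"
proof (rule two_term.intro[OF Kb_triangulated two_term_axioms.intro])
  show "\<exists>Xs. K.dec Xs X \<and> (\<forall>x\<in>set Xs. lit x)" if "lit X" for X
  proof -
    have "X \<in> Obj (K2 A)" using that unfolding K2_obj .
    from bspec[OF KS[unfolded Krull_Schmidt_def] this]
    obtain Xs where Xs: "\<forall>Y\<in>set Xs. lit Y \<and> local_ring (End_ring (K2 A) Y)" "direct_sum (K2 A) Xs X"
      unfolding K2_obj by (elim exE conjE)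
    have "End_ring (K2 A) Y = End_ring KA Y" for Y unfolding End_ring_def K2_sel ..
    then have l: "\<forall>Y\<in>set Xs. K.loc Y" using Xs(1) local_ring_loc unfolding lit_def by simp
    show ?thesis by (rule exI[of _ Xs]) (use Xs(1) l K2_direct_sum[OF Xs(2)] in \<open>simp add: K.dec_def\<close>)
  qed
  show "\<exists>Z. lit Z \<and> K.isbip X Y Z" if h: "lit X" "lit Y" for X Y
  proof -
    have b: "bdd X" "bdd Y" using h unfolding lit_def by auto
    obtain Z where "bdd Z" "K.isbip X Y Z" "\<forall>n. nul X n \<longrightarrow> nul Y n \<longrightarrow> nul Z n"
      using biproduct_support[OF b] .
    then have "lit Z \<and> K.isbip X Y Z" using h unfolding lit_def by simp
    then show ?thesis ..
  qed
  show "\<exists>Z. conc Z \<and> K.isbip X Y Z" if h: "conc X" "conc Y" for X Y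
  proof -
    have b: "bdd X" "bdd Y" using h unfolding conc_def by auto
    obtain Z where "bdd Z" "K.isbip X Y Z" "\<forall>n. nul X n \<longrightarrow> nul Y n \<longrightarrow> nul Z n"
      using biproduct_support[OF b] .
    then have "conc Z \<and> K.isbip X Y Z" using h unfolding conc_def by simp
    then show ?thesis ..
  qed
  show "\<exists>Z. lit Z \<and> K.zero_obj Z"
  proof -
    obtain z where z: "zero_object A z" using zero_object_exists by blast
    then have "z \<in> Obj A" unfolding zero_object_def by blast
    note c = conc_point(1)[OF z this]
    have "K.zero_obj (point z z)" by (rule zero_complex) (use c z in \<open>auto simp: conc_def point_def\<close>)
    then show ?thesis using conc_lit[OF c] by blast
  qed
  show "K.van X Y n" if h: "lit X" "lit Y" "2 \<le> n" for X Y n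
  proof (rule van_support)
    show "bdd X" "bdd Y" using h unfolding lit_def by auto
    fix k show "nul X k \<or> nul Y (k + n)"
      using h unfolding lit_def by (cases "k = 0 \<or> k = - 1") auto
  qed
  show "lit L" by (rule conc_lit[OF L])
  show "conc L" by (rule L)
  show "K.van L X n" if h: "lit X" "1 \<le> n" for X n
  proof (rule van_support)
    show "bdd L" "bdd X" using h L unfolding lit_def conc_def by auto
    fix k show "nul L k \<or> nul X (k + n)"
      using h L unfolding lit_def conc_def by (cases "k = 0") auto
  qed
  show "\<exists>M1 M0. conc M1 \<and> conc M0 \<and> K.tri M1 M0 X" if h: "lit X" for X
  proof -
    have low: "\<And>n. n < - 1 \<Longrightarrow> nul X n" and b: "bdd X" using h unfolding lit_def by auto
    obtain M1 M0 where M: "bdd M1" "bdd M0" "K.tri M1 M0 X" "\<And>n. n \<noteq> - 1 + 1 \<Longrightarrow> nul M1 n"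
      "\<And>n. n \<le> - 1 \<Longrightarrow> nul M0 n" "\<And>n. nul X n \<Longrightarrow> nul M0 n"
      using truncation[OF b low] by metis
    have "nul M0 n" if "n \<noteq> 0" for n
      using M(5,6)[of n] h that unfolding lit_def by (cases "n \<le> - 1") auto
    then have "conc M1 \<and> conc M0" unfolding conc_def using M(1,2,4) by simp
    then show ?thesis using M(3) by (intro exI[of _ M1] exI[of _ M0]) simp
  qed
  show "\<exists>X'. lit X' \<and> K.iso X' X" if h: "conc M1" "conc M0" "K.tri M1 M0 X" for M1 M0 X
  proof -
    obtain f j p Z where Z: "triangle M1 M0 Z f j p" "K.iso Z X" using h(3) unfolding K.tri_def by blast
    have "bdd Z" using K.tr_ob[OF Z(1)] by simp
    then have "lit Z" unfolding lit_def using triangle_support[OF Z(1)] h(1,2) unfolding conc_def by simp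
    then show ?thesis using Z(2) by (intro exI[of _ Z]) simp
  qed
  show "conc M \<Longrightarrow> M \<in> K.addc L" for M by (rule conc_addc)
  show "K.generates L" by (rule generates_conc)
qed

end

end

section \<open>Counting indecomposable summands inside the two-term category\<close>

context two_term
begin

definition lit_indec :: "'a \<Rightarrow> bool" where
  "lit_indec Y \<longleftrightarrow> lit Y \<and> \<not> zero_obj Y \<and> (\<forall>U V. lit U \<and> lit V \<and> isbip U V Y \<longrightarrow> zero_obj U \<or> zero_obj V)"

text \<open>Summands in \<open>K2\<close> and their complements must be literally two-term, so
  complements produced by Krull-Schmidt are exchanged for isomorphic two-term objects. Sending a
  representative to its class is then a bijection from the set of Ns.\<close>

lemma card_classes:
  assumes Ns: "reps Ns X"
  shows "card ({Y. lit_indec Y \<and> (\<exists>Z. lit Z \<and> isbip Y Z X)} // {(Y, Y'). lit Y \<and> lit Y' \<and> iso Y Y'}) = card (set Ns)"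
proof -
  let ?C = "{Y. lit_indec Y \<and> (\<exists>Z. lit Z \<and> isbip Y Z X)}" and ?r = "{(Y, Y'). lit Y \<and> lit Y' \<and> iso Y Y'}"
  obtain Xs where Xs: "dec Xs X" "\<forall>x\<in>set Xs. lit x" "\<forall>x\<in>set Xs. \<exists>n\<in>set Ns. iso x n" using Ns unfolding reps_def by blast
  have d: "dsum Xs X" "\<forall>x\<in>set Xs. loc x" using Xs(1) unfolding dec_def by auto
  have two: "two x" if "x \<in> set Xs" for x using lit_two Xs(2) that by blast
  have cls: "?r `` {Y} = ?r `` {N}" if h: "lit Y" "lit N" "iso Y N" for Y N
  proof -
    have "iso Y W \<longleftrightarrow> iso N W" for W using iso_trans[OF h(3), of W] iso_trans[OF iso_sym[OF h(3)], of W] by blast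
    then show ?thesis using h(1,2) by auto
  qed
  have C1: "N \<in> ?C" if N: "N \<in> set Ns" for N
  proof -
    note l = repsD(1)[OF Ns, rule_format, OF N] repsD(2)[OF Ns N]
    have i: "indec N" by (rule loc_indec[OF l(1)])
    obtain Z Ys Zs where Z: "isbip N Z X" "dsum Zs Z" "set Ys \<union> set Zs = set Xs"
      using retract_dsum[OF d repsD(3)[OF Ns N]] by metis
    have "two Z" by (rule two_dsum[OF Z(2)]) (use two Z(3) in blast)
    then obtain Z' where Z': "lit Z'" "iso Z' Z" unfolding two_def by blast
    have "isbip N Z' X" by (rule isbip_iso_right[OF Z(1) iso_sym[OF Z'(2)]])
    then show ?thesis using Z'(1) l(2) i unfolding lit_indec_def indec_def by blast
  qed
  have C2: "\<exists>N\<in>set Ns. iso Y N" if Y: "Y \<in> ?C" for Y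
  proof -
    obtain Z0 where lY: "lit_indec Y" and Z0: "isbip Y Z0 X" using Y by blast
    obtain Z Ys Zs where Ys: "dsum Ys Y" "set Ys \<union> set Zs = set Xs" using retract_dsum[OF d isbip_retract(1)[OF Z0]] by metis
    obtain y Ws where yW: "Ys = y # Ws" using Ys(1) lY unfolding lit_indec_def by (cases Ys) auto
    obtain W where W: "dsum Ws W" "isbip y W Y" using Ys(1) unfolding yW by auto
    have y: "y \<in> set Xs" "set Ws \<subseteq> set Xs" using Ys(2) yW by auto
    have "two W" by (rule two_dsum[OF W(1)]) (use two y in blast)
    then obtain W' where W': "lit W'" "iso W' W" unfolding two_def by blast
    have b: "isbip y W' Y" by (rule isbip_iso_right[OF W(2) iso_sym[OF W'(2)]])
    have "\<not> zero_obj y" using d(2) y(1) unfolding loc_def zero_obj_def by blast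
    then have "zero_obj W'" using lY b W'(1) Xs(2) y(1) unfolding lit_indec_def by blast
    then have "iso y Y" by (rule isbip_zero_iso[OF b])
    moreover obtain N where "N \<in> set Ns" "iso y N" using Xs(3) y(1) by blast
    ultimately show ?thesis using iso_trans[OF iso_sym[of y Y]] by blast
  qed
  have "?C // ?r = (\<lambda>N. ?r `` {N}) ` set Ns"
  proof
    show "?C // ?r \<subseteq> (\<lambda>N. ?r `` {N}) ` set Ns"
    proof
      fix c assume "c \<in> ?C // ?r"
      then obtain Y where Y: "Y \<in> ?C" "c = ?r `` {Y}" by (rule quotientE)
      obtain N where N: "N \<in> set Ns" "iso Y N" using C2[OF Y(1)] by blast
      have "lit Y" using Y(1) unfolding lit_indec_def by blast
      then show "c \<in> (\<lambda>N. ?r `` {N}) ` set Ns" using cls[OF _ repsD(2)[OF Ns N(1)] N(2)] Y(2) N(1) by blast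
    qed
    show "(\<lambda>N. ?r `` {N}) ` set Ns \<subseteq> ?C // ?r" using C1 by (intro image_subsetI quotientI)
  qed
  moreover have "inj_on (\<lambda>N. ?r `` {N}) (set Ns)"
  proof (rule inj_onI)
    fix N N' assume N: "N \<in> set Ns" "N' \<in> set Ns" "?r `` {N} = ?r `` {N'}"
    have l: "lit N'" by (rule repsD(2)[OF Ns N(2)])
    have "N' \<in> ?r `` {N'}" using l iso_refl[OF lit_ob[OF l]] by blast
    then have "iso N N'" unfolding N(3)[symmetric] by blast
    then show "N = N'" by (rule repsD(5)[OF Ns N(1,2)])
  qed
  ultimately show ?thesis by (simp add: card_image)
qed

end

section \<open>The result over an additive category\<close>

context additive_cat
begin

text \<open>The Bongartz completion with a complex L in the place of the stalk complex of the
  ring.\<close>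

definition bongartz_over :: "('o, 'f) cplx \<Rightarrow> ('o, 'f) cplx \<Rightarrow> ('o, 'f) cplx \<Rightarrow> bool" where
  "bongartz_over L P S \<longleftrightarrow> (\<exists>Q f Z. right_approx KA (add_cat KA P) Q (shift A 1 L) f \<and>
     cone A Q (shift A 1 L) f Z \<and> biproduct KA P (shift A (- 1) Z) S)"

definition co_bongartz_over :: "('o, 'f) cplx \<Rightarrow> ('o, 'f) cplx \<Rightarrow> ('o, 'f) cplx \<Rightarrow> bool" where
  "co_bongartz_over L P S \<longleftrightarrow> (\<exists>Q f Z. left_approx KA (add_cat KA P) L Q f \<and> cone A L Q f Z \<and> biproduct KA P Z S)"

theorem completions_additive:
  assumes L: "conc L" and gen: "Obj A \<subseteq> add_cat A (cob L 0)" and KS: "Krull_Schmidt (K2 A)"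
    and P: "P \<in> Obj (K2 A)" "presilting A P"
    and num: "int (num_indec (K2 A) P) = int (num_indec (K2 A) L) - 1"
  shows "\<lbrakk>T \<in> Obj (K2 A); silting A T; add_cat KA P \<subseteq> add_cat KA T\<rbrakk> \<Longrightarrow>
      (\<exists>S. bongartz_over L P S \<and> additively_equivalent KA T S) \<or>
      (\<exists>S. co_bongartz_over L P S \<and> additively_equivalent KA T S)"
    and "\<lbrakk>bongartz_over L P S; co_bongartz_over L P S'\<rbrakk> \<Longrightarrow> irreducible_left_mutation A S S'"
proof -
  interpret T: two_term "Obj KA" kb.G kb.unit "shift A" triangle L lit conc by (rule two_term_K2[OF L gen KS])
  have bL: "bdd L" using L unfolding conc_def by blast
  have lP: "lit P" "K.presil P" using P unfolding K2_obj presilting_iff by auto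
  obtain Ps where Ps: "T.reps Ps P" using T.reps_exists[OF lP(1)] by blast
  obtain Qs where Qs: "T.reps Qs L" using T.reps_exists[OF T.lit_L] by blast
  have n: "num_indec (K2 A) X = card (set Ns)" if X: "T.reps Ns X" "lit X" for Ns X
  proof -
    have "indecomposable (K2 A) Y \<longleftrightarrow> T.lit_indec Y" for Y
      unfolding indecomposable_def T.lit_indec_def K2_obj K2_zero_object K2_biproduct by blast
    moreover have "T.lit_indec Y \<and> summand (K2 A) Y X \<longleftrightarrow> T.lit_indec Y \<and> (\<exists>Z. lit Z \<and> K.isbip Y Z X)" for Y
      unfolding summand_def K2_biproduct T.lit_indec_def using X(2) by blast
    ultimately show ?thesis using T.card_classes[OF X(1)] unfolding num_indec_def K2_isomorphic by simp
  qed
  have c: "card (set Qs) = card (set Ps) + 1" using num n[OF Ps lP(1)] n[OF Qs T.lit_L] by simp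
  have bong: "bongartz_over L P S \<longleftrightarrow> T.bongartz P S" for S
  proof
    assume "T.bongartz P S"
    then obtain Q u Z j p where u: "K.right_app (K.addc P) Q (shift A 1 L) u" "triangle Q (shift A 1 L) Z u j p" "K.isbip P (shift A (- 1) Z) S"
      unfolding T.bongartz_def by blast
    obtain f where "cone A Q (shift A 1 L) f Z" "u = arr Q (shift A 1 L) f" using triangle_cone[OF u(2)] .
    then show "bongartz_over L P S"
      using u(1,3) unfolding bongartz_over_def add_cat_eq biproduct_iff right_approx_iff[OF addc_sub bdd_shift[OF bL]] cone_iff by blast
  qed (unfold bongartz_over_def T.bongartz_def add_cat_eq biproduct_iff right_approx_iff[OF addc_sub bdd_shift[OF bL]] cone_iff, blast)
  have cobong: "co_bongartz_over L P S \<longleftrightarrow> T.cobongartz P S" for S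
  proof
    assume "T.cobongartz P S"
    then obtain Q u Z j p where u: "K.left_app (K.addc P) L Q u" "triangle L Q Z u j p" "K.isbip P Z S"
      unfolding T.cobongartz_def by blast
    obtain f where "cone A L Q f Z" "u = arr L Q f" using triangle_cone[OF u(2)] .
    then show "co_bongartz_over L P S"
      using u(1,3) unfolding co_bongartz_over_def add_cat_eq biproduct_iff left_approx_iff[OF addc_sub bL] cone_iff by blast
  qed (unfold co_bongartz_over_def T.cobongartz_def add_cat_eq biproduct_iff left_approx_iff[OF addc_sub bL] cone_iff, blast)
  show "(\<exists>S. bongartz_over L P S \<and> additively_equivalent KA T S) \<or>
      (\<exists>S. co_bongartz_over L P S \<and> additively_equivalent KA T S)"
    if h: "T \<in> Obj (K2 A)" "silting A T" "add_cat KA P \<subseteq> add_cat KA T"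
  proof -
    have "P \<in> K.addc T" using h(3) K.addc_self[OF T.lit_ob[OF lP(1)]] unfolding add_cat_eq by blast
    from T.completion_bongartz[OF lP Ps Qs c _ _ this] h(1,2)
    show ?thesis unfolding bong cobong additively_equivalent_def add_cat_eq K2_obj silting_iff by blast
  qed
  show "irreducible_left_mutation A S S'" if "bongartz_over L P S" "co_bongartz_over L P S'"
    by (rule mutation_irreducible[OF T.bongartz_mutation[OF lP Ps Qs c]]) (use that bong cobong in auto)
qed

end

section \<open>Direct sums of retracts\<close>

context preadd
begin

text \<open>The mixed products vanish by themselves: r s = r (u r) s = r (1 - s e) s = 0, and
  likewise for e u.\<close>

lemma biproduct_complement:
  assumes o: "M \<in> Obj C" "F \<in> Obj C" "Z \<in> Obj C"
    and h: "s \<in> Hom C M F" "e \<in> Hom C F M" "u \<in> Hom C Z F" "r \<in> Hom C F Z"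
    and eq: "Cmp C e s = Idn C M" "Cmp C r u = Idn C Z" "Add C (Cmp C s e) (Cmp C u r) = Idn C F"
  shows "biproduct_diagram C M Z F s u e r"
proof -
  let ?s = "E M F s" and ?e = "E F M e" and ?u = "E Z F u" and ?r = "E F Z r"
  have q: "?e * ?s = E M M (Idn C M)" "?r * ?u = E Z Z (Idn C Z)"
    using E_mult[OF o(1,2,1) h(1,2)] E_mult[OF o(3,2,3) h(3,4)] eq by simp_all
  have c: "Cmp C s e \<in> Hom C F F" "Cmp C u r \<in> Hom C F F" using cmp_in[OF h(1,2) o(2,1,2)] cmp_in[OF h(3,4) o(2,3,2)] by auto
  have "E F F (Cmp C s e) + E F F (Cmp C u r) = E F F (Idn C F)" using E_add[OF o(2,2) c] eq(3) by simp
  then have ur: "?u * ?r = E F F (Idn C F) - ?s * ?e"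
    using E_mult[OF o(2,1,2) h(2,1)] E_mult[OF o(2,3,2) h(4,3)] by (simp add: algebra_simps)
  note i = E_idn_left[OF o(1,2) h(1)] E_idn_right[OF o(1,2) h(1)] E_idn_left[OF o(2,1) h(2)] E_idn_right[OF o(2,1) h(2)]
    E_idn_left[OF o(3,2) h(3)] E_idn_right[OF o(3,2) h(3)] E_idn_left[OF o(2,3) h(4)] E_idn_right[OF o(2,3) h(4)]
  note rl = q[THEN assoc_rule] i i[THEN assoc_rule] ur ur[THEN assoc_rule]
  have "?r * ?s = ?r * ?u * (?r * ?s)" by (simp add: q i mult.assoc[symmetric])
  also have "\<dots> = ?r * (?u * ?r) * ?s" by (simp add: mult.assoc)
  also have "\<dots> = 0" unfolding ur by (simp add: algebra_simps q i rl(1-10))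
  finally have rs: "Cmp C r s = Zer C M Z"
    using E_inject[OF o(1,3) cmp_in[OF h(4,1) o(1,2,3)] zer_in[OF o(1,3)]] E_mult[OF o(1,2,3) h(1,4)] E_zer[OF o(1,3)] by simp
  have "?e * ?u = ?e * ?u * (?r * ?u)" by (simp add: q i mult.assoc)
  also have "\<dots> = ?e * (?u * ?r) * ?u" by (simp add: mult.assoc)
  also have "\<dots> = 0" unfolding ur by (simp add: algebra_simps q i rl(1-10))
  finally have "Cmp C e u = Zer C Z M"
    using E_inject[OF o(3,1) cmp_in[OF h(2,3) o(3,2,1)] zer_in[OF o(3,1)]] E_mult[OF o(3,2,1) h(3,2)] E_zer[OF o(3,1)] by simp
  then show ?thesis unfolding biproduct_diagram_def using o h eq rs by simp
qed

text \<open>This provides direct sums of projective modules. Their elements are lists of no fixed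
  shape and cannot simply be concatenated, so M and N are embedded in free modules F and G. The
  direct sum of M and N is the image of the block idempotent with entries s e and t d on H.\<close>

lemma biproduct_of_retracts:
  assumes b: "biproduct_diagram C F G H i j p q" and oM: "M \<in> Obj C" "N \<in> Obj C"
    and M: "s \<in> Hom C M F" "e \<in> Hom C F M" "Cmp C e s = Idn C M"
    and N: "t \<in> Hom C N G" "d \<in> Hom C G N" "Cmp C d t = Idn C N"
    and split: "\<And>\<epsilon>. \<lbrakk>\<epsilon> \<in> Hom C H H; Cmp C \<epsilon> \<epsilon> = \<epsilon>\<rbrakk> \<Longrightarrow>
      \<exists>Z\<in>Obj C. \<exists>r\<in>Hom C H Z. \<exists>u\<in>Hom C Z H. Cmp C r u = Idn C Z \<and> Cmp C u r = \<epsilon>"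
  shows "\<exists>Z. biproduct C M N Z"
proof -
  have o: "F \<in> Obj C" "G \<in> Obj C" "H \<in> Obj C" and m: "i \<in> Hom C F H" "j \<in> Hom C G H" "p \<in> Hom C H F" "q \<in> Hom C H G"
    and eq: "Cmp C p i = Idn C F" "Cmp C q j = Idn C G" "Cmp C q i = Zer C F G" "Cmp C p j = Zer C G F"
    using b unfolding biproduct_diagram_def by auto
  let ?I = "\<lambda>X. E X X (Idn C X)"
  let ?i = "E F H i" and ?j = "E G H j" and ?p = "E H F p" and ?q = "E H G q"
    and ?s = "E M F s" and ?e = "E F M e" and ?t = "E N G t" and ?d = "E G N d"
  have k: "?p * ?i = ?I F" "?q * ?j = ?I G" "?q * ?i = 0" "?p * ?j = 0" "?e * ?s = ?I M" "?d * ?t = ?I N"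
    using E_mult[OF o(1,3,1) m(1,3)] E_mult[OF o(2,3,2) m(2,4)] E_mult[OF o(1,3,2) m(1,4)] E_mult[OF o(2,3,1) m(2,3)]
      E_mult[OF oM(1) o(1) oM(1) M(1,2)] E_mult[OF oM(2) o(2) oM(2) N(1,2)] eq M(3) N(3) E_zer[OF o(1,2)] E_zer[OF o(2,1)] by simp_all
  have u: "?I Y * E X Y f = E X Y f" "E X Y f * ?I X = E X Y f" "?I Y * (E X Y f * w) = E X Y f * w" "E X Y f * (?I X * w) = E X Y f * w"
    if "f \<in> Hom C X Y" "X \<in> Obj C" "Y \<in> Obj C" for f X Y w
    using E_idn_left[OF that(2,3,1)] E_idn_right[OF that(2,3,1)] by (simp_all add: mult.assoc[symmetric])
  note rl = k k[THEN assoc_rule] u[OF m(1) o(1,3)] u[OF m(2) o(2,3)] u[OF m(3) o(3,1)] u[OF m(4) o(3,2)]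
    u[OF M(1) oM(1) o(1)] u[OF M(2) o(1) oM(1)] u[OF N(1) oM(2) o(2)] u[OF N(2) o(2) oM(2)]
  define a where "a = Cmp C i (Cmp C s (Cmp C e p))"
  define c where "c = Cmp C j (Cmp C t (Cmp C d q))"
  note ep = cmp_in[OF M(2) m(3) o(3,1) oM(1)] and dq = cmp_in[OF N(2) m(4) o(3,2) oM(2)]
  note sep = cmp_in[OF M(1) ep o(3) oM(1) o(1)] and tdq = cmp_in[OF N(1) dq o(3) oM(2) o(2)]
  have aH: "a \<in> Hom C H H" "c \<in> Hom C H H" unfolding a_def c_def
    using cmp_in[OF m(1) sep o(3,1,3)] cmp_in[OF m(2) tdq o(3,2,3)] by auto
  let ?\<epsilon> = "Add C a c"
  have \<epsilon>H: "?\<epsilon> \<in> Hom C H H" using add_in[OF aH o(3,3)] .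
  have Ea: "E H H a = ?i * ?s * ?e * ?p" "E H H c = ?j * ?t * ?d * ?q" unfolding a_def c_def
    using E_mult[OF o(3,1,3) sep m(1)] E_mult[OF o(3) oM(1) o(1) ep M(1)] E_mult[OF o(3,1) oM(1) m(3) M(2)]
      E_mult[OF o(3,2,3) tdq m(2)] E_mult[OF o(3) oM(2) o(2) dq N(1)] E_mult[OF o(3,2) oM(2) m(4) N(2)] by (simp_all add: mult.assoc)
  have E\<epsilon>: "E H H ?\<epsilon> = ?i * ?s * ?e * ?p + ?j * ?t * ?d * ?q" using E_add[OF o(3,3) aH] unfolding Ea by simp
  have "E H H ?\<epsilon> * E H H ?\<epsilon> = E H H ?\<epsilon>" unfolding E\<epsilon> by (simp add: algebra_simps rl)
  then have "Cmp C ?\<epsilon> ?\<epsilon> = ?\<epsilon>"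
    using E_inject[OF o(3,3) cmp_in[OF \<epsilon>H \<epsilon>H o(3,3,3)] \<epsilon>H] E_mult[OF o(3,3,3) \<epsilon>H \<epsilon>H] by simp
  then obtain Z r v where Z: "Z \<in> Obj C" "r \<in> Hom C H Z" "v \<in> Hom C Z H" "Cmp C r v = Idn C Z" "Cmp C v r = ?\<epsilon>"
    using split[OF \<epsilon>H] by blast
  let ?r = "E H Z r" and ?v = "E Z H v"
  have rv: "?r * ?v = ?I Z" using E_mult[OF Z(1) o(3) Z(1) Z(3,2)] Z(4) by simp
  have vr: "?v * ?r = ?i * (?s * (?e * ?p)) + ?j * (?t * (?d * ?q))"
    using E_mult[OF o(3) Z(1) o(3) Z(2,3)] unfolding Z(5) E\<epsilon> by (simp add: mult.assoc)
  note rZ = rv rv[THEN assoc_rule] vr vr[THEN assoc_rule] u[OF Z(2) o(3) Z(1)] u[OF Z(3) Z(1) o(3)]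
  note is' = cmp_in[OF m(1) M(1) oM(1) o(1,3)] and jt = cmp_in[OF m(2) N(1) oM(2) o(2,3)]
  note pv = cmp_in[OF m(3) Z(3) Z(1) o(3,1)] and qv = cmp_in[OF m(4) Z(3) Z(1) o(3,2)]
  let ?a = "Cmp C r (Cmp C i s)" and ?b = "Cmp C r (Cmp C j t)" and ?c = "Cmp C e (Cmp C p v)" and ?f = "Cmp C d (Cmp C q v)"
  have H: "?a \<in> Hom C M Z" "?b \<in> Hom C N Z" "?c \<in> Hom C Z M" "?f \<in> Hom C Z N"
    using cmp_in[OF Z(2) is' oM(1) o(3) Z(1)] cmp_in[OF Z(2) jt oM(2) o(3) Z(1)] cmp_in[OF M(2) pv Z(1) o(1) oM(1)] cmp_in[OF N(2) qv Z(1) o(2) oM(2)] by auto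
  have EH: "E M Z ?a = ?r * (?i * ?s)" "E N Z ?b = ?r * (?j * ?t)" "E Z M ?c = ?e * (?p * ?v)" "E Z N ?f = ?d * (?q * ?v)"
    using E_mult[OF oM(1) o(3) Z(1) is' Z(2)] E_mult[OF oM(1) o(1,3) M(1) m(1)] E_mult[OF oM(2) o(3) Z(1) jt Z(2)] E_mult[OF oM(2) o(2,3) N(1) m(2)]
      E_mult[OF Z(1) o(1) oM(1) pv M(2)] E_mult[OF Z(1) o(3,1) Z(3) m(3)] E_mult[OF Z(1) o(2) oM(2) qv N(2)] E_mult[OF Z(1) o(3,2) Z(3) m(4)] by simp_all
  have 1: "Cmp C ?c ?a = Idn C M"
    using E_inject[OF oM(1,1) cmp_in[OF H(3,1) oM(1) Z(1) oM(1)] idn_in[OF oM(1)]] E_mult[OF oM(1) Z(1) oM(1) H(1,3)]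
    unfolding EH by (simp add: algebra_simps rl rZ)
  have 2: "Cmp C ?f ?b = Idn C N"
    using E_inject[OF oM(2,2) cmp_in[OF H(4,2) oM(2) Z(1) oM(2)] idn_in[OF oM(2)]] E_mult[OF oM(2) Z(1) oM(2) H(2,4)]
    unfolding EH by (simp add: algebra_simps rl rZ)
  have 3: "Cmp C ?f ?a = Zer C M N"
    using E_inject[OF oM(1,2) cmp_in[OF H(4,1) oM(1) Z(1) oM(2)] zer_in[OF oM(1,2)]] E_mult[OF oM(1) Z(1) oM(2) H(1,4)] E_zer[OF oM(1,2)]
    unfolding EH by (simp add: algebra_simps rl rZ)
  have 4: "Cmp C ?c ?b = Zer C N M"
    using E_inject[OF oM(2,1) cmp_in[OF H(3,2) oM(2) Z(1) oM(1)] zer_in[OF oM(2,1)]] E_mult[OF oM(2) Z(1) oM(1) H(2,3)] E_zer[OF oM(2,1)]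
    unfolding EH by (simp add: algebra_simps rl rZ)
  note ac = cmp_in[OF H(1,3) Z(1) oM(1) Z(1)] and bf = cmp_in[OF H(2,4) Z(1) oM(2) Z(1)]
  have "E Z Z (Add C (Cmp C ?a ?c) (Cmp C ?b ?f)) = ?r * (?v * ?r) * ?v"
    using E_add[OF Z(1,1) ac bf] E_mult[OF Z(1) oM(1) Z(1) H(3,1)] E_mult[OF Z(1) oM(2) Z(1) H(4,2)]
    unfolding EH vr by (simp add: algebra_simps)
  also have "\<dots> = ?I Z" using rv by (simp add: mult.assoc rv(1) rZ(1,2) u[OF Z(2) o(3) Z(1)] u[OF Z(3) Z(1) o(3)])
  finally have 5: "Add C (Cmp C ?a ?c) (Cmp C ?b ?f) = Idn C Z"
    using E_inject[OF Z(1,1) add_in[OF ac bf Z(1,1)] idn_in[OF Z(1)]] by simp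
  show ?thesis unfolding biproduct_def biproduct_diagram_def using oM Z(1) H 1 2 3 4 5 by blast
qed

end

subsection \<open>Left modules\<close>

context left_module
begin

lemma smult_zero: "r \<in> carrier R \<Longrightarrow> r \<odot>\<^bsub>M\<^esub> \<zero>\<^bsub>M\<^esub> = \<zero>\<^bsub>M\<^esub>"
  using smult_r_distr[of r "\<zero>\<^bsub>M\<^esub>" "\<zero>\<^bsub>M\<^esub>"] smult_closed[of r "\<zero>\<^bsub>M\<^esub>"] M.add.l_cancel_one[of "r \<odot>\<^bsub>M\<^esub> \<zero>\<^bsub>M\<^esub>" "r \<odot>\<^bsub>M\<^esub> \<zero>\<^bsub>M\<^esub>"] by simp

lemma zero_smult: "x \<in> carrier M \<Longrightarrow> \<zero>\<^bsub>R\<^esub> \<odot>\<^bsub>M\<^esub> x = \<zero>\<^bsub>M\<^esub>"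
  using smult_l_distr[of "\<zero>\<^bsub>R\<^esub>" "\<zero>\<^bsub>R\<^esub>" x] smult_closed[of "\<zero>\<^bsub>R\<^esub>" x] M.add.l_cancel_one[of "\<zero>\<^bsub>R\<^esub> \<odot>\<^bsub>M\<^esub> x" "\<zero>\<^bsub>R\<^esub> \<odot>\<^bsub>M\<^esub> x"] by simp

lemma smult_neg: assumes "r \<in> carrier R" "x \<in> carrier M" shows "r \<odot>\<^bsub>M\<^esub> (\<ominus>\<^bsub>M\<^esub> x) = \<ominus>\<^bsub>M\<^esub> (r \<odot>\<^bsub>M\<^esub> x)"
proof (rule M.minus_equality[symmetric])
  show "r \<odot>\<^bsub>M\<^esub> (\<ominus>\<^bsub>M\<^esub> x) \<oplus>\<^bsub>M\<^esub> r \<odot>\<^bsub>M\<^esub> x = \<zero>\<^bsub>M\<^esub>"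
    using smult_r_distr[of r "\<ominus>\<^bsub>M\<^esub> x" x] assms by (simp add: M.l_neg smult_zero)
qed (use assms smult_closed in auto)

end

lemma lmod_homD:
  assumes "f \<in> lmod_hom R M N"
  shows "x \<in> carrier M \<Longrightarrow> f x \<in> carrier N" "\<lbrakk>x \<in> carrier M; y \<in> carrier M\<rbrakk> \<Longrightarrow> f (x \<oplus>\<^bsub>M\<^esub> y) = f x \<oplus>\<^bsub>N\<^esub> f y"
    "\<lbrakk>r \<in> carrier R; x \<in> carrier M\<rbrakk> \<Longrightarrow> f (r \<odot>\<^bsub>M\<^esub> x) = r \<odot>\<^bsub>N\<^esub> f x" "(\<lambda>x\<in>carrier M. f x) = f"
  using assms unfolding lmod_hom_def by (auto simp: extensional_restrict PiE_iff)

lemma lmod_homI: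
  assumes "\<And>x. x \<in> carrier M \<Longrightarrow> f x \<in> carrier N" "\<And>x y. \<lbrakk>x \<in> carrier M; y \<in> carrier M\<rbrakk> \<Longrightarrow> f (x \<oplus>\<^bsub>M\<^esub> y) = f x \<oplus>\<^bsub>N\<^esub> f y"
    "\<And>r x. \<lbrakk>r \<in> carrier R; x \<in> carrier M\<rbrakk> \<Longrightarrow> f (r \<odot>\<^bsub>M\<^esub> x) = r \<odot>\<^bsub>N\<^esub> f x" and M: "left_module R M"
  shows "(\<lambda>x\<in>carrier M. f x) \<in> lmod_hom R M N"
proof -
  interpret M: left_module R M by fact
  show ?thesis unfolding lmod_hom_def using assms M.smult_closed by auto
qed

lemma lmod_hom_zero:
  assumes "left_module R M" "left_module R N" "f \<in> lmod_hom R M N" shows "f \<zero>\<^bsub>M\<^esub> = \<zero>\<^bsub>N\<^esub>"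
proof -
  interpret M: left_module R M by fact
  interpret N: left_module R N by fact
  show ?thesis
    using lmod_homD(3)[OF assms(3) M.R.zero_closed M.M.zero_closed] lmod_homD(1)[OF assms(3) M.M.zero_closed]
    by (simp add: M.zero_smult N.zero_smult)
qed

lemma lmod_hom_cmp:
  assumes "left_module R M" "f \<in> lmod_hom R M N" "g \<in> lmod_hom R N L" shows "(\<lambda>x\<in>carrier M. g (f x)) \<in> lmod_hom R M L"
  by (rule lmod_homI) (use assms in \<open>auto simp: lmod_homD[OF assms(2)] lmod_homD[OF assms(3)]\<close>)

lemma lmod_hom_add:
  assumes "left_module R M" "left_module R N" "f \<in> lmod_hom R M N" "g \<in> lmod_hom R M N"
  shows "(\<lambda>x\<in>carrier M. f x \<oplus>\<^bsub>N\<^esub> g x) \<in> lmod_hom R M N"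
proof -
  interpret N: left_module R N by fact
  show ?thesis
    by (rule lmod_homI)
      (use assms in \<open>auto simp: lmod_homD[OF assms(3)] lmod_homD[OF assms(4)] N.smult_r_distr N.M.a_ac\<close>)
qed

lemma lmod_hom_neg:
  assumes "left_module R M" "left_module R N" "f \<in> lmod_hom R M N"
  shows "(\<lambda>x\<in>carrier M. \<ominus>\<^bsub>N\<^esub> f x) \<in> lmod_hom R M N"
proof -
  interpret N: left_module R N by fact
  show ?thesis
    by (rule lmod_homI) (use assms in \<open>auto simp: lmod_homD[OF assms(3)] N.smult_neg N.M.minus_add\<close>)
qed

lemma lmod_hom_zer:
  assumes "left_module R M" "left_module R N" shows "(\<lambda>x\<in>carrier M. \<zero>\<^bsub>N\<^esub>) \<in> lmod_hom R M N"
proof -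
  interpret N: left_module R N by fact
  show ?thesis by (rule lmod_homI) (use assms in \<open>auto simp: N.smult_zero\<close>)
qed

lemma lmod_hom_id: "left_module R M \<Longrightarrow> (\<lambda>x\<in>carrier M. x) \<in> lmod_hom R M M"
  by (rule lmod_homI) auto

lemma proj_obj: "M \<in> Obj (proj R) \<longleftrightarrow> left_module R M \<and> fin_generated R M \<and> projective_module R M"
  by (simp add: proj_def)

lemma proj_hom: "a \<in> Hom (proj R) M N \<longleftrightarrow> (\<exists>f\<in>lmod_hom R M N. a = (M, f, N))"
  by (auto simp: proj_def)

lemma proj_sel: "Cmp (proj R) = lmod_cmp" "Idn (proj R) M = (M, \<lambda>x\<in>carrier M. x, M)" "Add (proj R) = lmod_add"
  "Neg (proj R) = lmod_neg" "Zer (proj R) M N = (M, \<lambda>x\<in>carrier M. \<zero>\<^bsub>N\<^esub>, N)"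
  by (simp_all add: proj_def)

lemma preadd_proj: "preadd (proj R)"
proof
  fix M N L K f g h f' g'
  assume M: "M \<in> Obj (proj R)"
  then have lM: "left_module R M" by (simp add: proj_obj)
  show "Idn (proj R) M \<in> Hom (proj R) M M" using lmod_hom_id[OF lM] by (simp add: proj_hom proj_sel)
  assume N: "N \<in> Obj (proj R)"
  then have lN: "left_module R N" by (simp add: proj_obj)
  interpret N: left_module R N by (rule lN)
  note s = lmod_homD(1) N.M.a_ac N.M.l_zero N.M.l_neg
  show "Zer (proj R) M N \<in> Hom (proj R) M N" using lmod_hom_zer[OF lM lN] by (simp add: proj_hom proj_sel)
  assume f: "f \<in> Hom (proj R) M N"
  then obtain f1 where f1: "f1 \<in> lmod_hom R M N" "f = (M, f1, N)" by (auto simp: proj_hom)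
  show "Cmp (proj R) (Idn (proj R) N) f = f" "Cmp (proj R) f (Idn (proj R) M) = f"
    using lmod_homD(4)[OF f1(1)] lmod_homD(1)[OF f1(1)] by (simp_all add: proj_sel f1(2) cong: restrict_cong)
  show "Neg (proj R) f \<in> Hom (proj R) M N" using lmod_hom_neg[OF lM lN f1(1)] by (simp add: proj_hom proj_sel f1(2))
  show "Add (proj R) (Zer (proj R) M N) f = f"
    using lmod_homD(4)[OF f1(1)] lmod_homD(1)[OF f1(1)] by (simp add: proj_sel f1(2) cong: restrict_cong)
  show "Add (proj R) (Neg (proj R) f) f = Zer (proj R) M N"
    using lmod_homD(1)[OF f1(1)] by (simp add: proj_sel f1(2) N.M.l_neg cong: restrict_cong)
  {
    assume f': "f' \<in> Hom (proj R) M N"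
    then obtain f2 where f2: "f2 \<in> lmod_hom R M N" "f' = (M, f2, N)" by (auto simp: proj_hom)
    show "Add (proj R) f f' \<in> Hom (proj R) M N" using lmod_hom_add[OF lM lN f1(1) f2(1)] by (simp add: proj_hom proj_sel f1(2) f2(2))
    show "Add (proj R) f f' = Add (proj R) f' f"
      using lmod_homD(1)[OF f1(1)] lmod_homD(1)[OF f2(1)] by (simp add: proj_sel f1(2) f2(2) N.M.a_comm cong: restrict_cong)
    assume h: "h \<in> Hom (proj R) M N"
    then obtain h1 where h1: "h1 \<in> lmod_hom R M N" "h = (M, h1, N)" by (auto simp: proj_hom)
    show "Add (proj R) (Add (proj R) f f') h = Add (proj R) f (Add (proj R) f' h)"
      using lmod_homD(1)[OF f1(1)] lmod_homD(1)[OF f2(1)] lmod_homD(1)[OF h1(1)]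
      by (simp add: proj_sel f1(2) f2(2) h1(2) N.M.a_assoc cong: restrict_cong)
  }
  assume L: "L \<in> Obj (proj R)" and g: "g \<in> Hom (proj R) N L"
  then have lL: "left_module R L" by (simp add: proj_obj)
  interpret L: left_module R L by (rule lL)
  obtain g1 where g1: "g1 \<in> lmod_hom R N L" "g = (N, g1, L)" using g by (auto simp: proj_hom)
  show "Cmp (proj R) g f \<in> Hom (proj R) M L" using lmod_hom_cmp[OF lM f1(1) g1(1)] by (simp add: proj_hom proj_sel f1(2) g1(2))
  {
    assume "f' \<in> Hom (proj R) M N"
    then obtain f2 where f2: "f2 \<in> lmod_hom R M N" "f' = (M, f2, N)" by (auto simp: proj_hom)
    show "Cmp (proj R) g (Add (proj R) f f') = Add (proj R) (Cmp (proj R) g f) (Cmp (proj R) g f')"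
      using lmod_homD(1)[OF f1(1)] lmod_homD(1)[OF f2(1)] lmod_homD(2)[OF g1(1)]
      by (simp add: proj_sel f1(2) f2(2) g1(2) cong: restrict_cong)
  }
  {
    assume "g' \<in> Hom (proj R) N L"
    then obtain g2 where g2: "g2 \<in> lmod_hom R N L" "g' = (N, g2, L)" by (auto simp: proj_hom)
    show "Cmp (proj R) (Add (proj R) g g') f = Add (proj R) (Cmp (proj R) g f) (Cmp (proj R) g' f)"
      using lmod_homD(1)[OF f1(1)] by (simp add: proj_sel f1(2) g2(2) g1(2) cong: restrict_cong)
  }
  assume K: "K \<in> Obj (proj R)" and h: "h \<in> Hom (proj R) L K"
  then obtain h1 where h1: "h1 \<in> lmod_hom R L K" "h = (L, h1, K)" by (auto simp: proj_hom)
  show "Cmp (proj R) (Cmp (proj R) h g) f = Cmp (proj R) h (Cmp (proj R) g f)"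
    using lmod_homD(1)[OF f1(1)] by (simp add: proj_sel f1(2) h1(2) g1(2) cong: restrict_cong)
qed

subsection \<open>Linear combinations and free modules\<close>

fun lc :: "('a, 'm) module \<Rightarrow> 'a list \<Rightarrow> 'm list \<Rightarrow> 'm" where
  "lc M (r # rs) (y # ys) = (r \<odot>\<^bsub>M\<^esub> y) \<oplus>\<^bsub>M\<^esub> lc M rs ys"
| "lc M _ _ = \<zero>\<^bsub>M\<^esub>"

context left_module
begin

lemma lc_closed: "\<lbrakk>set rs \<subseteq> carrier R; set ys \<subseteq> carrier M\<rbrakk> \<Longrightarrow> lc M rs ys \<in> carrier M"
proof (induction rs arbitrary: ys)
  case (Cons r rs)
  then show ?case by (cases ys) (auto simp: smult_closed)
qed simp

lemma lc_add: "\<lbrakk>set rs \<subseteq> carrier R; set ss \<subseteq> carrier R; set ys \<subseteq> carrier M; length rs = length ss\<rbrakk> \<Longrightarrow>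
    lc M (map2 (add R) rs ss) ys = lc M rs ys \<oplus>\<^bsub>M\<^esub> lc M ss ys"
proof (induction rs arbitrary: ss ys)
  case (Cons r rs)
  then obtain s ss' where s: "ss = s # ss'" by (cases ss) auto
  show ?case
  proof (cases ys)
    case (Cons y ys')
    have "lc M rs ys' \<in> carrier M" "lc M ss' ys' \<in> carrier M" "r \<odot>\<^bsub>M\<^esub> y \<in> carrier M" "s \<odot>\<^bsub>M\<^esub> y \<in> carrier M"
      using Cons.prems lc_closed smult_closed unfolding s Cons by auto
    then show ?thesis using Cons.IH[of ss' ys'] Cons.prems unfolding s Cons by (simp add: smult_l_distr M.a_ac)
  qed (simp add: s)
qed simp

lemma lc_smult: "\<lbrakk>r \<in> carrier R; set rs \<subseteq> carrier R; set ys \<subseteq> carrier M\<rbrakk> \<Longrightarrow>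
    lc M (map (\<lambda>x. r \<otimes> x) rs) ys = r \<odot>\<^bsub>M\<^esub> lc M rs ys"
proof (induction rs arbitrary: ys)
  case (Cons s rs)
  show ?case
  proof (cases ys)
    case c: (Cons y ys')
    have "lc M rs ys' \<in> carrier M" "s \<odot>\<^bsub>M\<^esub> y \<in> carrier M" using Cons.prems lc_closed smult_closed unfolding c by auto
    then show ?thesis using Cons.IH[of ys'] Cons.prems unfolding c by (simp add: smult_r_distr smult_assoc)
  qed (use Cons.prems in \<open>simp add: smult_zero\<close>)
qed (simp add: smult_zero)

text \<open>The list may repeat entries while \<open>fin_generated\<close> sums over a set, so
  coefficients of equal entries are added up.\<close>

lemma lc_finsum:
  "\<lbrakk>set rs \<subseteq> carrier R; set ys \<subseteq> carrier M; length rs = length ys\<rbrakk> \<Longrightarrow>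
     \<exists>c\<in>set ys \<rightarrow> carrier R. lc M rs ys = (\<Oplus>\<^bsub>M\<^esub>b\<in>set ys. c b \<odot>\<^bsub>M\<^esub> b)"
proof (induction rs arbitrary: ys)
  case (Cons r rs)
  then obtain y ys' where y: "ys = y # ys'" by (cases ys) auto
  obtain c where c: "c \<in> set ys' \<rightarrow> carrier R" "lc M rs ys' = (\<Oplus>\<^bsub>M\<^esub>b\<in>set ys'. c b \<odot>\<^bsub>M\<^esub> b)"
    using Cons.IH[of ys'] Cons.prems unfolding y by auto
  have yM: "y \<in> carrier M" "set ys' \<subseteq> carrier M" "r \<in> carrier R" using Cons.prems unfolding y by auto
  have cl: "(\<lambda>b. c b \<odot>\<^bsub>M\<^esub> b) \<in> B \<rightarrow> carrier M" if "B \<subseteq> set ys'" for B using c(1) yM that smult_closed by blast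
  show ?case
  proof (cases "y \<in> set ys'")
    case False
    let ?c = "c(y := r)"
    have e: "(\<Oplus>\<^bsub>M\<^esub>b\<in>set ys'. ?c b \<odot>\<^bsub>M\<^esub> b) = (\<Oplus>\<^bsub>M\<^esub>b\<in>set ys'. c b \<odot>\<^bsub>M\<^esub> b)"
      by (rule M.finsum_cong') (use False cl in auto)
    have "(\<Oplus>\<^bsub>M\<^esub>b\<in>insert y (set ys'). ?c b \<odot>\<^bsub>M\<^esub> b) = r \<odot>\<^bsub>M\<^esub> y \<oplus>\<^bsub>M\<^esub> (\<Oplus>\<^bsub>M\<^esub>b\<in>set ys'. ?c b \<odot>\<^bsub>M\<^esub> b)"
      using M.finsum_insert[of "set ys'" y "\<lambda>b. ?c b \<odot>\<^bsub>M\<^esub> b"] False cl[OF order_refl] yM smult_closed by (auto simp: Pi_iff)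
    then have "lc M (r # rs) ys = (\<Oplus>\<^bsub>M\<^esub>b\<in>set ys. ?c b \<odot>\<^bsub>M\<^esub> b)" using c(2) e unfolding y by simp
    moreover have "?c \<in> set ys \<rightarrow> carrier R" using c(1) yM unfolding y by auto
    ultimately show ?thesis by blast
  next
    case True
    let ?c = "c(y := r \<oplus> c y)" and ?B = "set ys' - {y}"
    have cy: "c y \<in> carrier R" using c(1) True by blast
    have s: "set ys' = insert y ?B" "set ys = insert y ?B" using True unfolding y by auto
    have e: "(\<Oplus>\<^bsub>M\<^esub>b\<in>?B. ?c b \<odot>\<^bsub>M\<^esub> b) = (\<Oplus>\<^bsub>M\<^esub>b\<in>?B. c b \<odot>\<^bsub>M\<^esub> b)"
      by (rule M.finsum_cong') (use cl[of ?B] in auto)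
    have cB: "(\<Oplus>\<^bsub>M\<^esub>b\<in>?B. c b \<odot>\<^bsub>M\<^esub> b) \<in> carrier M" by (rule M.finsum_closed) (use cl[of ?B] in auto)
    have 1: "(\<Oplus>\<^bsub>M\<^esub>b\<in>insert y ?B. c b \<odot>\<^bsub>M\<^esub> b) = c y \<odot>\<^bsub>M\<^esub> y \<oplus>\<^bsub>M\<^esub> (\<Oplus>\<^bsub>M\<^esub>b\<in>?B. c b \<odot>\<^bsub>M\<^esub> b)"
      by (rule M.finsum_insert) (use cl[of ?B] cy yM smult_closed in auto)
    have "(\<Oplus>\<^bsub>M\<^esub>b\<in>insert y ?B. ?c b \<odot>\<^bsub>M\<^esub> b) = (r \<oplus> c y) \<odot>\<^bsub>M\<^esub> y \<oplus>\<^bsub>M\<^esub> (\<Oplus>\<^bsub>M\<^esub>b\<in>?B. ?c b \<odot>\<^bsub>M\<^esub> b)"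
      using M.finsum_insert[of ?B y "\<lambda>b. ?c b \<odot>\<^bsub>M\<^esub> b"] cl[of ?B] cy yM smult_closed by (auto simp: Pi_iff)
    also have "\<dots> = r \<odot>\<^bsub>M\<^esub> y \<oplus>\<^bsub>M\<^esub> lc M rs ys'"
      unfolding e c(2) 1[folded s(1)] using cy yM cB smult_closed by (simp add: smult_l_distr M.a_assoc)
    finally have "lc M (r # rs) ys = (\<Oplus>\<^bsub>M\<^esub>b\<in>set ys. ?c b \<odot>\<^bsub>M\<^esub> b)" unfolding s(2) by (simp add: y)
    moreover have "?c \<in> set ys \<rightarrow> carrier R" using c(1) cy yM unfolding y by auto
    ultimately show ?thesis by blast
  qed
qed auto

lemma finsum_lc: "\<lbrakk>distinct ys; set ys \<subseteq> carrier M; c \<in> set ys \<rightarrow> carrier R\<rbrakk> \<Longrightarrow>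
    (\<Oplus>\<^bsub>M\<^esub>b\<in>set ys. c b \<odot>\<^bsub>M\<^esub> b) = lc M (map c ys) ys"
proof (induction ys)
  case (Cons y ys)
  have "(\<Oplus>\<^bsub>M\<^esub>b\<in>insert y (set ys). c b \<odot>\<^bsub>M\<^esub> b) = c y \<odot>\<^bsub>M\<^esub> y \<oplus>\<^bsub>M\<^esub> (\<Oplus>\<^bsub>M\<^esub>b\<in>set ys. c b \<odot>\<^bsub>M\<^esub> b)"
    by (rule M.finsum_insert) (use Cons.prems smult_closed in \<open>auto simp: Pi_iff\<close>)
  then show ?case using Cons by simp
qed simp

lemma lc_hom: assumes N: "left_module R N" and f: "f \<in> lmod_hom R M N"
  shows "\<lbrakk>set rs \<subseteq> carrier R; set ys \<subseteq> carrier M\<rbrakk> \<Longrightarrow> f (lc M rs ys) = lc N rs (map f ys)"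
proof (induction rs arbitrary: ys)
  case (Cons r rs)
  show ?case
  proof (cases ys)
    case c: (Cons y ys')
    then show ?thesis using Cons lmod_homD[OF f] lc_closed[of rs ys'] smult_closed by simp
  qed (simp add: lmod_hom_zero[OF left_module_axioms N f])
qed (simp add: lmod_hom_zero[OF left_module_axioms N f])

end

lemma map2_append: "length xs = length ys \<Longrightarrow> map2 f (xs @ xs') (ys @ ys') = map2 f xs ys @ map2 f xs' ys'"
  by simp

context ring
begin

abbreviation "PR \<equiv> proj R"
abbreviation "FR \<equiv> free_module R"

lemma free_sel: "x \<in> carrier (FR n) \<longleftrightarrow> length x = n \<and> set x \<subseteq> carrier R" "\<zero>\<^bsub>FR n\<^esub> = replicate n \<zero>"
  "x \<oplus>\<^bsub>FR n\<^esub> y = map2 (add R) x y" "r \<odot>\<^bsub>FR n\<^esub> x = map (\<lambda>x. r \<otimes> x) x"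
  by (simp_all add: free_module_def)

lemma free_nth: "x \<in> carrier (FR n) \<longleftrightarrow> length x = n \<and> (\<forall>i<n. x ! i \<in> carrier R)"
  unfolding free_sel by (auto simp: set_conv_nth)

lemma left_module_free: "left_module R (FR n)"
proof -
  have "abelian_group (FR n)"
  proof (rule abelian_groupI)
    fix x y z assume x: "x \<in> carrier (FR n)" and y: "y \<in> carrier (FR n)"
    show "x \<oplus>\<^bsub>FR n\<^esub> y \<in> carrier (FR n)" using x y unfolding free_nth free_sel(3) by simp
    show "x \<oplus>\<^bsub>FR n\<^esub> y = y \<oplus>\<^bsub>FR n\<^esub> x" using x y unfolding free_nth free_sel(3) by (auto intro!: nth_equalityI simp: a_comm)
    show "\<zero>\<^bsub>FR n\<^esub> \<oplus>\<^bsub>FR n\<^esub> x = x" using x unfolding free_nth free_sel(2,3) by (auto intro!: nth_equalityI)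
    have "map (a_inv R) x \<in> carrier (FR n)" using x unfolding free_nth by simp
    moreover have "map (a_inv R) x \<oplus>\<^bsub>FR n\<^esub> x = \<zero>\<^bsub>FR n\<^esub>"
      using x unfolding free_nth free_sel(2,3) by (auto intro!: nth_equalityI simp: l_neg)
    ultimately show "\<exists>y\<in>carrier (FR n). y \<oplus>\<^bsub>FR n\<^esub> x = \<zero>\<^bsub>FR n\<^esub>" by blast
    assume z: "z \<in> carrier (FR n)"
    show "x \<oplus>\<^bsub>FR n\<^esub> y \<oplus>\<^bsub>FR n\<^esub> z = x \<oplus>\<^bsub>FR n\<^esub> (y \<oplus>\<^bsub>FR n\<^esub> z)"
      using x y z unfolding free_nth free_sel(3) by (auto intro!: nth_equalityI simp: a_assoc)
  qed (simp add: free_nth free_sel(2))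
  then show ?thesis
    by (intro left_module.intro left_module_axioms.intro ring_axioms)
      (auto simp: free_nth free_sel(3,4) l_distr r_distr m_assoc in_set_conv_nth intro!: nth_equalityI)
qed

fun basis :: "nat \<Rightarrow> 'a list list" where
  "basis 0 = []"
| "basis (Suc n) = (\<one> # replicate n \<zero>) # map ((#) \<zero>) (basis n)"

lemma basis_in: "length (basis n) = n" "set (basis n) \<subseteq> carrier (FR n)"
  by (induction n) (auto simp: free_sel)

lemma lc_map_Cons: "\<lbrakk>set xs \<subseteq> carrier R; set ys \<subseteq> carrier (FR n)\<rbrakk> \<Longrightarrow> lc (FR (Suc n)) xs (map ((#) \<zero>) ys) = \<zero> # lc (FR n) xs ys"
proof (induction xs arbitrary: ys)
  case (Cons x xs)
  then show ?case by (cases ys) (auto simp: free_sel)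
qed (simp add: free_sel)

lemma lc_basis: "x \<in> carrier (FR n) \<Longrightarrow> lc (FR n) x (basis n) = x"
proof (induction n arbitrary: x)
  case (Suc n)
  then obtain a y where y: "x = a # y" "a \<in> carrier R" "y \<in> carrier (FR n)" by (cases x) (auto simp: free_sel)
  have s: "set y \<subseteq> carrier R" and l: "length y = n" using y(3) unfolding free_sel by auto
  have "map (\<lambda>x. a \<otimes> x) (replicate n \<zero>) = replicate n \<zero>" using y(2) by simp
  moreover have "map2 (add R) (replicate n \<zero>) y = y" using s l by (auto intro!: nth_equalityI l_zero subsetD[OF s])
  ultimately show ?case using Suc.IH[OF y(3)] y(2) unfolding y(1) by (simp add: lc_map_Cons[OF s basis_in(2)] free_sel)
qed (simp add: free_sel)

lemma lc_free_hom: assumes "left_module R M" "set ys \<subseteq> carrier M"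
  shows "(\<lambda>x\<in>carrier (FR n). lc M x ys) \<in> lmod_hom R (FR n) M"
proof -
  interpret M: left_module R M by fact
  show ?thesis
    by (rule lmod_homI[OF _ _ _ left_module_free])
      (use assms(2) in \<open>auto simp: free_sel intro!: M.lc_closed M.lc_add M.lc_smult\<close>)
qed

lemma free_hom_lc: assumes "left_module R M" "f \<in> lmod_hom R (FR n) M" "x \<in> carrier (FR n)"
  shows "f x = lc M x (map f (basis n))" "set (map f (basis n)) \<subseteq> carrier M"
proof -
  interpret F: left_module R "FR n" by (rule left_module_free)
  show "f x = lc M x (map f (basis n))"
    using F.lc_hom[OF assms(1,2), of x "basis n"] basis_in(2) lc_basis[OF assms(3)] assms(3) by (simp add: free_sel)
  show "set (map f (basis n)) \<subseteq> carrier M" using lmod_homD(1)[OF assms(2)] basis_in(2) by auto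
qed

text \<open>Being a retract of some free module of finite rank is equivalent to being finitely
  generated projective, by \<open>retraction_obj\<close> and \<open>obj_retraction\<close>; all
  later constructions use this form.\<close>

definition retraction where
  "retraction M n s e \<longleftrightarrow> s \<in> lmod_hom R M (FR n) \<and> e \<in> lmod_hom R (FR n) M \<and> (\<forall>x\<in>carrier M. e (s x) = x)"

lemma retraction_obj: assumes M: "left_module R M" and r: "retraction M n s e" shows "M \<in> Obj PR"
proof -
  interpret M: left_module R M by (rule M)
  note h = r[unfolded retraction_def]
  have s: "s \<in> lmod_hom R M (FR n)" and e: "e \<in> lmod_hom R (FR n) M" and es: "\<And>x. x \<in> carrier M \<Longrightarrow> e (s x) = x" using h by auto
  let ?ys = "map e (basis n)"
  have ys: "set ?ys \<subseteq> carrier M" "length ?ys = n" using lmod_homD(1)[OF e] basis_in by auto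
  have x: "x = lc M (s x) ?ys" if "x \<in> carrier M" for x
    using free_hom_lc(1)[OF M e lmod_homD(1)[OF s that]] es[OF that] by simp
  have sx: "set (s x) \<subseteq> carrier R \<and> length (s x) = n" if "x \<in> carrier M" for x using lmod_homD(1)[OF s that] by (simp add: free_sel)
  have fg: "fin_generated R M"
    unfolding fin_generated_def
  proof (intro exI[of _ "set ?ys"] conjI ballI ys(1))
    fix m assume m: "m \<in> carrier M"
    obtain c where c: "c \<in> set ?ys \<rightarrow> carrier R" "lc M (s m) ?ys = (\<Oplus>\<^bsub>M\<^esub>b\<in>set ?ys. c b \<odot>\<^bsub>M\<^esub> b)"
      using M.lc_finsum[of "s m" ?ys] sx[OF m] ys by auto
    show "\<exists>c\<in>set ?ys \<rightarrow> carrier R. m = (\<Oplus>\<^bsub>M\<^esub>b\<in>set ?ys. c b \<odot>\<^bsub>M\<^esub> b)"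
      by (rule bexI[OF _ c(1)]) (rule trans[OF x[OF m] c(2)])
  qed simp
  have "projective_module R M"
    unfolding projective_module_def
  proof (intro allI ballI impI)
    fix N N' :: "'a lmod" and d f
    assume d: "d \<in> lmod_hom R N N'" and f: "f \<in> lmod_hom R M N'" and N: "left_module R N \<and> left_module R N' \<and> d ` carrier N = carrier N'"
    interpret N: left_module R N using N by blast
    have "\<exists>z. z \<in> carrier N \<and> d z = f y" if "y \<in> set ?ys" for y
    proof -
      have "f y \<in> d ` carrier N" using lmod_homD(1)[OF f subsetD[OF ys(1) that]] N by simp
      then show ?thesis by auto
    qed
    then have "\<forall>y\<in>set ?ys. \<exists>z. z \<in> carrier N \<and> d z = f y" by blast
    from bchoice[OF this] obtain w where w: "\<forall>y\<in>set ?ys. w y \<in> carrier N \<and> d (w y) = f y" ..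
    let ?zs = "map w ?ys"
    have zs: "set ?zs \<subseteq> carrier N" using w by auto
    have dz: "map d ?zs = map f ?ys" using w by auto
    let ?g = "\<lambda>x\<in>carrier M. (\<lambda>x\<in>carrier (FR n). lc N x ?zs) (s x)"
    have "?g \<in> lmod_hom R M N" by (rule lmod_hom_cmp[OF M s lc_free_hom[OF _ zs]]) (use N in blast)
    moreover have "d (?g m) = f m" if m: "m \<in> carrier M" for m
    proof -
      have "d (?g m) = d (lc N (s m) ?zs)" using m lmod_homD(1)[OF s m] by simp
      also have "\<dots> = lc N' (s m) (map f ?ys)" using N.lc_hom[OF _ d _ zs, of "s m"] N sx[OF m] unfolding dz by blast
      also have "\<dots> = f (lc M (s m) ?ys)" using M.lc_hom[OF _ f _ ys(1), of "s m"] N sx[OF m] by simp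
      finally show ?thesis using x[OF m] by simp
    qed
    ultimately show "\<exists>g\<in>lmod_hom R M N. \<forall>x\<in>carrier M. d (g x) = f x" by blast
  qed
  then show ?thesis using M fg by (simp add: proj_obj)
qed

lemma obj_retraction: assumes "M \<in> Obj PR" shows "\<exists>n s e. retraction M n s e"
proof -
  have M: "left_module R M" "fin_generated R M" "projective_module R M" using assms by (auto simp: proj_obj)
  interpret M: left_module R M by (rule M(1))
  obtain B where B: "finite B" "B \<subseteq> carrier M" "\<forall>x\<in>carrier M. \<exists>c\<in>B \<rightarrow> carrier R. x = (\<Oplus>\<^bsub>M\<^esub>b\<in>B. c b \<odot>\<^bsub>M\<^esub> b)"
    using M(2) unfolding fin_generated_def by blast
  obtain ys where ys: "set ys = B" "distinct ys" using finite_distinct_list[OF B(1)] by blast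
  let ?n = "length ys"
  let ?e = "\<lambda>x\<in>carrier (FR ?n). lc M x ys"
  have e: "?e \<in> lmod_hom R (FR ?n) M" by (rule lc_free_hom[OF M(1)]) (use ys B in simp)
  have "carrier M \<subseteq> ?e ` carrier (FR ?n)"
  proof
    fix x assume "x \<in> carrier M"
    then obtain c where c: "c \<in> set ys \<rightarrow> carrier R" "x = (\<Oplus>\<^bsub>M\<^esub>b\<in>set ys. c b \<odot>\<^bsub>M\<^esub> b)" using B(3) unfolding ys(1)[symmetric] by blast
    then have "x = lc M (map c ys) ys" using M.finsum_lc[OF ys(2) _ c(1)] B(2) ys(1) by simp
    moreover have "map c ys \<in> carrier (FR ?n)" using c(1) by (auto simp: free_sel)
    ultimately show "x \<in> ?e ` carrier (FR ?n)" by (intro image_eqI[of _ _ "map c ys"]) simp_all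
  qed
  then have im: "?e ` carrier (FR ?n) = carrier M" using lmod_homD(1)[OF e] by blast
  obtain s where "s \<in> lmod_hom R M (FR ?n)" "\<forall>x\<in>carrier M. ?e (s x) = (\<lambda>x\<in>carrier M. x) x"
    using M(3)[unfolded projective_module_def, rule_format, OF e lmod_hom_id[OF M(1)]] left_module_free M(1) im by blast
  then have "retraction M ?n s ?e" unfolding retraction_def using e by simp
  then show ?thesis by blast
qed

lemma free_obj: "FR n \<in> Obj PR"
  by (rule retraction_obj[OF left_module_free, of n n "\<lambda>x\<in>carrier (FR n). x" "\<lambda>x\<in>carrier (FR n). x"])
    (simp add: retraction_def lmod_hom_id[OF left_module_free])

text \<open>For an idempotent \<epsilon> the fixed points are its image. Realised inside F, the
  image again has lists as elements and is an object of the required type.\<close>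

lemma fixed_module: assumes F: "left_module R F" and \<epsilon>: "\<epsilon> \<in> lmod_hom R F F"
  shows "left_module R (F\<lparr>carrier := {x \<in> carrier F. \<epsilon> x = x}\<rparr>)"
proof -
  interpret F: left_module R F by (rule F)
  note h = lmod_homD[OF \<epsilon>] lmod_hom_zero[OF F F \<epsilon>]
  have neg: "\<epsilon> (\<ominus>\<^bsub>F\<^esub> x) = \<ominus>\<^bsub>F\<^esub> \<epsilon> x" if "x \<in> carrier F" for x
    by (rule F.M.minus_equality[symmetric]) (use that h(2)[of "\<ominus>\<^bsub>F\<^esub> x" x] h(1,5) in \<open>simp_all add: F.M.l_neg\<close>)
  have "abelian_group (F\<lparr>carrier := {x \<in> carrier F. \<epsilon> x = x}\<rparr>)"
  proof (rule abelian_groupI)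
    fix x assume "x \<in> carrier (F\<lparr>carrier := {x \<in> carrier F. \<epsilon> x = x}\<rparr>)"
    then show "\<exists>y\<in>carrier (F\<lparr>carrier := {x \<in> carrier F. \<epsilon> x = x}\<rparr>).
        y \<oplus>\<^bsub>F\<lparr>carrier := {x \<in> carrier F. \<epsilon> x = x}\<rparr>\<^esub> x = \<zero>\<^bsub>F\<lparr>carrier := {x \<in> carrier F. \<epsilon> x = x}\<rparr>\<^esub>"
      using neg by (intro bexI[of _ "\<ominus>\<^bsub>F\<^esub> x"]) (simp_all add: F.M.l_neg)
  qed (simp_all add: h F.M.a_ac)
  then show ?thesis
    by (intro left_module.intro left_module_axioms.intro ring_axioms)
      (simp_all add: h F.smult_closed F.smult_l_distr F.smult_r_distr F.smult_assoc F.smult_one)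
qed

lemma split_idempotent_free:
  assumes a: "\<alpha> \<in> Hom PR (FR n) (FR n)" and id: "Cmp PR \<alpha> \<alpha> = \<alpha>"
  shows "\<exists>Z\<in>Obj PR. \<exists>r\<in>Hom PR (FR n) Z. \<exists>u\<in>Hom PR Z (FR n).
    Cmp PR r u = Idn PR Z \<and> Cmp PR u r = \<alpha>"
proof -
  obtain \<epsilon> where \<epsilon>: "\<epsilon> \<in> lmod_hom R (FR n) (FR n)" "\<alpha> = (FR n, \<epsilon>, FR n)" using a by (auto simp: proj_hom)
  note h = lmod_homD[OF \<epsilon>(1)]
  have ee: "\<epsilon> (\<epsilon> x) = \<epsilon> x" if "x \<in> carrier (FR n)" for x
    using id that unfolding \<epsilon>(2) proj_sel lmod_cmp.simps by (metis (no_types, lifting) Pair_inject restrict_apply')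
  define Z where "Z = (FR n)\<lparr>carrier := {x \<in> carrier (FR n). \<epsilon> x = x}\<rparr>"
  have Z: "left_module R Z" unfolding Z_def by (rule fixed_module[OF left_module_free \<epsilon>(1)])
  have zs: "carrier Z = {x \<in> carrier (FR n). \<epsilon> x = x}" "add Z = add (FR n)" "smult Z = smult (FR n)" by (simp_all add: Z_def)
  let ?s = "\<lambda>x\<in>carrier Z. x" and ?e = "\<lambda>x\<in>carrier (FR n). \<epsilon> x"
  have s: "?s \<in> lmod_hom R Z (FR n)" by (rule lmod_homI[OF _ _ _ Z]) (simp_all add: zs)
  have e: "?e \<in> lmod_hom R (FR n) Z" by (rule lmod_homI[OF _ _ _ left_module_free]) (simp_all add: zs h ee)
  have "retraction Z n ?s ?e" unfolding retraction_def using s e by (simp add: zs)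
  then have "Z \<in> Obj PR" by (rule retraction_obj[OF Z])
  moreover have "Cmp PR (FR n, ?e, Z) (Z, ?s, FR n) = Idn PR Z"
    unfolding proj_sel lmod_cmp.simps by (auto simp: zs intro!: restrict_ext)
  moreover have "Cmp PR (Z, ?s, FR n) (FR n, ?e, Z) = \<alpha>"
    unfolding proj_sel lmod_cmp.simps \<epsilon>(2) using h(4) ee h(1) by (simp add: zs cong: restrict_cong)
  moreover have "(FR n, ?e, Z) \<in> Hom PR (FR n) Z" "(Z, ?s, FR n) \<in> Hom PR Z (FR n)"
    using s e by (simp_all add: proj_hom)
  ultimately show ?thesis by (intro bexI[of _ Z] bexI[of _ "(FR n, ?e, Z)"] bexI[of _ "(Z, ?s, FR n)"] conjI)
qed

lemma biproduct_free: "biproduct PR (FR m) (FR n) (FR (m + n))"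
proof -
  let ?i = "\<lambda>x\<in>carrier (FR m). x @ replicate n \<zero>" and ?j = "\<lambda>x\<in>carrier (FR n). replicate m \<zero> @ x"
  let ?p = "\<lambda>x\<in>carrier (FR (m + n)). take m x" and ?q = "\<lambda>x\<in>carrier (FR (m + n)). drop m x"
  have z: "map2 (add R) (replicate k \<zero>) (replicate k \<zero>) = replicate k \<zero>" for k by (auto intro!: nth_equalityI)
  have zr: "map2 (add R) x (replicate k \<zero>) = x" "map2 (add R) (replicate k \<zero>) x = x" if "x \<in> carrier (FR k)" for x k
    using that unfolding free_nth by (auto intro!: nth_equalityI)
  have i: "?i \<in> lmod_hom R (FR m) (FR (m + n))"
    by (rule lmod_homI[OF _ _ _ left_module_free]) (auto simp: free_sel z)
  have j: "?j \<in> lmod_hom R (FR n) (FR (m + n))"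
    by (rule lmod_homI[OF _ _ _ left_module_free]) (auto simp: free_sel z)
  have p: "?p \<in> lmod_hom R (FR (m + n)) (FR m)"
    by (rule lmod_homI[OF _ _ _ left_module_free]) (auto simp: free_sel take_map take_zip dest: in_set_takeD)
  have q: "?q \<in> lmod_hom R (FR (m + n)) (FR n)"
    by (rule lmod_homI[OF _ _ _ left_module_free]) (auto simp: free_sel drop_map drop_zip dest: in_set_dropD)
  have sum: "map2 (add R) (take m x @ replicate n \<zero>) (replicate m \<zero> @ drop m x) = x" if "x \<in> carrier (FR (m + n))" for x
  proof -
    have tk: "take m x \<in> carrier (FR m)" "drop m x \<in> carrier (FR n)"
      using lmod_homD(1)[OF p that] lmod_homD(1)[OF q that] that by simp_all
    then have "length (take m x) = length (replicate m \<zero>)" by (simp add: free_sel)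
    then show ?thesis unfolding map2_append[OF \<open>length (take m x) = length (replicate m \<zero>)\<close>] zr(1)[OF tk(1)] zr(2)[OF tk(2)] by simp
  qed
  have "biproduct_diagram PR (FR m) (FR n) (FR (m + n)) (FR m, ?i, FR (m + n)) (FR n, ?j, FR (m + n)) (FR (m + n), ?p, FR m) (FR (m + n), ?q, FR n)"
    unfolding biproduct_diagram_def proj_sel lmod_cmp.simps lmod_add.simps
  proof (intro conjI free_obj)
    show "(FR (m + n), \<lambda>x\<in>carrier (FR (m + n)). (\<lambda>x\<in>carrier (FR (m + n)). ?i (?p x)) x \<oplus>\<^bsub>FR (m + n)\<^esub> (\<lambda>x\<in>carrier (FR (m + n)). ?j (?q x)) x, FR (m + n)) =
        (FR (m + n), \<lambda>x\<in>carrier (FR (m + n)). x, FR (m + n))"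
      using lmod_homD(1)[OF p] lmod_homD(1)[OF q] sum by (auto simp: free_sel(3) intro!: restrict_ext)
  qed (use i j p q lmod_homD(1)[OF i] lmod_homD(1)[OF j] in \<open>auto simp: proj_hom free_sel(1,2) intro!: restrict_ext\<close>)
  then show ?thesis unfolding biproduct_def by blast
qed

lemma zero_free: "zero_object PR (FR 0)"
  unfolding zero_object_def using free_obj[of 0] by (auto simp: proj_sel free_sel intro!: restrict_ext)

lemma direct_sum_free: "direct_sum PR (replicate n (FR 1)) (FR n)"
proof (induction n)
  case (Suc n)
  then show ?case using biproduct_free[of 1 n] by auto
qed (simp add: zero_free)

lemma retraction_arrows:
  assumes "M \<in> Obj PR"
  obtains n s e where "s \<in> Hom PR M (FR n)" "e \<in> Hom PR (FR n) M" "Cmp PR e s = Idn PR M"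
proof -
  obtain n s e where r: "retraction M n s e" using obj_retraction[OF assms] by blast
  then have "(M, s, FR n) \<in> Hom PR M (FR n)" "(FR n, e, M) \<in> Hom PR (FR n) M"
    "Cmp PR (FR n, e, M) (M, s, FR n) = Idn PR M"
    unfolding retraction_def proj_hom proj_sel lmod_cmp.simps by (auto intro!: restrict_ext)
  then show ?thesis by (rule that)
qed

lemma additive_proj: "additive_cat PR"
proof (intro additive_cat.intro preadd_proj additive_cat_axioms.intro)
  show "\<exists>Z. zero_object PR Z" using zero_free by blast
  fix M N assume M: "M \<in> Obj PR" and N: "N \<in> Obj PR"
  obtain m s e where s: "s \<in> Hom PR M (FR m)" "e \<in> Hom PR (FR m) M" "Cmp PR e s = Idn PR M"
    using retraction_arrows[OF M] .
  obtain n t d where t: "t \<in> Hom PR N (FR n)" "d \<in> Hom PR (FR n) N" "Cmp PR d t = Idn PR N"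
    using retraction_arrows[OF N] .
  obtain i j p q where b: "biproduct_diagram PR (FR m) (FR n) (FR (m + n)) i j p q" using biproduct_free unfolding biproduct_def by blast
  show "\<exists>Z. biproduct PR M N Z"
    by (rule preadd.biproduct_of_retracts[OF preadd_proj b M N s t]) (rule split_idempotent_free)
qed

text \<open>The complement of M in the free module is the image of the idempotent 1 - s e, which
  splits because idempotents of free modules do.\<close>

lemma proj_add_cat: "Obj PR \<subseteq> add_cat PR (FR 1)"
proof
  interpret P: preadd "proj R" by (rule preadd_proj)
  fix M assume M: "M \<in> Obj PR"
  obtain n s e where s: "s \<in> Hom PR M (FR n)" "e \<in> Hom PR (FR n) M" "Cmp PR e s = Idn PR M"
    using retraction_arrows[OF M] .
  note F = free_obj[of n]
  let ?E = "P.E (FR n) (FR n)"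
  have se: "Cmp PR s e \<in> Hom PR (FR n) (FR n)" using P.cmp_in[OF s(1,2) F M F] .
  let ?c = "Add PR (Idn PR (FR n)) (Neg PR (Cmp PR s e))"
  note I = P.idn_in[OF F] and ng = P.neg_in[OF se F F]
  have c: "?c \<in> Hom PR (FR n) (FR n)" using P.add_in[OF I ng F F] .
  have Ec: "?E ?c = ?E (Idn PR (FR n)) - ?E (Cmp PR s e)"
    using P.E_add[OF F F I ng] P.E_neg[OF F F se] by simp
  have "Cmp PR (Cmp PR s e) (Cmp PR s e) = Cmp PR s (Cmp PR (Cmp PR e s) e)"
    using P.cmp_assoc s(1,2) M F P.cmp_in by metis
  also have "\<dots> = Cmp PR s e" unfolding s(3) using P.idn_left[OF s(2) F M] by simp
  finally have "?E (Cmp PR s e) * ?E (Cmp PR s e) = ?E (Cmp PR s e)" using P.E_mult[OF F F F se se] by simp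
  then have "?E ?c * ?E ?c = ?E ?c"
    unfolding Ec using P.E_idn_left[OF F F se] P.E_idn_right[OF F F se] P.E_idn_left[OF F F I] by (simp add: algebra_simps)
  then have "Cmp PR ?c ?c = ?c" using P.E_inject[OF F F P.cmp_in[OF c c F F F] c] P.E_mult[OF F F F c c] by simp
  then obtain Z r u where Z: "Z \<in> Obj PR" "r \<in> Hom PR (FR n) Z" "u \<in> Hom PR Z (FR n)"
    "Cmp PR r u = Idn PR Z" "Cmp PR u r = ?c" using split_idempotent_free[OF c] by blast
  have "?E (Add PR (Cmp PR s e) ?c) = ?E (Idn PR (FR n))" using P.E_add[OF F F se c] Ec by simp
  then have "Add PR (Cmp PR s e) (Cmp PR u r) = Idn PR (FR n)"
    unfolding Z(5) using P.E_inject[OF F F P.add_in[OF se c F F] I] by simp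
  from P.biproduct_complement[OF M F Z(1) s(1,2) Z(3,2) s(3) Z(4) this]
  show "M \<in> add_cat PR (FR 1)" unfolding add_cat_def summand_def biproduct_def using direct_sum_free by blast
qed

end

theorem theorem1p3:
  fixes R :: "('a, 'r) ring_scheme" and P :: "'a pcplx"
  assumes "ring R"
    and "Krull_Schmidt (K2 (proj R))"
    and "almost_complete_two_term_silting R P"
  shows "(\<forall>T. completion R P T \<longrightarrow>
            (\<exists>S. bongartz_completion R P S \<and> additively_equivalent (Kb (proj R)) T S) \<or>
            (\<exists>S. co_bongartz_completion R P S \<and> additively_equivalent (Kb (proj R)) T S)) \<and>
         (\<forall>S T. bongartz_completion R P S \<and> co_bongartz_completion R P T \<longrightarrow>
            irreducible_left_mutation (proj R) S T)"
proof -
  interpret R: ring R by fact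
  interpret A: additive_cat "proj R" by (rule R.additive_proj)
  have "A.bdd (stalk R)"
    unfolding stalk_def Let_def
    by (rule A.bdd_zero_dif) (use R.free_obj R.zero_free in \<open>auto intro: finite_subset[of _ "{0}"]\<close>)
  then have L: "A.conc (stalk R)" unfolding A.conc_def using R.zero_free by (simp add: stalk_def)
  have L0: "cob (stalk R) 0 = free_module R 1" by (simp add: stalk_def)
  have P: "P \<in> Obj (K2 (proj R))" "presilting (proj R) P"
    and n: "int (num_indec (K2 (proj R)) P) = int (num_indec (K2 (proj R)) (stalk R)) - 1"
    using assms(3) unfolding almost_complete_two_term_silting_def two_term_presilting_def by auto
  note main = A.completions_additive[OF L R.proj_add_cat[folded L0] assms(2) P n]
  show ?thesis
    unfolding completion_def two_term_silting_def bongartz_completion_def co_bongartz_completion_def Let_def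
    using main unfolding A.bongartz_over_def A.co_bongartz_over_def by blast
qed

end
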